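(* Let $(R,\mathfrak m)$ be a commutative Noetherian local ring of dimension $n$ and let $M$ be a finitely generated $R$-module. Let $J\subset I$ be two ideals of $R$ such that $\operatorname{grade}(I,M)=c=\operatorname{grade}(J,M)$. Write $D(\cdot)=\operatorname{Hom}_R(\cdot,E_R(R/\mathfrak m))$. (a) There is a natural homomorphism $$\operatorname{Hom}_R(H^c_J(M),H^c_J(M))\to\operatorname{Hom}_R(H^c_I(M),H^c_I(M)).$$ (b) Suppose that $\operatorname{Rad} IR_{\mathfrak p}=\operatorname{Rad} JR_{\mathfrak p}$ for all $\mathfrak p\in V(J)\cap\operatorname{Supp}_R(M)$ such that $\operatorname{depth}_{R_{\mathfrak p}}(M_{\mathfrak p})\leq c$. Then the natural homomorphism in (a) is an isomorphism. (c) Suppose in addition that $R$ is complete. Then there is a natural homomorphism $$\operatorname{Hom}_R(D(H^c_J(M)),D(H^c_J(M)))\to\operatorname{Hom}_R(D(H^c_I(M)),D(H^c_I(M))),$$ and under the assumption of (b) it is an isomorphism.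
   Context: $H^i_I(M)$ denotes the $i$-th local cohomology module of $M$ with respect to $I$. For finitely generated $M$, $\operatorname{grade}(I,M)=\inf\{i\in\mathbb Z: H^i_I(M)\neq 0\}$; writing $H^c_I(M)$ presupposes that $c$ is finite. $E_R(R/\mathfrak m)$ is the injective hull of the residue field, so $D$ is the Matlis dual functor. $V(J)$ is the set of prime ideals containing $J$ and $\operatorname{Rad}$ is the radical of an ideal. Complete means $\mathfrak m$-adically complete. The natural homomorphism in (a) is the following. The surjections $R/J^\alpha\to R/I^\alpha$ induce, by applying $\operatorname{Ext}^c_R(\cdot,M)$ and passing to the direct limit over $\alpha$, an injection $H^c_I(M)\to H^c_J(M)$. Applying $\operatorname{Ext}^c_R(\cdot,M)$ to this injection gives $\operatorname{Ext}^c_R(H^c_J(M),M)\to\operatorname{Ext}^c_R(H^c_I(M),M)$, and for $K\in\{I,J\}$ one uses the natural isomorphism $\operatorname{Ext}^c_R(N,M)\cong\operatorname{Hom}_R(N,H^c_K(M))$, valid for $R$-modules $N$ with $\operatorname{Supp}_R N\subseteq V(K)$, with $N=H^c_K(M)$. The natural homomorphism in (c) is obtained from that in (a) via the isomorphisms $\operatorname{Hom}_R(H^c_K(M),H^c_K(M))\cong\operatorname{Hom}_R(D(H^c_K(M)),D(H^c_K(M)))$, $g\mapsto D(g)$, for $K\in\{I,J\}$, which hold when $R$ is complete. *)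

theory Defs
  imports
    "HOL-Algebra.Module"
    "HOL-Algebra.Ideal_Product"
    "HOL-Algebra.Ring_Divisibility"
    "HOL-Library.Extended_Nat"
begin

text \<open>
  Conventions. Maps between modules are extensional functions on the carrier, so that equality of
  functions is equality of homomorphisms. Elements of quotients, localizations and direct limits
  are equivalence classes; an operation on classes is defined as the union, over all
  representatives, of the resulting classes, which all coincide when the operation is well defined.
  The ring multiplication and unit, which a module record also has, are irrelevant and left unspecified.
\<close>

section \<open>Modules\<close>

definition reg_module :: "('r, 'z) ring_scheme \<Rightarrow> ('r, 'r) module" where
  "reg_module R = \<lparr>carrier = carrier R, monoid.mult = monoid.mult R, one = one R,
     zero = zero R, add = add R, smult = monoid.mult R\<rparr>"

definition mod_hom ::
  "('r, 'z) ring_scheme \<Rightarrow> ('r, 'a, 'p) module_scheme \<Rightarrow> ('r, 'b, 'q) module_scheme \<Rightarrow> ('a \<Rightarrow> 'b) set"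
where
  "mod_hom R A B = {f \<in> carrier A \<rightarrow>\<^sub>E carrier B.
     (\<forall>x\<in>carrier A. \<forall>y\<in>carrier A. f (x \<oplus>\<^bsub>A\<^esub> y) = f x \<oplus>\<^bsub>B\<^esub> f y) \<and>
     (\<forall>r\<in>carrier R. \<forall>x\<in>carrier A. f (r \<odot>\<^bsub>A\<^esub> x) = r \<odot>\<^bsub>B\<^esub> f x)}"

definition mod_iso ::
  "('r, 'z) ring_scheme \<Rightarrow> ('r, 'a, 'p) module_scheme \<Rightarrow> ('r, 'b, 'q) module_scheme \<Rightarrow> ('a \<Rightarrow> 'b) set"
where
  "mod_iso R A B = {f \<in> mod_hom R A B. bij_betw f (carrier A) (carrier B)}"

definition Hom_mod ::
  "('r, 'z) ring_scheme \<Rightarrow> ('r, 'a, 'p) module_scheme \<Rightarrow> ('r, 'b, 'q) module_scheme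
     \<Rightarrow> ('r, 'a \<Rightarrow> 'b) module"
where
  "Hom_mod R A B = \<lparr>carrier = mod_hom R A B, monoid.mult = undefined, one = undefined,
     zero = (\<lambda>x\<in>carrier A. \<zero>\<^bsub>B\<^esub>),
     add = (\<lambda>f g. \<lambda>x\<in>carrier A. f x \<oplus>\<^bsub>B\<^esub> g x),
     smult = (\<lambda>r f. \<lambda>x\<in>carrier A. r \<odot>\<^bsub>B\<^esub> f x)\<rparr>"

definition quot_module :: "('r, 'a, 'p) module_scheme \<Rightarrow> 'a set \<Rightarrow> ('r, 'a set) module" where
  "quot_module A N = \<lparr>carrier = {N +>\<^bsub>A\<^esub> x | x. x \<in> carrier A},
     monoid.mult = undefined, one = undefined, zero = N,
     add = (\<lambda>X Y. \<Union>x\<in>X. \<Union>y\<in>Y. N +>\<^bsub>A\<^esub> (x \<oplus>\<^bsub>A\<^esub> y)),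
     smult = (\<lambda>r X. \<Union>x\<in>X. N +>\<^bsub>A\<^esub> (r \<odot>\<^bsub>A\<^esub> x))\<rparr>"

definition gen_submodule :: "('r, 'z) ring_scheme \<Rightarrow> ('r, 'a, 'p) module_scheme \<Rightarrow> 'a set \<Rightarrow> 'a set"
where
  "gen_submodule R A S = \<Inter>{N. submodule N R A \<and> S \<subseteq> N}"

definition fin_gen_module :: "('r, 'z) ring_scheme \<Rightarrow> ('r, 'a, 'p) module_scheme \<Rightarrow> bool" where
  "fin_gen_module R A \<longleftrightarrow>
     module R A \<and> (\<exists>S\<subseteq>carrier A. finite S \<and> gen_submodule R A S = carrier A)"

text \<open>
  The extension property is required for monomorphisms of modules whose elements are taken from the
  type of the ring. All inclusions of ideals are among them, so by Baer's criterion this is the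
  extension property for monomorphisms of arbitrary modules.
\<close>

definition injective_module :: "('r, 'z) ring_scheme \<Rightarrow> ('r, 'a, 'p) module_scheme \<Rightarrow> bool" where
  "injective_module R Q \<longleftrightarrow> module R Q \<and>
     (\<forall>(A :: ('r, 'r) module) (B :: ('r, 'r) module). \<forall>f\<in>mod_hom R A B. \<forall>g\<in>mod_hom R A Q.
        module R A \<and> module R B \<and> inj_on f (carrier A) \<longrightarrow>
        (\<exists>h\<in>mod_hom R B Q. compose (carrier A) h f = g))"

text \<open>The map \<open>e\<close> is the embedding of \<open>N\<close> into its injective hull \<open>E\<close>.\<close>

definition injective_hull ::
  "('r, 'z) ring_scheme \<Rightarrow> ('r, 'a, 'p) module_scheme \<Rightarrow> ('r, 'h, 'q) module_scheme \<Rightarrow> ('a \<Rightarrow> 'h) \<Rightarrow> bool"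
where
  "injective_hull R N E e \<longleftrightarrow>
     injective_module R E \<and> e \<in> mod_hom R N E \<and> inj_on e (carrier N) \<and>
     (\<forall>S. submodule S R E \<and> S \<noteq> {\<zero>\<^bsub>E\<^esub>} \<longrightarrow> S \<inter> e ` carrier N \<noteq> {\<zero>\<^bsub>E\<^esub>})"

text \<open>Exactness of \<open>0 \<rightarrow> M \<rightarrow> Q 0 \<rightarrow> Q 1 \<rightarrow> \<dots>\<close> with augmentation \<open>\<epsilon>\<close> and differentials \<open>d i\<close>.\<close>

definition injective_resolution ::
  "('r, 'z) ring_scheme \<Rightarrow> ('r, 'm, 'p) module_scheme \<Rightarrow> (nat \<Rightarrow> ('r, 'q) module) \<Rightarrow> ('m \<Rightarrow> 'q)
     \<Rightarrow> (nat \<Rightarrow> 'q \<Rightarrow> 'q) \<Rightarrow> bool"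
where
  "injective_resolution R M Q \<epsilon> d \<longleftrightarrow>
     (\<forall>i. injective_module R (Q i)) \<and>
     \<epsilon> \<in> mod_hom R M (Q 0) \<and> inj_on \<epsilon> (carrier M) \<and>
     (\<forall>i. d i \<in> mod_hom R (Q i) (Q (Suc i))) \<and>
     {x \<in> carrier (Q 0). d 0 x = \<zero>\<^bsub>Q 1\<^esub>} = \<epsilon> ` carrier M \<and>
     (\<forall>i. {x \<in> carrier (Q (Suc i)). d (Suc i) x = \<zero>\<^bsub>Q (Suc (Suc i))\<^esub>} = d i ` carrier (Q i))"


section \<open>Ext\<close>

text \<open>
  Here \<open>(Q, d)\<close> is an injective resolution of a module \<open>M\<close>, and \<open>Ext_mod R Q d i N\<close> is
  \<open>Ext\<^sup>i(N, M)\<close>, the \<open>i\<close>-th cohomology of the complex \<open>Hom(N, Q)\<close>.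
\<close>

definition cocycles ::
  "('r, 'z) ring_scheme \<Rightarrow> (nat \<Rightarrow> ('r, 'q) module) \<Rightarrow> (nat \<Rightarrow> 'q \<Rightarrow> 'q) \<Rightarrow> nat
     \<Rightarrow> ('r, 'a, 'p) module_scheme \<Rightarrow> ('a \<Rightarrow> 'q) set"
where
  "cocycles R Q d i N =
     {f \<in> mod_hom R N (Q i). \<forall>x\<in>carrier N. d i (f x) = \<zero>\<^bsub>Q (Suc i)\<^esub>}"

definition coboundaries ::
  "('r, 'z) ring_scheme \<Rightarrow> (nat \<Rightarrow> ('r, 'q) module) \<Rightarrow> (nat \<Rightarrow> 'q \<Rightarrow> 'q) \<Rightarrow> nat
     \<Rightarrow> ('r, 'a, 'p) module_scheme \<Rightarrow> ('a \<Rightarrow> 'q) set"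
where
  "coboundaries R Q d i N =
     (case i of 0 \<Rightarrow> {\<zero>\<^bsub>Hom_mod R N (Q 0)\<^esub>}
      | Suc j \<Rightarrow> {compose (carrier N) (d j) g | g. g \<in> mod_hom R N (Q j)})"

definition Ext_mod ::
  "('r, 'z) ring_scheme \<Rightarrow> (nat \<Rightarrow> ('r, 'q) module) \<Rightarrow> (nat \<Rightarrow> 'q \<Rightarrow> 'q) \<Rightarrow> nat
     \<Rightarrow> ('r, 'a, 'p) module_scheme \<Rightarrow> ('r, ('a \<Rightarrow> 'q) set) module"
where
  "Ext_mod R Q d i N =
     quot_module ((Hom_mod R N (Q i))\<lparr>carrier := cocycles R Q d i N\<rparr>) (coboundaries R Q d i N)"

text \<open>The map \<open>Ext\<^sup>i(N', M) \<rightarrow> Ext\<^sup>i(N, M)\<close> induced by \<open>h : N \<rightarrow> N'\<close>.\<close>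

definition Ext_map ::
  "('r, 'z) ring_scheme \<Rightarrow> (nat \<Rightarrow> ('r, 'q) module) \<Rightarrow> (nat \<Rightarrow> 'q \<Rightarrow> 'q) \<Rightarrow> nat
     \<Rightarrow> ('r, 'a, 'p) module_scheme \<Rightarrow> ('r, 'b, 's) module_scheme \<Rightarrow> ('a \<Rightarrow> 'b)
     \<Rightarrow> ('b \<Rightarrow> 'q) set \<Rightarrow> ('a \<Rightarrow> 'q) set"
where
  "Ext_map R Q d i N N' h =
     (\<lambda>\<xi>\<in>carrier (Ext_mod R Q d i N').
        \<Union>f\<in>\<xi>. coboundaries R Q d i N +>\<^bsub>Hom_mod R N (Q i)\<^esub> compose (carrier N) f h)"


section \<open>Direct limits of sequences of modules\<close>

text \<open>The transition map from \<open>A i\<close> to \<open>A j\<close>, for \<open>i \<le> j\<close>, is \<open>t i j\<close>.\<close>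

definition dlim_rel ::
  "(nat \<Rightarrow> ('r, 'a) module) \<Rightarrow> (nat \<Rightarrow> nat \<Rightarrow> 'a \<Rightarrow> 'a) \<Rightarrow> ((nat \<times> 'a) \<times> (nat \<times> 'a)) set"
where
  "dlim_rel A t = {((i, x), (j, y)) | i x j y. x \<in> carrier (A i) \<and> y \<in> carrier (A j) \<and>
     (\<exists>k. i \<le> k \<and> j \<le> k \<and> t i k x = t j k y)}"

definition dlim_in ::
  "(nat \<Rightarrow> ('r, 'a) module) \<Rightarrow> (nat \<Rightarrow> nat \<Rightarrow> 'a \<Rightarrow> 'a) \<Rightarrow> nat \<Rightarrow> 'a \<Rightarrow> (nat \<times> 'a) set"
where
  "dlim_in A t i x = dlim_rel A t `` {(i, x)}"

definition direct_limit ::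
  "(nat \<Rightarrow> ('r, 'a) module) \<Rightarrow> (nat \<Rightarrow> nat \<Rightarrow> 'a \<Rightarrow> 'a) \<Rightarrow> ('r, (nat \<times> 'a) set) module"
where
  "direct_limit A t = \<lparr>carrier = {dlim_in A t i x | i x. x \<in> carrier (A i)},
     monoid.mult = undefined, one = undefined,
     zero = dlim_in A t 0 \<zero>\<^bsub>A 0\<^esub>,
     add = (\<lambda>X Y. \<Union>(i, x)\<in>X. \<Union>(j, y)\<in>Y.
       dlim_in A t (max i j) (t i (max i j) x \<oplus>\<^bsub>A (max i j)\<^esub> t j (max i j) y)),
     smult = (\<lambda>r X. \<Union>(i, x)\<in>X. dlim_in A t i (r \<odot>\<^bsub>A i\<^esub> x))\<rparr>"


section \<open>Local cohomology\<close>

abbreviation ideal_pow :: "('r, 'z) ring_scheme \<Rightarrow> 'r set \<Rightarrow> nat \<Rightarrow> 'r set" where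
  "ideal_pow R I \<alpha> \<equiv> I [^]\<^bsub>ideals_set R\<^esub> \<alpha>"

abbreviation cyc_module :: "('r, 'z) ring_scheme \<Rightarrow> 'r set \<Rightarrow> ('r, 'r set) module" where
  "cyc_module R \<aa> \<equiv> quot_module (reg_module R) \<aa>"

text \<open>The surjection \<open>R/\<aa> \<rightarrow> R/\<bb>\<close> for ideals \<open>\<aa> \<subseteq> \<bb>\<close>.\<close>

definition cyc_proj :: "('r, 'z) ring_scheme \<Rightarrow> 'r set \<Rightarrow> 'r set \<Rightarrow> 'r set \<Rightarrow> 'r set" where
  "cyc_proj R \<aa> \<bb> = (\<lambda>X\<in>carrier (cyc_module R \<aa>). \<Union>r\<in>X. \<bb> +>\<^bsub>R\<^esub> r)"

text \<open>The direct system \<open>\<alpha> \<mapsto> Ext\<^sup>i(R/I\<^sup>\<alpha>, M)\<close>, whose limit is \<open>H\<^sup>i\<^sub>I(M)\<close>.\<close>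

definition lc_system ::
  "('r, 'z) ring_scheme \<Rightarrow> (nat \<Rightarrow> ('r, 'q) module) \<Rightarrow> (nat \<Rightarrow> 'q \<Rightarrow> 'q) \<Rightarrow> 'r set \<Rightarrow> nat
     \<Rightarrow> nat \<Rightarrow> ('r, ('r set \<Rightarrow> 'q) set) module"
where
  "lc_system R Q d I i \<alpha> = Ext_mod R Q d i (cyc_module R (ideal_pow R I \<alpha>))"

definition lc_trans ::
  "('r, 'z) ring_scheme \<Rightarrow> (nat \<Rightarrow> ('r, 'q) module) \<Rightarrow> (nat \<Rightarrow> 'q \<Rightarrow> 'q) \<Rightarrow> 'r set \<Rightarrow> nat
     \<Rightarrow> nat \<Rightarrow> nat \<Rightarrow> ('r set \<Rightarrow> 'q) set \<Rightarrow> ('r set \<Rightarrow> 'q) set"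
where
  "lc_trans R Q d I i \<alpha> \<beta> =
     Ext_map R Q d i (cyc_module R (ideal_pow R I \<beta>)) (cyc_module R (ideal_pow R I \<alpha>))
       (cyc_proj R (ideal_pow R I \<beta>) (ideal_pow R I \<alpha>))"

definition loc_coh ::
  "('r, 'z) ring_scheme \<Rightarrow> (nat \<Rightarrow> ('r, 'q) module) \<Rightarrow> (nat \<Rightarrow> 'q \<Rightarrow> 'q) \<Rightarrow> 'r set \<Rightarrow> nat
     \<Rightarrow> ('r, (nat \<times> ('r set \<Rightarrow> 'q) set) set) module"
where
  "loc_coh R Q d I i = direct_limit (lc_system R Q d I i) (lc_trans R Q d I i)"

text \<open>The grade of \<open>I\<close> on \<open>M\<close>; it is \<open>\<infinity>\<close> if all local cohomology modules vanish.\<close>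

definition grade ::
  "('r, 'z) ring_scheme \<Rightarrow> (nat \<Rightarrow> ('r, 'q) module) \<Rightarrow> (nat \<Rightarrow> 'q \<Rightarrow> 'q) \<Rightarrow> 'r set \<Rightarrow> enat"
where
  "grade R Q d I =
     Inf {enat i | i. carrier (loc_coh R Q d I i) \<noteq> {\<zero>\<^bsub>loc_coh R Q d I i\<^esub>}}"

text \<open>
  For \<open>J \<subseteq> I\<close>, the map \<open>H\<^sup>i\<^sub>I(M) \<rightarrow> H\<^sup>i\<^sub>J(M)\<close> induced by the surjections
  \<open>R/J\<^sup>\<alpha> \<rightarrow> R/I\<^sup>\<alpha>\<close>.
\<close>

definition lc_incl ::
  "('r, 'z) ring_scheme \<Rightarrow> (nat \<Rightarrow> ('r, 'q) module) \<Rightarrow> (nat \<Rightarrow> 'q \<Rightarrow> 'q) \<Rightarrow> 'r set \<Rightarrow> 'r set \<Rightarrow> nat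
     \<Rightarrow> (nat \<times> ('r set \<Rightarrow> 'q) set) set \<Rightarrow> (nat \<times> ('r set \<Rightarrow> 'q) set) set"
where
  "lc_incl R Q d I J i = (\<lambda>X\<in>carrier (loc_coh R Q d I i). \<Union>(\<alpha>, \<xi>)\<in>X.
     dlim_in (lc_system R Q d J i) (lc_trans R Q d J i) \<alpha>
       (Ext_map R Q d i (cyc_module R (ideal_pow R J \<alpha>)) (cyc_module R (ideal_pow R I \<alpha>))
          (cyc_proj R (ideal_pow R J \<alpha>) (ideal_pow R I \<alpha>)) \<xi>))"

text \<open>The homomorphism \<open>R/\<aa> \<rightarrow> N\<close>, \<open>r + \<aa> \<mapsto> r x\<close>, for an element \<open>x\<close> annihilated by \<open>\<aa>\<close>.\<close>

definition orbit_map ::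
  "('r, 'z) ring_scheme \<Rightarrow> ('r, 'a, 'p) module_scheme \<Rightarrow> 'r set \<Rightarrow> 'a \<Rightarrow> 'r set \<Rightarrow> 'a"
where
  "orbit_map R N \<aa> x = (\<lambda>X\<in>carrier (cyc_module R \<aa>). the_elem ((\<lambda>r. r \<odot>\<^bsub>N\<^esub> x) ` X))"

text \<open>
  The natural map \<open>Ext\<^sup>i(N, M) \<rightarrow> Hom(N, H\<^sup>i\<^sub>K(M))\<close> for a module \<open>N\<close> supported in \<open>V(K)\<close>, that is,
  each of whose elements is annihilated by a power of \<open>K\<close>. It sends \<open>\<xi>\<close> to the map taking \<open>x\<close>
  to the class of the pullback of \<open>\<xi>\<close> to \<open>Ext\<^sup>i(R/K\<^sup>\<alpha>, M)\<close> along \<open>r + K\<^sup>\<alpha> \<mapsto> r x\<close>, for any \<open>\<alpha>\<close>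
  with \<open>K\<^sup>\<alpha> x = 0\<close>. On cocycles with values in the \<open>K\<close>-torsion of \<open>Q i\<close> it is \<open>[f] \<mapsto> (x \<mapsto> [f x])\<close>.
\<close>

definition Ext_to_Hom ::
  "('r, 'z) ring_scheme \<Rightarrow> (nat \<Rightarrow> ('r, 'q) module) \<Rightarrow> (nat \<Rightarrow> 'q \<Rightarrow> 'q) \<Rightarrow> 'r set \<Rightarrow> nat
     \<Rightarrow> ('r, 'a, 'p) module_scheme
     \<Rightarrow> ('a \<Rightarrow> 'q) set \<Rightarrow> 'a \<Rightarrow> (nat \<times> ('r set \<Rightarrow> 'q) set) set"
where
  "Ext_to_Hom R Q d K i N = (\<lambda>\<xi>\<in>carrier (Ext_mod R Q d i N). \<lambda>x\<in>carrier N.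
     \<Union>\<alpha>\<in>{\<alpha>. \<forall>a\<in>ideal_pow R K \<alpha>. a \<odot>\<^bsub>N\<^esub> x = \<zero>\<^bsub>N\<^esub>}.
       dlim_in (lc_system R Q d K i) (lc_trans R Q d K i) \<alpha>
         (Ext_map R Q d i (cyc_module R (ideal_pow R K \<alpha>)) N
            (orbit_map R N (ideal_pow R K \<alpha>) x) \<xi>))"

abbreviation Ext_to_End ::
  "('r, 'z) ring_scheme \<Rightarrow> (nat \<Rightarrow> ('r, 'q) module) \<Rightarrow> (nat \<Rightarrow> 'q \<Rightarrow> 'q) \<Rightarrow> 'r set \<Rightarrow> nat
     \<Rightarrow> ((nat \<times> ('r set \<Rightarrow> 'q) set) set \<Rightarrow> 'q) set
     \<Rightarrow> (nat \<times> ('r set \<Rightarrow> 'q) set) set \<Rightarrow> (nat \<times> ('r set \<Rightarrow> 'q) set) set"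
where
  "Ext_to_End R Q d K c \<equiv> Ext_to_Hom R Q d K c (loc_coh R Q d K c)"

abbreviation End_loc_coh ::
  "('r, 'z) ring_scheme \<Rightarrow> (nat \<Rightarrow> ('r, 'q) module) \<Rightarrow> (nat \<Rightarrow> 'q \<Rightarrow> 'q) \<Rightarrow> 'r set \<Rightarrow> nat
     \<Rightarrow> ('r, (nat \<times> ('r set \<Rightarrow> 'q) set) set \<Rightarrow> (nat \<times> ('r set \<Rightarrow> 'q) set) set) module"
where
  "End_loc_coh R Q d K c \<equiv> Hom_mod R (loc_coh R Q d K c) (loc_coh R Q d K c)"

text \<open>
  The composite
  \<open>Hom(H\<^sub>J, H\<^sub>J) \<cong> Ext\<^sup>c(H\<^sub>J, M) \<rightarrow> Ext\<^sup>c(H\<^sub>I, M) \<cong> Hom(H\<^sub>I, H\<^sub>I)\<close>, where \<open>H\<^sub>K = H\<^sup>c\<^sub>K(M)\<close>.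
\<close>

definition nat_End_map ::
  "('r, 'z) ring_scheme \<Rightarrow> (nat \<Rightarrow> ('r, 'q) module) \<Rightarrow> (nat \<Rightarrow> 'q \<Rightarrow> 'q) \<Rightarrow> 'r set \<Rightarrow> 'r set \<Rightarrow> nat
     \<Rightarrow> ((nat \<times> ('r set \<Rightarrow> 'q) set) set \<Rightarrow> (nat \<times> ('r set \<Rightarrow> 'q) set) set)
     \<Rightarrow> ((nat \<times> ('r set \<Rightarrow> 'q) set) set \<Rightarrow> (nat \<times> ('r set \<Rightarrow> 'q) set) set)"
where
  "nat_End_map R Q d I J c = (\<lambda>g\<in>carrier (End_loc_coh R Q d J c).
     Ext_to_End R Q d I c
       (Ext_map R Q d c (loc_coh R Q d I c) (loc_coh R Q d J c) (lc_incl R Q d I J c)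
          (inv_into (carrier (Ext_mod R Q d c (loc_coh R Q d J c))) (Ext_to_End R Q d J c) g)))"


section \<open>Matlis duality\<close>

text \<open>The transpose \<open>g \<mapsto> Hom(g, E)\<close> on endomorphisms; \<open>Hom(_, E)\<close> is the Matlis dual when \<open>E\<close> is
  the injective hull of the residue field.\<close>

definition dual_End_map ::
  "('r, 'z) ring_scheme \<Rightarrow> ('r, 'h, 's) module_scheme \<Rightarrow> ('r, 'a, 'p) module_scheme
     \<Rightarrow> ('a \<Rightarrow> 'a) \<Rightarrow> ('a \<Rightarrow> 'h) \<Rightarrow> ('a \<Rightarrow> 'h)"
where
  "dual_End_map R E A = (\<lambda>g\<in>carrier (Hom_mod R A A). \<lambda>f\<in>carrier (Hom_mod R A E).
     compose (carrier A) f g)"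

abbreviation End_dual_loc_coh ::
  "('r, 'z) ring_scheme \<Rightarrow> ('r, 'h, 's) module_scheme
     \<Rightarrow> (nat \<Rightarrow> ('r, 'q) module) \<Rightarrow> (nat \<Rightarrow> 'q \<Rightarrow> 'q) \<Rightarrow> 'r set \<Rightarrow> nat
     \<Rightarrow> ('r, ((nat \<times> ('r set \<Rightarrow> 'q) set) set \<Rightarrow> 'h) \<Rightarrow> ((nat \<times> ('r set \<Rightarrow> 'q) set) set \<Rightarrow> 'h)) module"
where
  "End_dual_loc_coh R E Q d K c \<equiv>
     Hom_mod R (Hom_mod R (loc_coh R Q d K c) E) (Hom_mod R (loc_coh R Q d K c) E)"

definition nat_End_dual_map ::
  "('r, 'z) ring_scheme \<Rightarrow> ('r, 'h, 's) module_scheme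
     \<Rightarrow> (nat \<Rightarrow> ('r, 'q) module) \<Rightarrow> (nat \<Rightarrow> 'q \<Rightarrow> 'q) \<Rightarrow> 'r set \<Rightarrow> 'r set \<Rightarrow> nat
     \<Rightarrow> (((nat \<times> ('r set \<Rightarrow> 'q) set) set \<Rightarrow> 'h) \<Rightarrow> ((nat \<times> ('r set \<Rightarrow> 'q) set) set \<Rightarrow> 'h))
     \<Rightarrow> (((nat \<times> ('r set \<Rightarrow> 'q) set) set \<Rightarrow> 'h) \<Rightarrow> ((nat \<times> ('r set \<Rightarrow> 'q) set) set \<Rightarrow> 'h))"
where
  "nat_End_dual_map R E Q d I J c = (\<lambda>u\<in>carrier (End_dual_loc_coh R E Q d J c).
     dual_End_map R E (loc_coh R Q d I c)
       (nat_End_map R Q d I J c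
          (inv_into (carrier (End_loc_coh R Q d J c)) (dual_End_map R E (loc_coh R Q d J c)) u)))"


section \<open>Localization, support and depth\<close>

definition loc_rel ::
  "('r, 'z) ring_scheme \<Rightarrow> ('r, 'a, 'p) module_scheme \<Rightarrow> 'r set \<Rightarrow> (('a \<times> 'r) \<times> ('a \<times> 'r)) set"
where
  "loc_rel R A \<pp> = {((x, s), (y, t)) | x s y t.
     x \<in> carrier A \<and> y \<in> carrier A \<and> s \<in> carrier R - \<pp> \<and> t \<in> carrier R - \<pp> \<and>
     (\<exists>u\<in>carrier R - \<pp>. u \<odot>\<^bsub>A\<^esub> (t \<odot>\<^bsub>A\<^esub> x) = u \<odot>\<^bsub>A\<^esub> (s \<odot>\<^bsub>A\<^esub> y))}"

definition loc_frac ::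
  "('r, 'z) ring_scheme \<Rightarrow> ('r, 'a, 'p) module_scheme \<Rightarrow> 'r set \<Rightarrow> 'a \<Rightarrow> 'r \<Rightarrow> ('a \<times> 'r) set"
where
  "loc_frac R A \<pp> x s = loc_rel R A \<pp> `` {(x, s)}"

definition loc_module ::
  "('r, 'z) ring_scheme \<Rightarrow> 'r set \<Rightarrow> ('r, 'a, 'p) module_scheme
     \<Rightarrow> (('r \<times> 'r) set, ('a \<times> 'r) set) module"
where
  "loc_module R \<pp> A =
     \<lparr>carrier = {loc_frac R A \<pp> x s | x s. x \<in> carrier A \<and> s \<in> carrier R - \<pp>},
     monoid.mult = undefined, one = undefined,
     zero = loc_frac R A \<pp> \<zero>\<^bsub>A\<^esub> \<one>\<^bsub>R\<^esub>,
     add = (\<lambda>X Y. \<Union>(x, s)\<in>X. \<Union>(y, t)\<in>Y.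
       loc_frac R A \<pp> (t \<odot>\<^bsub>A\<^esub> x \<oplus>\<^bsub>A\<^esub> s \<odot>\<^bsub>A\<^esub> y) (s \<otimes>\<^bsub>R\<^esub> t)),
     smult = (\<lambda>Z X. \<Union>(r, s)\<in>Z. \<Union>(x, t)\<in>X. loc_frac R A \<pp> (r \<odot>\<^bsub>A\<^esub> x) (s \<otimes>\<^bsub>R\<^esub> t))\<rparr>"

definition loc_ring :: "('r, 'z) ring_scheme \<Rightarrow> 'r set \<Rightarrow> ('r \<times> 'r) set ring" where
  "loc_ring R \<pp> =
     \<lparr>carrier = carrier (loc_module R \<pp> (reg_module R)),
     monoid.mult = smult (loc_module R \<pp> (reg_module R)),
     one = loc_frac R (reg_module R) \<pp> \<one>\<^bsub>R\<^esub> \<one>\<^bsub>R\<^esub>,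
     zero = zero (loc_module R \<pp> (reg_module R)),
     add = add (loc_module R \<pp> (reg_module R))\<rparr>"

text \<open>The extension \<open>\<aa>R\<^sub>\<pp>\<close> of an ideal \<open>\<aa>\<close>.\<close>

definition loc_ideal :: "('r, 'z) ring_scheme \<Rightarrow> 'r set \<Rightarrow> 'r set \<Rightarrow> ('r \<times> 'r) set set" where
  "loc_ideal R \<pp> \<aa> = genideal (loc_ring R \<pp>) ((\<lambda>a. loc_frac R (reg_module R) \<pp> a \<one>\<^bsub>R\<^esub>) ` \<aa>)"

definition Rad :: "('r, 'z) ring_scheme \<Rightarrow> 'r set \<Rightarrow> 'r set" where
  "Rad R \<aa> = {x \<in> carrier R. \<exists>k::nat. x [^]\<^bsub>R\<^esub> k \<in> \<aa>}"

definition Vset :: "('r, 'z) ring_scheme \<Rightarrow> 'r set \<Rightarrow> 'r set set" where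
  "Vset R \<aa> = {\<pp>. primeideal \<pp> R \<and> \<aa> \<subseteq> \<pp>}"

definition Supp :: "('r, 'z) ring_scheme \<Rightarrow> ('r, 'a, 'p) module_scheme \<Rightarrow> 'r set set" where
  "Supp R A = {\<pp>. primeideal \<pp> R \<and> carrier (loc_module R \<pp> A) \<noteq> {\<zero>\<^bsub>loc_module R \<pp> A\<^esub>}}"

definition seq_submodule ::
  "('r, 'z) ring_scheme \<Rightarrow> ('r, 'a, 'p) module_scheme \<Rightarrow> 'r list \<Rightarrow> 'a set"
where
  "seq_submodule R A rs = gen_submodule R A {r \<odot>\<^bsub>A\<^esub> x | r x. r \<in> set rs \<and> x \<in> carrier A}"

definition regular_seq :: "('r, 'z) ring_scheme \<Rightarrow> ('r, 'a, 'p) module_scheme \<Rightarrow> 'r list \<Rightarrow> bool" where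
  "regular_seq R A rs \<longleftrightarrow> set rs \<subseteq> carrier R \<and>
     (\<forall>i<length rs. \<forall>X\<in>carrier (quot_module A (seq_submodule R A (take i rs))).
        rs ! i \<odot>\<^bsub>quot_module A (seq_submodule R A (take i rs))\<^esub> X
          = \<zero>\<^bsub>quot_module A (seq_submodule R A (take i rs))\<^esub> \<longrightarrow>
        X = \<zero>\<^bsub>quot_module A (seq_submodule R A (take i rs))\<^esub>) \<and>
     seq_submodule R A rs \<noteq> carrier A"

text \<open>The depth of a module over a local ring with maximal ideal \<open>\<mm>\<close>; by convention it is \<open>\<infinity>\<close> for
  the zero module.\<close>

definition depth ::
  "('r, 'z) ring_scheme \<Rightarrow> 'r set \<Rightarrow> ('r, 'a, 'p) module_scheme \<Rightarrow> enat"
where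
  "depth R \<mm> A = (if carrier A = {\<zero>\<^bsub>A\<^esub>} then \<infinity>
     else Sup {enat (length rs) | rs. set rs \<subseteq> \<mm> \<and> regular_seq R A rs})"

text \<open>\<open>Rad IR\<^sub>\<pp> = Rad JR\<^sub>\<pp>\<close> for all \<open>\<pp> \<in> V(J) \<inter> Supp M\<close> with \<open>depth M\<^sub>\<pp> \<le> c\<close>.\<close>

definition rad_eq_upto_depth ::
  "('r, 'z) ring_scheme \<Rightarrow> ('r, 'm, 'p) module_scheme \<Rightarrow> 'r set \<Rightarrow> 'r set \<Rightarrow> nat \<Rightarrow> bool"
where
  "rad_eq_upto_depth R M I J c \<longleftrightarrow>
     (\<forall>\<pp>\<in>Vset R J \<inter> Supp R M.
        depth (loc_ring R \<pp>) (loc_ideal R \<pp> \<pp>) (loc_module R \<pp> M) \<le> enat c \<longrightarrow>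
        Rad (loc_ring R \<pp>) (loc_ideal R \<pp> I) = Rad (loc_ring R \<pp>) (loc_ideal R \<pp> J))"


section \<open>Local rings\<close>

definition noetherian_local_ring :: "('r, 'z) ring_scheme \<Rightarrow> 'r set \<Rightarrow> bool" where
  "noetherian_local_ring R \<mm> \<longleftrightarrow> cring R \<and> noetherian_ring R \<and>
     maximalideal \<mm> R \<and> (\<forall>\<nn>. maximalideal \<nn> R \<longrightarrow> \<nn> = \<mm>)"

definition krull_dim :: "('r, 'z) ring_scheme \<Rightarrow> enat" where
  "krull_dim R = Sup {enat k | k. \<exists>P :: nat \<Rightarrow> 'r set.
     (\<forall>i\<le>k. primeideal (P i) R) \<and> (\<forall>i<k. P i \<subset> P (Suc i))}"

text \<open>Adic completeness includes separatedness: \<open>R\<close> is the inverse limit of the \<open>R/\<mm>\<^sup>k\<close>.\<close>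

definition adically_complete :: "('r, 'z) ring_scheme \<Rightarrow> 'r set \<Rightarrow> bool" where
  "adically_complete R \<mm> \<longleftrightarrow>
     (\<Inter>k. ideal_pow R \<mm> k) = {\<zero>\<^bsub>R\<^esub>} \<and>
     (\<forall>x :: nat \<Rightarrow> 'r. (\<forall>k. x k \<in> carrier R) \<and> (\<forall>k. x (Suc k) \<ominus>\<^bsub>R\<^esub> x k \<in> ideal_pow R \<mm> k) \<longrightarrow>
        (\<exists>r\<in>carrier R. \<forall>k. r \<ominus>\<^bsub>R\<^esub> x k \<in> ideal_pow R \<mm> k))"

end

theory Submission
  imports Defs
begin

text \<open>
  Local cohomology is the cohomology of the \<open>K\<close>-torsion subcomplex of the resolution \<open>Q\<close>, because
  \<open>Hom(R/K\<^sup>\<alpha>, Q i)\<close> is the submodule of the elements of \<open>Q i\<close> killed by \<open>K\<^sup>\<alpha>\<close>. The torsion subcomplex consists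
  of injective modules (Artin--Rees) and is exact below the grade \<open>c\<close>, hence splits there, so that the torsion
  cocycles of degree \<open>c\<close> are the direct sum of the coboundaries and \<open>H\<^sup>c\<^sub>K(M)\<close>. This gives
  \<open>Ext\<^sup>c(N, M) \<cong> Hom(N, H\<^sup>c\<^sub>K(M))\<close> for \<open>K\<close>-torsion modules \<open>N\<close>, and the injectivity of
  \<open>\<iota> : H\<^sup>c\<^sub>I(M) \<rightarrow> H\<^sup>c\<^sub>J(M)\<close>; the natural map of (a) is then the restriction of endomorphisms along \<open>\<iota>\<close>.

  For (b), it suffices that \<open>\<iota>\<close> is surjective. Otherwise some element of \<open>H\<^sup>c\<^sub>J(M)\<close> has a prime annihilator \<open>\<pp>\<close>
  that contains \<open>J\<close> but not \<open>I\<close>. By hypothesis \<open>depth M\<^sub>\<pp> > c\<close>, so the Koszul complex of a regular sequence shows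
  that the element is zero after multiplication with some \<open>v \<notin> \<pp>\<close>.

  For (c), let \<open>f\<close> be an endomorphism of \<open>D(H)\<close> with \<open>H = H\<^sup>c\<^sub>K(M)\<close>, and \<open>x \<in> H\<close> with \<open>K\<^sup>\<alpha>x = 0\<close>. The functional
  \<open>\<phi> \<mapsto> f \<phi> x\<close> depends only on \<open>\<phi>\<close> on the submodule \<open>L\<close> of \<open>H\<close> killed by \<open>K\<^sup>\<alpha>\<close>, which is finitely
  generated as \<open>Ext\<^sup>c(R/K\<^sup>\<alpha>, M)\<close> is. Since \<open>End(E) = R\<close> for complete \<open>R\<close>, functionals on \<open>D(L)\<close> are
  evaluations, so \<open>f\<close> is the transpose of an endomorphism of \<open>H\<close>.
\<close>

text \<open>Injectivity is used only in the form of Baer's criterion, which speaks of ideals of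
  \<open>R\<close>; \<open>baer_factor\<close> recovers from it extensions between modules with
  elements of any type. Only \<open>R\<close> and \<open>M\<close> are ever localized, in the depth
  and in the radicals. For the resolution, exactness at \<pp> is replaced by exactness up to
  multiplication by an element outside \<pp>. The same induction,
  \<open>partial_contraction\<close>, then serves twice: with u = 1 for the torsion complex below
  the grade, and with u a power of a common denominator for the Koszul complex. It yields a linear
  contraction and not just preimages of cocycles; this is essential, because a linear map preserves
  annihilators and torsion, so that an element killed by \<pp> gets a preimage killed by \<pp>. The
  terms of the injective resolution are rarely finitely generated, so finiteness of Ext is not read
  off from them: it is proved by induction on the degree, along 0 \<rightarrow> \<bb> \<rightarrow>
  R \<rightarrow> R/\<bb> \<rightarrow> 0 and by adding the generators of \<bb> one at a
  time.\<close>

definition lin ::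
  "('r, 'z) ring_scheme \<Rightarrow> ('r, 'a, 'p) module_scheme \<Rightarrow> ('r, 'b, 'q) module_scheme \<Rightarrow> ('a \<Rightarrow> 'b) \<Rightarrow> bool"
where
  "lin R A B f \<longleftrightarrow> f \<in> carrier A \<rightarrow> carrier B \<and>
     (\<forall>x\<in>carrier A. \<forall>y\<in>carrier A. f (x \<oplus>\<^bsub>A\<^esub> y) = f x \<oplus>\<^bsub>B\<^esub> f y) \<and>
     (\<forall>r\<in>carrier R. \<forall>x\<in>carrier A. f (r \<odot>\<^bsub>A\<^esub> x) = r \<odot>\<^bsub>B\<^esub> f x)"

text \<open>Separates linearity from extensionality. Sums and composites written as lambda terms are
  linear but not extensional, so most arguments work with \<open>lin\<close> and restrict only at
  the end.\<close>

lemma mod_hom_iff: "f \<in> mod_hom R A B \<longleftrightarrow> lin R A B f \<and> f \<in> extensional (carrier A)"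
  by (auto simp: mod_hom_def lin_def PiE_def)

lemma mod_hom_lin: "f \<in> mod_hom R A B \<Longrightarrow> lin R A B f"
  by (simp add: mod_hom_iff)

lemma linI:
  assumes "\<And>x. x \<in> carrier A \<Longrightarrow> f x \<in> carrier B"
    and "\<And>x y. x \<in> carrier A \<Longrightarrow> y \<in> carrier A \<Longrightarrow> f (x \<oplus>\<^bsub>A\<^esub> y) = f x \<oplus>\<^bsub>B\<^esub> f y"
    and "\<And>r x. r \<in> carrier R \<Longrightarrow> x \<in> carrier A \<Longrightarrow> f (r \<odot>\<^bsub>A\<^esub> x) = r \<odot>\<^bsub>B\<^esub> f x"
  shows "lin R A B f"
  using assms by (auto simp: lin_def)

lemma lin_closed: "lin R A B f \<Longrightarrow> x \<in> carrier A \<Longrightarrow> f x \<in> carrier B"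
  by (auto simp: lin_def)

lemma lin_add:
  "lin R A B f \<Longrightarrow> x \<in> carrier A \<Longrightarrow> y \<in> carrier A \<Longrightarrow> f (x \<oplus>\<^bsub>A\<^esub> y) = f x \<oplus>\<^bsub>B\<^esub> f y"
  by (auto simp: lin_def)

lemma lin_smult:
  "lin R A B f \<Longrightarrow> r \<in> carrier R \<Longrightarrow> x \<in> carrier A \<Longrightarrow> f (r \<odot>\<^bsub>A\<^esub> x) = r \<odot>\<^bsub>B\<^esub> f x"
  by (auto simp: lin_def)

lemma lin_zero:
  assumes "lin R A B f" "module R A" "module R B"
  shows "f \<zero>\<^bsub>A\<^esub> = \<zero>\<^bsub>B\<^esub>"
proof -
  interpret A: module R A by fact
  interpret B: module R B by fact
  have "f (\<zero>\<^bsub>R\<^esub> \<odot>\<^bsub>A\<^esub> \<zero>\<^bsub>A\<^esub>) = \<zero>\<^bsub>R\<^esub> \<odot>\<^bsub>B\<^esub> f \<zero>\<^bsub>A\<^esub>"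
    by (rule lin_smult[OF assms(1)]) auto
  then show ?thesis using lin_closed[OF assms(1), of "\<zero>\<^bsub>A\<^esub>"] by simp
qed

lemma smult_neg_one:
  assumes "module R A" "x \<in> carrier A"
  shows "(\<ominus>\<^bsub>R\<^esub> \<one>\<^bsub>R\<^esub>) \<odot>\<^bsub>A\<^esub> x = \<ominus>\<^bsub>A\<^esub> x"
proof -
  interpret A: module R A by fact
  show ?thesis using assms(2) by (simp add: A.smult_l_minus)
qed

lemma lin_neg:
  assumes "lin R A B f" "module R A" "module R B" "x \<in> carrier A"
  shows "f (\<ominus>\<^bsub>A\<^esub> x) = \<ominus>\<^bsub>B\<^esub> f x"
proof -
  interpret A: module R A by fact
  interpret B: module R B by fact
  show ?thesis
    using lin_smult[OF assms(1), of "\<ominus>\<^bsub>R\<^esub> \<one>\<^bsub>R\<^esub>" x] assms smult_neg_one[of R A x]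
      smult_neg_one[of R B "f x"] lin_closed[OF assms(1,4)] by simp
qed

lemma lin_diff:
  assumes "lin R A B f" "module R A" "module R B" "x \<in> carrier A" "y \<in> carrier A"
  shows "f (x \<ominus>\<^bsub>A\<^esub> y) = f x \<ominus>\<^bsub>B\<^esub> f y"
proof -
  interpret A: module R A by fact
  interpret B: module R B by fact
  show ?thesis
    using assms lin_add[OF assms(1), of x "\<ominus>\<^bsub>A\<^esub> y"] lin_neg[OF assms(1-3,5)]
    by (simp add: a_minus_def)
qed

lemma lin_comp: "lin R A B f \<Longrightarrow> lin R B C g \<Longrightarrow> lin R A C (\<lambda>x. g (f x))"
  unfolding lin_def by (auto simp: Pi_iff)

lemma lin_cong: "lin R A B f \<Longrightarrow> (\<And>x. x \<in> carrier A \<Longrightarrow> f x = g x) \<Longrightarrow> module R A \<Longrightarrow> lin R A B g"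
proof -
  assume a: "lin R A B f" "\<And>x. x \<in> carrier A \<Longrightarrow> f x = g x" "module R A"
  interpret A: module R A by fact
  show ?thesis
    by (rule linI) (use a(1) in \<open>auto simp flip: a(2) simp: lin_closed lin_add lin_smult\<close>)
qed

lemma lin_restrict: "lin R A B f \<Longrightarrow> module R A \<Longrightarrow> restrict f (carrier A) \<in> mod_hom R A B"
  unfolding mod_hom_iff by (auto intro: lin_cong)

lemma lin_fun_add:
  assumes "lin R A B f" "lin R A B g" "module R A" "module R B"
  shows "lin R A B (\<lambda>x. f x \<oplus>\<^bsub>B\<^esub> g x)"
proof -
  interpret A: module R A by fact
  interpret B: module R B by fact
  show ?thesis
    by (rule linI) (use assms(1,2) in \<open>auto simp: lin_closed lin_add lin_smult B.smult_r_distr B.M.a_ac\<close>)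
qed

lemma lin_fun_smult:
  assumes "lin R A B f" "r \<in> carrier R" "module R A" "module R B"
  shows "lin R A B (\<lambda>x. r \<odot>\<^bsub>B\<^esub> f x)"
proof -
  interpret A: module R A by fact
  interpret B: module R B by fact
  show ?thesis
    by (rule linI) (use assms(1,2) in \<open>auto simp: lin_closed lin_add lin_smult B.smult_r_distr B.M.a_ac
          A.R.m_comm simp flip: B.smult_assoc1\<close>)
qed

lemma lin_fun_diff:
  assumes "lin R A B f" "lin R A B g" "module R A" "module R B"
  shows "lin R A B (\<lambda>x. f x \<ominus>\<^bsub>B\<^esub> g x)"
proof -
  interpret A: module R A by fact
  interpret B: module R B by fact
  have 1: "f x \<ominus>\<^bsub>B\<^esub> g x = f x \<oplus>\<^bsub>B\<^esub> (\<ominus>\<^bsub>R\<^esub> \<one>\<^bsub>R\<^esub>) \<odot>\<^bsub>B\<^esub> g x" if "x \<in> carrier A" for x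
    using that smult_neg_one[of R B "g x"] lin_closed[OF assms(2)] assms(4) by (simp add: a_minus_def)
  have "lin R A B (\<lambda>x. f x \<oplus>\<^bsub>B\<^esub> (\<ominus>\<^bsub>R\<^esub> \<one>\<^bsub>R\<^esub>) \<odot>\<^bsub>B\<^esub> g x)"
    by (intro lin_fun_add lin_fun_smult) (use assms in auto)
  then show ?thesis by (rule lin_cong) (simp_all add: 1 assms)
qed

lemma lin_const_zero:
  assumes "module R A" "module R B"
  shows "lin R A B (\<lambda>x. \<zero>\<^bsub>B\<^esub>)"
proof -
  interpret A: module R A by fact
  interpret B: module R B by fact
  show ?thesis by (rule linI) auto
qed

lemma lin_dom: "lin R A B f \<Longrightarrow> N \<subseteq> carrier A \<Longrightarrow> lin R (A\<lparr>carrier := N\<rparr>) B f"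
  by (auto simp: lin_def subset_iff)

lemma lin_cod: "lin R A B f \<Longrightarrow> (\<And>x. x \<in> carrier A \<Longrightarrow> f x \<in> N) \<Longrightarrow> lin R A (B\<lparr>carrier := N\<rparr>) f"
  by (auto simp: lin_def)

lemma lin_cod_incl: "lin R A (B\<lparr>carrier := N\<rparr>) f \<Longrightarrow> N \<subseteq> carrier B \<Longrightarrow> lin R A B f"
  by (auto simp: lin_def)

lemma lin_id: "N \<subseteq> carrier A \<Longrightarrow> lin R (A\<lparr>carrier := N\<rparr>) A (\<lambda>x. x)"
  by (auto simp: lin_def)

text \<open>Closure under negatives follows from closure under scalars, as -a = (-1) a.\<close>

lemma submodI:
  assumes "module R A" "N \<subseteq> carrier A" "\<zero>\<^bsub>A\<^esub> \<in> N"
    and "\<And>x y. x \<in> N \<Longrightarrow> y \<in> N \<Longrightarrow> x \<oplus>\<^bsub>A\<^esub> y \<in> N"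
    and s: "\<And>r x. r \<in> carrier R \<Longrightarrow> x \<in> N \<Longrightarrow> r \<odot>\<^bsub>A\<^esub> x \<in> N"
  shows "submodule N R A"
proof -
  interpret A: module R A by fact
  show ?thesis
  proof (rule A.submoduleI)
    fix a assume a: "a \<in> N"
    then have "(\<ominus>\<^bsub>R\<^esub> \<one>\<^bsub>R\<^esub>) \<odot>\<^bsub>A\<^esub> a \<in> N" by (intro s) auto
    then show "\<ominus>\<^bsub>A\<^esub> a \<in> N" using smult_neg_one[of R A a] assms(1,2) a by (metis subsetD)
  qed (use assms in auto)
qed

lemma submodD:
  assumes "submodule N R A"
  shows "N \<subseteq> carrier A" "\<zero>\<^bsub>A\<^esub> \<in> N" "\<And>x y. x \<in> N \<Longrightarrow> y \<in> N \<Longrightarrow> x \<oplus>\<^bsub>A\<^esub> y \<in> N"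
    "\<And>r x. r \<in> carrier R \<Longrightarrow> x \<in> N \<Longrightarrow> r \<odot>\<^bsub>A\<^esub> x \<in> N"
    "\<And>x. x \<in> N \<Longrightarrow> \<ominus>\<^bsub>A\<^esub> x \<in> N"
proof -
  have s: "subgroup N (add_monoid A)" using assms by (simp add: submodule_def)
  show "N \<subseteq> carrier A" "\<zero>\<^bsub>A\<^esub> \<in> N" "\<And>x y. x \<in> N \<Longrightarrow> y \<in> N \<Longrightarrow> x \<oplus>\<^bsub>A\<^esub> y \<in> N"
    using s by (auto simp: subgroup_def)
  show "\<And>r x. r \<in> carrier R \<Longrightarrow> x \<in> N \<Longrightarrow> r \<odot>\<^bsub>A\<^esub> x \<in> N"
    using assms by (rule submodule.smult_closed)
  show "\<And>x. x \<in> N \<Longrightarrow> \<ominus>\<^bsub>A\<^esub> x \<in> N"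
    using s by (auto simp: subgroup_def a_inv_def)
qed

lemma submodD_diff: "submodule N R A \<Longrightarrow> x \<in> N \<Longrightarrow> y \<in> N \<Longrightarrow> x \<ominus>\<^bsub>A\<^esub> y \<in> N"
  by (simp add: a_minus_def submodD)

lemma submod_module: "submodule N R A \<Longrightarrow> module R A \<Longrightarrow> module R (A\<lparr>carrier := N\<rparr>)"
  by (rule submodule.submodule_is_module)

lemma submod_add_cancel:
  assumes "submodule N R A" "module R A" "x \<in> N" "y \<in> carrier A" "x \<oplus>\<^bsub>A\<^esub> y \<in> N"
  shows "y \<in> N"
proof -
  interpret A: module R A by fact
  have "\<ominus>\<^bsub>A\<^esub> x \<oplus>\<^bsub>A\<^esub> (x \<oplus>\<^bsub>A\<^esub> y) \<in> N" using assms submodD[OF assms(1)] by blast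
  moreover have "x \<in> carrier A" using assms submodD[OF assms(1)] by blast
  ultimately show ?thesis using assms(4) by (simp add: A.M.r_neg1)
qed

lemma submod_ker:
  assumes "lin R A B f" "module R A" "module R B"
  shows "submodule {x \<in> carrier A. f x = \<zero>\<^bsub>B\<^esub>} R A"
proof -
  interpret A: module R A by fact
  interpret B: module R B by fact
  show ?thesis
    by (rule submodI) (use assms in \<open>auto simp: lin_add lin_smult lin_zero\<close>)
qed

lemma submod_vimage:
  assumes "lin R A B f" "module R A" "module R B" "submodule N R B"
  shows "submodule {x \<in> carrier A. f x \<in> N} R A"
proof -
  interpret A: module R A by fact
  interpret B: module R B by fact
  show ?thesis
    by (rule submodI) (use assms in \<open>auto simp: lin_add lin_smult lin_zero submodD\<close>)
qed

lemma submod_image: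
  assumes "lin R A B f" "module R A" "module R B" "submodule N R A"
  shows "submodule (f ` N) R B"
proof -
  interpret A: module R A by fact
  interpret B: module R B by fact
  note N = submodD[OF assms(4)]
  show ?thesis
  proof (rule submodI)
    show "f ` N \<subseteq> carrier B" using N(1) assms(1) by (auto simp: lin_closed)
    show "\<zero>\<^bsub>B\<^esub> \<in> f ` N" using lin_zero[OF assms(1-3)] N(2) by (metis imageI)
    show "x \<oplus>\<^bsub>B\<^esub> y \<in> f ` N" if "x \<in> f ` N" "y \<in> f ` N" for x y
      using that N(1,3) lin_add[OF assms(1)] by (auto simp: image_iff subset_iff) metis
    show "r \<odot>\<^bsub>B\<^esub> x \<in> f ` N" if "r \<in> carrier R" "x \<in> f ` N" for r x
      using that N(1,4) lin_smult[OF assms(1)] by (auto simp: image_iff subset_iff) metis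
  qed fact
qed

lemma submod_carrier: "module R A \<Longrightarrow> submodule (carrier A) R A"
  by (rule module.carrier_is_submodule)

lemma submod_zero: "module R A \<Longrightarrow> submodule {\<zero>\<^bsub>A\<^esub>} R A"
proof -
  assume "module R A"
  then interpret A: module R A .
  show ?thesis by (rule submodI) (auto simp: A.module_axioms)
qed

lemma submod_inter: "module R A \<Longrightarrow> submodule N R A \<Longrightarrow> submodule N' R A \<Longrightarrow> submodule (N \<inter> N') R A"
  by (rule submodI) (auto simp: submodD dest: submodD(1))

lemma reg_module: "cring R \<Longrightarrow> module R (reg_module R)"
proof -
  assume "cring R"
  then interpret cring R .
  have "abelian_group (reg_module R)"
    by (rule abelian_groupI)
      (auto simp: reg_module_def a_ac intro!: bexI[of _ "\<ominus>\<^bsub>R\<^esub> _"] l_neg)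
  then show ?thesis
    by (intro moduleI) (auto simp: reg_module_def l_distr r_distr m_assoc cring_axioms)
qed

lemma reg_module_simps [simp]:
  "carrier (reg_module R) = carrier R" "x \<oplus>\<^bsub>reg_module R\<^esub> y = x \<oplus>\<^bsub>R\<^esub> y"
  "r \<odot>\<^bsub>reg_module R\<^esub> x = r \<otimes>\<^bsub>R\<^esub> x" "\<zero>\<^bsub>reg_module R\<^esub> = \<zero>\<^bsub>R\<^esub>"
  "a_r_coset (reg_module R) = a_r_coset R"
  by (auto simp: reg_module_def a_r_coset_def r_coset_def fun_eq_iff)

lemma ideal_submod: "cring R \<Longrightarrow> ideal I R \<Longrightarrow> submodule I R (reg_module R)"
proof -
  assume R: "cring R" and I: "ideal I R"
  interpret cring R by fact
  interpret ideal I R by fact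
  show ?thesis
    by (rule submodI[OF reg_module[OF R]]) (auto simp: I_l_closed a_Hcarr)
qed

lemma submod_ideal: "cring R \<Longrightarrow> submodule I R (reg_module R) \<Longrightarrow> ideal I R"
proof -
  assume R: "cring R" and I: "submodule I R (reg_module R)"
  interpret cring R by fact
  note d = submodD[OF I]
  have neg: "\<ominus>\<^bsub>R\<^esub> x \<in> I" if "x \<in> I" for x
  proof -
    have "(\<ominus>\<^bsub>R\<^esub> \<one>\<^bsub>R\<^esub>) \<otimes>\<^bsub>R\<^esub> x \<in> I" using d(4)[of "\<ominus>\<^bsub>R\<^esub> \<one>\<^bsub>R\<^esub>" x] that by simp
    then show ?thesis using that d(1) by (auto simp: l_minus subset_iff)
  qed
  show ?thesis
  proof (rule idealI)
    show "subgroup I (add_monoid R)"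
      by (rule add.subgroupI) (use d neg in \<open>auto simp: a_inv_def[symmetric]\<close>)
    show "x \<otimes>\<^bsub>R\<^esub> a \<in> I" if "a \<in> I" "x \<in> carrier R" for a x
      using d(4) that by simp
    then show "a \<otimes>\<^bsub>R\<^esub> x \<in> I" if "a \<in> I" "x \<in> carrier R" for a x
      using that d(1) m_comm[of a x] by (auto simp: subset_iff)
  qed (rule ring_axioms)
qed

section \<open>Injectivity through Baer's criterion, and extension of homomorphisms\<close>

definition baer :: "('r, 'z) ring_scheme \<Rightarrow> ('r, 'a, 'p) module_scheme \<Rightarrow> bool" where
  "baer R E \<longleftrightarrow> module R E \<and> (\<forall>\<bb> f. ideal \<bb> R \<and> lin R (reg_module R\<lparr>carrier := \<bb>\<rparr>) E f \<longrightarrow>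
     (\<exists>e\<in>carrier E. \<forall>r\<in>\<bb>. f r = r \<odot>\<^bsub>E\<^esub> e))"

text \<open>An ideal and the ring itself are modules over the type of the ring, so the inclusion of
  the ideal is one of the monomorphisms tested in \<open>injective_module\<close>. The element
  sought is the value at 1 of the extension.\<close>

lemma injective_baer:
  assumes "injective_module R E"
  shows "baer R E"
  unfolding baer_def
proof (intro conjI allI impI)
  show m: "module R E" using assms by (simp add: injective_module_def)
  interpret E: module R E by fact
  have R: "cring R" using m by (simp add: module_def)
  fix \<bb> f assume "ideal \<bb> R \<and> lin R (reg_module R\<lparr>carrier := \<bb>\<rparr>) E f"
  then have b: "ideal \<bb> R" and f: "lin R (reg_module R\<lparr>carrier := \<bb>\<rparr>) E f" by auto
  have bs: "\<bb> \<subseteq> carrier R" using submodD(1)[OF ideal_submod[OF R b]] by simp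
  let ?A = "reg_module R\<lparr>carrier := \<bb>\<rparr>"
  have A: "module R ?A" by (rule submod_module[OF ideal_submod[OF R b] reg_module[OF R]])
  have 1: "restrict (\<lambda>x. x) (carrier ?A) \<in> mod_hom R ?A (reg_module R)"
    by (rule lin_restrict[OF lin_id A]) (use bs in auto)
  have 2: "restrict f (carrier ?A) \<in> mod_hom R ?A E" by (rule lin_restrict[OF f A])
  have "\<exists>h\<in>mod_hom R (reg_module R) E. compose (carrier ?A) h (restrict (\<lambda>x. x) (carrier ?A)) = restrict f (carrier ?A)"
  proof -
    have "\<forall>f\<in>mod_hom R ?A (reg_module R). \<forall>g\<in>mod_hom R ?A E.
        module R ?A \<and> module R (reg_module R) \<and> inj_on f (carrier ?A) \<longrightarrow>
        (\<exists>h\<in>mod_hom R (reg_module R) E. compose (carrier ?A) h f = g)"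
      using assms unfolding injective_module_def by blast
    moreover have "inj_on (restrict (\<lambda>x. x) (carrier ?A)) (carrier ?A)" by (auto simp: inj_on_def)
    ultimately show ?thesis using 1 2 A reg_module[OF R] by blast
  qed
  then obtain h where h: "h \<in> mod_hom R (reg_module R) E"
    and c: "compose (carrier ?A) h (restrict (\<lambda>x. x) (carrier ?A)) = restrict f (carrier ?A)" by blast
  note lh = mod_hom_lin[OF h]
  show "\<exists>e\<in>carrier E. \<forall>r\<in>\<bb>. f r = r \<odot>\<^bsub>E\<^esub> e"
  proof (intro bexI ballI)
    show "h \<one>\<^bsub>R\<^esub> \<in> carrier E" using lin_closed[OF lh] by simp
    fix r assume r: "r \<in> \<bb>"
    have "f r = h r" using fun_cong[OF c, of r] r by (simp add: compose_def)
    also have "\<dots> = h (r \<odot>\<^bsub>reg_module R\<^esub> \<one>\<^bsub>R\<^esub>)" using r bs by (auto simp: subset_iff)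
    also have "\<dots> = r \<odot>\<^bsub>E\<^esub> h \<one>\<^bsub>R\<^esub>" by (rule lin_smult[OF lh]) (use r bs in auto)
    finally show "f r = r \<odot>\<^bsub>E\<^esub> h \<one>\<^bsub>R\<^esub>" .
  qed
qed

lemma baer_module: "baer R E \<Longrightarrow> module R E"
  by (simp add: baer_def)

text \<open>Zorn's lemma is applied to graphs of partial homomorphisms on \<open>W\<close>.\<close>

lemma baer_factor:
  assumes E: "baer R E" and P: "module R P" and W: "module R W"
    and al: "lin R P W \<alpha>" and la: "lin R P E \<theta>"
    and ker: "\<And>x. x \<in> carrier P \<Longrightarrow> \<alpha> x = \<zero>\<^bsub>W\<^esub> \<Longrightarrow> \<theta> x = \<zero>\<^bsub>E\<^esub>"
  shows "\<exists>\<psi>. lin R W E \<psi> \<and> (\<forall>x\<in>carrier P. \<psi> (\<alpha> x) = \<theta> x)"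
proof -
  interpret P: module R P by fact
  interpret W: module R W by fact
  have mE: "module R E" by (rule baer_module[OF E])
  interpret E: module R E by fact
  have R: "cring R" using mE by (simp add: module_def)
  \<comment> \<open>Single-valuedness is demanded only at zero; \<open>Gu\<close> recovers it
    everywhere by subtracting pairs. The smallest admissible graph satisfies this clause precisely
    by \<open>ker\<close>.\<close>
  define ok where "ok G \<longleftrightarrow> G \<subseteq> carrier W \<times> carrier E \<and> {(\<alpha> x, \<theta> x) |x. x \<in> carrier P} \<subseteq> G \<and>
    (\<forall>x y x' y'. (x,y) \<in> G \<longrightarrow> (x',y') \<in> G \<longrightarrow> (x \<oplus>\<^bsub>W\<^esub> x', y \<oplus>\<^bsub>E\<^esub> y') \<in> G) \<and>
    (\<forall>r x y. r \<in> carrier R \<longrightarrow> (x,y) \<in> G \<longrightarrow> (r \<odot>\<^bsub>W\<^esub> x, r \<odot>\<^bsub>E\<^esub> y) \<in> G) \<and>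
    (\<forall>y. (\<zero>\<^bsub>W\<^esub>, y) \<in> G \<longrightarrow> y = \<zero>\<^bsub>E\<^esub>)" for G
  have "\<exists>G\<in>Collect ok. \<forall>X\<in>Collect ok. G \<subseteq> X \<longrightarrow> X = G"
  proof (rule subset_Zorn_nonempty)
    have "ok {(\<alpha> x, \<theta> x) |x. x \<in> carrier P}"
      unfolding ok_def
    proof (intro conjI allI impI)
      fix x y x' y' assume "(x,y) \<in> {(\<alpha> x, \<theta> x) |x. x \<in> carrier P}" "(x',y') \<in> {(\<alpha> x, \<theta> x) |x. x \<in> carrier P}"
      then obtain a b where "a \<in> carrier P" "b \<in> carrier P" "x = \<alpha> a" "y = \<theta> a" "x' = \<alpha> b" "y' = \<theta> b" by auto
      then show "(x \<oplus>\<^bsub>W\<^esub> x', y \<oplus>\<^bsub>E\<^esub> y') \<in> {(\<alpha> x, \<theta> x) |x. x \<in> carrier P}"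
        using lin_add[OF al] lin_add[OF la] by (auto intro!: exI[of _ "a \<oplus>\<^bsub>P\<^esub> b"])
    next
      fix r x y assume "r \<in> carrier R" "(x,y) \<in> {(\<alpha> x, \<theta> x) |x. x \<in> carrier P}"
      then obtain a where "a \<in> carrier P" "x = \<alpha> a" "y = \<theta> a" by auto
      then show "(r \<odot>\<^bsub>W\<^esub> x, r \<odot>\<^bsub>E\<^esub> y) \<in> {(\<alpha> x, \<theta> x) |x. x \<in> carrier P}"
        using lin_smult[OF al] lin_smult[OF la] \<open>r \<in> carrier R\<close> by (auto intro!: exI[of _ "r \<odot>\<^bsub>P\<^esub> a"])
    qed (use ker al la in \<open>auto simp: lin_closed\<close>)
    then show "Collect ok \<noteq> {}" by auto
  next
    fix C assume C: "C \<noteq> {}" "subset.chain (Collect ok) C"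
    then have ok: "\<And>G. G \<in> C \<Longrightarrow> ok G" and ch: "\<And>G H. G \<in> C \<Longrightarrow> H \<in> C \<Longrightarrow> G \<subseteq> H \<or> H \<subseteq> G"
      by (auto simp: subset.chain_def)
    have "ok (\<Union>C)"
      unfolding ok_def
    proof (intro conjI allI impI)
      show "\<Union>C \<subseteq> carrier W \<times> carrier E" using ok unfolding ok_def by blast
      show "{(\<alpha> x, \<theta> x) |x. x \<in> carrier P} \<subseteq> \<Union>C" using ok C(1) unfolding ok_def by blast
      fix x y x' y' assume "(x,y) \<in> \<Union>C" "(x',y') \<in> \<Union>C"
      then obtain G where "G \<in> C" "(x,y) \<in> G" "(x',y') \<in> G" using ch by blast
      then show "(x \<oplus>\<^bsub>W\<^esub> x', y \<oplus>\<^bsub>E\<^esub> y') \<in> \<Union>C" using ok[of G] unfolding ok_def by blast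
    next
      fix r x y assume "r \<in> carrier R" "(x,y) \<in> \<Union>C"
      then show "(r \<odot>\<^bsub>W\<^esub> x, r \<odot>\<^bsub>E\<^esub> y) \<in> \<Union>C" using ok unfolding ok_def by blast
    next
      fix y assume "(\<zero>\<^bsub>W\<^esub>, y) \<in> \<Union>C"
      then show "y = \<zero>\<^bsub>E\<^esub>" using ok unfolding ok_def by blast
    qed
    then show "\<Union>C \<in> Collect ok" by simp
  qed
  then obtain G where G: "ok G" and mx: "\<And>X. ok X \<Longrightarrow> G \<subseteq> X \<Longrightarrow> X = G" by auto
  have Gc: "\<And>x y. (x,y) \<in> G \<Longrightarrow> x \<in> carrier W \<and> y \<in> carrier E"
    and Gb: "\<And>x. x \<in> carrier P \<Longrightarrow> (\<alpha> x, \<theta> x) \<in> G"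
    and Ga: "\<And>x y x' y'. (x,y) \<in> G \<Longrightarrow> (x',y') \<in> G \<Longrightarrow> (x \<oplus>\<^bsub>W\<^esub> x', y \<oplus>\<^bsub>E\<^esub> y') \<in> G"
    and Gs: "\<And>r x y. r \<in> carrier R \<Longrightarrow> (x,y) \<in> G \<Longrightarrow> (r \<odot>\<^bsub>W\<^esub> x, r \<odot>\<^bsub>E\<^esub> y) \<in> G"
    and G0: "\<And>y. (\<zero>\<^bsub>W\<^esub>, y) \<in> G \<Longrightarrow> y = \<zero>\<^bsub>E\<^esub>"
    using G unfolding ok_def by blast+
  have Gn: "(\<ominus>\<^bsub>W\<^esub> x, \<ominus>\<^bsub>E\<^esub> y) \<in> G" if "(x,y) \<in> G" for x y
    using Gs[OF _ that, of "\<ominus>\<^bsub>R\<^esub> \<one>\<^bsub>R\<^esub>"] Gc[OF that] smult_neg_one[OF W, of x] smult_neg_one[OF mE, of y] by simp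
  have Gu: "y = y'" if "(x,y) \<in> G" "(x,y') \<in> G" for x y y'
  proof -
    have "(x \<oplus>\<^bsub>W\<^esub> \<ominus>\<^bsub>W\<^esub> x, y \<oplus>\<^bsub>E\<^esub> \<ominus>\<^bsub>E\<^esub> y') \<in> G" using Ga[OF that(1) Gn[OF that(2)]] .
    then have "y \<oplus>\<^bsub>E\<^esub> \<ominus>\<^bsub>E\<^esub> y' = \<zero>\<^bsub>E\<^esub>" using G0 Gc[OF that(1)] by (simp add: W.M.r_neg)
    then show ?thesis using Gc that by (metis E.M.minus_equality E.M.minus_minus E.M.a_inv_closed)
  qed
  have z: "(\<zero>\<^bsub>W\<^esub>, \<zero>\<^bsub>E\<^esub>) \<in> G"
    using Gb[of "\<zero>\<^bsub>P\<^esub>"] lin_zero[OF al P W] lin_zero[OF la P mE] by simp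
  have dom: "\<exists>y. (w, y) \<in> G" if w: "w \<in> carrier W" for w
  proof -
    \<comment> \<open>These are the scalars that carry w into the domain of the maximal graph.
      Baer's criterion represents r \<mapsto> g r as r \<mapsto> r e, which makes e the value to
      assign to w.\<close>
    define \<bb> where "\<bb> = {r \<in> carrier R. \<exists>y. (r \<odot>\<^bsub>W\<^esub> w, y) \<in> G}"
    define g where "g r = (SOME y. (r \<odot>\<^bsub>W\<^esub> w, y) \<in> G)" for r
    have g: "(r \<odot>\<^bsub>W\<^esub> w, g r) \<in> G" if "r \<in> \<bb>" for r
      using that unfolding \<bb>_def g_def by (auto intro: someI)
    have bi: "submodule \<bb> R (reg_module R)"
    proof (rule submodI[OF reg_module[OF R]])
      show "\<bb> \<subseteq> carrier (reg_module R)" by (auto simp: \<bb>_def)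
      show "\<zero>\<^bsub>reg_module R\<^esub> \<in> \<bb>" using z w by (auto simp: \<bb>_def)
      show "x \<oplus>\<^bsub>reg_module R\<^esub> y \<in> \<bb>" if "x \<in> \<bb>" "y \<in> \<bb>" for x y
        using Ga[OF g[OF that(1)] g[OF that(2)]] that w by (auto simp: \<bb>_def W.smult_l_distr)
      show "r \<odot>\<^bsub>reg_module R\<^esub> x \<in> \<bb>" if "r \<in> carrier R" "x \<in> \<bb>" for r x
        using Gs[OF that(1) g[OF that(2)]] that w by (auto simp: \<bb>_def W.smult_assoc1)
    qed
    have bc: "\<bb> \<subseteq> carrier R" by (auto simp: \<bb>_def)
    have "lin R (reg_module R\<lparr>carrier := \<bb>\<rparr>) E g"
    proof (rule linI)
      fix x y assume x: "x \<in> carrier (reg_module R\<lparr>carrier := \<bb>\<rparr>)"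
      then have x': "x \<in> \<bb>" by simp
      show "g x \<in> carrier E" using g[OF x'] Gc by blast
      { assume "y \<in> carrier (reg_module R\<lparr>carrier := \<bb>\<rparr>)"
        then have y': "y \<in> \<bb>" by simp
        have xy: "x \<oplus>\<^bsub>R\<^esub> y \<in> \<bb>" using submodD(3)[OF bi x' y'] by simp
        show "g (x \<oplus>\<^bsub>reg_module R\<lparr>carrier := \<bb>\<rparr>\<^esub> y) = g x \<oplus>\<^bsub>E\<^esub> g y"
          using Gu[OF g[OF xy]] Ga[OF g[OF x'] g[OF y']] x' y' bc w by (auto simp: W.smult_l_distr subset_iff) }
      fix r assume r: "r \<in> carrier R"
      have rx: "r \<otimes>\<^bsub>R\<^esub> x \<in> \<bb>" using submodD(4)[OF bi r x'] by simp
      show "g (r \<odot>\<^bsub>reg_module R\<lparr>carrier := \<bb>\<rparr>\<^esub> x) = r \<odot>\<^bsub>E\<^esub> g x"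
        using Gu[OF g[OF rx]] Gs[OF r g[OF x']] x' r bc w by (auto simp: W.smult_assoc1 subset_iff)
    qed
    then obtain e where e: "e \<in> carrier E" and ge: "\<And>r. r \<in> \<bb> \<Longrightarrow> g r = r \<odot>\<^bsub>E\<^esub> e"
      using E submod_ideal[OF R bi] unfolding baer_def by blast
    \<comment> \<open>The graph generated by G and (w, e). It stays single-valued because a relation
      a + r w = 0 puts r into \<bb>, where r e is already the prescribed value -b.\<close>
    define H where "H = {(x \<oplus>\<^bsub>W\<^esub> r \<odot>\<^bsub>W\<^esub> w, y \<oplus>\<^bsub>E\<^esub> r \<odot>\<^bsub>E\<^esub> e) |x y r. (x,y) \<in> G \<and> r \<in> carrier R}"
    have HI: "(x \<oplus>\<^bsub>W\<^esub> r \<odot>\<^bsub>W\<^esub> w, y \<oplus>\<^bsub>E\<^esub> r \<odot>\<^bsub>E\<^esub> e) \<in> H" if "(x,y) \<in> G" "r \<in> carrier R" for x y r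
      unfolding H_def using that by blast
    have GH: "G \<subseteq> H"
    proof
      fix p assume "p \<in> G"
      then obtain x y where p: "p = (x,y)" "(x,y) \<in> G" by (cases p) auto
      show "p \<in> H" using HI[OF p(2) P.R.zero_closed] Gc[OF p(2)] w e p(1) by simp
    qed
    have "ok H"
      unfolding ok_def
    proof (intro conjI allI impI)
      show "H \<subseteq> carrier W \<times> carrier E" unfolding H_def using Gc w e by auto
      show "{(\<alpha> x, \<theta> x) |x. x \<in> carrier P} \<subseteq> H" using GH Gb by auto
      fix x y x' y' assume "(x,y) \<in> H" "(x',y') \<in> H"
      then obtain a b r a' b' r' where *: "(a,b) \<in> G" "r \<in> carrier R" "(a',b') \<in> G" "r' \<in> carrier R"
        and eq: "x = a \<oplus>\<^bsub>W\<^esub> r \<odot>\<^bsub>W\<^esub> w" "y = b \<oplus>\<^bsub>E\<^esub> r \<odot>\<^bsub>E\<^esub> e" "x' = a' \<oplus>\<^bsub>W\<^esub> r' \<odot>\<^bsub>W\<^esub> w" "y' = b' \<oplus>\<^bsub>E\<^esub> r' \<odot>\<^bsub>E\<^esub> e"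
        unfolding H_def by blast
      have "x \<oplus>\<^bsub>W\<^esub> x' = (a \<oplus>\<^bsub>W\<^esub> a') \<oplus>\<^bsub>W\<^esub> (r \<oplus>\<^bsub>R\<^esub> r') \<odot>\<^bsub>W\<^esub> w" "y \<oplus>\<^bsub>E\<^esub> y' = (b \<oplus>\<^bsub>E\<^esub> b') \<oplus>\<^bsub>E\<^esub> (r \<oplus>\<^bsub>R\<^esub> r') \<odot>\<^bsub>E\<^esub> e"
        using * Gc w e unfolding eq by (auto simp: W.smult_l_distr E.smult_l_distr W.M.a_ac E.M.a_ac)
      then show "(x \<oplus>\<^bsub>W\<^esub> x', y \<oplus>\<^bsub>E\<^esub> y') \<in> H" using HI[OF Ga[OF *(1,3)]] * by simp
    next
      fix s x y assume s: "s \<in> carrier R" "(x,y) \<in> H"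
      then obtain a b r where *: "(a,b) \<in> G" "r \<in> carrier R"
        and eq: "x = a \<oplus>\<^bsub>W\<^esub> r \<odot>\<^bsub>W\<^esub> w" "y = b \<oplus>\<^bsub>E\<^esub> r \<odot>\<^bsub>E\<^esub> e"
        unfolding H_def by blast
      have "s \<odot>\<^bsub>W\<^esub> x = s \<odot>\<^bsub>W\<^esub> a \<oplus>\<^bsub>W\<^esub> (s \<otimes>\<^bsub>R\<^esub> r) \<odot>\<^bsub>W\<^esub> w" "s \<odot>\<^bsub>E\<^esub> y = s \<odot>\<^bsub>E\<^esub> b \<oplus>\<^bsub>E\<^esub> (s \<otimes>\<^bsub>R\<^esub> r) \<odot>\<^bsub>E\<^esub> e"
        using * s Gc w e unfolding eq by (auto simp: W.smult_r_distr E.smult_r_distr W.smult_assoc1 E.smult_assoc1)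
      then show "(s \<odot>\<^bsub>W\<^esub> x, s \<odot>\<^bsub>E\<^esub> y) \<in> H" using HI[OF Gs[OF s(1) *(1)], of "s \<otimes>\<^bsub>R\<^esub> r"] * s by simp
    next
      fix y assume "(\<zero>\<^bsub>W\<^esub>, y) \<in> H"
      then obtain a b r where *: "(a,b) \<in> G" "r \<in> carrier R"
        and eq: "\<zero>\<^bsub>W\<^esub> = a \<oplus>\<^bsub>W\<^esub> r \<odot>\<^bsub>W\<^esub> w" "y = b \<oplus>\<^bsub>E\<^esub> r \<odot>\<^bsub>E\<^esub> e"
        unfolding H_def by blast
      have "r \<odot>\<^bsub>W\<^esub> w = \<ominus>\<^bsub>W\<^esub> a" using eq(1) * Gc w
        by (metis W.M.add.inv_closed W.M.a_comm W.M.minus_equality W.smult_closed)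
      then have rb: "(r \<odot>\<^bsub>W\<^esub> w, \<ominus>\<^bsub>E\<^esub> b) \<in> G" using Gn[OF *(1)] by simp
      then have r: "r \<in> \<bb>" using * by (auto simp: \<bb>_def)
      have "r \<odot>\<^bsub>E\<^esub> e = \<ominus>\<^bsub>E\<^esub> b" using ge[OF r] Gu[OF g[OF r] rb] by simp
      then show "y = \<zero>\<^bsub>E\<^esub>" using eq(2) Gc[OF *(1)] by (simp add: E.M.r_neg)
    qed
    then have "H = G" using mx GH by blast
    moreover have "(w, e) \<in> H" using HI[OF z P.R.one_closed] w e by simp
    ultimately show ?thesis by auto
  qed
  define \<psi> where "\<psi> w = (SOME y. (w,y) \<in> G)" for w
  have p: "(w, \<psi> w) \<in> G" if "w \<in> carrier W" for w
    unfolding \<psi>_def using dom[OF that] by (rule someI_ex)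
  show ?thesis
  proof (intro exI conjI ballI)
    show "lin R W E \<psi>"
    proof (rule linI)
      fix x assume x: "x \<in> carrier W"
      show "\<psi> x \<in> carrier E" using Gc[OF p[OF x]] by blast
      show "\<psi> (x \<oplus>\<^bsub>W\<^esub> y) = \<psi> x \<oplus>\<^bsub>E\<^esub> \<psi> y" if y: "y \<in> carrier W" for y
        using Gu[OF p Ga[OF p[OF x] p[OF y]]] x y by simp
      show "\<psi> (r \<odot>\<^bsub>W\<^esub> x) = r \<odot>\<^bsub>E\<^esub> \<psi> x" if r: "r \<in> carrier R" for r
        using Gu[OF p Gs[OF r p[OF x]]] x r by simp
    qed
    show "\<psi> (\<alpha> x) = \<theta> x" if "x \<in> carrier P" for x
      using Gu[OF p Gb[OF that]] lin_closed[OF al that] by blast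
  qed
qed

lemma module_cring: "module R A \<Longrightarrow> cring R"
  by (simp add: module_def)

lemma minus_zero_right: "module R A \<Longrightarrow> x \<in> carrier A \<Longrightarrow> x \<ominus>\<^bsub>A\<^esub> \<zero>\<^bsub>A\<^esub> = x"
proof -
  assume "module R A" "x \<in> carrier A"
  then interpret A: module R A by simp
  have "\<ominus>\<^bsub>A\<^esub> \<zero>\<^bsub>A\<^esub> = \<zero>\<^bsub>A\<^esub>" using A.M.r_neg[of "\<zero>\<^bsub>A\<^esub>"] by simp
  then show ?thesis using \<open>x \<in> carrier A\<close> by (simp add: a_minus_def)
qed

lemma minus_eq_zero_iff:
  "module R A \<Longrightarrow> x \<in> carrier A \<Longrightarrow> y \<in> carrier A \<Longrightarrow> x \<ominus>\<^bsub>A\<^esub> y = \<zero>\<^bsub>A\<^esub> \<longleftrightarrow> x = y"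
proof -
  assume a: "module R A" "x \<in> carrier A" "y \<in> carrier A"
  then interpret A: module R A by simp
  show ?thesis using a A.M.add.inv_solve_right'[of "\<zero>\<^bsub>A\<^esub>" x y]
    by (auto simp: a_minus_def A.M.r_neg)
qed

lemma smult_commute:
  assumes "module R A" "a \<in> carrier R" "b \<in> carrier R" "x \<in> carrier A"
  shows "a \<odot>\<^bsub>A\<^esub> (b \<odot>\<^bsub>A\<^esub> x) = b \<odot>\<^bsub>A\<^esub> (a \<odot>\<^bsub>A\<^esub> x)"
proof -
  interpret A: module R A by fact
  show ?thesis using assms(2-4) by (simp add: A.R.m_comm flip: A.smult_assoc1)
qed

text \<open>Operations on classes are unions over all representatives; this evaluates such a union
  once its members are shown to be independent of the representative.\<close>

lemma UN_const_eq: "a \<in> X \<Longrightarrow> (\<And>x. x \<in> X \<Longrightarrow> f x = c) \<Longrightarrow> (\<Union>x\<in>X. f x) = c"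
  by auto

lemma submod_trans:
  assumes "submodule N' R (A\<lparr>carrier := N\<rparr>)" "submodule N R A" "module R A"
  shows "submodule N' R A"
  by (rule submodI[OF assms(3)])
    (use submodD(1-4)[OF assms(1)] submodD(1)[OF assms(2)] in \<open>force | simp\<close>)+

section \<open>Quotient modules\<close>

lemma coset_mem: "z \<in> N +>\<^bsub>A\<^esub> x \<longleftrightarrow> (\<exists>h\<in>N. z = h \<oplus>\<^bsub>A\<^esub> x)"
  by (auto simp: a_r_coset_def r_coset_def)

lemma coset_self:
  assumes "submodule N R A" "module R A" "x \<in> carrier A"
  shows "x \<in> N +>\<^bsub>A\<^esub> x"
proof -
  interpret A: module R A by fact
  show ?thesis using submodD(2)[OF assms(1)] assms(3) by (auto simp: coset_mem intro!: bexI[of _ "\<zero>\<^bsub>A\<^esub>"])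
qed

lemma coset_eq:
  assumes "submodule N R A" "module R A" "x \<in> carrier A" "y \<in> carrier A"
  shows "N +>\<^bsub>A\<^esub> x = N +>\<^bsub>A\<^esub> y \<longleftrightarrow> x \<ominus>\<^bsub>A\<^esub> y \<in> N"
proof -
  interpret A: module R A by fact
  note N = submodD[OF assms(1)]
  note [simp] = assms(3,4) subsetD[OF N(1)]
  show ?thesis
  proof
    assume "N +>\<^bsub>A\<^esub> x = N +>\<^bsub>A\<^esub> y"
    then obtain h where h: "h \<in> N" "x = h \<oplus>\<^bsub>A\<^esub> y"
      using coset_self[OF assms(1-3)] by (auto simp: coset_mem)
    have "x \<ominus>\<^bsub>A\<^esub> y = h" using h(1) unfolding h(2) by (simp add: a_minus_def A.M.a_assoc A.M.r_neg)
    then show "x \<ominus>\<^bsub>A\<^esub> y \<in> N" using h by simp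
  next
    assume d: "x \<ominus>\<^bsub>A\<^esub> y \<in> N"
    have "h \<oplus>\<^bsub>A\<^esub> x = (h \<oplus>\<^bsub>A\<^esub> (x \<ominus>\<^bsub>A\<^esub> y)) \<oplus>\<^bsub>A\<^esub> y" if "h \<in> N" for h
      using that by (simp add: a_minus_def A.M.a_assoc A.M.l_neg)
    moreover have "h \<oplus>\<^bsub>A\<^esub> y = (h \<oplus>\<^bsub>A\<^esub> \<ominus>\<^bsub>A\<^esub> (x \<ominus>\<^bsub>A\<^esub> y)) \<oplus>\<^bsub>A\<^esub> x" if "h \<in> N" for h
      using that by (simp add: a_minus_def A.M.a_assoc A.M.minus_add A.M.a_comm[of y] A.M.r_neg1 A.M.r_neg2 A.M.l_neg A.M.r_neg A.M.a_lcomm)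
    ultimately show "N +>\<^bsub>A\<^esub> x = N +>\<^bsub>A\<^esub> y"
      unfolding set_eq_iff coset_mem using N(3) N(5)[OF d] d by blast
  qed
qed

lemma coset_eq_sub:
  assumes "submodule N R A" "module R A" "x \<in> carrier A"
  shows "N +>\<^bsub>A\<^esub> x = N \<longleftrightarrow> x \<in> N"
proof -
  interpret A: module R A by fact
  note N = submodD[OF assms(1)]
  have "N +>\<^bsub>A\<^esub> \<zero>\<^bsub>A\<^esub> = N"
    using N(1) by (force simp: coset_mem subset_iff)
  then show ?thesis using coset_eq[OF assms(1,2,3) A.M.zero_closed] assms(3)
    by (simp add: minus_zero_right[OF assms(2)])
qed

lemma coset_mem_eq:
  assumes "submodule N R A" "module R A" "x \<in> carrier A" "z \<in> N +>\<^bsub>A\<^esub> x"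
  shows "z \<in> carrier A" "N +>\<^bsub>A\<^esub> z = N +>\<^bsub>A\<^esub> x"
proof -
  interpret A: module R A by fact
  note N = submodD[OF assms(1)]
  obtain h where h: "h \<in> N" "z = h \<oplus>\<^bsub>A\<^esub> x" using assms(4) by (auto simp: coset_mem)
  show z: "z \<in> carrier A" using h N(1) assms(3) by auto
  have "z \<ominus>\<^bsub>A\<^esub> x = h" using h N(1) assms(3) by (auto simp: a_minus_def A.M.a_assoc A.M.r_neg)
  then show "N +>\<^bsub>A\<^esub> z = N +>\<^bsub>A\<^esub> x" using coset_eq[OF assms(1,2) z assms(3)] h by simp
qed

lemma quot_carrier: "carrier (quot_module A N) = (\<lambda>x. N +>\<^bsub>A\<^esub> x) ` carrier A"
  by (auto simp: quot_module_def)

lemma quot_zero [simp]: "\<zero>\<^bsub>quot_module A N\<^esub> = N"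
  by (simp add: quot_module_def)

lemma quot_add:
  assumes "submodule N R A" "module R A" "x \<in> carrier A" "y \<in> carrier A"
  shows "(N +>\<^bsub>A\<^esub> x) \<oplus>\<^bsub>quot_module A N\<^esub> (N +>\<^bsub>A\<^esub> y) = N +>\<^bsub>A\<^esub> (x \<oplus>\<^bsub>A\<^esub> y)"
proof -
  interpret A: module R A by fact
  note N = submodD[OF assms(1)]
  have "N +>\<^bsub>A\<^esub> (x' \<oplus>\<^bsub>A\<^esub> y') = N +>\<^bsub>A\<^esub> (x \<oplus>\<^bsub>A\<^esub> y)" if "x' \<in> N +>\<^bsub>A\<^esub> x" "y' \<in> N +>\<^bsub>A\<^esub> y" for x' y'
  proof -
    have c: "x' \<in> carrier A" "y' \<in> carrier A" using coset_mem_eq assms that by metis+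
    have "x' \<ominus>\<^bsub>A\<^esub> x \<in> N" "y' \<ominus>\<^bsub>A\<^esub> y \<in> N" using coset_mem_eq assms that coset_eq[OF assms(1,2)] c by metis+
    then have "(x' \<ominus>\<^bsub>A\<^esub> x) \<oplus>\<^bsub>A\<^esub> (y' \<ominus>\<^bsub>A\<^esub> y) \<in> N" by (rule N(3))
    moreover have "(x' \<ominus>\<^bsub>A\<^esub> x) \<oplus>\<^bsub>A\<^esub> (y' \<ominus>\<^bsub>A\<^esub> y) = (x' \<oplus>\<^bsub>A\<^esub> y') \<ominus>\<^bsub>A\<^esub> (x \<oplus>\<^bsub>A\<^esub> y)"
      using c assms(3,4) by (simp add: a_minus_def A.M.minus_add A.M.a_ac)
    ultimately show ?thesis using coset_eq[OF assms(1,2)] c assms(3,4) by simp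
  qed
  then have "(\<Union>x\<in>N +>\<^bsub>A\<^esub> x. \<Union>y\<in>N +>\<^bsub>A\<^esub> y. N +>\<^bsub>A\<^esub> (x \<oplus>\<^bsub>A\<^esub> y)) = N +>\<^bsub>A\<^esub> (x \<oplus>\<^bsub>A\<^esub> y)"
    by (intro UN_const_eq[OF coset_self[OF assms(1,2,3)]] UN_const_eq[OF coset_self[OF assms(1,2,4)]])
  then show ?thesis by (simp add: quot_module_def)
qed

lemma quot_smult:
  assumes "submodule N R A" "module R A" "r \<in> carrier R" "x \<in> carrier A"
  shows "r \<odot>\<^bsub>quot_module A N\<^esub> (N +>\<^bsub>A\<^esub> x) = N +>\<^bsub>A\<^esub> (r \<odot>\<^bsub>A\<^esub> x)"
proof -
  interpret A: module R A by fact
  note N = submodD[OF assms(1)]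
  have "N +>\<^bsub>A\<^esub> (r \<odot>\<^bsub>A\<^esub> x') = N +>\<^bsub>A\<^esub> (r \<odot>\<^bsub>A\<^esub> x)" if "x' \<in> N +>\<^bsub>A\<^esub> x" for x'
  proof -
    have c: "x' \<in> carrier A" using coset_mem_eq assms that by metis
    have "x' \<ominus>\<^bsub>A\<^esub> x \<in> N" using coset_mem_eq assms that coset_eq[OF assms(1,2)] c by metis
    then have "r \<odot>\<^bsub>A\<^esub> (x' \<ominus>\<^bsub>A\<^esub> x) \<in> N" by (rule N(4)[OF assms(3)])
    moreover have "r \<odot>\<^bsub>A\<^esub> (x' \<ominus>\<^bsub>A\<^esub> x) = r \<odot>\<^bsub>A\<^esub> x' \<ominus>\<^bsub>A\<^esub> r \<odot>\<^bsub>A\<^esub> x"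
      using c assms(3,4) by (simp add: a_minus_def A.smult_r_distr A.smult_r_minus)
    ultimately show ?thesis using coset_eq[OF assms(1,2)] c assms(3,4) by simp
  qed
  then have "(\<Union>x\<in>N +>\<^bsub>A\<^esub> x. N +>\<^bsub>A\<^esub> (r \<odot>\<^bsub>A\<^esub> x)) = N +>\<^bsub>A\<^esub> (r \<odot>\<^bsub>A\<^esub> x)"
    by (intro UN_const_eq[OF coset_self[OF assms(1,2,4)]])
  then show ?thesis by (simp add: quot_module_def)
qed

text \<open>The axioms pass along a surjection that respects the operations, and nothing about B is
  presupposed. Quotients, constant sequences and local cohomology all obtain their module structure
  in this way.\<close>

lemma module_image:
  assumes A: "module R A" and im: "carrier B = f ` carrier A"
    and add: "\<And>x y. x \<in> carrier A \<Longrightarrow> y \<in> carrier A \<Longrightarrow> f x \<oplus>\<^bsub>B\<^esub> f y = f (x \<oplus>\<^bsub>A\<^esub> y)"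
    and sm: "\<And>r x. r \<in> carrier R \<Longrightarrow> x \<in> carrier A \<Longrightarrow> r \<odot>\<^bsub>B\<^esub> f x = f (r \<odot>\<^bsub>A\<^esub> x)"
    and z: "\<zero>\<^bsub>B\<^esub> = f \<zero>\<^bsub>A\<^esub>"
  shows "module R B" "lin R A B f"
proof -
  interpret A: module R A by fact
  have "abelian_group B"
  proof (rule abelian_groupI)
    fix x assume "x \<in> carrier B"
    then obtain a where a: "a \<in> carrier A" "x = f a" by (auto simp: im)
    then have "f (\<ominus>\<^bsub>A\<^esub> a) \<in> carrier B" "f (\<ominus>\<^bsub>A\<^esub> a) \<oplus>\<^bsub>B\<^esub> x = \<zero>\<^bsub>B\<^esub>"
      by (auto simp: im add z A.M.l_neg)
    then show "\<exists>y\<in>carrier B. y \<oplus>\<^bsub>B\<^esub> x = \<zero>\<^bsub>B\<^esub>" by blast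
  qed (auto simp: im add z A.M.a_ac)
  then show "module R B"
    by (intro moduleI module_cring[OF A]) (auto simp: im add sm A.smult_l_distr A.smult_r_distr A.smult_assoc1)
  show "lin R A B f" by (rule linI) (auto simp: im add sm)
qed

lemma quot_module_module:
  assumes "submodule N R A" "module R A"
  shows "module R (quot_module A N)" "lin R A (quot_module A N) (\<lambda>x. N +>\<^bsub>A\<^esub> x)"
proof -
  interpret A: module R A by fact
  show "module R (quot_module A N)" "lin R A (quot_module A N) (\<lambda>x. N +>\<^bsub>A\<^esub> x)"
    by (rule module_image[OF assms(2) quot_carrier];
      use assms coset_eq_sub[OF assms A.M.zero_closed] submodD(2)[OF assms(1)] in \<open>simp add: quot_add quot_smult\<close>)+
qed

section \<open>Powers of ideals in Noetherian rings\<close>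

lemma ideals_set_simps [simp]:
  "\<one>\<^bsub>ideals_set R\<^esub> = carrier R" "A \<otimes>\<^bsub>ideals_set R\<^esub> B = ideal_prod R A B"
  by (simp_all add: ideals_set_def)

context cring
begin

lemma ideal_pow_ideal: "ideal I R \<Longrightarrow> ideal (ideal_pow R I n) R"
  by (induction n) (auto simp: oneideal ideal_prod_is_ideal)

lemma ideal_pow_antimono: "ideal I R \<Longrightarrow> m \<le> n \<Longrightarrow> ideal_pow R I n \<subseteq> ideal_pow R I m"
proof (induction n)
  case (Suc n)
  then show ?case using ideal_prod_inter[OF ideal_pow_ideal[of I n], of I] by (cases "m = Suc n") auto
qed simp

lemma ideal_prod_mono: "A \<subseteq> A' \<Longrightarrow> B \<subseteq> B' \<Longrightarrow> ideal_prod R A B \<subseteq> ideal_prod R A' B'"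
proof
  fix x assume s: "A \<subseteq> A'" "B \<subseteq> B'" and "x \<in> ideal_prod R A B"
  from this(3) show "x \<in> ideal_prod R A' B'"
    by induction (use s in \<open>auto intro: ideal_prod.intros\<close>)
qed

lemma ideal_pow_mono: "J \<subseteq> I \<Longrightarrow> ideal_pow R J n \<subseteq> ideal_pow R I n"
  by (induction n) (auto dest: ideal_prod_mono[of _ _ J I])

lemma ideal_pow_1: "ideal I R \<Longrightarrow> ideal_pow R I 1 = I"
  using ideal_prod_commute[OF oneideal, of I] ideal_prod_one[of I] by simp

lemma elt_pow_in: "ideal I R \<Longrightarrow> x \<in> I \<Longrightarrow> x [^] n \<in> ideal_pow R I n"
  by (induction n) (auto intro: ideal_prod.prod)

lemma ideal_sum_mem: "ideal A R \<Longrightarrow> ideal B R \<Longrightarrow> A \<subseteq> A <+> B \<and> B \<subseteq> A <+> B"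
proof -
  assume A: "ideal A R" and B: "ideal B R"
  interpret A: ideal A R by fact
  interpret B: ideal B R by fact
  show ?thesis
  proof (intro conjI subsetI)
    fix x assume x: "x \<in> A"
    then have "x = x \<oplus> \<zero>" by (simp add: A.a_Hcarr)
    then show "x \<in> A <+> B" using x B.zero_closed unfolding set_add_def' by blast
  next
    fix x assume x: "x \<in> B"
    then have "x = \<zero> \<oplus> x" by (simp add: B.a_Hcarr)
    then show "x \<in> A <+> B" using x A.zero_closed unfolding set_add_def' by blast
  qed
qed

text \<open>A factor from A raises the exponent of A and a factor from B that of B. For x in the
  power n of the sum, the induction hypothesis is therefore used twice, with (i - 1, j) to treat x a
  and with (i, j - 1) to treat x b.\<close>

lemma ideal_sum_pow:
  assumes A: "ideal A R" and B: "ideal B R"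
  shows "i + j \<le> n \<Longrightarrow> ideal_pow R (A <+> B) n \<subseteq> ideal_pow R A i <+> ideal_pow R B j"
proof (induction n arbitrary: i j)
  case 0
  then show ?case by (auto simp: set_add_def' intro!: exI[of _ \<zero>] exI)
next
  case (Suc n)
  have AB: "ideal (A <+> B) R" by (rule add_ideals[OF A B])
  have id: "ideal (ideal_pow R A i <+> ideal_pow R B j) R" for i j
    by (intro add_ideals ideal_pow_ideal A B)
  show ?case
  \<comment> \<open>A zeroth power is the whole ring, and then so is the sum.\<close>
  proof (cases "i = 0 \<or> j = 0")
    case True
    have "\<one> \<in> ideal_pow R A i <+> ideal_pow R B j"
      using True ideal_sum_mem[OF ideal_pow_ideal[OF A, of i] ideal_pow_ideal[OF B, of j]] by auto
    then have "ideal_pow R A i <+> ideal_pow R B j = carrier R"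
      using ideal.one_imp_carrier[OF id] by blast
    then show ?thesis using ideal_pow_ideal[OF AB, of "Suc n"] by (metis additive_subgroup.a_subset ideal.axioms(1))
  next
    case False
    then obtain i' j' where ij: "i = Suc i'" "j = Suc j'" by (meson not0_implies_Suc)
    show ?thesis
    proof
      fix x assume "x \<in> ideal_pow R (A <+> B) (Suc n)"
      then have "x \<in> ideal_prod R (ideal_pow R (A <+> B) n) (A <+> B)" by simp
      then show "x \<in> ideal_pow R A i <+> ideal_pow R B j"
      proof induction
        case (prod x c)
        then obtain a b where ab: "c = a \<oplus> b" "a \<in> A" "b \<in> B" by (auto simp: set_add_def')
        have c: "a \<in> carrier R" "b \<in> carrier R" "x \<in> carrier R"
          using ab A B prod(1) ideal.Icarr ideal_pow_ideal[OF AB, of n] by metis+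
        obtain p q where pq: "p \<in> ideal_pow R A i'" "q \<in> ideal_pow R B j" "x = p \<oplus> q"
          using Suc.IH[of i' j] Suc.prems prod(1) by (auto simp: set_add_def' ij)
        obtain p' q' where pq': "p' \<in> ideal_pow R A i" "q' \<in> ideal_pow R B j'" "x = p' \<oplus> q'"
          using Suc.IH[of i j'] Suc.prems prod(1) by (auto simp: set_add_def' ij)
        have cc: "p \<in> carrier R" "q \<in> carrier R" "p' \<in> carrier R" "q' \<in> carrier R"
          using pq pq' ideal.Icarr ideal_pow_ideal[OF A] ideal_pow_ideal[OF B] by metis+
        have "p \<otimes> a \<in> ideal_pow R A i" "q' \<otimes> b \<in> ideal_pow R B j"
          using pq(1) pq'(2) ab by (auto simp: ij intro: ideal_prod.prod)
        moreover have "q \<otimes> a \<in> ideal_pow R B j" "p' \<otimes> b \<in> ideal_pow R A i"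
          using pq(2) pq'(1) c ideal.I_r_closed[OF ideal_pow_ideal[OF B]] ideal.I_r_closed[OF ideal_pow_ideal[OF A]] by blast+
        ultimately have "p \<otimes> a \<oplus> q \<otimes> a \<in> ideal_pow R A i <+> ideal_pow R B j"
          "p' \<otimes> b \<oplus> q' \<otimes> b \<in> ideal_pow R A i <+> ideal_pow R B j"
          unfolding set_add_def' by blast+
        moreover have "x \<otimes> a = p \<otimes> a \<oplus> q \<otimes> a" "x \<otimes> b = p' \<otimes> b \<oplus> q' \<otimes> b"
          unfolding pq(3)[THEN arg_cong[of _ _ "\<lambda>x. x \<otimes> a"]] pq'(3)[THEN arg_cong[of _ _ "\<lambda>x. x \<otimes> b"]]
          using c cc by (simp_all add: l_distr)
        moreover have "x \<otimes> c = x \<otimes> a \<oplus> x \<otimes> b" using c ab by (simp add: r_distr)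
        ultimately show ?case
          using additive_subgroup.a_closed[OF ideal.axioms(1)[OF id]] by simp
      next
        case (sum s1 s2)
        then show ?case using additive_subgroup.a_closed[OF ideal.axioms(1)[OF id]] by blast
      qed
    qed
  qed
qed

lemma PIdl_pow:
  assumes "x \<in> carrier R"
  shows "y \<in> ideal_pow R (PIdl x) t \<Longrightarrow> \<exists>r\<in>carrier R. y = r \<otimes> x [^] t"
proof (induction t arbitrary: y)
  case (Suc t)
  then have "y \<in> ideal_prod R (ideal_pow R (PIdl x) t) (PIdl x)" by simp
  then show ?case
  proof induction
    case (prod a b)
    obtain r where r: "r \<in> carrier R" "a = r \<otimes> x [^] t" using Suc.IH prod(1) by blast
    obtain s where s: "s \<in> carrier R" "b = s \<otimes> x" using prod(2) by (auto simp: cgenideal_def)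
    show ?case by (rule bexI[of _ "r \<otimes> s"]) (use r s assms in \<open>auto simp: m_ac\<close>)
  next
    case (sum a b)
    then obtain r s where "r \<in> carrier R" "a = r \<otimes> x [^] Suc t" "s \<in> carrier R" "b = s \<otimes> x [^] Suc t" by blast
    then show ?case using assms by (intro bexI[of _ "r \<oplus> s"]) (auto simp: l_distr)
  qed
qed auto

lemma ideal_sum_le:
  assumes "ideal L R" "A \<subseteq> L" "B \<subseteq> L" shows "A <+>\<^bsub>R\<^esub> B \<subseteq> L"
  using assms additive_subgroup.a_closed[OF ideal.axioms(1)[OF assms(1)]] by (auto simp: set_add_def')

end

text \<open>A nonempty chain of ideals of a Noetherian ring contains its own union, so Zorn's lemma
  applies to any nonempty set of ideals, without a closure condition on the set.\<close>

lemma noetherian_maximal: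
  assumes "noetherian_ring R" and "S \<noteq> {}" and "\<And>I. I \<in> S \<Longrightarrow> ideal I R"
  shows "\<exists>I\<in>S. \<forall>J\<in>S. I \<subseteq> J \<longrightarrow> J = I"
proof (rule subset_Zorn_nonempty[OF assms(2)])
  fix C assume C: "C \<noteq> {}" "subset.chain S C"
  then have "subset.chain {I. ideal I R} C" using assms(3) by (auto simp: subset.chain_def)
  then have "\<Union>C \<in> C" by (rule noetherian_ring.ideal_chain_is_trivial[OF assms(1) C(1)])
  then show "\<Union>C \<in> S" using C by (auto simp: subset.chain_def)
qed

text \<open>Among the ideals A contained in K that have a power in L, take a maximal one. For x in K
  with x^t in L, the ideal A + (x) has this property as well by \<open>ideal_sum_pow\<close>, so x
  lies in A.\<close>

lemma ideal_pow_le_of_radical: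
  assumes R: "cring R" and N: "noetherian_ring R" and K: "ideal K R" and L: "ideal L R"
    and rad: "\<And>x. x \<in> K \<Longrightarrow> \<exists>t::nat. x [^]\<^bsub>R\<^esub> t \<in> L"
  shows "\<exists>m. ideal_pow R K m \<subseteq> L"
proof -
  interpret cring R by fact
  define S where "S = {A. ideal A R \<and> A \<subseteq> K \<and> (\<exists>m. ideal_pow R A m \<subseteq> L)}"
  have z: "{\<zero>\<^bsub>R\<^esub>} \<in> S"
  proof -
    have "ideal_pow R {\<zero>\<^bsub>R\<^esub>} 1 \<subseteq> L" unfolding ideal_pow_1[OF zeroideal]
      using additive_subgroup.zero_closed[OF ideal.axioms(1)[OF L]] by simp
    then show ?thesis unfolding S_def using zeroideal additive_subgroup.zero_closed[OF ideal.axioms(1)[OF K]] by blast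
  qed
  have "\<exists>I\<in>S. \<forall>J\<in>S. I \<subseteq> J \<longrightarrow> J = I"
    by (rule noetherian_maximal[OF N]) (use z in \<open>auto simp: S_def\<close>)
  then obtain A where AS: "A \<in> S" and mx: "\<And>B. B \<in> S \<Longrightarrow> A \<subseteq> B \<Longrightarrow> B = A" by blast
  then obtain m where A: "ideal A R" "A \<subseteq> K" "ideal_pow R A m \<subseteq> L" unfolding S_def by blast
  have "K \<subseteq> A"
  proof
    fix x assume x: "x \<in> K"
    have xc: "x \<in> carrier R" using ideal.Icarr[OF K x] .
    obtain t :: nat where t: "x [^]\<^bsub>R\<^esub> t \<in> L" using rad[OF x] by blast
    have P: "ideal (PIdl\<^bsub>R\<^esub> x) R" by (rule cgenideal_ideal[OF xc])
    have "ideal_pow R (PIdl\<^bsub>R\<^esub> x) t \<subseteq> L"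
      using PIdl_pow[OF xc] t ideal.I_l_closed[OF L] by blast
    then have "ideal_pow R A m <+>\<^bsub>R\<^esub> ideal_pow R (PIdl\<^bsub>R\<^esub> x) t \<subseteq> L"
      by (intro ideal_sum_le[OF L] A)
    then have "ideal_pow R (A <+>\<^bsub>R\<^esub> PIdl\<^bsub>R\<^esub> x) (m + t) \<subseteq> L"
      using ideal_sum_pow[OF A(1) P order_refl] by blast
    moreover have "A <+>\<^bsub>R\<^esub> PIdl\<^bsub>R\<^esub> x \<subseteq> K"
      by (intro ideal_sum_le[OF K] A cgenideal_minimal[OF K x])
    ultimately have "A <+>\<^bsub>R\<^esub> PIdl\<^bsub>R\<^esub> x \<in> S" unfolding S_def using add_ideals[OF A(1) P] by blast
    then have "A <+>\<^bsub>R\<^esub> PIdl\<^bsub>R\<^esub> x = A" using mx ideal_sum_mem[OF A(1) P] by blast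
    then show "x \<in> A" using ideal_sum_mem[OF A(1) P] cgenideal_self[OF xc] by blast
  qed
  then show ?thesis using A by (metis antisym)
qed

text \<open>An ideal \<open>L\<close> that is maximal with \<open>L \<inter> \<bb> \<subseteq> K\<^sup>n\<bb>\<close> contains a power of \<open>K\<close>.\<close>

lemma artin_rees_weak:
  assumes R: "cring R" and N: "noetherian_ring R" and K: "ideal K R" and b: "ideal \<bb> R"
  shows "\<exists>m. ideal_pow R K m \<inter> \<bb> \<subseteq> ideal_prod R (ideal_pow R K n) \<bb>"
proof -
  interpret cring R by fact
  let ?P = "ideal_prod R (ideal_pow R K n) \<bb>"
  have P: "ideal ?P R" by (intro ideal_prod_is_ideal ideal_pow_ideal K b)
  define S where "S = {L. ideal L R \<and> ?P \<subseteq> L \<and> L \<inter> \<bb> \<subseteq> ?P}"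
  have "\<exists>I\<in>S. \<forall>J\<in>S. I \<subseteq> J \<longrightarrow> J = I"
    by (rule noetherian_maximal[OF N]) (use P in \<open>auto simp: S_def\<close>)
  then obtain L where LS: "L \<in> S" and mx: "\<And>B. B \<in> S \<Longrightarrow> L \<subseteq> B \<Longrightarrow> B = L" by blast
  then have L: "ideal L R" "?P \<subseteq> L" "L \<inter> \<bb> \<subseteq> ?P" unfolding S_def by blast+
  interpret L: ideal L R by fact
  have "\<exists>t::nat. x [^]\<^bsub>R\<^esub> t \<in> L" if x: "x \<in> K" for x
  proof -
    have xc: "x \<in> carrier R" using ideal.Icarr[OF K x] .
    define y where "y = x [^]\<^bsub>R\<^esub> n"
    have y: "y \<in> ideal_pow R K n" "y \<in> carrier R" unfolding y_def using elt_pow_in[OF K x] xc by auto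
    \<comment> \<open>The ascending chain of colon ideals (L : y^t), with y = x^n, becomes
      stationary at some t. If z = l + r y^t lies in \<bb>, then y z lies in K^n \<bb> and so in L,
      hence so does r y^(t+1); stationarity gives r y^t in L and so z in L. Thus L + (y^t) has the
      maximal property too, which forces y^t into L.\<close>
    define Q where "Q t = {r \<in> carrier R. r \<otimes>\<^bsub>R\<^esub> y [^]\<^bsub>R\<^esub> t \<in> L}" for t :: nat
    have Q: "ideal (Q t) R" for t
    proof (rule submod_ideal[OF R submodI[OF reg_module[OF R]]])
      show "\<zero>\<^bsub>reg_module R\<^esub> \<in> Q t" using y by (auto simp: Q_def)
    qed (use y in \<open>auto simp: Q_def l_distr m_assoc L.I_l_closed\<close>)
    have Qm: "Q t \<subseteq> Q (Suc t)" for t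
    proof
      fix r assume r: "r \<in> Q t"
      then have "(r \<otimes>\<^bsub>R\<^esub> y [^]\<^bsub>R\<^esub> t) \<otimes>\<^bsub>R\<^esub> y \<in> L"
        by (rule_tac L.I_r_closed[OF _ y(2)]) (simp add: Q_def)
      then show "r \<in> Q (Suc t)" using r y by (auto simp: Q_def m_assoc)
    qed
    have "\<exists>I\<in>range Q. \<forall>J\<in>range Q. I \<subseteq> J \<longrightarrow> J = I"
      by (rule noetherian_maximal[OF N]) (use Q in auto)
    then obtain t where "\<forall>J\<in>range Q. Q t \<subseteq> J \<longrightarrow> J = Q t" by auto
    then have t: "Q (Suc t) = Q t" using Qm[of t] by (meson rangeI)
    let ?L = "L <+>\<^bsub>R\<^esub> PIdl\<^bsub>R\<^esub> (y [^]\<^bsub>R\<^esub> t)"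
    have Pt: "ideal (PIdl\<^bsub>R\<^esub> (y [^]\<^bsub>R\<^esub> t)) R" by (rule cgenideal_ideal) (use y in auto)
    have "?L \<inter> \<bb> \<subseteq> ?P"
    proof
      fix z assume z: "z \<in> ?L \<inter> \<bb>"
      then obtain l r where lr: "l \<in> L" "r \<in> carrier R" "z = l \<oplus>\<^bsub>R\<^esub> r \<otimes>\<^bsub>R\<^esub> y [^]\<^bsub>R\<^esub> t"
        by (auto simp: set_add_def' cgenideal_def)
      have "y \<otimes>\<^bsub>R\<^esub> z \<in> L" using z y L(2) ideal_prod.prod[of y "ideal_pow R K n" z \<bb> R] by blast
      moreover have "y \<otimes>\<^bsub>R\<^esub> z = y \<otimes>\<^bsub>R\<^esub> l \<oplus>\<^bsub>R\<^esub> r \<otimes>\<^bsub>R\<^esub> y [^]\<^bsub>R\<^esub> Suc t"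
        using lr y L.a_Hcarr by (simp add: r_distr m_ac)
      moreover have "y \<otimes>\<^bsub>R\<^esub> l \<in> L" by (rule L.I_l_closed[OF lr(1) y(2)])
      moreover have "r \<otimes>\<^bsub>R\<^esub> y [^]\<^bsub>R\<^esub> Suc t \<in> carrier R" using lr(2) y(2) by simp
      ultimately have "r \<otimes>\<^bsub>R\<^esub> y [^]\<^bsub>R\<^esub> Suc t \<in> L"
        using submod_add_cancel[OF ideal_submod[OF R L(1)] reg_module[OF R], of "y \<otimes>\<^bsub>R\<^esub> l"]
        unfolding reg_module_simps by metis
      then have "r \<in> Q (Suc t)" using lr(2) unfolding Q_def by blast
      then have "r \<otimes>\<^bsub>R\<^esub> y [^]\<^bsub>R\<^esub> t \<in> L" unfolding t unfolding Q_def by blast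
      then have "z \<in> L" unfolding lr(3) by (rule L.a_closed[OF lr(1)])
      then show "z \<in> ?P" using z L(3) by blast
    qed
    moreover have "ideal ?L R" by (rule add_ideals[OF L(1) Pt])
    ultimately have "?L = L" using mx[of ?L] L(2) ideal_sum_mem[OF L(1) Pt] unfolding S_def by blast
    then have "y [^]\<^bsub>R\<^esub> t \<in> L" using ideal_sum_mem[OF L(1) Pt] cgenideal_self[of "y [^]\<^bsub>R\<^esub> t"] y by blast
    then show ?thesis using xc unfolding y_def by (auto simp: nat_pow_pow)
  qed
  then obtain m where "ideal_pow R K m \<subseteq> L" using ideal_pow_le_of_radical[OF R N K L(1)] by blast
  then show ?thesis using L(3) by blast
qed

lemma ideal_pow_carr: "cring R \<Longrightarrow> ideal K R \<Longrightarrow> ideal_pow R K n \<subseteq> carrier R"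
  using cring.ideal_pow_ideal[of R K n] by (auto dest: ideal.Icarr)

section \<open>Torsion\<close>

definition killed :: "('r, 'a, 'p) module_scheme \<Rightarrow> 'r set \<Rightarrow> 'a set" where
  "killed A \<aa> = {x \<in> carrier A. \<forall>a\<in>\<aa>. a \<odot>\<^bsub>A\<^esub> x = \<zero>\<^bsub>A\<^esub>}"

definition tors :: "('r, 'z) ring_scheme \<Rightarrow> 'r set \<Rightarrow> ('r, 'a, 'p) module_scheme \<Rightarrow> 'a set" where
  "tors R K A = (\<Union>n. killed A (ideal_pow R K n))"

lemma killed_submod:
  assumes "module R A" "\<aa> \<subseteq> carrier R"
  shows "submodule (killed A \<aa>) R A"
proof -
  interpret A: module R A by fact
  have "a \<odot>\<^bsub>A\<^esub> (r \<odot>\<^bsub>A\<^esub> x) = \<zero>\<^bsub>A\<^esub>" if "x \<in> killed A \<aa>" "a \<in> \<aa>" "r \<in> carrier R" for a r x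
  proof -
    have "a \<odot>\<^bsub>A\<^esub> (r \<odot>\<^bsub>A\<^esub> x) = r \<odot>\<^bsub>A\<^esub> (a \<odot>\<^bsub>A\<^esub> x)"
      using that assms(2) by (intro smult_commute[OF assms(1)]) (auto simp: killed_def)
    then show ?thesis using that by (auto simp: killed_def)
  qed
  then show ?thesis
    by (intro submodI) (use assms in \<open>auto simp: killed_def A.smult_r_distr subset_iff\<close>)
qed

lemma killed_antimono: "\<aa> \<subseteq> \<bb> \<Longrightarrow> killed A \<bb> \<subseteq> killed A \<aa>"
  by (auto simp: killed_def)

lemma killed_pow_mono:
  assumes "cring R" "ideal K R" "m \<le> n"
  shows "killed A (ideal_pow R K m) \<subseteq> killed A (ideal_pow R K n)"
  by (intro killed_antimono cring.ideal_pow_antimono assms)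

lemma tors_submod:
  assumes "module R A" "ideal K R"
  shows "submodule (tors R K A) R A"
proof -
  interpret A: module R A by fact
  have s: "submodule (killed A (ideal_pow R K n)) R A" for n
    by (intro killed_submod assms ideal_pow_carr A.R.cring_axioms)
  show ?thesis
  proof (rule submodI[OF assms(1)])
    show "tors R K A \<subseteq> carrier A" by (auto simp: tors_def killed_def)
    show "\<zero>\<^bsub>A\<^esub> \<in> tors R K A" using submodD(2)[OF s] by (auto simp: tors_def)
    show "x \<oplus>\<^bsub>A\<^esub> y \<in> tors R K A" if xy: "x \<in> tors R K A" "y \<in> tors R K A" for x y
    proof -
      obtain m n where "x \<in> killed A (ideal_pow R K m)" "y \<in> killed A (ideal_pow R K n)" using xy by (auto simp: tors_def)
      then have "x \<in> killed A (ideal_pow R K (max m n))" "y \<in> killed A (ideal_pow R K (max m n))"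
        using killed_pow_mono[OF A.R.cring_axioms assms(2)] by (metis max.cobounded1 max.cobounded2 subsetD)+
      then show ?thesis using submodD(3)[OF s] by (auto simp: tors_def)
    qed
    show "r \<odot>\<^bsub>A\<^esub> x \<in> tors R K A" if "r \<in> carrier R" "x \<in> tors R K A" for r x
      using submodD(4)[OF s] that by (auto simp: tors_def)
  qed
qed

lemma killed_lin:
  assumes "lin R A B f" "module R A" "module R B" "\<aa> \<subseteq> carrier R" "x \<in> killed A \<aa>"
  shows "f x \<in> killed B \<aa>"
  using assms lin_smult[OF assms(1)] lin_zero[OF assms(1-3)]
  by (auto simp: killed_def lin_closed subset_iff) metis

lemma tors_lin:
  assumes "lin R A B f" "module R A" "module R B" "ideal K R" "x \<in> tors R K A"
  shows "f x \<in> tors R K B"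
proof -
  interpret A: module R A by fact
  obtain n where "x \<in> killed A (ideal_pow R K n)" using assms(5) by (auto simp: tors_def)
  then have "f x \<in> killed B (ideal_pow R K n)"
    using killed_lin[OF assms(1-3) ideal_pow_carr[OF A.R.cring_axioms assms(4)]] by blast
  then show ?thesis by (auto simp: tors_def)
qed

text \<open>As \<bb> is finitely generated, the values of f are killed by one power K^k, so f
  vanishes on K^k \<bb> and, by Artin-Rees, on the intersection of K^m with \<bb>. Hence f factors
  through the image of \<bb> in R/K^m and extends to R/K^m by injectivity of E. The value at 1 of
  this extension is killed by K^m, so it is torsion.\<close>

lemma tors_baer:
  assumes E: "baer R E" and N: "noetherian_ring R" and K: "ideal K R"
  shows "baer R (E\<lparr>carrier := tors R K E\<rparr>)"
  unfolding baer_def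
proof (intro conjI allI impI)
  have mE: "module R E" by (rule baer_module[OF E])
  interpret E: module R E by fact
  have R: "cring R" by (rule module_cring[OF mE])
  note ts = tors_submod[OF mE K]
  let ?T = "E\<lparr>carrier := tors R K E\<rparr>"
  show "module R ?T" by (rule submod_module[OF ts mE])
  fix \<bb> f assume "ideal \<bb> R \<and> lin R (reg_module R\<lparr>carrier := \<bb>\<rparr>) ?T f"
  then have b: "ideal \<bb> R" and f: "lin R (reg_module R\<lparr>carrier := \<bb>\<rparr>) ?T f" by auto
  let ?b = "reg_module R\<lparr>carrier := \<bb>\<rparr>"
  have mb: "module R ?b" by (rule submod_module[OF ideal_submod[OF R b] reg_module[OF R]])
  have fE: "lin R ?b E f" by (rule lin_cod_incl[OF f submodD(1)[OF ts]])
  have pc: "ideal_pow R K n \<subseteq> carrier R" for n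
    by (rule ideal_pow_carr[OF R K])
  obtain S where S: "S \<subseteq> carrier R" "finite S" "\<bb> = Idl\<^bsub>R\<^esub> S"
    using noetherian_ring.finetely_gen[OF N b] by blast
  have Sb: "S \<subseteq> \<bb>" using E.R.genideal_self[OF S(1)] S(3) by simp
  have "\<forall>s\<in>S. \<exists>n. f s \<in> killed E (ideal_pow R K n)"
    using lin_closed[OF f] Sb by (auto simp: tors_def)
  then obtain n where n: "\<And>s. s \<in> S \<Longrightarrow> f s \<in> killed E (ideal_pow R K (n s))" by metis
  \<comment> \<open>The inserted 0 makes the maximum meaningful for an empty set of
    generators.\<close>
  define k where "k = Max (insert 0 (n ` S))"
  have "f s \<in> killed E (ideal_pow R K k)" if "s \<in> S" for s
    using n[OF that] killed_pow_mono[OF R K, of "n s" k E] that S(2) unfolding k_def by auto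
  moreover have "ideal {x \<in> \<bb>. f x \<in> killed E (ideal_pow R K k)} R"
  proof -
    have "submodule {x \<in> carrier ?b. f x \<in> killed E (ideal_pow R K k)} R ?b"
      by (rule submod_vimage[OF fE mb mE killed_submod[OF mE pc]])
    then have "submodule {x \<in> \<bb>. f x \<in> killed E (ideal_pow R K k)} R (reg_module R)"
      using submod_trans[OF _ ideal_submod[OF R b] reg_module[OF R]] by simp
    then show ?thesis by (rule submod_ideal[OF R])
  qed
  ultimately have fk: "f x \<in> killed E (ideal_pow R K k)" if "x \<in> \<bb>" for x
    using E.R.genideal_minimal[of "{x \<in> \<bb>. f x \<in> killed E (ideal_pow R K k)}" S] Sb that unfolding S(3)[symmetric] by blast
  obtain m where m: "ideal_pow R K m \<inter> \<bb> \<subseteq> ideal_prod R (ideal_pow R K k) \<bb>"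
    using artin_rees_weak[OF R N K b] by blast
  have f0: "f z = \<zero>\<^bsub>E\<^esub>" if "z \<in> ideal_prod R (ideal_pow R K k) \<bb>" for z
  proof -
    have "f z = \<zero>\<^bsub>E\<^esub> \<and> z \<in> \<bb>" using that
    proof induction
      case (prod i j)
      then show ?case using lin_smult[OF fE, of i j] fk[of j] pc[of k] ideal.I_l_closed[OF b, of j i]
        by (auto simp: killed_def subset_iff)
    next
      case (sum a b')
      then show ?case using lin_add[OF fE, of a b'] additive_subgroup.a_closed[OF ideal.axioms(1)[OF b]] by simp
    qed
    then show ?thesis by simp
  qed
  let ?Km = "ideal_pow R K m"
  have Km: "submodule ?Km R (reg_module R)" by (rule ideal_submod[OF R E.R.ideal_pow_ideal[OF K]])
  let ?W = "quot_module (reg_module R) ?Km"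
  note W = quot_module_module[OF Km reg_module[OF R]]
  have bs: "\<bb> \<subseteq> carrier R" using submodD(1)[OF ideal_submod[OF R b]] by simp
  have "\<exists>\<psi>. lin R ?W E \<psi> \<and> (\<forall>x\<in>carrier ?b. \<psi> (?Km +>\<^bsub>reg_module R\<^esub> x) = f x)"
  proof (rule baer_factor[OF E mb W(1) _ fE])
    show "lin R ?b ?W (\<lambda>x. ?Km +>\<^bsub>reg_module R\<^esub> x)" by (rule lin_dom[OF W(2)]) (use bs in simp)
    fix x assume "x \<in> carrier ?b" "?Km +>\<^bsub>reg_module R\<^esub> x = \<zero>\<^bsub>?W\<^esub>"
    then show "f x = \<zero>\<^bsub>E\<^esub>" using coset_eq_sub[OF Km reg_module[OF R], of x] bs m f0 by auto
  qed
  then obtain \<psi> where psi: "lin R ?W E \<psi>" and psif: "\<And>x. x \<in> \<bb> \<Longrightarrow> \<psi> (?Km +>\<^bsub>reg_module R\<^esub> x) = f x" by auto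
  let ?q = "\<lambda>x. \<psi> (?Km +>\<^bsub>reg_module R\<^esub> x)"
  have q: "lin R (reg_module R) E ?q" by (rule lin_comp[OF W(2) psi])
  have qr: "?q r = r \<odot>\<^bsub>E\<^esub> ?q \<one>\<^bsub>R\<^esub>" if "r \<in> carrier R" for r
    using lin_smult[OF q that, of "\<one>\<^bsub>R\<^esub>"] that by simp
  have q1: "?q \<one>\<^bsub>R\<^esub> \<in> carrier E" using lin_closed[OF q] by simp
  have "?q \<one>\<^bsub>R\<^esub> \<in> killed E ?Km"
  proof -
    have "r \<odot>\<^bsub>E\<^esub> ?q \<one>\<^bsub>R\<^esub> = \<zero>\<^bsub>E\<^esub>" if r: "r \<in> ?Km" for r
    proof -
      have rc: "r \<in> carrier R" using pc r by blast
      have "?Km +>\<^bsub>reg_module R\<^esub> r = ?Km" using coset_eq_sub[OF Km reg_module[OF R], of r] r rc by simp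
      then show ?thesis using qr[OF rc] lin_zero[OF psi W(1) mE] by simp
    qed
    then show ?thesis using q1 by (auto simp: killed_def)
  qed
  then have "?q \<one>\<^bsub>R\<^esub> \<in> carrier ?T" unfolding tors_def by auto
  moreover have "f r = r \<odot>\<^bsub>?T\<^esub> ?q \<one>\<^bsub>R\<^esub>" if "r \<in> \<bb>" for r
    using psif[OF that] qr[of r] that bs by (simp add: subset_iff)
  ultimately show "\<exists>e\<in>carrier ?T. \<forall>r\<in>\<bb>. f r = r \<odot>\<^bsub>?T\<^esub> e" by blast
qed

section \<open>Partial contractions of complexes of injective modules\<close>

lemma smult_diff:
  assumes "module R A" "r \<in> carrier R" "x \<in> carrier A" "y \<in> carrier A"
  shows "r \<odot>\<^bsub>A\<^esub> (x \<ominus>\<^bsub>A\<^esub> y) = r \<odot>\<^bsub>A\<^esub> x \<ominus>\<^bsub>A\<^esub> r \<odot>\<^bsub>A\<^esub> y"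
proof -
  interpret A: module R A by fact
  show ?thesis using assms by (simp add: a_minus_def A.smult_r_distr A.smult_r_minus)
qed

lemma minus_closed: "module R A \<Longrightarrow> x \<in> carrier A \<Longrightarrow> y \<in> carrier A \<Longrightarrow> x \<ominus>\<^bsub>A\<^esub> y \<in> carrier A"
proof -
  assume "module R A" "x \<in> carrier A" "y \<in> carrier A"
  then interpret A: module R A by simp
  show ?thesis by (rule A.M.minus_closed) fact+
qed

lemma minus_add_cancel:
  assumes "module R A" "x \<in> carrier A" "y \<in> carrier A"
  shows "(x \<ominus>\<^bsub>A\<^esub> y) \<oplus>\<^bsub>A\<^esub> y = x" "y \<oplus>\<^bsub>A\<^esub> (x \<ominus>\<^bsub>A\<^esub> y) = x" "(x \<oplus>\<^bsub>A\<^esub> y) \<ominus>\<^bsub>A\<^esub> y = x"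
proof -
  interpret A: module R A by fact
  show "(x \<ominus>\<^bsub>A\<^esub> y) \<oplus>\<^bsub>A\<^esub> y = x" "y \<oplus>\<^bsub>A\<^esub> (x \<ominus>\<^bsub>A\<^esub> y) = x" "(x \<oplus>\<^bsub>A\<^esub> y) \<ominus>\<^bsub>A\<^esub> y = x"
    using assms(2,3) by (simp_all add: a_minus_def A.M.a_assoc A.M.l_neg A.M.r_neg A.M.a_lcomm[of y])
qed

text \<open>If \<open>u\<close> kills the cohomology in degrees at most \<open>k\<close>, then a map \<open>h\<close> with \<open>d h d = u\<^sup>b d\<close> in degree
  \<open>n\<close> makes \<open>u (u\<^sup>b - d h)\<close> vanish on the cocycles of degree \<open>n + 1\<close>; extending the map it induces on the
  coboundaries of degree \<open>n + 2\<close> gives the next \<open>h\<close>.\<close>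

lemma partial_contraction:
  fixes C :: "nat \<Rightarrow> ('r, 'c) module"
  assumes C: "\<And>n. baer R (C n)" and d: "\<And>n. lin R (C n) (C (Suc n)) (d n)"
    and dd: "\<And>n x. x \<in> carrier (C n) \<Longrightarrow> d (Suc n) (d n x) = \<zero>\<^bsub>C (Suc (Suc n))\<^esub>"
    and triv: "carrier (C 0) = {\<zero>\<^bsub>C 0\<^esub>}" and u: "u \<in> carrier R"
    and ann: "\<And>n z. n < k \<Longrightarrow> z \<in> carrier (C (Suc n)) \<Longrightarrow> d (Suc n) z = \<zero>\<^bsub>C (Suc (Suc n))\<^esub> \<Longrightarrow>
      \<exists>w\<in>carrier (C n). d n w = u \<odot>\<^bsub>C (Suc n)\<^esub> z"
    and "n \<le> k"
  shows "\<exists>(b::nat) h. lin R (C (Suc n)) (C n) h \<and>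
    (\<forall>x\<in>carrier (C n). d n (h (d n x)) = (u [^]\<^bsub>R\<^esub> b) \<odot>\<^bsub>C (Suc n)\<^esub> d n x)"
  using \<open>n \<le> k\<close>
proof (induction n)
  case 0
  have m: "module R (C n)" for n by (rule baer_module[OF C])
  interpret C1: module R "C (Suc 0)" by (rule m)
  have "lin R (C 1) (C 0) (\<lambda>x. \<zero>\<^bsub>C 0\<^esub>)" by (rule lin_const_zero[OF m m])
  then show ?case
    by (intro exI[of _ "0::nat"] exI[of _ "\<lambda>x. \<zero>\<^bsub>C 0\<^esub>"]) (use triv lin_zero[OF d m m, of 0] in auto)
next
  case (Suc n)
  have m: "module R (C n)" for n by (rule baer_module[OF C])
  obtain b :: nat and h where h: "lin R (C (Suc n)) (C n) h"
    and dhd: "\<And>x. x \<in> carrier (C n) \<Longrightarrow> d n (h (d n x)) = (u [^]\<^bsub>R\<^esub> b) \<odot>\<^bsub>C (Suc n)\<^esub> d n x"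
    using Suc by auto
  interpret A: module R "C (Suc n)" by (rule m)
  interpret B: module R "C (Suc (Suc n))" by (rule m)
  have ub: "u [^]\<^bsub>R\<^esub> b \<in> carrier R" using u by simp
  let ?l = "\<lambda>x. u \<odot>\<^bsub>C (Suc n)\<^esub> ((u [^]\<^bsub>R\<^esub> b) \<odot>\<^bsub>C (Suc n)\<^esub> x \<ominus>\<^bsub>C (Suc n)\<^esub> d n (h x))"
  have id: "lin R (C (Suc n)) (C (Suc n)) (\<lambda>x. x)" by (auto simp: lin_def)
  have l0: "lin R (C (Suc n)) (C (Suc n)) (\<lambda>x. (u [^]\<^bsub>R\<^esub> b) \<odot>\<^bsub>C (Suc n)\<^esub> x \<ominus>\<^bsub>C (Suc n)\<^esub> d n (h x))"
    by (intro lin_fun_diff lin_fun_smult lin_comp[OF h d] id ub m)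
  have l: "lin R (C (Suc n)) (C (Suc n)) ?l" by (intro lin_fun_smult l0 m u)
  have "\<exists>h'. lin R (C (Suc (Suc n))) (C (Suc n)) h' \<and> (\<forall>x\<in>carrier (C (Suc n)). h' (d (Suc n) x) = ?l x)"
  proof (rule baer_factor[OF C m m d l])
    fix z assume z: "z \<in> carrier (C (Suc n))" "d (Suc n) z = \<zero>\<^bsub>C (Suc (Suc n))\<^esub>"
    then obtain w where w: "w \<in> carrier (C n)" "d n w = u \<odot>\<^bsub>C (Suc n)\<^esub> z" using ann[of n z] Suc.prems by auto
    have "?l z = (u [^]\<^bsub>R\<^esub> b) \<odot>\<^bsub>C (Suc n)\<^esub> (u \<odot>\<^bsub>C (Suc n)\<^esub> z) \<ominus>\<^bsub>C (Suc n)\<^esub> d n (h (u \<odot>\<^bsub>C (Suc n)\<^esub> z))"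
      using lin_smult[OF l0 u z(1)] by simp
    also have "\<dots> = \<zero>\<^bsub>C (Suc n)\<^esub>"
      unfolding w(2)[symmetric] dhd[OF w(1)] using lin_closed[OF d w(1)] ub minus_eq_zero_iff[OF m[of "Suc n"]] by simp
    finally show "?l z = \<zero>\<^bsub>C (Suc n)\<^esub>" .
  qed
  then obtain h' where h': "lin R (C (Suc (Suc n))) (C (Suc n)) h'"
    and e: "\<And>x. x \<in> carrier (C (Suc n)) \<Longrightarrow> h' (d (Suc n) x) = ?l x" by blast
  have "d (Suc n) (h' (d (Suc n) x)) = (u [^]\<^bsub>R\<^esub> Suc b) \<odot>\<^bsub>C (Suc (Suc n))\<^esub> d (Suc n) x"
    if x: "x \<in> carrier (C (Suc n))" for x
  proof -
    have hx: "h x \<in> carrier (C n)" "d n (h x) \<in> carrier (C (Suc n))" using lin_closed[OF h x] lin_closed[OF d] by auto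
    have ux: "(u [^]\<^bsub>R\<^esub> b) \<odot>\<^bsub>C (Suc n)\<^esub> x \<in> carrier (C (Suc n))" using ub x by simp
    have dx: "d (Suc n) x \<in> carrier (C (Suc (Suc n)))" by (rule lin_closed[OF d x])
    have "d (Suc n) (h' (d (Suc n) x)) = u \<odot>\<^bsub>C (Suc (Suc n))\<^esub> (d (Suc n) ((u [^]\<^bsub>R\<^esub> b) \<odot>\<^bsub>C (Suc n)\<^esub> x) \<ominus>\<^bsub>C (Suc (Suc n))\<^esub> d (Suc n) (d n (h x)))"
      unfolding e[OF x] using lin_smult[OF d[of "Suc n"] u minus_closed[OF m ux hx(2)]] lin_diff[OF d[of "Suc n"] m m ux hx(2)] by simp
    also have "\<dots> = u \<odot>\<^bsub>C (Suc (Suc n))\<^esub> ((u [^]\<^bsub>R\<^esub> b) \<odot>\<^bsub>C (Suc (Suc n))\<^esub> d (Suc n) x)"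
      unfolding dd[OF hx(1)] lin_smult[OF d[of "Suc n"] ub x] using ub dx minus_zero_right[OF m] by simp
    also have "\<dots> = (u [^]\<^bsub>R\<^esub> Suc b) \<odot>\<^bsub>C (Suc (Suc n))\<^esub> d (Suc n) x"
      using ub u dx A.R.m_comm[OF ub u] by (simp flip: B.smult_assoc1)
    finally show ?thesis .
  qed
  then show ?case using h' by blast
qed

text \<open>For a cocycle z the multiple u z is a coboundary d w, and d h d = u^b d gives d (u h z)
  = d h d w = u^b u z. One further factor u thus extends the contraction identity from coboundaries
  to cocycles, at the price of n < k.\<close>

lemma partial_contraction_cycles:
  fixes C :: "nat \<Rightarrow> ('r, 'c) module"
  assumes C: "\<And>n. baer R (C n)" and d: "\<And>n. lin R (C n) (C (Suc n)) (d n)"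
    and dd: "\<And>n x. x \<in> carrier (C n) \<Longrightarrow> d (Suc n) (d n x) = \<zero>\<^bsub>C (Suc (Suc n))\<^esub>"
    and triv: "carrier (C 0) = {\<zero>\<^bsub>C 0\<^esub>}" and u: "u \<in> carrier R"
    and ann: "\<And>n z. n < k \<Longrightarrow> z \<in> carrier (C (Suc n)) \<Longrightarrow> d (Suc n) z = \<zero>\<^bsub>C (Suc (Suc n))\<^esub> \<Longrightarrow>
      \<exists>w\<in>carrier (C n). d n w = u \<odot>\<^bsub>C (Suc n)\<^esub> z"
    and n: "n < k"
  shows "\<exists>(b::nat) h. lin R (C (Suc n)) (C n) h \<and>
    (\<forall>z\<in>carrier (C (Suc n)). d (Suc n) z = \<zero>\<^bsub>C (Suc (Suc n))\<^esub> \<longrightarrow> d n (h z) = (u [^]\<^bsub>R\<^esub> b) \<odot>\<^bsub>C (Suc n)\<^esub> z)"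
proof -
  have m: "module R (C n)" for n by (rule baer_module[OF C])
  interpret A: module R "C (Suc n)" by (rule m)
  have "\<exists>(b::nat) h. lin R (C (Suc n)) (C n) h \<and>
    (\<forall>x\<in>carrier (C n). d n (h (d n x)) = (u [^]\<^bsub>R\<^esub> b) \<odot>\<^bsub>C (Suc n)\<^esub> d n x)"
    by (rule partial_contraction[where k = k, OF C d dd triv u ann]) (use n in auto)
  then obtain b :: nat and h where h: "lin R (C (Suc n)) (C n) h"
    and dhd: "\<And>x. x \<in> carrier (C n) \<Longrightarrow> d n (h (d n x)) = (u [^]\<^bsub>R\<^esub> b) \<odot>\<^bsub>C (Suc n)\<^esub> d n x" by blast
  have "d n (u \<odot>\<^bsub>C n\<^esub> h z) = (u [^]\<^bsub>R\<^esub> Suc b) \<odot>\<^bsub>C (Suc n)\<^esub> z"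
    if z: "z \<in> carrier (C (Suc n))" "d (Suc n) z = \<zero>\<^bsub>C (Suc (Suc n))\<^esub>" for z
  proof -
    obtain w where w: "w \<in> carrier (C n)" "d n w = u \<odot>\<^bsub>C (Suc n)\<^esub> z" using ann[OF n z] by blast
    have "d n (u \<odot>\<^bsub>C n\<^esub> h z) = d n (h (d n w))" using lin_smult[OF h u z(1)] w by simp
    also have "\<dots> = (u [^]\<^bsub>R\<^esub> b) \<odot>\<^bsub>C (Suc n)\<^esub> (u \<odot>\<^bsub>C (Suc n)\<^esub> z)" using dhd[OF w(1)] w by simp
    finally show ?thesis using u z by (simp add: A.smult_assoc1)
  qed
  moreover have "lin R (C (Suc n)) (C n) (\<lambda>z. u \<odot>\<^bsub>C n\<^esub> h z)" by (rule lin_fun_smult[OF h u m m])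
  ultimately show ?thesis by blast
qed

section \<open>Relatively Noetherian pairs of submodules\<close>

text \<open>For submodules \<open>B \<subseteq> Z\<close> of \<open>A\<close>, the module \<open>Z/B\<close> is Noetherian.\<close>

definition noeth_pair ::
  "('r, 'z) ring_scheme \<Rightarrow> ('r, 'a, 'p) module_scheme \<Rightarrow> 'a set \<Rightarrow> 'a set \<Rightarrow> bool" where
  "noeth_pair R A B Z \<longleftrightarrow> (\<forall>U. submodule U R A \<and> B \<subseteq> U \<and> U \<subseteq> Z \<longrightarrow>
     (\<exists>S. finite S \<and> S \<subseteq> U \<and> (\<forall>V. submodule V R A \<and> B \<subseteq> V \<and> S \<subseteq> V \<longrightarrow> U \<subseteq> V)))"

lemma noeth_pairD:
  assumes "noeth_pair R A B Z" "submodule U R A" "B \<subseteq> U" "U \<subseteq> Z"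
  shows "\<exists>S. finite S \<and> S \<subseteq> U \<and> (\<forall>V. submodule V R A \<longrightarrow> B \<subseteq> V \<longrightarrow> S \<subseteq> V \<longrightarrow> U \<subseteq> V)"
  using assms(1)[unfolded noeth_pair_def, rule_format, of U] assms(2-4) by (simp add: imp_conjL)

lemma noeth_pair_subset: "noeth_pair R A B Z \<Longrightarrow> Z' \<subseteq> Z \<Longrightarrow> noeth_pair R A B Z'"
  unfolding noeth_pair_def by (meson subset_trans)

lemma noeth_pair_trivial:
  assumes "Z \<subseteq> B"
  shows "noeth_pair R A B Z"
  unfolding noeth_pair_def
proof (intro allI impI exI[of _ "{}"] conjI)
  fix U V assume "submodule U R A \<and> B \<subseteq> U \<and> U \<subseteq> Z" "submodule V R A \<and> B \<subseteq> V \<and> {} \<subseteq> V"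
  then show "U \<subseteq> V" using assms by (meson subset_trans)
qed auto

lemma set_addI: "x \<in> X \<Longrightarrow> y \<in> Y \<Longrightarrow> x \<oplus>\<^bsub>A\<^esub> y \<in> X <+>\<^bsub>A\<^esub> Y"
  by (auto simp: set_add_def')

lemma set_addE:
  assumes "z \<in> X <+>\<^bsub>A\<^esub> Y"
  obtains x y where "x \<in> X" "y \<in> Y" "z = x \<oplus>\<^bsub>A\<^esub> y"
  using assms by (auto simp: set_add_def')

lemma submod_sum:
  assumes "module R A" "submodule X R A" "submodule Y R A"
  shows "submodule (X <+>\<^bsub>A\<^esub> Y) R A" "X \<subseteq> X <+>\<^bsub>A\<^esub> Y" "Y \<subseteq> X <+>\<^bsub>A\<^esub> Y"
proof -
  interpret A: module R A by fact
  note X = submodD[OF assms(2)] and Y = submodD[OF assms(3)]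
  note Xc = subsetD[OF X(1)] and Yc = subsetD[OF Y(1)]
  show "submodule (X <+>\<^bsub>A\<^esub> Y) R A"
  proof (rule submodI[OF assms(1)])
    show "X <+>\<^bsub>A\<^esub> Y \<subseteq> carrier A" using Xc Yc by (auto simp: set_add_def')
    have "\<zero>\<^bsub>A\<^esub> = \<zero>\<^bsub>A\<^esub> \<oplus>\<^bsub>A\<^esub> \<zero>\<^bsub>A\<^esub>" by simp
    then show "\<zero>\<^bsub>A\<^esub> \<in> X <+>\<^bsub>A\<^esub> Y" using set_addI[OF X(2) Y(2), of A] by simp
    show "a \<oplus>\<^bsub>A\<^esub> b \<in> X <+>\<^bsub>A\<^esub> Y" if ab: "a \<in> X <+>\<^bsub>A\<^esub> Y" "b \<in> X <+>\<^bsub>A\<^esub> Y" for a b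
    proof -
      obtain x y x' y' where e: "x \<in> X" "y \<in> Y" "x' \<in> X" "y' \<in> Y" "a = x \<oplus>\<^bsub>A\<^esub> y" "b = x' \<oplus>\<^bsub>A\<^esub> y'"
        using ab by (auto simp: set_add_def')
      have "a \<oplus>\<^bsub>A\<^esub> b = (x \<oplus>\<^bsub>A\<^esub> x') \<oplus>\<^bsub>A\<^esub> (y \<oplus>\<^bsub>A\<^esub> y')" using e Xc Yc by (simp add: A.M.a_ac)
      then show ?thesis using set_addI[of "x \<oplus>\<^bsub>A\<^esub> x'" X "y \<oplus>\<^bsub>A\<^esub> y'" Y A] e X(3) Y(3) by simp
    qed
    show "r \<odot>\<^bsub>A\<^esub> a \<in> X <+>\<^bsub>A\<^esub> Y" if ra: "r \<in> carrier R" "a \<in> X <+>\<^bsub>A\<^esub> Y" for r a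
    proof -
      obtain x y where e: "x \<in> X" "y \<in> Y" "a = x \<oplus>\<^bsub>A\<^esub> y" using ra by (auto simp: set_add_def')
      have "r \<odot>\<^bsub>A\<^esub> a = r \<odot>\<^bsub>A\<^esub> x \<oplus>\<^bsub>A\<^esub> r \<odot>\<^bsub>A\<^esub> y" using e Xc Yc ra by (simp add: A.smult_r_distr)
      then show ?thesis using set_addI[of "r \<odot>\<^bsub>A\<^esub> x" X "r \<odot>\<^bsub>A\<^esub> y" Y A] e X(4) Y(4) ra by simp
    qed
  qed
  show "X \<subseteq> X <+>\<^bsub>A\<^esub> Y"
  proof
    fix x assume x: "x \<in> X"
    have "x = x \<oplus>\<^bsub>A\<^esub> \<zero>\<^bsub>A\<^esub>" using Xc[OF x] by simp
    then show "x \<in> X <+>\<^bsub>A\<^esub> Y" using set_addI[OF x Y(2), of A] by simp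
  qed
  show "Y \<subseteq> X <+>\<^bsub>A\<^esub> Y"
  proof
    fix x assume x: "x \<in> Y"
    have "x = \<zero>\<^bsub>A\<^esub> \<oplus>\<^bsub>A\<^esub> x" using Yc[OF x] by simp
    then show "x \<in> X <+>\<^bsub>A\<^esub> Y" using set_addI[OF X(2) x, of A] by simp
  qed
qed

lemma submod_sum_le: "submodule V R A \<Longrightarrow> X \<subseteq> V \<Longrightarrow> Y \<subseteq> V \<Longrightarrow> X <+>\<^bsub>A\<^esub> Y \<subseteq> V"
  using submodD(3)[of V R A] by (auto simp: set_add_def')

text \<open>The map Z/B \<rightarrow> Z'/B' induced by \<alpha> has kernel {z \<in> Z. \<alpha> z
  \<in> B'}/B. When the kernel and the target are Noetherian, U is generated over B by generators of
  its part in the kernel together with lifts of generators of its image.\<close>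

lemma noeth_pair_extension:
  assumes A: "module R A" and A': "module R A'" and al: "lin R A A' \<alpha>"
    and n': "noeth_pair R A' B' Z'" and sB': "submodule B' R A'" and B'Z': "B' \<subseteq> Z'" and sZ': "submodule Z' R A'"
    and ZZ': "\<And>z. z \<in> Z \<Longrightarrow> \<alpha> z \<in> Z'"
    and BB': "\<And>z. z \<in> B \<Longrightarrow> \<alpha> z \<in> B'"
    and n: "noeth_pair R A B {z \<in> Z. \<alpha> z \<in> B'}"
  shows "noeth_pair R A B Z"
  unfolding noeth_pair_def
proof (intro allI impI)
  fix U assume U: "submodule U R A \<and> B \<subseteq> U \<and> U \<subseteq> Z"
  then have sU: "submodule U R A" and BU: "B \<subseteq> U" and UZ: "U \<subseteq> Z" by simp_all
  note Us = submodD[OF sU]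
  \<comment> \<open>The image of U is enlarged by B', because a pair (B', Z') only sees submodules
    that contain B'.\<close>
  let ?U' = "\<alpha> ` U <+>\<^bsub>A'\<^esub> B'"
  note U' = submod_sum[OF A' submod_image[OF al A A' sU] sB']
  have "?U' \<subseteq> Z'" by (rule submod_sum_le[OF sZ' _ B'Z']) (use ZZ' UZ in auto)
  from noeth_pairD[OF n' U'(1,3) this] obtain S' where S'0: "finite S' \<and> S' \<subseteq> ?U' \<and>
    (\<forall>V. submodule V R A' \<longrightarrow> B' \<subseteq> V \<longrightarrow> S' \<subseteq> V \<longrightarrow> ?U' \<subseteq> V)" by (elim exE)
  then have S': "finite S'" "S' \<subseteq> ?U'" by simp_all
  note S'3 = S'0[THEN conjunct2, THEN conjunct2, rule_format]
  have "\<forall>s\<in>S'. \<exists>x. x \<in> U \<and> (\<exists>b\<in>B'. s = \<alpha> x \<oplus>\<^bsub>A'\<^esub> b)"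
  proof
    fix s assume "s \<in> S'"
    with S'(2) have "s \<in> ?U'" by blast
    then show "\<exists>x. x \<in> U \<and> (\<exists>b\<in>B'. s = \<alpha> x \<oplus>\<^bsub>A'\<^esub> b)" by (rule set_addE) blast
  qed
  then obtain g where g: "\<And>s. s \<in> S' \<Longrightarrow> g s \<in> U \<and> (\<exists>b\<in>B'. s = \<alpha> (g s) \<oplus>\<^bsub>A'\<^esub> b)" by metis
  let ?U0 = "{x \<in> carrier A. \<alpha> x \<in> B'} \<inter> U"
  have sU0: "submodule ?U0 R A" by (rule submod_inter[OF A submod_vimage[OF al A A' sB'] sU])
  have BU0: "B \<subseteq> ?U0" using BB' BU Us(1) by blast
  have UZ0: "?U0 \<subseteq> {z \<in> Z. \<alpha> z \<in> B'}" using UZ by blast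
  from noeth_pairD[OF n sU0 BU0 UZ0] obtain S0 where S00: "finite S0 \<and> S0 \<subseteq> ?U0 \<and>
    (\<forall>V. submodule V R A \<longrightarrow> B \<subseteq> V \<longrightarrow> S0 \<subseteq> V \<longrightarrow> ?U0 \<subseteq> V)" by (elim exE)
  then have S0: "finite S0" "S0 \<subseteq> ?U0" by simp_all
  note S03 = S00[THEN conjunct2, THEN conjunct2, rule_format]
  show "\<exists>S. finite S \<and> S \<subseteq> U \<and> (\<forall>V. submodule V R A \<and> B \<subseteq> V \<and> S \<subseteq> V \<longrightarrow> U \<subseteq> V)"
  proof (intro exI conjI allI impI)
    show "finite (S0 \<union> g ` S')" using S0 S' by simp
    show "S0 \<union> g ` S' \<subseteq> U" using S0(2) g by blast
    fix V assume "submodule V R A \<and> B \<subseteq> V \<and> S0 \<union> g ` S' \<subseteq> V"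
    then have V: "submodule V R A" "B \<subseteq> V" "S0 \<subseteq> V" "g ` S' \<subseteq> V" by auto
    have sVU: "submodule (V \<inter> U) R A" by (rule submod_inter[OF A V(1) sU])
    let ?V' = "\<alpha> ` (V \<inter> U) <+>\<^bsub>A'\<^esub> B'"
    note V' = submod_sum[OF A' submod_image[OF al A A' sVU] sB']
    have "S' \<subseteq> ?V'"
    proof
      fix s assume s: "s \<in> S'"
      then show "s \<in> ?V'" using g[OF s] V(4) unfolding set_add_def' by blast
    qed
    then have UV: "?U' \<subseteq> ?V'" by (rule S'3[OF V'(1,3)])
    show "U \<subseteq> V"
    proof
      fix x assume x: "x \<in> U"
      then have "\<alpha> x \<in> ?V'" using U'(2) UV by blast
      then obtain v b where v: "v \<in> V" "v \<in> U" "b \<in> B'" "\<alpha> x = \<alpha> v \<oplus>\<^bsub>A'\<^esub> b" by (auto simp: set_add_def')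
      have c: "x \<in> carrier A" "v \<in> carrier A" "b \<in> carrier A'" using x v Us(1) submodD(1)[OF sB'] by auto
      interpret A': module R A' by fact
      have "\<alpha> (x \<ominus>\<^bsub>A\<^esub> v) = b" unfolding lin_diff[OF al A A' c(1,2)] v(4)
        using minus_add_cancel(3)[OF A' c(3) lin_closed[OF al c(2)]] A'.M.a_comm[OF c(3) lin_closed[OF al c(2)]] by simp
      then have "x \<ominus>\<^bsub>A\<^esub> v \<in> ?U0" using v(3) submodD_diff[OF sU x v(2)] Us(1) by auto
      then have "x \<ominus>\<^bsub>A\<^esub> v \<in> V" using S03[OF V(1-3)] by blast
      then show "x \<in> V" using submodD(3)[OF V(1) _ v(1)] minus_add_cancel(1)[OF A c(1,2)] by metis
    qed
  qed
qed

text \<open>The case of an injective induced map: the quotient of Z by the preimage of B' embeds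
  into Z'/B'.\<close>

lemma noeth_pair_vimage:
  assumes "module R A" "module R A'" "lin R A A' \<alpha>"
    and "noeth_pair R A' B' Z'" "submodule B' R A'" "B' \<subseteq> Z'" "submodule Z' R A'"
    and "\<And>z. z \<in> Z \<Longrightarrow> \<alpha> z \<in> Z'"
  shows "noeth_pair R A {z \<in> Z. \<alpha> z \<in> B'} Z"
  by (rule noeth_pair_extension[OF assms(1-8)]) (auto intro: noeth_pair_trivial)

text \<open>The image of Z/B in A'/B' contains Z'/B', so the latter is a subquotient of Z/B.
  Generators of a submodule are the images of generators of its preimage in Z.\<close>

lemma noeth_pair_image:
  assumes A: "module R A" and A': "module R A'" and al: "lin R A A' \<alpha>"
    and n: "noeth_pair R A B Z" and sZ: "submodule Z R A" and BZ: "B \<subseteq> Z"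
    and BB': "\<And>x. x \<in> B \<Longrightarrow> \<alpha> x \<in> B'" and ZZ': "Z' \<subseteq> \<alpha> ` Z <+>\<^bsub>A'\<^esub> B'"
  shows "noeth_pair R A' B' Z'"
  unfolding noeth_pair_def
proof (intro allI impI)
  fix U' assume "submodule U' R A' \<and> B' \<subseteq> U' \<and> U' \<subseteq> Z'"
  then have U': "submodule U' R A'" "B' \<subseteq> U'" "U' \<subseteq> Z'" by auto
  let ?U = "{x \<in> carrier A. \<alpha> x \<in> U'} \<inter> Z"
  have sU: "submodule ?U R A" by (rule submod_inter[OF A submod_vimage[OF al A A' U'(1)] sZ])
  have BU: "B \<subseteq> ?U" using BZ BB' U'(2) submodD(1)[OF sZ] by blast
  have UZ: "?U \<subseteq> Z" by blast
  from noeth_pairD[OF n sU BU UZ] obtain S where S0: "finite S \<and> S \<subseteq> ?U \<and>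
    (\<forall>V. submodule V R A \<longrightarrow> B \<subseteq> V \<longrightarrow> S \<subseteq> V \<longrightarrow> ?U \<subseteq> V)" by (elim exE)
  then have S: "finite S" "S \<subseteq> ?U" by simp_all
  note S3 = S0[THEN conjunct2, THEN conjunct2, rule_format]
  show "\<exists>S. finite S \<and> S \<subseteq> U' \<and> (\<forall>V. submodule V R A' \<and> B' \<subseteq> V \<and> S \<subseteq> V \<longrightarrow> U' \<subseteq> V)"
  proof (intro exI conjI allI impI)
    show "finite (\<alpha> ` S)" "\<alpha> ` S \<subseteq> U'" using S by auto
    fix V' assume "submodule V' R A' \<and> B' \<subseteq> V' \<and> \<alpha> ` S \<subseteq> V'"
    then have V': "submodule V' R A'" "B' \<subseteq> V'" "\<alpha> ` S \<subseteq> V'" by auto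
    let ?V = "{x \<in> carrier A. \<alpha> x \<in> V'} \<inter> Z"
    have "?U \<subseteq> ?V"
      by (rule S3[OF submod_inter[OF A submod_vimage[OF al A A' V'(1)] sZ]])
        (use BZ BB' V'(2,3) S(2) submodD(1)[OF sZ] in blast)+
    show "U' \<subseteq> V'"
    proof
      fix y assume y: "y \<in> U'"
      then obtain z b where z: "z \<in> Z" "b \<in> B'" "y = \<alpha> z \<oplus>\<^bsub>A'\<^esub> b" using U'(3) ZZ' by (force simp: set_add_def')
      interpret A': module R A' by fact
      have c: "z \<in> carrier A" "\<alpha> z \<in> carrier A'" "b \<in> carrier A'" using z submodD(1)[OF sZ] lin_closed[OF al]
        U'(1,2) submodD(1)[OF U'(1)] by auto
      have "b \<oplus>\<^bsub>A'\<^esub> \<alpha> z \<in> U'" using y z A'.M.a_comm[OF c(2,3)] by simp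
      then have "\<alpha> z \<in> U'" using submod_add_cancel[OF U'(1) A' _ c(2)] z(2) U'(2) by blast
      then have "z \<in> ?U" using z c by blast
      then have "\<alpha> z \<in> V'" using \<open>?U \<subseteq> ?V\<close> by blast
      then show "y \<in> V'" using z V'(2) submodD(3)[OF V'(1)] by blast
    qed
  qed
qed

lemma noeth_pair_ring:
  assumes "cring R" "noetherian_ring R"
  shows "noeth_pair R (reg_module R) {\<zero>\<^bsub>R\<^esub>} (carrier R)"
  unfolding noeth_pair_def
proof (intro allI impI)
  interpret cring R by fact
  fix U assume "submodule U R (reg_module R) \<and> {\<zero>\<^bsub>R\<^esub>} \<subseteq> U \<and> U \<subseteq> carrier R"
  then have U: "submodule U R (reg_module R)" by auto
  obtain S where S: "S \<subseteq> carrier R" "finite S" "U = Idl\<^bsub>R\<^esub> S"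
    using noetherian_ring.finetely_gen[OF assms(2) submod_ideal[OF assms(1) U]] by blast
  show "\<exists>S. finite S \<and> S \<subseteq> U \<and> (\<forall>V. submodule V R (reg_module R) \<and> {\<zero>\<^bsub>R\<^esub>} \<subseteq> V \<and> S \<subseteq> V \<longrightarrow> U \<subseteq> V)"
    using S genideal_self[OF S(1)] genideal_minimal submod_ideal[OF assms(1)] by metis
qed

lemma lin_orbit: "module R A \<Longrightarrow> x \<in> carrier A \<Longrightarrow> lin R (reg_module R) A (\<lambda>r. r \<odot>\<^bsub>A\<^esub> x)"
proof -
  assume "module R A" "x \<in> carrier A"
  then interpret A: module R A by simp
  show ?thesis by (rule linI) (use \<open>x \<in> carrier A\<close> in \<open>auto simp: A.smult_l_distr A.smult_assoc1\<close>)
qed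

text \<open>Generators are added one at a time: (N' + R x)/N' is an image of the Noetherian module
  R, and \<open>noeth_pair_extension\<close> joins it to N'.\<close>

lemma noeth_fin_gen:
  assumes N: "noetherian_ring R" and M: "fin_gen_module R M"
  shows "noeth_pair R M {\<zero>\<^bsub>M\<^esub>} (carrier M)"
proof -
  have mM: "module R M" using M by (simp add: fin_gen_module_def)
  interpret M: module R M by fact
  have R: "cring R" by (rule module_cring[OF mM])
  obtain S where S: "S \<subseteq> carrier M" "finite S" "gen_submodule R M S = carrier M"
    using M unfolding fin_gen_module_def by blast
  have "\<exists>N. submodule N R M \<and> S \<subseteq> N \<and> noeth_pair R M {\<zero>\<^bsub>M\<^esub>} N" using S(2,1)
  proof induction
    case empty
    then show ?case using submod_zero[OF mM] noeth_pair_trivial by blast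
  next
    case (insert x S)
    then obtain N' where N': "submodule N' R M" "S \<subseteq> N'" "noeth_pair R M {\<zero>\<^bsub>M\<^esub>} N'" by auto
    have x: "x \<in> carrier M" using insert by simp
    let ?X = "(\<lambda>r. r \<odot>\<^bsub>M\<^esub> x) ` carrier R"
    have sX: "submodule ?X R M"
      using submod_image[OF lin_orbit[OF mM x] reg_module[OF R] mM submod_carrier[OF reg_module[OF R]]] by simp
    let ?N = "N' <+>\<^bsub>M\<^esub> ?X"
    note NX = submod_sum[OF mM N'(1) sX]
    have "x \<in> ?X" using x M.smult_one[OF x] by force
    then have xN: "insert x S \<subseteq> ?N" using NX N'(2) by blast
    let ?Q = "quot_module M N'"
    note Q = quot_module_module[OF N'(1) mM]
    interpret Q: module R ?Q by (rule Q(1))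
    let ?\<pi> = "\<lambda>x. N' +>\<^bsub>M\<^esub> x"
    let ?Y = "?\<pi> ` ?X"
    have sY: "submodule ?Y R ?Q" by (rule submod_image[OF Q(2) mM Q(1) sX])
    have "noeth_pair R ?Q {\<zero>\<^bsub>?Q\<^esub>} ?Y"
    proof (rule noeth_pair_image[OF reg_module[OF R] Q(1) lin_comp[OF lin_orbit[OF mM x] Q(2)] noeth_pair_ring[OF R N]])
      show "submodule (carrier R) R (reg_module R)" using submod_carrier[OF reg_module[OF R]] by simp
      show "?Y \<subseteq> (\<lambda>r. ?\<pi> (r \<odot>\<^bsub>M\<^esub> x)) ` carrier R <+>\<^bsub>?Q\<^esub> {\<zero>\<^bsub>?Q\<^esub>}"
      proof
        fix y assume y: "y \<in> ?Y"
        have e: "y \<oplus>\<^bsub>?Q\<^esub> \<zero>\<^bsub>?Q\<^esub> = y" by (rule Q.M.r_zero[OF subsetD[OF submodD(1)[OF sY] y]])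
        have "y \<in> (\<lambda>r. ?\<pi> (r \<odot>\<^bsub>M\<^esub> x)) ` carrier R" using y by blast
        from set_addI[OF this singletonI[of "\<zero>\<^bsub>?Q\<^esub>"], of ?Q]
        show "y \<in> (\<lambda>r. ?\<pi> (r \<odot>\<^bsub>M\<^esub> x)) ` carrier R <+>\<^bsub>?Q\<^esub> {\<zero>\<^bsub>?Q\<^esub>}" unfolding e .
      qed
      fix r assume "r \<in> {\<zero>\<^bsub>R\<^esub>}"
      then show "?\<pi> (r \<odot>\<^bsub>M\<^esub> x) \<in> {\<zero>\<^bsub>?Q\<^esub>}" using x lin_zero[OF Q(2) mM Q(1)] by simp
    qed simp
    moreover have "submodule {\<zero>\<^bsub>?Q\<^esub>} R ?Q" by (rule submod_zero[OF Q(1)])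
    moreover have "{\<zero>\<^bsub>?Q\<^esub>} \<subseteq> ?Y" using submodD(2)[OF sY] by simp
    moreover have "?\<pi> z \<in> ?Y" if zN: "z \<in> ?N" for z
    proof -
      obtain a b where ab: "a \<in> N'" "b \<in> ?X" "z = a \<oplus>\<^bsub>M\<^esub> b" using set_addE[OF zN] by metis
      have c: "a \<in> carrier M" "b \<in> carrier M" using ab submodD(1)[OF N'(1)] submodD(1)[OF sX] by auto
      have "?\<pi> a = \<zero>\<^bsub>?Q\<^esub>" using coset_eq_sub[OF N'(1) mM c(1)] ab by simp
      then have "?\<pi> z = ?\<pi> b" unfolding ab(3) lin_add[OF Q(2) c] using Q.M.l_zero[OF lin_closed[OF Q(2) c(2)]] by simp
      then show ?thesis using ab(2) by blast
    qed
    moreover have "?\<pi> z \<in> {\<zero>\<^bsub>?Q\<^esub>}" if "z \<in> {\<zero>\<^bsub>M\<^esub>}" for z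
      using that lin_zero[OF Q(2) mM Q(1)] by simp
    moreover have "noeth_pair R M {\<zero>\<^bsub>M\<^esub>} {z \<in> ?N. ?\<pi> z \<in> {\<zero>\<^bsub>?Q\<^esub>}}"
      by (rule noeth_pair_subset[OF N'(3)]) (use coset_eq_sub[OF N'(1) mM] submodD(1)[OF NX(1)] in auto)
    ultimately have "noeth_pair R M {\<zero>\<^bsub>M\<^esub>} ?N"
      using noeth_pair_extension[OF mM Q(1,2) _ _ _ sY, of "{\<zero>\<^bsub>?Q\<^esub>}" ?N "{\<zero>\<^bsub>M\<^esub>}"] by blast
    then show ?case using NX(1) xN by blast
  qed
  then obtain N' where N': "submodule N' R M" "S \<subseteq> N'" "noeth_pair R M {\<zero>\<^bsub>M\<^esub>} N'" by blast
  have "carrier M \<subseteq> N'" unfolding S(3)[symmetric] gen_submodule_def using N'(1,2) by blast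
  then show ?thesis using noeth_pair_subset[OF N'(3)] by blast
qed

text \<open>Exactness is not assumed. The zero module in index 0 gives inductions on the degree a
  trivial start, and every other index has a predecessor, so coboundaries need no case
  distinction.\<close>

locale inj_complex =
  fixes R :: "('r, 'z) ring_scheme" and C :: "nat \<Rightarrow> ('r, 'c) module" and d :: "nat \<Rightarrow> 'c \<Rightarrow> 'c"
  assumes C: "baer R (C n)" and d: "lin R (C n) (C (Suc n)) (d n)"
    and dd: "x \<in> carrier (C n) \<Longrightarrow> d (Suc n) (d n x) = \<zero>\<^bsub>C (Suc (Suc n))\<^esub>"
    and triv: "carrier (C 0) = {\<zero>\<^bsub>C 0\<^esub>}"
begin

lemma m: "module R (C n)" by (rule baer_module[OF C])

lemma R: "cring R" by (rule module_cring[OF m])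

lemma d_closed: "x \<in> carrier (C n) \<Longrightarrow> d n x \<in> carrier (C (Suc n))" by (rule lin_closed[OF d])

definition cyc where "cyc n = {z \<in> carrier (C n). d n z = \<zero>\<^bsub>C (Suc n)\<^esub>}"

lemma cyc_submod: "submodule (cyc n) R (C n)"
  unfolding cyc_def by (rule submod_ker[OF d m m])

lemma bd_submod: "submodule (d n ` carrier (C n)) R (C (Suc n))"
  by (rule submod_image[OF d m m submod_carrier[OF m]])

end

text \<open>The annihilator of an element is an ideal, so it contains the ideal generated by S as
  soon as it contains S.\<close>

lemma killed_genideal:
  assumes A: "module R A" and S: "S \<subseteq> carrier R"
  shows "killed A (Idl\<^bsub>R\<^esub> S) = killed A S"
proof -
  interpret A: module R A by fact
  have R: "cring R" by (rule module_cring[OF A])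
  show ?thesis
  proof
    show "killed A (Idl\<^bsub>R\<^esub> S) \<subseteq> killed A S" by (rule killed_antimono[OF A.R.genideal_self[OF S]])
    show "killed A S \<subseteq> killed A (Idl\<^bsub>R\<^esub> S)"
    proof
      fix x assume x: "x \<in> killed A S"
      then have xc: "x \<in> carrier A" by (simp add: killed_def)
      let ?K = "{r \<in> carrier (reg_module R). r \<odot>\<^bsub>A\<^esub> x = \<zero>\<^bsub>A\<^esub>}"
      have "ideal ?K R" by (rule submod_ideal[OF R submod_ker[OF lin_orbit[OF A xc] reg_module[OF R] A]])
      moreover have "S \<subseteq> ?K" using x S by (auto simp: killed_def)
      ultimately have "Idl\<^bsub>R\<^esub> S \<subseteq> ?K" by (rule A.R.genideal_minimal)
      then show "x \<in> killed A (Idl\<^bsub>R\<^esub> S)" using xc by (auto simp: killed_def)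
    qed
  qed
qed

text \<open>The homomorphism \<open>Idl S + R x \<rightarrow> E\<close> with \<open>x \<mapsto> v\<close> that vanishes on \<open>S\<close> extends to \<open>R\<close>.\<close>

lemma baer_divide:
  assumes E: "baer R E" and S: "S \<subseteq> carrier R" and x: "x \<in> carrier R"
    and v: "v \<in> killed E {r \<in> carrier R. r \<otimes>\<^bsub>R\<^esub> x \<in> Idl\<^bsub>R\<^esub> S}"
  shows "\<exists>v'\<in>killed E S. x \<odot>\<^bsub>E\<^esub> v' = v"
proof -
  have mE: "module R E" by (rule baer_module[OF E])
  interpret E: module R E by fact
  have R: "cring R" by (rule module_cring[OF mE])
  have I: "ideal (Idl\<^bsub>R\<^esub> S) R" by (rule E.R.genideal_ideal[OF S])
  note sI = ideal_submod[OF R I]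
  note Rm = reg_module[OF R]
  let ?W = "quot_module (reg_module R) (Idl\<^bsub>R\<^esub> S)"
  note W = quot_module_module[OF sI Rm]
  let ?\<pi> = "\<lambda>r. Idl\<^bsub>R\<^esub> S +>\<^bsub>reg_module R\<^esub> r"
  have vc: "v \<in> carrier E" using v by (simp add: killed_def)
  have mx: "lin R (reg_module R) (reg_module R) (\<lambda>r. r \<otimes>\<^bsub>R\<^esub> x)"
    by (rule linI) (use x in \<open>auto simp: E.R.l_distr E.R.m_assoc\<close>)
  \<comment> \<open>The map r \<mapsto> r v factors through r \<mapsto> r x modulo Idl S, because v
    is killed by the colon ideal (Idl S : x). The value of the extension at 1 is the required
    v'.\<close>
  have "\<exists>\<psi>. lin R ?W E \<psi> \<and> (\<forall>r\<in>carrier (reg_module R). \<psi> (?\<pi> (r \<otimes>\<^bsub>R\<^esub> x)) = r \<odot>\<^bsub>E\<^esub> v)"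
  proof (rule baer_factor[OF E Rm W(1) lin_comp[OF mx W(2)] lin_orbit[OF mE vc]])
    fix r assume r: "r \<in> carrier (reg_module R)" "?\<pi> (r \<otimes>\<^bsub>R\<^esub> x) = \<zero>\<^bsub>?W\<^esub>"
    then have "r \<otimes>\<^bsub>R\<^esub> x \<in> Idl\<^bsub>R\<^esub> S" using coset_eq_sub[OF sI Rm, of "r \<otimes>\<^bsub>R\<^esub> x"] x by simp
    then show "r \<odot>\<^bsub>E\<^esub> v = \<zero>\<^bsub>E\<^esub>" using v r(1) by (simp add: killed_def)
  qed
  then obtain \<psi> where psi: "lin R ?W E \<psi>" and e: "\<And>r. r \<in> carrier R \<Longrightarrow> \<psi> (?\<pi> (r \<otimes>\<^bsub>R\<^esub> x)) = r \<odot>\<^bsub>E\<^esub> v" by auto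
  have q: "lin R (reg_module R) E (\<lambda>r. \<psi> (?\<pi> r))" by (rule lin_comp[OF W(2) psi])
  define v' where "v' = \<psi> (?\<pi> \<one>\<^bsub>R\<^esub>)"
  have v'c: "v' \<in> carrier E" unfolding v'_def using lin_closed[OF q] by simp
  have rv: "r \<odot>\<^bsub>E\<^esub> v' = \<psi> (?\<pi> r)" if "r \<in> carrier R" for r
    using lin_smult[OF q that, of "\<one>\<^bsub>R\<^esub>"] that by (simp add: v'_def)
  have "s \<odot>\<^bsub>E\<^esub> v' = \<zero>\<^bsub>E\<^esub>" if s: "s \<in> S" for s
  proof -
    have "?\<pi> s = \<zero>\<^bsub>?W\<^esub>" using coset_eq_sub[OF sI Rm, of s] s S E.R.genideal_self[OF S] by auto
    then show ?thesis using rv[of s] s S lin_zero[OF psi W(1) mE] by auto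
  qed
  moreover have "x \<odot>\<^bsub>E\<^esub> v' = v" using rv[OF x] e[OF E.R.one_closed] x vc by simp
  ultimately show ?thesis using v'c by (auto simp: killed_def)
qed

section \<open>Finiteness of \<open>Ext\<close>\<close>

text \<open>For an ideal \<open>\<bb>\<close>, the first predicate expresses that \<open>Ext\<^sup>m(R/\<bb>, M)\<close> is Noetherian. As every
  homomorphism from \<open>\<bb>\<close> to an injective module is given by \<open>r \<mapsto> r w\<close>, the second one expresses that
  \<open>Ext\<^sup>m(\<bb>, M)\<close> is Noetherian when \<open>S\<close> generates \<open>\<bb>\<close>.\<close>

context inj_complex
begin

definition ext_quot_noeth where
  "ext_quot_noeth m \<bb> \<longleftrightarrow>
     noeth_pair R (C (Suc m)) (d m ` killed (C m) \<bb>) (killed (C (Suc m)) \<bb> \<inter> cyc (Suc m))"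

definition ext_ideal_noeth where
  "ext_ideal_noeth m S \<longleftrightarrow>
     noeth_pair R (C (Suc m)) (d m ` carrier (C m) <+>\<^bsub>C (Suc m)\<^esub> killed (C (Suc m)) S)
       {w \<in> carrier (C (Suc m)). d (Suc m) w \<in> killed (C (Suc (Suc m))) S}"

lemma sub_BS:
  assumes "S \<subseteq> carrier R"
  shows "submodule (d n ` carrier (C n) <+>\<^bsub>C (Suc n)\<^esub> killed (C (Suc n)) S) R (C (Suc n))"
  by (rule submod_sum(1)[OF m bd_submod killed_submod[OF m assms]])

text \<open>Write \<bb> for the ideal generated by S and \<cc> for the colon ideal (\<bb> : x). The
  sequence 0 \<rightarrow> \<bb> \<rightarrow> \<bb> + R x \<rightarrow> R/\<cc> \<rightarrow> 0
  places Ext(\<bb> + R x) between Ext(R/\<cc>) and Ext(\<bb>). Restriction to \<bb> is the identity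
  on representing elements w, and its kernel is controlled by the hypothesis on quotients.\<close>

lemma ext_ideal_noeth_step:
  assumes F: "\<And>\<bb>. ideal \<bb> R \<Longrightarrow> ext_quot_noeth n \<bb>"
    and G: "ext_ideal_noeth n S" and S: "S \<subseteq> carrier R" and x: "x \<in> carrier R"
  shows "ext_ideal_noeth n (insert x S)"
proof -
  interpret R: cring R by (rule R)
  interpret C1: module R "C (Suc n)" by (rule m)
  interpret C2: module R "C (Suc (Suc n))" by (rule m)
  have xS: "insert x S \<subseteq> carrier R" using S x by simp
  let ?c = "{r \<in> carrier R. r \<otimes>\<^bsub>R\<^esub> x \<in> Idl\<^bsub>R\<^esub> S}"
  let ?C1 = "C (Suc n)" and ?C2 = "C (Suc (Suc n))"
  have Rm: "module R (reg_module R)" by (rule reg_module[OF R])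
  have I: "ideal (Idl\<^bsub>R\<^esub> S) R" by (rule R.genideal_ideal[OF S])
  have mx: "lin R (reg_module R) (reg_module R) (\<lambda>r. r \<otimes>\<^bsub>R\<^esub> x)"
    by (rule linI) (use x in \<open>auto simp: R.l_distr R.m_assoc\<close>)
  have "submodule {r \<in> carrier (reg_module R). r \<otimes>\<^bsub>R\<^esub> x \<in> Idl\<^bsub>R\<^esub> S} R (reg_module R)"
    by (rule submod_vimage[OF mx Rm Rm ideal_submod[OF R I]])
  then have c: "ideal ?c R" using submod_ideal[OF R] by simp
  have cc: "?c \<subseteq> carrier R" by auto
  \<comment> \<open>Modulo coboundaries, a class that restricts to zero on \<bb> is represented by
    some k killed by S. Its datum in Hom(R/\<cc>, C) is x k, which is killed by \<cc> and is a
    cocycle as x d k = 0.\<close>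
  let ?K' = "{k \<in> carrier ?C1. d (Suc n) k \<in> killed ?C2 {x}} \<inter> killed ?C1 S"
  let ?D = "{k \<in> ?K'. x \<odot>\<^bsub>?C1\<^esub> k \<in> d n ` killed (C n) ?c}"
  let ?B = "d n ` carrier (C n) <+>\<^bsub>?C1\<^esub> killed ?C1 S"
  let ?B' = "d n ` carrier (C n) <+>\<^bsub>?C1\<^esub> killed ?C1 (insert x S)"
  let ?Z = "{w \<in> carrier ?C1. d (Suc n) w \<in> killed ?C2 S}"
  let ?Z' = "{w \<in> carrier ?C1. d (Suc n) w \<in> killed ?C2 (insert x S)}"
  have id1: "lin R ?C1 ?C1 (\<lambda>w. w)" by (auto simp: lin_def)
  have sK': "submodule ?K' R ?C1"
    by (intro submod_inter m submod_vimage[OF d m m] killed_submod) (use x S in auto)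
  have sBc: "submodule (d n ` killed (C n) ?c) R ?C1"
    by (rule submod_image[OF d m m killed_submod[OF m cc]])
  have "noeth_pair R ?C1 ?D ?K'"
  proof (rule noeth_pair_vimage[OF m m lin_fun_smult[OF id1 x m m] F[OF c, unfolded ext_quot_noeth_def] sBc])
    show "d n ` killed (C n) ?c \<subseteq> killed ?C1 ?c \<inter> cyc (Suc n)"
      using killed_lin[OF d m m cc] dd d_closed by (auto simp: cyc_def killed_def)
    show "submodule (killed ?C1 ?c \<inter> cyc (Suc n)) R ?C1"
      by (intro submod_inter m killed_submod cyc_submod cc)
    fix k assume k: "k \<in> ?K'"
    then have kc: "k \<in> carrier ?C1" and kI: "k \<in> killed ?C1 (Idl\<^bsub>R\<^esub> S)" using killed_genideal[OF m S] by auto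
    have "r \<odot>\<^bsub>?C1\<^esub> (x \<odot>\<^bsub>?C1\<^esub> k) = \<zero>\<^bsub>?C1\<^esub>" if "r \<in> ?c" for r
      using that kI kc x C1.smult_assoc1[of r x k] by (simp add: killed_def)
    moreover have "d (Suc n) (x \<odot>\<^bsub>?C1\<^esub> k) = \<zero>\<^bsub>?C2\<^esub>"
      using lin_smult[OF d x kc] k by (simp add: killed_def)
    ultimately show "x \<odot>\<^bsub>?C1\<^esub> k \<in> killed ?C1 ?c \<inter> cyc (Suc n)" using kc x by (simp add: killed_def cyc_def)
  qed
  then have nK: "noeth_pair R ?C1 ?B' {w \<in> ?Z'. w \<in> ?B}"
  proof (rule noeth_pair_image[OF m m id1 _ sK'])
    show "?D \<subseteq> ?K'" by blast
    fix k assume "k \<in> ?D"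
    then obtain v where k: "k \<in> ?K'" and v: "v \<in> killed (C n) ?c" "x \<odot>\<^bsub>?C1\<^esub> k = d n v" by blast
    have kc: "k \<in> carrier ?C1" using k by blast
    \<comment> \<open>If x k = d v with v killed by \<cc>, then v = x v' with v' killed by S, and k
      - d v' is killed by S and by x; so k represents the zero class.\<close>
    obtain v' where v': "v' \<in> killed (C n) S" "x \<odot>\<^bsub>C n\<^esub> v' = v" using baer_divide[OF C S x v(1)] by blast
    have v'c: "v' \<in> carrier (C n)" using v' by (simp add: killed_def)
    have "k \<ominus>\<^bsub>?C1\<^esub> d n v' \<in> killed ?C1 S"
      using submodD_diff[OF killed_submod[OF m S]] k killed_lin[OF d m m S v'(1)] by blast
    moreover have "x \<odot>\<^bsub>?C1\<^esub> (k \<ominus>\<^bsub>?C1\<^esub> d n v') = \<zero>\<^bsub>?C1\<^esub>"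
      using smult_diff[OF m x kc d_closed[OF v'c]] v(2) v'(2) lin_smult[OF d x v'c] minus_eq_zero_iff[OF m]
        d_closed[OF v'c] x by (metis C1.smult_closed)
    ultimately have "k \<ominus>\<^bsub>?C1\<^esub> d n v' \<in> killed ?C1 (insert x S)" by (simp add: killed_def)
    then have "d n v' \<oplus>\<^bsub>?C1\<^esub> (k \<ominus>\<^bsub>?C1\<^esub> d n v') \<in> ?B'" using v'c by (intro set_addI) auto
    then show "k \<in> ?B'" using minus_add_cancel(2)[OF m kc d_closed[OF v'c]] by simp
  next
    show "{w \<in> ?Z'. w \<in> ?B} \<subseteq> (\<lambda>w. w) ` ?K' <+>\<^bsub>?C1\<^esub> ?B'"
    proof
      fix w assume w: "w \<in> {w \<in> ?Z'. w \<in> ?B}"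
      then have "w \<in> ?B" by blast
      then obtain y k where yk: "y \<in> d n ` carrier (C n)" "k \<in> killed ?C1 S" "w = y \<oplus>\<^bsub>?C1\<^esub> k" by (rule set_addE)
      then obtain v where v: "v \<in> carrier (C n)" "y = d n v" by blast
      have kc: "k \<in> carrier ?C1" using yk by (simp add: killed_def)
      have "d (Suc n) w = d (Suc n) k"
        unfolding yk(3) v(2) using lin_add[OF d d_closed[OF v(1)] kc] dd[OF v(1)] d_closed[OF kc] by simp
      then have "d (Suc n) k \<in> killed ?C2 {x}" using w by (simp add: killed_def)
      then have kK: "k \<in> (\<lambda>w. w) ` ?K'" using kc yk(2) by simp
      have "y \<in> ?B'" using submod_sum(2)[OF m bd_submod killed_submod[OF m xS]] yk(1) by blast
      then have "k \<oplus>\<^bsub>?C1\<^esub> y \<in> (\<lambda>w. w) ` ?K' <+>\<^bsub>?C1\<^esub> ?B'" by (rule set_addI[OF kK])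
      then show "w \<in> (\<lambda>w. w) ` ?K' <+>\<^bsub>?C1\<^esub> ?B'"
        using C1.M.a_comm[OF kc] d_closed[OF v(1)] unfolding yk(3) v(2) by simp
    qed
  qed
  have BZ: "?B \<subseteq> ?Z"
  proof (rule submod_sum_le)
    show "submodule ?Z R ?C1" by (rule submod_vimage[OF d m m killed_submod[OF m S]])
    show "d n ` carrier (C n) \<subseteq> ?Z" using dd d_closed S by (auto simp: killed_def)
    show "killed ?C1 S \<subseteq> ?Z" using killed_lin[OF d m m S] by (auto simp: killed_def)
  qed
  have sZ: "submodule ?Z R ?C1" by (rule submod_vimage[OF d m m killed_submod[OF m S]])
  have B'B: "?B' \<subseteq> ?B"
    by (rule submod_sum_le[OF sub_BS[OF S] submod_sum(2)[OF m bd_submod killed_submod[OF m S]]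
        subset_trans[OF killed_antimono[OF subset_insertI] submod_sum(3)[OF m bd_submod killed_submod[OF m S]]]])
  show ?thesis
    unfolding ext_ideal_noeth_def
  proof (rule noeth_pair_extension[OF m m id1 G[unfolded ext_ideal_noeth_def] sub_BS[OF S] BZ sZ _ _ nK])
    show "w \<in> ?Z" if "w \<in> ?Z'" for w using that by (simp add: killed_def)
    show "w \<in> ?B" if "w \<in> ?B'" for w using that B'B by blast
  qed
qed

lemma ext_ideal_noeth:
  assumes F: "\<And>\<bb>. ideal \<bb> R \<Longrightarrow> ext_quot_noeth n \<bb>" and "finite S" "S \<subseteq> carrier R"
  shows "ext_ideal_noeth n S"
  using assms(2,3)
proof induction
  case empty
  have "{w \<in> carrier (C (Suc n)). d (Suc n) w \<in> killed (C (Suc (Suc n))) {}} \<subseteq> killed (C (Suc n)) {}"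
    by (auto simp: killed_def)
  also have "\<dots> \<subseteq> d n ` carrier (C n) <+>\<^bsub>C (Suc n)\<^esub> killed (C (Suc n)) {}"
    by (rule submod_sum(3)[OF m bd_submod killed_submod[OF m]]) simp
  finally show ?case unfolding ext_ideal_noeth_def by (rule noeth_pair_trivial)
qed (auto intro: ext_ideal_noeth_step[OF F])

text \<open>Exactness of the complex makes the connecting map from Ext in degree n of \<bb> to Ext
  in degree n + 1 of R/\<bb> surjective; on representing elements it is the differential. The
  induction hypothesis is needed for all ideals at once, because the colon ideals enter through
  \<open>ext_ideal_noeth\<close>.\<close>

lemma ext_quot_noeth:
  assumes N: "noetherian_ring R" and H: "noeth_pair R (C 1) {\<zero>\<^bsub>C 1\<^esub>} (cyc 1)"
    and exact: "\<And>n. cyc (Suc (Suc n)) \<subseteq> d (Suc n) ` carrier (C (Suc n))"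
    and b: "ideal \<bb> R"
  shows "ext_quot_noeth n \<bb>"
  using b
proof (induction n arbitrary: \<bb>)
  case 0
  have bc: "\<bb> \<subseteq> carrier R" using 0 by (auto dest: ideal.Icarr)
  have "killed (C 0) \<bb> = {\<zero>\<^bsub>C 0\<^esub>}" using triv submodD(2)[OF killed_submod[OF m[of 0] bc]] by (auto simp: killed_def)
  then have "d 0 ` killed (C 0) \<bb> = {\<zero>\<^bsub>C 1\<^esub>}" using lin_zero[OF d m m, of 0] by simp
  then show ?case using noeth_pair_subset[OF H] unfolding ext_quot_noeth_def by simp
next
  case (Suc n)
  interpret C2: module R "C (Suc (Suc n))" by (rule m)
  interpret R: cring R by (rule R)
  have bc: "\<bb> \<subseteq> carrier R" using Suc.prems by (auto dest: ideal.Icarr)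
  obtain S where S: "S \<subseteq> carrier R" "finite S" "\<bb> = Idl\<^bsub>R\<^esub> S"
    using noetherian_ring.finetely_gen[OF N Suc.prems] by blast
  have k: "killed (C i) \<bb> = killed (C i) S" for i unfolding S(3) by (rule killed_genideal[OF m S(1)])
  let ?B = "d n ` carrier (C n) <+>\<^bsub>C (Suc n)\<^esub> killed (C (Suc n)) S"
  let ?Z = "{w \<in> carrier (C (Suc n)). d (Suc n) w \<in> killed (C (Suc (Suc n))) S}"
  let ?B' = "d (Suc n) ` killed (C (Suc n)) S"
  have sZ: "submodule ?Z R (C (Suc n))" by (rule submod_vimage[OF d m m killed_submod[OF m S(1)]])
  have sB': "submodule ?B' R (C (Suc (Suc n)))" by (rule submod_image[OF d m m killed_submod[OF m S(1)]])
  show ?case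
    unfolding ext_quot_noeth_def k
  proof (rule noeth_pair_image[OF m m d ext_ideal_noeth[OF Suc.IH S(2,1), unfolded ext_ideal_noeth_def] sZ])
    show "?B \<subseteq> ?Z"
      by (rule submod_sum_le[OF sZ]) (use dd d_closed S(1) killed_lin[OF d m m S(1)] in \<open>auto simp: killed_def\<close>)
    fix w assume "w \<in> ?B"
    then obtain y k where yk: "y \<in> d n ` carrier (C n)" "k \<in> killed (C (Suc n)) S" "w = y \<oplus>\<^bsub>C (Suc n)\<^esub> k" by (rule set_addE)
    then obtain v where v: "v \<in> carrier (C n)" "y = d n v" by blast
    have kc: "k \<in> carrier (C (Suc n))" using yk by (simp add: killed_def)
    have "d (Suc n) w = d (Suc n) k"
      unfolding yk(3) v(2) using lin_add[OF d d_closed[OF v(1)] kc] dd[OF v(1)] d_closed[OF kc] by simp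
    then show "d (Suc n) w \<in> ?B'" using yk(2) by blast
  next
    show "killed (C (Suc (Suc n))) S \<inter> cyc (Suc (Suc n)) \<subseteq> d (Suc n) ` ?Z <+>\<^bsub>C (Suc (Suc n))\<^esub> ?B'"
    proof
      fix z assume z: "z \<in> killed (C (Suc (Suc n))) S \<inter> cyc (Suc (Suc n))"
      then obtain w where w: "w \<in> carrier (C (Suc n))" "z = d (Suc n) w" using exact[of n] by blast
      then have "z \<in> d (Suc n) ` ?Z" using z by blast
      then show "z \<in> d (Suc n) ` ?Z <+>\<^bsub>C (Suc (Suc n))\<^esub> ?B'"
        using submod_sum(2)[OF m submod_image[OF d m m sZ] sB'] by blast
    qed
  qed
qed

end

section \<open>Mapping cones\<close>

text \<open>Sequences of elements serve as a type that is closed under forming pairs, so that the mapping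
  cone can be iterated.\<close>

definition ev :: "(nat \<Rightarrow> 'q) \<Rightarrow> nat \<Rightarrow> 'q" where "ev f = (\<lambda>n. f (2 * n))"
definition od :: "(nat \<Rightarrow> 'q) \<Rightarrow> nat \<Rightarrow> 'q" where "od f = (\<lambda>n. f (Suc (2 * n)))"
definition pr :: "(nat \<Rightarrow> 'q) \<Rightarrow> (nat \<Rightarrow> 'q) \<Rightarrow> nat \<Rightarrow> 'q" where
  "pr f g = (\<lambda>n. if even n then f (n div 2) else g (n div 2))"

lemma ev_pr [simp]: "ev (pr f g) = f" and od_pr [simp]: "od (pr f g) = g"
  by (auto simp: ev_def od_def pr_def)

lemma pr_ev_od [simp]: "pr (ev f) (od f) = f"
  by (auto simp: ev_def od_def pr_def fun_eq_iff)

lemma pr_eqI: "ev f = a \<Longrightarrow> od f = b \<Longrightarrow> f = pr a b"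
  by (metis pr_ev_od)

definition pair_module ::
  "('r, nat \<Rightarrow> 'q) module \<Rightarrow> ('r, nat \<Rightarrow> 'q) module \<Rightarrow> ('r, nat \<Rightarrow> 'q) module" where
  "pair_module A B = \<lparr>carrier = {f. ev f \<in> carrier A \<and> od f \<in> carrier B},
     monoid.mult = undefined, one = undefined, zero = pr \<zero>\<^bsub>A\<^esub> \<zero>\<^bsub>B\<^esub>,
     add = (\<lambda>f g. pr (ev f \<oplus>\<^bsub>A\<^esub> ev g) (od f \<oplus>\<^bsub>B\<^esub> od g)),
     smult = (\<lambda>r f. pr (r \<odot>\<^bsub>A\<^esub> ev f) (r \<odot>\<^bsub>B\<^esub> od f))\<rparr>"

lemma pair_simps [simp]:
  "f \<in> carrier (pair_module A B) \<longleftrightarrow> ev f \<in> carrier A \<and> od f \<in> carrier B"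
  "\<zero>\<^bsub>pair_module A B\<^esub> = pr \<zero>\<^bsub>A\<^esub> \<zero>\<^bsub>B\<^esub>"
  "f \<oplus>\<^bsub>pair_module A B\<^esub> g = pr (ev f \<oplus>\<^bsub>A\<^esub> ev g) (od f \<oplus>\<^bsub>B\<^esub> od g)"
  "r \<odot>\<^bsub>pair_module A B\<^esub> f = pr (r \<odot>\<^bsub>A\<^esub> ev f) (r \<odot>\<^bsub>B\<^esub> od f)"
  by (simp_all add: pair_module_def)

lemma pair_module_module:
  assumes A: "module R A" and B: "module R B"
  shows "module R (pair_module A B)"
proof -
  interpret A: module R A by fact
  interpret B: module R B by fact
  have "abelian_group (pair_module A B)"
  proof (rule abelian_groupI)
    fix f assume f: "f \<in> carrier (pair_module A B)"
    then show "\<exists>g\<in>carrier (pair_module A B). g \<oplus>\<^bsub>pair_module A B\<^esub> f = \<zero>\<^bsub>pair_module A B\<^esub>"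
      by (intro bexI[of _ "pr (\<ominus>\<^bsub>A\<^esub> ev f) (\<ominus>\<^bsub>B\<^esub> od f)"]) (simp_all add: A.M.l_neg B.M.l_neg)
  qed (simp_all add: A.M.a_ac B.M.a_ac)
  then show ?thesis
    by (intro moduleI module_cring[OF A])
      (simp_all add: A.smult_l_distr B.smult_l_distr A.smult_r_distr B.smult_r_distr A.smult_assoc1 B.smult_assoc1)
qed

lemma pair_baer:
  assumes A: "baer R A" and B: "baer R B"
  shows "baer R (pair_module A B)"
  unfolding baer_def
proof (intro conjI allI impI)
  show "module R (pair_module A B)" by (intro pair_module_module baer_module A B)
  fix \<bb> f assume bf: "ideal \<bb> R \<and> lin R (reg_module R\<lparr>carrier := \<bb>\<rparr>) (pair_module A B) f"
  then have "lin R (reg_module R\<lparr>carrier := \<bb>\<rparr>) A (\<lambda>x. ev (f x))" "lin R (reg_module R\<lparr>carrier := \<bb>\<rparr>) B (\<lambda>x. od (f x))"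
    by (auto simp: lin_def Pi_iff)
  then obtain a b where "a \<in> carrier A" "\<forall>r\<in>\<bb>. ev (f r) = r \<odot>\<^bsub>A\<^esub> a" "b \<in> carrier B" "\<forall>r\<in>\<bb>. od (f r) = r \<odot>\<^bsub>B\<^esub> b"
    using A B bf unfolding baer_def by metis
  then show "\<exists>e\<in>carrier (pair_module A B). \<forall>r\<in>\<bb>. f r = r \<odot>\<^bsub>pair_module A B\<^esub> e"
    by (intro bexI[of _ "pr a b"]) (auto intro: pr_eqI)
qed

text \<open>A copy of A inside the type of sequences: the start from which the cones are iterated
  without leaving that type.\<close>

definition const_module :: "('r, 'q, 'p) module_scheme \<Rightarrow> ('r, nat \<Rightarrow> 'q) module" where
  "const_module A = \<lparr>carrier = (\<lambda>a _. a) ` carrier A,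
     monoid.mult = undefined, one = undefined, zero = (\<lambda>_. \<zero>\<^bsub>A\<^esub>),
     add = (\<lambda>f g _. f 0 \<oplus>\<^bsub>A\<^esub> g 0), smult = (\<lambda>r f _. r \<odot>\<^bsub>A\<^esub> f 0)\<rparr>"

lemma const_simps [simp]:
  "carrier (const_module A) = (\<lambda>a _. a) ` carrier A"
  "\<zero>\<^bsub>const_module A\<^esub> = (\<lambda>_. \<zero>\<^bsub>A\<^esub>)"
  "f \<oplus>\<^bsub>const_module A\<^esub> g = (\<lambda>_. f 0 \<oplus>\<^bsub>A\<^esub> g 0)"
  "r \<odot>\<^bsub>const_module A\<^esub> f = (\<lambda>_. r \<odot>\<^bsub>A\<^esub> f 0)"
  by (simp_all add: const_module_def)

lemma const_module_module:
  assumes A: "module R A"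
  shows "module R (const_module A)" "lin R A (const_module A) (\<lambda>a _. a)" "lin R (const_module A) A (\<lambda>f. f 0)"
proof -
  interpret A: module R A by fact
  show "module R (const_module A)" "lin R A (const_module A) (\<lambda>a _. a)"
    by (rule module_image[OF A, of "const_module A" "\<lambda>a _. a"]; simp)+
  show "lin R (const_module A) A (\<lambda>f. f 0)" by (rule linI) auto
qed

lemma const_baer:
  assumes A: "baer R A"
  shows "baer R (const_module A)"
  unfolding baer_def
proof (intro conjI allI impI)
  have mA: "module R A" by (rule baer_module[OF A])
  show "module R (const_module A)" by (rule const_module_module[OF mA])
  fix \<bb> f assume bf: "ideal \<bb> R \<and> lin R (reg_module R\<lparr>carrier := \<bb>\<rparr>) (const_module A) f"
  then have f: "lin R (reg_module R\<lparr>carrier := \<bb>\<rparr>) (const_module A) f" by simp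
  have "lin R (reg_module R\<lparr>carrier := \<bb>\<rparr>) A (\<lambda>x. f x 0)"
    by (rule lin_comp[OF f const_module_module(3)[OF mA]])
  then obtain a where a: "a \<in> carrier A" "\<forall>r\<in>\<bb>. f r 0 = r \<odot>\<^bsub>A\<^esub> a"
    using A bf unfolding baer_def by metis
  have "f r = (\<lambda>_. f r 0)" if "r \<in> \<bb>" for r
    using lin_closed[OF f, of r] that by auto
  then show "\<exists>e\<in>carrier (const_module A). \<forall>r\<in>\<bb>. f r = r \<odot>\<^bsub>const_module A\<^esub> e"
    using a by (intro bexI[of _ "\<lambda>_. a"]) auto
qed

lemma neg_neg_diff:
  assumes "module R A" "x \<in> carrier A" "y \<in> carrier A"
  shows "x \<ominus>\<^bsub>A\<^esub> (\<ominus>\<^bsub>A\<^esub> y) = x \<oplus>\<^bsub>A\<^esub> y" "\<zero>\<^bsub>A\<^esub> \<ominus>\<^bsub>A\<^esub> (\<ominus>\<^bsub>A\<^esub> y) = y"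
proof -
  interpret A: module R A by fact
  show "x \<ominus>\<^bsub>A\<^esub> (\<ominus>\<^bsub>A\<^esub> y) = x \<oplus>\<^bsub>A\<^esub> y" "\<zero>\<^bsub>A\<^esub> \<ominus>\<^bsub>A\<^esub> (\<ominus>\<^bsub>A\<^esub> y) = y"
    using assms by (simp_all add: a_minus_def)
qed

text \<open>The mapping cone of multiplication by an element, shifted so that it starts in degree 0.
  Truncated subtraction puts C 0 into the second place in degree 0, which is the zero module in an
  \<open>inj_complex\<close>.\<close>

definition cone :: "(nat \<Rightarrow> ('r, nat \<Rightarrow> 'q) module) \<Rightarrow> nat \<Rightarrow> ('r, nat \<Rightarrow> 'q) module" where
  "cone C n = pair_module (C n) (C (n - 1))"

text \<open>This is (a, b) \<mapsto> (d a, x a - d b); the minus sign makes the square vanish. In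
  degree 0 the component b lies in the zero module and its differential is left out.\<close>

definition cone_d ::
  "(nat \<Rightarrow> ('r, nat \<Rightarrow> 'q) module) \<Rightarrow> (nat \<Rightarrow> (nat \<Rightarrow> 'q) \<Rightarrow> (nat \<Rightarrow> 'q)) \<Rightarrow> 'r \<Rightarrow> nat \<Rightarrow> (nat \<Rightarrow> 'q) \<Rightarrow> (nat \<Rightarrow> 'q)"
where
  "cone_d C d x n f = pr (d n (ev f))
     (case n of 0 \<Rightarrow> x \<odot>\<^bsub>C 0\<^esub> ev f | Suc k \<Rightarrow> x \<odot>\<^bsub>C n\<^esub> ev f \<ominus>\<^bsub>C n\<^esub> d k (od f))"

lemma cone_inj_complex:
  assumes "inj_complex R C d" and x: "x \<in> carrier R"
  shows "inj_complex R (cone C) (cone_d C d x)"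
proof -
  interpret inj_complex R C d by fact
  have id: "lin R (C n) (C n) (\<lambda>a. a)" for n by (auto simp: lin_def)
  have le: "lin R (cone C n) (C n) ev" and lo: "lin R (cone C n) (C (n - 1)) od" for n
    by (auto simp: lin_def cone_def)
  have mc: "module R (cone C n)" for n unfolding cone_def by (rule pair_module_module[OF m m])
  have pair: "lin R (cone C n) (cone C (Suc n)) (\<lambda>f. pr (a f) (b f))"
    if "lin R (cone C n) (C (Suc n)) a" "lin R (cone C n) (C n) b" for n a b
    using that by (auto simp: lin_def cone_def Pi_iff)
  have xm: "module R (C n)" for n by (rule m)
  show ?thesis
  proof
    show "baer R (cone C n)" for n unfolding cone_def by (rule pair_baer[OF C C])
    show "lin R (cone C n) (cone C (Suc n)) (cone_d C d x n)" for n
    proof (cases n)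
      case 0
      have "lin R (cone C 0) (C 0) (\<lambda>f. x \<odot>\<^bsub>C 0\<^esub> ev f)" by (rule lin_fun_smult[OF le x mc m])
      then show ?thesis unfolding 0 cone_d_def by (auto intro!: pair lin_comp[OF le d])
    next
      case (Suc k)
      have "lin R (cone C (Suc k)) (C k) od" using lo[of "Suc k"] by simp
      then have "lin R (cone C (Suc k)) (C (Suc k)) (\<lambda>f. x \<odot>\<^bsub>C (Suc k)\<^esub> ev f \<ominus>\<^bsub>C (Suc k)\<^esub> d k (od f))"
        by (intro lin_fun_diff lin_fun_smult le x mc m lin_comp[OF _ d])
      then show ?thesis unfolding Suc cone_d_def by (auto intro!: pair lin_comp[OF le d])
    qed
    show "carrier (cone C 0) = {\<zero>\<^bsub>cone C 0\<^esub>}"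
      using triv by (auto simp: cone_def intro: pr_eqI)
    show "cone_d C d x (Suc n) (cone_d C d x n f) = \<zero>\<^bsub>cone C (Suc (Suc n))\<^esub>" if "f \<in> carrier (cone C n)" for n f
    proof -
      have e: "ev f \<in> carrier (C n)" and o: "od f \<in> carrier (C (n - 1))" using that by (auto simp: cone_def)
      interpret A: module R "C (Suc n)" by (rule m)
      have xe: "d n (x \<odot>\<^bsub>C n\<^esub> ev f) = x \<odot>\<^bsub>C (Suc n)\<^esub> d n (ev f)" by (rule lin_smult[OF d x e])
      have ev: "x \<odot>\<^bsub>C (Suc n)\<^esub> d n (ev f) \<in> carrier (C (Suc n))" using x d_closed[OF e] by simp
      have "d n (od (cone_d C d x n f)) = x \<odot>\<^bsub>C (Suc n)\<^esub> d n (ev f)"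
      proof (cases n)
        case 0
        then show ?thesis using xe by (simp add: cone_d_def)
      next
        case (Suc k)
        interpret B: module R "C (Suc k)" by (rule m)
        have o': "d k (od f) \<in> carrier (C (Suc k))" "od f \<in> carrier (C k)" using o d_closed Suc by auto
        have "d (Suc k) (x \<odot>\<^bsub>C (Suc k)\<^esub> ev f \<ominus>\<^bsub>C (Suc k)\<^esub> d k (od f)) = x \<odot>\<^bsub>C (Suc (Suc k))\<^esub> d (Suc k) (ev f) \<ominus>\<^bsub>C (Suc (Suc k))\<^esub> \<zero>\<^bsub>C (Suc (Suc k))\<^esub>"
          using lin_diff[OF d[of "Suc k"] m m, of "x \<odot>\<^bsub>C (Suc k)\<^esub> ev f" "d k (od f)"] x e xe dd[OF o'(2)] o'(1) Suc by simp
        then show ?thesis using minus_zero_right[OF m ev] unfolding cone_d_def Suc by simp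
      qed
      then show ?thesis
        using dd[OF e] ev minus_eq_zero_iff[OF m ev ev] by (simp add: cone_d_def cone_def)
    qed
  qed
qed

section \<open>Regular sequences and vanishing of \<open>Ext\<close>\<close>

text \<open>The lists below are reversed sequences: the head is the last element.\<close>

primrec seqsub :: "('r, 'm, 'p) module_scheme \<Rightarrow> 'r list \<Rightarrow> 'm set" where
  "seqsub M [] = {\<zero>\<^bsub>M\<^esub>}"
| "seqsub M (x # xs) = seqsub M xs <+>\<^bsub>M\<^esub> (\<lambda>m. x \<odot>\<^bsub>M\<^esub> m) ` carrier M"

text \<open>Regularity up to u: the kernel of x on M/xs M is killed by u instead of being zero. This
  is what remains over R of a sequence that is regular on a localization after denominators have
  been cleared; one u serves all steps.\<close>

primrec almost_regular :: "('r, 'm, 'p) module_scheme \<Rightarrow> 'r \<Rightarrow> 'r list \<Rightarrow> bool" where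
  "almost_regular M u [] = True"
| "almost_regular M u (x # xs) \<longleftrightarrow> almost_regular M u xs \<and>
     (\<forall>m\<in>carrier M. x \<odot>\<^bsub>M\<^esub> m \<in> seqsub M xs \<longrightarrow> u \<odot>\<^bsub>M\<^esub> m \<in> seqsub M xs)"

lemma lin_mult: "module R A \<Longrightarrow> x \<in> carrier R \<Longrightarrow> lin R A A (\<lambda>m. x \<odot>\<^bsub>A\<^esub> m)"
proof -
  assume A: "module R A" and x: "x \<in> carrier R"
  have "lin R A A (\<lambda>m. m)" by (auto simp: lin_def)
  then show ?thesis by (rule lin_fun_smult[OF _ x A A])
qed

lemma seqsub_submod: "module R M \<Longrightarrow> set xs \<subseteq> carrier R \<Longrightarrow> submodule (seqsub M xs) R M"
proof (induction xs)
  case (Cons x xs)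
  then show ?case
    using submod_sum(1)[OF _ _ submod_image[OF lin_mult _ _ submod_carrier], of R M "seqsub M xs" x] by simp
qed (simp add: submod_zero)

lemma add_minus_cancel_left:
  assumes "module R A" "p \<in> carrier A" "q \<in> carrier A" "e \<in> carrier A"
  shows "(p \<oplus>\<^bsub>A\<^esub> q \<ominus>\<^bsub>A\<^esub> e) \<ominus>\<^bsub>A\<^esub> p = q \<ominus>\<^bsub>A\<^esub> e"
proof -
  interpret A: module R A by fact
  have "(p \<oplus>\<^bsub>A\<^esub> q \<ominus>\<^bsub>A\<^esub> e) \<ominus>\<^bsub>A\<^esub> p = (p \<oplus>\<^bsub>A\<^esub> \<ominus>\<^bsub>A\<^esub> p) \<oplus>\<^bsub>A\<^esub> (q \<ominus>\<^bsub>A\<^esub> e)"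
    using assms(2-4) by (simp add: a_minus_def A.M.a_ac del: A.M.r_neg)
  then show ?thesis using assms(2-4) by (simp add: A.M.r_neg minus_closed[OF assms(1)])
qed

text \<open>An injective resolution with indices shifted by one: index n + 1 holds degree n, and M
  is the module of cocycles of index 1.\<close>

locale aug_complex = inj_complex R P \<delta> for R :: "('r, 'z) ring_scheme" and P :: "nat \<Rightarrow> ('r, 'q) module" and \<delta> +
  fixes M :: "('r, 'm) module" and \<epsilon> :: "'m \<Rightarrow> 'q"
  assumes M: "module R M" and eps: "lin R M (P 1) \<epsilon>"
    and eps_inj: "x \<in> carrier M \<Longrightarrow> \<epsilon> x = \<zero>\<^bsub>P 1\<^esub> \<Longrightarrow> x = \<zero>\<^bsub>M\<^esub>"
    and cyc1: "cyc 1 = \<epsilon> ` carrier M"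
    and exact: "cyc (Suc (Suc n)) \<subseteq> \<delta> (Suc n) ` carrier (P (Suc n))"

text \<open>Properties of the Koszul cocomplex of \<open>xs\<close> with coefficients in \<open>P\<close>: its cohomology vanishes above
  degree \<open>length xs + 1\<close>, is \<open>M/xs M\<close> in that degree, and is killed by \<open>u\<^sup>s\<close> below.\<close>

locale koszul = aug_complex R P \<delta> M \<epsilon> + K: inj_complex R C d
  for R :: "('r, 'z) ring_scheme" and P :: "nat \<Rightarrow> ('r, 'q) module" and \<delta> and M :: "('r, 'm) module" and \<epsilon>
    and C :: "nat \<Rightarrow> ('r, nat \<Rightarrow> 'q) module" and d +
  fixes xs :: "'r list" and u :: 'r and \<pi> :: "nat \<Rightarrow> (nat \<Rightarrow> 'q) \<Rightarrow> 'q" and \<mu> :: "'m \<Rightarrow> (nat \<Rightarrow> 'q)" and s :: nat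
  assumes xs: "set xs \<subseteq> carrier R" and u: "u \<in> carrier R"
    and pi: "lin R (C n) (P n) (\<pi> n)"
    and pi_d: "a \<in> carrier (C n) \<Longrightarrow> \<pi> (Suc n) (d n a) = \<delta> n (\<pi> n a)"
    and lift: "z \<in> carrier (P n) \<Longrightarrow> \<delta> n z = \<zero>\<^bsub>P (Suc n)\<^esub> \<Longrightarrow> (\<And>x. x \<in> set xs \<Longrightarrow> x \<odot>\<^bsub>P n\<^esub> z = \<zero>\<^bsub>P n\<^esub>) \<Longrightarrow>
      \<exists>z'\<in>carrier (C n). d n z' = \<zero>\<^bsub>C (Suc n)\<^esub> \<and> \<pi> n z' = z \<and>
        (\<forall>r\<in>carrier R. r \<odot>\<^bsub>P n\<^esub> z = \<zero>\<^bsub>P n\<^esub> \<longrightarrow> r \<odot>\<^bsub>C n\<^esub> z' = \<zero>\<^bsub>C n\<^esub>)"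
    and mu: "lin R M (C (Suc (length xs))) \<mu>"
    and mu_cyc: "x \<in> carrier M \<Longrightarrow> d (Suc (length xs)) (\<mu> x) = \<zero>\<^bsub>C (Suc (Suc (length xs)))\<^esub>"
    and mu_surj: "a \<in> carrier (C (Suc (length xs))) \<Longrightarrow> d (Suc (length xs)) a = \<zero>\<^bsub>C (Suc (Suc (length xs)))\<^esub> \<Longrightarrow>
      \<exists>x\<in>carrier M. \<exists>v\<in>carrier (C (length xs)). a = \<mu> x \<oplus>\<^bsub>C (Suc (length xs))\<^esub> d (length xs) v"
    and mu_ker: "x \<in> carrier M \<Longrightarrow> \<mu> x \<in> d (length xs) ` carrier (C (length xs)) \<longleftrightarrow> x \<in> seqsub M xs"
    and above: "length xs < n \<Longrightarrow> a \<in> carrier (C (Suc n)) \<Longrightarrow> d (Suc n) a = \<zero>\<^bsub>C (Suc (Suc n))\<^esub> \<Longrightarrow>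
      \<exists>v\<in>carrier (C n). a = d n v"
    and below: "n < length xs \<Longrightarrow> a \<in> carrier (C (Suc n)) \<Longrightarrow> d (Suc n) a = \<zero>\<^bsub>C (Suc (Suc n))\<^esub> \<Longrightarrow>
      \<exists>v\<in>carrier (C n). d n v = u [^]\<^bsub>R\<^esub> s \<odot>\<^bsub>C (Suc n)\<^esub> a"

text \<open>For the empty sequence C is a copy of P. The exponent is 0 because there are no degrees
  below \<open>length xs\<close>.\<close>

lemma (in aug_complex) koszul_Nil:
  assumes u: "u \<in> carrier R"
  shows "koszul R P \<delta> M \<epsilon> (\<lambda>n. const_module (P n)) (\<lambda>n f _. \<delta> n (f 0)) [] u (\<lambda>n f. f 0) (\<lambda>x _. \<epsilon> x) 0"
proof -
  let ?C = "\<lambda>n. const_module (P n)" and ?d = "\<lambda>n f (_::nat). \<delta> n (f 0)"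
  note c = const_module_module[OF m]
  have lin: "lin R (?C n) (?C (Suc n)) (?d n)" for n
    using lin_comp[OF lin_comp[OF c(3) d] c(2)] by simp
  interpret K: inj_complex R ?C ?d
  proof
    show "baer R (?C n)" for n by (rule const_baer[OF C])
    show "lin R (?C n) (?C (Suc n)) (?d n)" for n by (rule lin)
    show "carrier (?C 0) = {\<zero>\<^bsub>?C 0\<^esub>}" using triv by auto
    show "?d (Suc n) (?d n x) = \<zero>\<^bsub>?C (Suc (Suc n))\<^esub>" if "x \<in> carrier (?C n)" for n x using that dd by auto
  qed
  interpret P1: module R "P 1" by (rule m)
  show ?thesis
  proof
    show "lin R (?C n) (P n) (\<lambda>f. f 0)" for n by (rule c(3))
    show "lin R M (?C (Suc (length []))) (\<lambda>x _. \<epsilon> x)" using lin_comp[OF eps c(2)] by simp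
    have d0: "?d 0 v = (\<lambda>_. \<zero>\<^bsub>P 1\<^esub>)" if "v \<in> carrier (?C 0)" for v
      using that triv lin_zero[OF d m m, of 0] by auto
    have v0: "(\<lambda>_. \<zero>\<^bsub>P 0\<^esub>) \<in> carrier (?C 0)" using triv by auto
    show "?d (Suc (length [])) (\<lambda>_. \<epsilon> x) = \<zero>\<^bsub>?C (Suc (Suc (length [])))\<^esub>" if "x \<in> carrier M" for x
    proof -
      have "\<epsilon> x \<in> cyc 1" using that cyc1 by blast
      then show ?thesis by (simp add: cyc_def)
    qed
    show "\<exists>x\<in>carrier M. \<exists>v\<in>carrier (?C (length [])). a = (\<lambda>_. \<epsilon> x) \<oplus>\<^bsub>?C (Suc (length []))\<^esub> ?d (length []) v"
      if a: "a \<in> carrier (?C (Suc (length [])))" "?d (Suc (length [])) a = \<zero>\<^bsub>?C (Suc (Suc (length [])))\<^esub>" for a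
    proof -
      obtain z where z: "z \<in> carrier (P 1)" "a = (\<lambda>_. z)" using a(1) by auto
      then have "z \<in> cyc 1" using a(2) by (auto simp: cyc_def fun_eq_iff)
      then obtain x where x: "x \<in> carrier M" "z = \<epsilon> x" using cyc1 by blast
      have "a = (\<lambda>_. \<epsilon> x) \<oplus>\<^bsub>?C 1\<^esub> ?d 0 (\<lambda>_. \<zero>\<^bsub>P 0\<^esub>)" unfolding d0[OF v0] using z x P1.M.r_zero[OF lin_closed[OF eps x(1)]] by simp
      then have "a = (\<lambda>_. \<epsilon> x) \<oplus>\<^bsub>?C (Suc (length []))\<^esub> ?d (length []) (\<lambda>_. \<zero>\<^bsub>P 0\<^esub>)" by simp
      moreover have "(\<lambda>_. \<zero>\<^bsub>P 0\<^esub>) \<in> carrier (?C (length []))" using v0 by simp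
      ultimately show ?thesis by (intro bexI[OF _ x(1)] bexI)
    qed
    show "((\<lambda>_. \<epsilon> x) \<in> ?d (length []) ` carrier (?C (length []))) = (x \<in> seqsub M [])" if x: "x \<in> carrier M" for x
    proof -
      have "?d 0 ` carrier (?C 0) = {\<lambda>_. \<zero>\<^bsub>P 1\<^esub>}"
        using triv lin_zero[OF d m m, of 0] by simp
      then show ?thesis using eps_inj[OF x] lin_zero[OF eps M m] by (auto simp: fun_eq_iff)
    qed
    show "\<exists>v\<in>carrier (?C n). a = ?d n v"
      if n: "length [] < n" and a: "a \<in> carrier (?C (Suc n))" "?d (Suc n) a = \<zero>\<^bsub>?C (Suc (Suc n))\<^esub>" for n a
    proof -
      obtain k where k: "n = Suc k" using n by (cases n) auto
      obtain z where z: "z \<in> carrier (P (Suc n))" "a = (\<lambda>_. z)" using a(1) by auto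
      then have "z \<in> cyc (Suc n)" using a(2) by (auto simp: cyc_def fun_eq_iff)
      then obtain w where "w \<in> carrier (P n)" "z = \<delta> n w" using exact[of k] k by blast
      then show ?thesis using z by (intro bexI[of _ "\<lambda>_. w"]) auto
    qed
    show "\<exists>z'\<in>carrier (?C n). ?d n z' = \<zero>\<^bsub>?C (Suc n)\<^esub> \<and> z' 0 = z \<and>
        (\<forall>r\<in>carrier R. r \<odot>\<^bsub>P n\<^esub> z = \<zero>\<^bsub>P n\<^esub> \<longrightarrow> r \<odot>\<^bsub>?C n\<^esub> z' = \<zero>\<^bsub>?C n\<^esub>)"
      if "z \<in> carrier (P n)" "\<delta> n z = \<zero>\<^bsub>P (Suc n)\<^esub>" for z n
      using that by (intro bexI[of _ "\<lambda>_. z"]) auto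
  qed (use u in auto)
qed

context koszul
begin

text \<open>A cohomology class annihilated by x is annihilated by u^(s+1). For n < length xs already
  u^s suffices; for n = length xs the cohomology is M/xs M, where almost regularity of x contributes
  the factor u.\<close>

lemma below':
  assumes x: "x \<in> carrier R" and reg: "\<And>m. m \<in> carrier M \<Longrightarrow> x \<odot>\<^bsub>M\<^esub> m \<in> seqsub M xs \<Longrightarrow> u \<odot>\<^bsub>M\<^esub> m \<in> seqsub M xs"
    and n: "n \<le> length xs" and a: "a \<in> carrier (C (Suc n))" "d (Suc n) a = \<zero>\<^bsub>C (Suc (Suc n))\<^esub>"
    and xa: "x \<odot>\<^bsub>C (Suc n)\<^esub> a \<in> d n ` carrier (C n)"
  shows "\<exists>w\<in>carrier (C n). d n w = u [^]\<^bsub>R\<^esub> Suc s \<odot>\<^bsub>C (Suc n)\<^esub> a"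
proof -
  interpret A: module R "C n" by (rule K.m)
  interpret B: module R "C (Suc n)" by (rule K.m)
  interpret MM: module R M by (rule M)
  have us: "u [^]\<^bsub>R\<^esub> s \<in> carrier R" using u by simp
  show ?thesis
  proof (cases "n < length xs")
    case True
    obtain v where v: "v \<in> carrier (C n)" "d n v = u [^]\<^bsub>R\<^esub> s \<odot>\<^bsub>C (Suc n)\<^esub> a" using below[OF True a] by blast
    have "d n (u \<odot>\<^bsub>C n\<^esub> v) = u [^]\<^bsub>R\<^esub> Suc s \<odot>\<^bsub>C (Suc n)\<^esub> a"
      using lin_smult[OF K.d u v(1)] v(2) us u a(1) by (simp add: A.R.m_comm flip: B.smult_assoc1)
    then show ?thesis using v(1) u by (meson A.smult_closed)
  next
    case False
    then have nl: "n = length xs" using n by simp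
    obtain mm v where mv: "mm \<in> carrier M" "v \<in> carrier (C n)" "a = \<mu> mm \<oplus>\<^bsub>C (Suc n)\<^esub> d n v"
      using mu_surj a unfolding nl by blast
    have muc: "\<mu> y \<in> carrier (C (Suc n))" if "y \<in> carrier M" for y using lin_closed[OF mu that] unfolding nl .
    note lmu = mu[folded nl]
    have dv: "d n v \<in> carrier (C (Suc n))" by (rule K.d_closed[OF mv(2)])
    have "x \<odot>\<^bsub>C (Suc n)\<^esub> d n v \<oplus>\<^bsub>C (Suc n)\<^esub> \<mu> (x \<odot>\<^bsub>M\<^esub> mm) = x \<odot>\<^bsub>C (Suc n)\<^esub> a"
      unfolding mv(3) lin_smult[OF lmu x mv(1)] using x muc[OF mv(1)] dv by (simp add: B.smult_r_distr B.M.a_comm)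
    moreover have "x \<odot>\<^bsub>C (Suc n)\<^esub> d n v \<in> d n ` carrier (C n)"
      using submodD(4)[OF K.bd_submod x] mv(2) by blast
    ultimately have "\<mu> (x \<odot>\<^bsub>M\<^esub> mm) \<in> d n ` carrier (C n)"
      using submod_add_cancel[OF K.bd_submod K.m, of "x \<odot>\<^bsub>C (Suc n)\<^esub> d n v"] xa muc x mv(1) by simp
    then have "x \<odot>\<^bsub>M\<^esub> mm \<in> seqsub M xs" using mu_ker[of "x \<odot>\<^bsub>M\<^esub> mm"] x mv(1) unfolding nl by simp
    then have "u \<odot>\<^bsub>M\<^esub> mm \<in> seqsub M xs" by (rule reg[OF mv(1)])
    then have "\<mu> (u \<odot>\<^bsub>M\<^esub> mm) \<in> d n ` carrier (C n)" using mu_ker[of "u \<odot>\<^bsub>M\<^esub> mm"] u mv(1) unfolding nl by simp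
    then have "u \<odot>\<^bsub>C (Suc n)\<^esub> \<mu> mm \<in> d n ` carrier (C n)" using lin_smult[OF lmu u mv(1)] by simp
    moreover have "u \<odot>\<^bsub>C (Suc n)\<^esub> d n v \<in> d n ` carrier (C n)"
      using submodD(4)[OF K.bd_submod u] mv(2) by blast
    ultimately have "u \<odot>\<^bsub>C (Suc n)\<^esub> \<mu> mm \<oplus>\<^bsub>C (Suc n)\<^esub> u \<odot>\<^bsub>C (Suc n)\<^esub> d n v \<in> d n ` carrier (C n)"
      by (rule submodD(3)[OF K.bd_submod])
    then have "u \<odot>\<^bsub>C (Suc n)\<^esub> a \<in> d n ` carrier (C n)"
      unfolding mv(3) using muc[OF mv(1)] dv u by (simp add: B.smult_r_distr)
    then have "u [^]\<^bsub>R\<^esub> s \<odot>\<^bsub>C (Suc n)\<^esub> (u \<odot>\<^bsub>C (Suc n)\<^esub> a) \<in> d n ` carrier (C n)"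
      by (rule submodD(4)[OF K.bd_submod us])
    then show ?thesis using us u a(1) by (auto simp: B.smult_assoc1 eq_commute)
  qed
qed

lemma cone_carrier_Suc: "f \<in> carrier (cone C (Suc n)) \<longleftrightarrow> ev f \<in> carrier (C (Suc n)) \<and> od f \<in> carrier (C n)"
  by (simp add: cone_def)

lemma cone_d_Suc: "cone_d C d x (Suc n) f = pr (d (Suc n) (ev f)) (x \<odot>\<^bsub>C (Suc n)\<^esub> ev f \<ominus>\<^bsub>C (Suc n)\<^esub> d n (od f))"
  by (simp add: cone_d_def)

lemma pr_inject: "pr a b = pr a' b' \<longleftrightarrow> a = a' \<and> b = b'"
  by (metis ev_pr od_pr)

lemma cone_cycle_Suc:
  assumes "x \<in> carrier R" "f \<in> carrier (cone C (Suc n))"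
  shows "cone_d C d x (Suc n) f = \<zero>\<^bsub>cone C (Suc (Suc n))\<^esub> \<longleftrightarrow>
    d (Suc n) (ev f) = \<zero>\<^bsub>C (Suc (Suc n))\<^esub> \<and> x \<odot>\<^bsub>C (Suc n)\<^esub> ev f = d n (od f)"
proof -
  interpret B: module R "C (Suc n)" by (rule K.m)
  show ?thesis
    using assms minus_eq_zero_iff[OF K.m, of "x \<odot>\<^bsub>C (Suc n)\<^esub> ev f" "Suc n" "d n (od f)"] K.d_closed
    by (simp add: cone_carrier_Suc cone_d_Suc) (simp add: cone_def pr_inject)
qed

text \<open>The long exact sequence of the cone, carried out on elements: cohomology of the cone is
  built from the cokernel of x one degree lower and the kernel of x in the same degree. On top this
  gives M/xs M modulo x. The exponents add up because the kernel part needs u^(s+1) by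
  \<open>below'\<close> and the cokernel part another u^s.\<close>

lemma koszul_Cons:
  assumes x: "x \<in> carrier R" and reg: "\<And>m. m \<in> carrier M \<Longrightarrow> x \<odot>\<^bsub>M\<^esub> m \<in> seqsub M xs \<Longrightarrow> u \<odot>\<^bsub>M\<^esub> m \<in> seqsub M xs"
  shows "koszul R P \<delta> M \<epsilon> (cone C) (cone_d C d x) (x # xs) u (\<lambda>n f. \<pi> n (ev f))
    (\<lambda>y. pr \<zero>\<^bsub>C (Suc (Suc (length xs)))\<^esub> (\<mu> y)) (s + Suc s)"
proof -
  let ?l = "length xs"
  interpret D: inj_complex R "cone C" "cone_d C d x" by (rule cone_inj_complex[OF K.inj_complex_axioms x])
  interpret MM: module R M by (rule M)
  have mC: "module R (C n)" for n by (rule K.m)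
  have le: "lin R (cone C n) (C n) ev" for n by (auto simp: lin_def cone_def)
  have z: "\<zero>\<^bsub>C n\<^esub> \<in> carrier (C n)" for n
  proof -
    interpret A: module R "C n" by (rule mC)
    show ?thesis by simp
  qed
  have d0: "d n \<zero>\<^bsub>C n\<^esub> = \<zero>\<^bsub>C (Suc n)\<^esub>" for n by (rule lin_zero[OF K.d mC mC])
  have x0: "r \<odot>\<^bsub>C n\<^esub> \<zero>\<^bsub>C n\<^esub> = \<zero>\<^bsub>C n\<^esub>" if "r \<in> carrier R" for n r
  proof -
    interpret A: module R "C n" by (rule mC)
    show ?thesis using that by simp
  qed
  have muc: "\<mu> y \<in> carrier (C (Suc ?l))" if "y \<in> carrier M" for y using lin_closed[OF mu that] .
  \<comment> \<open>Coboundaries are taken of pairs (w, -v), so that the sign in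
    \<open>cone_d\<close> turns into a sum.\<close>
  have Dvw: "cone_d C d x (Suc n) (pr w (\<ominus>\<^bsub>C n\<^esub> v)) = pr (d (Suc n) w) (x \<odot>\<^bsub>C (Suc n)\<^esub> w \<oplus>\<^bsub>C (Suc n)\<^esub> d n v)"
    if "w \<in> carrier (C (Suc n))" "v \<in> carrier (C n)" for n v w
  proof -
    interpret B: module R "C (Suc n)" by (rule mC)
    show ?thesis unfolding cone_d_Suc using that x K.d_closed neg_neg_diff[OF mC] lin_neg[OF K.d mC mC] by simp
  qed
  have negc: "\<ominus>\<^bsub>C n\<^esub> v \<in> carrier (C n)" if "v \<in> carrier (C n)" for n v
  proof -
    interpret B: module R "C n" by (rule mC)
    show ?thesis using that by simp
  qed
  show ?thesis
  proof
    show "set (x # xs) \<subseteq> carrier R" using x xs by simp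
    show "u \<in> carrier R" by (rule u)
    show "lin R (cone C n) (P n) (\<lambda>f. \<pi> n (ev f))" for n by (rule lin_comp[OF le pi])
    show "\<pi> (Suc n) (ev (cone_d C d x n a)) = \<delta> n (\<pi> n (ev a))" if "a \<in> carrier (cone C n)" for a n
      using pi_d[of "ev a" n] that by (simp add: cone_def cone_d_def)
    show "\<exists>z'\<in>carrier (cone C n). cone_d C d x n z' = \<zero>\<^bsub>cone C (Suc n)\<^esub> \<and> \<pi> n (ev z') = zz \<and>
        (\<forall>r\<in>carrier R. r \<odot>\<^bsub>P n\<^esub> zz = \<zero>\<^bsub>P n\<^esub> \<longrightarrow> r \<odot>\<^bsub>cone C n\<^esub> z' = \<zero>\<^bsub>cone C n\<^esub>)"
      if zz: "zz \<in> carrier (P n)" "\<delta> n zz = \<zero>\<^bsub>P (Suc n)\<^esub>" "\<And>y. y \<in> set (x # xs) \<Longrightarrow> y \<odot>\<^bsub>P n\<^esub> zz = \<zero>\<^bsub>P n\<^esub>" for zz n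
    proof -
      have "\<exists>z'\<in>carrier (C n). d n z' = \<zero>\<^bsub>C (Suc n)\<^esub> \<and> \<pi> n z' = zz \<and>
        (\<forall>r\<in>carrier R. r \<odot>\<^bsub>P n\<^esub> zz = \<zero>\<^bsub>P n\<^esub> \<longrightarrow> r \<odot>\<^bsub>C n\<^esub> z' = \<zero>\<^bsub>C n\<^esub>)"
        by (rule lift[OF zz(1,2)]) (use zz(3) in simp)
      then obtain z' where z': "z' \<in> carrier (C n)" "d n z' = \<zero>\<^bsub>C (Suc n)\<^esub>" "\<pi> n z' = zz"
        "\<And>r. r \<in> carrier R \<Longrightarrow> r \<odot>\<^bsub>P n\<^esub> zz = \<zero>\<^bsub>P n\<^esub> \<Longrightarrow> r \<odot>\<^bsub>C n\<^esub> z' = \<zero>\<^bsub>C n\<^esub>" by blast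
      have xz: "x \<odot>\<^bsub>C n\<^esub> z' = \<zero>\<^bsub>C n\<^esub>" using z'(4)[OF x] zz(3) by simp
      show ?thesis
      \<comment> \<open>The pair (z', 0) is a cocycle because x z' = 0: the clause on annihilators
        in \<open>lift\<close> carries this over from x zz = 0. The same clause has to be handed on
        for the next cone.\<close>
      proof (intro bexI[of _ "pr z' \<zero>\<^bsub>C (n - 1)\<^esub>"] conjI ballI impI)
        show "pr z' \<zero>\<^bsub>C (n - 1)\<^esub> \<in> carrier (cone C n)" using z'(1) z by (simp add: cone_def)
        show "cone_d C d x n (pr z' \<zero>\<^bsub>C (n - 1)\<^esub>) = \<zero>\<^bsub>cone C (Suc n)\<^esub>"
          using z'(2) xz minus_zero_right[OF mC z] d0 by (cases n) (simp_all add: cone_d_def cone_def)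
        show "\<pi> n (ev (pr z' \<zero>\<^bsub>C (n - 1)\<^esub>)) = zz" using z'(3) by simp
        show "r \<odot>\<^bsub>cone C n\<^esub> pr z' \<zero>\<^bsub>C (n - 1)\<^esub> = \<zero>\<^bsub>cone C n\<^esub>" if "r \<in> carrier R" "r \<odot>\<^bsub>P n\<^esub> zz = \<zero>\<^bsub>P n\<^esub>" for r
          using z'(4)[OF that] x0[OF that(1)] by (simp add: cone_def)
      qed
    qed
    show "lin R M (cone C (Suc (length (x # xs)))) (\<lambda>y. pr \<zero>\<^bsub>C (Suc (Suc ?l))\<^esub> (\<mu> y))"
    proof (rule linI)
      interpret A: module R "C (Suc (Suc ?l))" by (rule mC)
      fix y assume y: "y \<in> carrier M"
      show "pr \<zero>\<^bsub>C (Suc (Suc ?l))\<^esub> (\<mu> y) \<in> carrier (cone C (Suc (length (x # xs))))"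
        using muc[OF y] by (simp add: cone_def)
      show "pr \<zero>\<^bsub>C (Suc (Suc ?l))\<^esub> (\<mu> (y \<oplus>\<^bsub>M\<^esub> y')) = pr \<zero>\<^bsub>C (Suc (Suc ?l))\<^esub> (\<mu> y) \<oplus>\<^bsub>cone C (Suc (length (x # xs)))\<^esub> pr \<zero>\<^bsub>C (Suc (Suc ?l))\<^esub> (\<mu> y')"
        if "y' \<in> carrier M" for y'
        using lin_add[OF mu y that] by (simp add: cone_def)
      show "pr \<zero>\<^bsub>C (Suc (Suc ?l))\<^esub> (\<mu> (r \<odot>\<^bsub>M\<^esub> y)) = r \<odot>\<^bsub>cone C (Suc (length (x # xs)))\<^esub> pr \<zero>\<^bsub>C (Suc (Suc ?l))\<^esub> (\<mu> y)"
        if "r \<in> carrier R" for r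
        using lin_smult[OF mu that y] that by (simp add: cone_def)
    qed
    show "cone_d C d x (Suc (length (x # xs))) (pr \<zero>\<^bsub>C (Suc (Suc ?l))\<^esub> (\<mu> y)) = \<zero>\<^bsub>cone C (Suc (Suc (length (x # xs))))\<^esub>"
      if y: "y \<in> carrier M" for y
      using cone_cycle_Suc[OF x, of "pr \<zero>\<^bsub>C (Suc (Suc ?l))\<^esub> (\<mu> y)" "Suc ?l"] mu_cyc[OF y] muc[OF y] z d0 x0[OF x]
      by (simp add: cone_carrier_Suc)
    \<comment> \<open>From degree length xs + 2 on the component \<open>ev f\<close> is a coboundary
      d w. Subtracting the coboundary of (w, 0) leaves the cocycle (0, od f - x w), so the question
      is about C in one degree lower.\<close>
    have red: "\<exists>w\<in>carrier (C (Suc n)). ev f = d (Suc n) w \<and> od f \<ominus>\<^bsub>C (Suc n)\<^esub> x \<odot>\<^bsub>C (Suc n)\<^esub> w \<in> carrier (C (Suc n)) \<and>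
        d (Suc n) (od f \<ominus>\<^bsub>C (Suc n)\<^esub> x \<odot>\<^bsub>C (Suc n)\<^esub> w) = \<zero>\<^bsub>C (Suc (Suc n))\<^esub>"
      if n: "?l \<le> n" and f: "f \<in> carrier (cone C (Suc (Suc n)))" "cone_d C d x (Suc (Suc n)) f = \<zero>\<^bsub>cone C (Suc (Suc (Suc n)))\<^esub>" for f n
    proof -
      interpret B: module R "C (Suc n)" by (rule mC)
      interpret B2: module R "C (Suc (Suc n))" by (rule mC)
      have fc: "ev f \<in> carrier (C (Suc (Suc n)))" "od f \<in> carrier (C (Suc n))" using f(1) by (simp_all add: cone_carrier_Suc)
      have fd: "d (Suc (Suc n)) (ev f) = \<zero>\<^bsub>C (Suc (Suc (Suc n)))\<^esub>" "x \<odot>\<^bsub>C (Suc (Suc n))\<^esub> ev f = d (Suc n) (od f)"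
        using cone_cycle_Suc[OF x f(1)] f(2) by simp_all
      obtain w where w: "w \<in> carrier (C (Suc n))" "ev f = d (Suc n) w" using above[OF _ fc(1) fd(1)] n by auto
      have xw: "x \<odot>\<^bsub>C (Suc n)\<^esub> w \<in> carrier (C (Suc n))" using x w by simp
      have "d (Suc n) (od f \<ominus>\<^bsub>C (Suc n)\<^esub> x \<odot>\<^bsub>C (Suc n)\<^esub> w) = \<zero>\<^bsub>C (Suc (Suc n))\<^esub>"
        unfolding lin_diff[OF K.d mC mC fc(2) xw] lin_smult[OF K.d x w(1)] fd(2)[symmetric] w(2)
        using minus_eq_zero_iff[OF mC] x K.d_closed[OF w(1)] by simp
      then show ?thesis using w minus_closed[OF mC fc(2) xw] by blast
    qed
    have fin: "f = cone_d C d x (Suc n) (pr w (\<ominus>\<^bsub>C n\<^esub> v))" "pr w (\<ominus>\<^bsub>C n\<^esub> v) \<in> carrier (cone C (Suc n))"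
      if "w \<in> carrier (C (Suc n))" "v \<in> carrier (C n)" "ev f = d (Suc n) w" "od f \<in> carrier (C (Suc n))"
        "od f \<ominus>\<^bsub>C (Suc n)\<^esub> x \<odot>\<^bsub>C (Suc n)\<^esub> w = d n v" for f n w v
    proof -
      interpret B: module R "C (Suc n)" by (rule mC)
      show "f = cone_d C d x (Suc n) (pr w (\<ominus>\<^bsub>C n\<^esub> v))" unfolding Dvw[OF that(1,2)]
        by (rule pr_eqI) (use that(3,4) that(5)[symmetric] minus_add_cancel(2)[OF mC, of "od f"] x that(1) in simp_all)
      show "pr w (\<ominus>\<^bsub>C n\<^esub> v) \<in> carrier (cone C (Suc n))" using that negc by (simp add: cone_carrier_Suc)
    qed
    show "\<exists>y\<in>carrier M. \<exists>v\<in>carrier (cone C (length (x # xs))).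
        f = pr \<zero>\<^bsub>C (Suc (Suc ?l))\<^esub> (\<mu> y) \<oplus>\<^bsub>cone C (Suc (length (x # xs)))\<^esub> cone_d C d x (length (x # xs)) v"
      if f: "f \<in> carrier (cone C (Suc (length (x # xs))))" "cone_d C d x (Suc (length (x # xs))) f = \<zero>\<^bsub>cone C (Suc (Suc (length (x # xs))))\<^esub>" for f
    proof -
      interpret B: module R "C (Suc ?l)" by (rule mC)
      interpret B2: module R "C (Suc (Suc ?l))" by (rule mC)
      obtain w where w: "w \<in> carrier (C (Suc ?l))" "ev f = d (Suc ?l) w" "od f \<ominus>\<^bsub>C (Suc ?l)\<^esub> x \<odot>\<^bsub>C (Suc ?l)\<^esub> w \<in> carrier (C (Suc ?l))"
        "d (Suc ?l) (od f \<ominus>\<^bsub>C (Suc ?l)\<^esub> x \<odot>\<^bsub>C (Suc ?l)\<^esub> w) = \<zero>\<^bsub>C (Suc (Suc ?l))\<^esub>"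
        using red[of ?l f] f by auto
      obtain y v where yv: "y \<in> carrier M" "v \<in> carrier (C ?l)" "od f \<ominus>\<^bsub>C (Suc ?l)\<^esub> x \<odot>\<^bsub>C (Suc ?l)\<^esub> w = \<mu> y \<oplus>\<^bsub>C (Suc ?l)\<^esub> d ?l v"
        using mu_surj[OF w(3,4)] by blast
      have oc: "od f \<in> carrier (C (Suc ?l))" using f(1) by (simp add: cone_carrier_Suc)
      have xw: "x \<odot>\<^bsub>C (Suc ?l)\<^esub> w \<in> carrier (C (Suc ?l))" using x w by simp
      have "od f = \<mu> y \<oplus>\<^bsub>C (Suc ?l)\<^esub> (x \<odot>\<^bsub>C (Suc ?l)\<^esub> w \<oplus>\<^bsub>C (Suc ?l)\<^esub> d ?l v)"
        using minus_add_cancel(2)[OF mC oc xw] unfolding yv(3) using muc[OF yv(1)] K.d_closed[OF yv(2)] xw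
        by (simp add: B.M.a_ac)
      then have "f = pr \<zero>\<^bsub>C (Suc (Suc ?l))\<^esub> (\<mu> y) \<oplus>\<^bsub>cone C (Suc (Suc ?l))\<^esub> cone_d C d x (Suc ?l) (pr w (\<ominus>\<^bsub>C ?l\<^esub> v))"
        unfolding Dvw[OF w(1) yv(2)] using w(2) K.d_closed[OF w(1)] by (simp add: cone_def pr_eqI)
      then show ?thesis using yv w(1) negc by (intro bexI[of _ y] bexI[of _ "pr w (\<ominus>\<^bsub>C ?l\<^esub> v)"]) (auto simp: cone_carrier_Suc)
    qed
    show "(pr \<zero>\<^bsub>C (Suc (Suc ?l))\<^esub> (\<mu> y) \<in> cone_d C d x (length (x # xs)) ` carrier (cone C (length (x # xs)))) = (y \<in> seqsub M (x # xs))"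
      if y: "y \<in> carrier M" for y
    proof
      interpret B: module R "C (Suc ?l)" by (rule mC)
      assume "pr \<zero>\<^bsub>C (Suc (Suc ?l))\<^esub> (\<mu> y) \<in> cone_d C d x (length (x # xs)) ` carrier (cone C (length (x # xs)))"
      then obtain f where f: "f \<in> carrier (cone C (Suc ?l))" "pr \<zero>\<^bsub>C (Suc (Suc ?l))\<^esub> (\<mu> y) = cone_d C d x (Suc ?l) f" by auto
      have fc: "ev f \<in> carrier (C (Suc ?l))" "od f \<in> carrier (C ?l)" using f(1) by (simp_all add: cone_carrier_Suc)
      have e: "d (Suc ?l) (ev f) = \<zero>\<^bsub>C (Suc (Suc ?l))\<^esub>" "\<mu> y = x \<odot>\<^bsub>C (Suc ?l)\<^esub> ev f \<ominus>\<^bsub>C (Suc ?l)\<^esub> d ?l (od f)"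
        using f(2) unfolding cone_d_Suc pr_inject by simp_all
      \<comment> \<open>The first component is a cocycle, hence \<mu> y' up to a coboundary.
        Comparing the second components shows that \<mu> (y - x y') is a coboundary, so that y - x
        y' lies in the submodule of xs.\<close>
      obtain y' v where yv: "y' \<in> carrier M" "v \<in> carrier (C ?l)" "ev f = \<mu> y' \<oplus>\<^bsub>C (Suc ?l)\<^esub> d ?l v"
        using mu_surj[OF fc(1) e(1)] by blast
      note dv = K.d_closed[OF yv(2)] and df = K.d_closed[OF fc(2)]
      have xy: "x \<odot>\<^bsub>M\<^esub> y' \<in> carrier M" using x yv by simp
      have "\<mu> (y \<ominus>\<^bsub>M\<^esub> x \<odot>\<^bsub>M\<^esub> y') = \<mu> y \<ominus>\<^bsub>C (Suc ?l)\<^esub> x \<odot>\<^bsub>C (Suc ?l)\<^esub> \<mu> y'"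
        using lin_diff[OF mu M mC y xy] lin_smult[OF mu x yv(1)] by simp
      also have "\<dots> = x \<odot>\<^bsub>C (Suc ?l)\<^esub> d ?l v \<ominus>\<^bsub>C (Suc ?l)\<^esub> d ?l (od f)"
      proof -
        have c: "x \<odot>\<^bsub>C (Suc ?l)\<^esub> \<mu> y' \<in> carrier (C (Suc ?l))" "x \<odot>\<^bsub>C (Suc ?l)\<^esub> d ?l v \<in> carrier (C (Suc ?l))" using x muc[OF yv(1)] dv by simp_all
        have "x \<odot>\<^bsub>C (Suc ?l)\<^esub> ev f = x \<odot>\<^bsub>C (Suc ?l)\<^esub> \<mu> y' \<oplus>\<^bsub>C (Suc ?l)\<^esub> x \<odot>\<^bsub>C (Suc ?l)\<^esub> d ?l v"
          unfolding yv(3) by (rule B.smult_r_distr[OF x muc[OF yv(1)] dv])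
        then show ?thesis unfolding e(2) using add_minus_cancel_left[OF mC c df] by simp
      qed
      also have "\<dots> = d ?l (x \<odot>\<^bsub>C ?l\<^esub> v \<ominus>\<^bsub>C ?l\<^esub> od f)"
      proof -
        interpret B0: module R "C ?l" by (rule mC)
        show ?thesis using lin_diff[OF K.d mC mC _ fc(2), of "x \<odot>\<^bsub>C ?l\<^esub> v"] lin_smult[OF K.d x yv(2)] x yv(2) by simp
      qed
      finally have "\<mu> (y \<ominus>\<^bsub>M\<^esub> x \<odot>\<^bsub>M\<^esub> y') \<in> d ?l ` carrier (C ?l)"
      proof -
        interpret B0: module R "C ?l" by (rule mC)
        have "x \<odot>\<^bsub>C ?l\<^esub> v \<ominus>\<^bsub>C ?l\<^esub> od f \<in> carrier (C ?l)" using x yv(2) fc(2) by simp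
        then show "\<mu> (y \<ominus>\<^bsub>M\<^esub> x \<odot>\<^bsub>M\<^esub> y') = d ?l (x \<odot>\<^bsub>C ?l\<^esub> v \<ominus>\<^bsub>C ?l\<^esub> od f) \<Longrightarrow> ?thesis" by blast
      qed
      then have "y \<ominus>\<^bsub>M\<^esub> x \<odot>\<^bsub>M\<^esub> y' \<in> seqsub M xs" using mu_ker minus_closed[OF M y xy] by blast
      then have "(y \<ominus>\<^bsub>M\<^esub> x \<odot>\<^bsub>M\<^esub> y') \<oplus>\<^bsub>M\<^esub> x \<odot>\<^bsub>M\<^esub> y' \<in> seqsub M (x # xs)" using yv(1) by (auto intro: set_addI)
      then show "y \<in> seqsub M (x # xs)" unfolding minus_add_cancel(1)[OF M y xy] .
    next
      interpret B: module R "C (Suc ?l)" by (rule mC)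
      assume "y \<in> seqsub M (x # xs)"
      then have "y \<in> seqsub M xs <+>\<^bsub>M\<^esub> (\<lambda>m. x \<odot>\<^bsub>M\<^esub> m) ` carrier M" by simp
      then obtain y' y'' where yy: "y' \<in> seqsub M xs" "y'' \<in> (\<lambda>m. x \<odot>\<^bsub>M\<^esub> m) ` carrier M" "y = y' \<oplus>\<^bsub>M\<^esub> y''" by (rule set_addE)
      then obtain t where t: "t \<in> carrier M" "y'' = x \<odot>\<^bsub>M\<^esub> t" by blast
      have y'c: "y' \<in> carrier M" using yy(1) submodD(1)[OF seqsub_submod[OF M xs]] by blast
      then obtain v where v: "v \<in> carrier (C ?l)" "\<mu> y' = d ?l v" using mu_ker yy(1) by blast
      have "\<mu> y = x \<odot>\<^bsub>C (Suc ?l)\<^esub> \<mu> t \<oplus>\<^bsub>C (Suc ?l)\<^esub> d ?l v"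
        unfolding yy(3) t(2) using lin_add[OF mu y'c, of "x \<odot>\<^bsub>M\<^esub> t"] lin_smult[OF mu x t(1)] x t(1) v(2) muc
          B.M.a_comm[OF K.d_closed[OF v(1)]] by simp
      then have "pr \<zero>\<^bsub>C (Suc (Suc ?l))\<^esub> (\<mu> y) = cone_d C d x (Suc ?l) (pr (\<mu> t) (\<ominus>\<^bsub>C ?l\<^esub> v))"
        unfolding Dvw[OF muc[OF t(1)] v(1)] mu_cyc[OF t(1)] by simp
      then show "pr \<zero>\<^bsub>C (Suc (Suc ?l))\<^esub> (\<mu> y) \<in> cone_d C d x (length (x # xs)) ` carrier (cone C (length (x # xs)))"
        using muc[OF t(1)] negc[OF v(1)] by (auto simp: cone_carrier_Suc)
    qed
    show "\<exists>v\<in>carrier (cone C n). f = cone_d C d x n v"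
      if n: "length (x # xs) < n" and f: "f \<in> carrier (cone C (Suc n))" "cone_d C d x (Suc n) f = \<zero>\<^bsub>cone C (Suc (Suc n))\<^esub>" for n f
    proof -
      obtain k where k: "n = Suc k" using n by (cases n) auto
      have lk: "?l < k" using n k by simp
      obtain w where w: "w \<in> carrier (C (Suc k))" "ev f = d (Suc k) w" "od f \<ominus>\<^bsub>C (Suc k)\<^esub> x \<odot>\<^bsub>C (Suc k)\<^esub> w \<in> carrier (C (Suc k))"
        "d (Suc k) (od f \<ominus>\<^bsub>C (Suc k)\<^esub> x \<odot>\<^bsub>C (Suc k)\<^esub> w) = \<zero>\<^bsub>C (Suc (Suc k))\<^esub>"
        using red[of k f] f lk unfolding k by auto
      obtain v where v: "v \<in> carrier (C k)" "od f \<ominus>\<^bsub>C (Suc k)\<^esub> x \<odot>\<^bsub>C (Suc k)\<^esub> w = d k v" using above[OF lk w(3,4)] by blast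
      have oc: "od f \<in> carrier (C (Suc k))" using f(1) unfolding k by (simp add: cone_carrier_Suc)
      show ?thesis using fin[OF w(1) v(1) w(2) oc v(2)] unfolding k by blast
    qed
    show "\<exists>v\<in>carrier (cone C n). cone_d C d x n v = u [^]\<^bsub>R\<^esub> (s + Suc s) \<odot>\<^bsub>cone C (Suc n)\<^esub> f"
      if n: "n < length (x # xs)" and f: "f \<in> carrier (cone C (Suc n))" "cone_d C d x (Suc n) f = \<zero>\<^bsub>cone C (Suc (Suc n))\<^esub>" for n f
    proof -
      interpret B: module R "C (Suc n)" by (rule mC)
      interpret B0: module R "C n" by (rule mC)
      have fc: "ev f \<in> carrier (C (Suc n))" "od f \<in> carrier (C n)" using f(1) by (simp_all add: cone_carrier_Suc)
      have fd: "d (Suc n) (ev f) = \<zero>\<^bsub>C (Suc (Suc n))\<^esub>" "x \<odot>\<^bsub>C (Suc n)\<^esub> ev f = d n (od f)"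
        using cone_cycle_Suc[OF x f(1)] f(2) by simp_all
      have us: "u [^]\<^bsub>R\<^esub> s \<in> carrier R" "u [^]\<^bsub>R\<^esub> Suc s \<in> carrier R" "u [^]\<^bsub>R\<^esub> (s + Suc s) \<in> carrier R" using u by simp_all
      have uss: "u [^]\<^bsub>R\<^esub> (s + Suc s) = u [^]\<^bsub>R\<^esub> s \<otimes>\<^bsub>R\<^esub> u [^]\<^bsub>R\<^esub> Suc s" using u by (rule MM.R.nat_pow_mult[symmetric])
      \<comment> \<open>The cocycle condition makes x times \<open>ev f\<close> the coboundary of
        \<open>od f\<close>, so \<open>below'\<close> applies to the first component. Multiplication
        by a further u^s prepares for the second one.\<close>
      obtain w where w: "w \<in> carrier (C n)" "d n w = u [^]\<^bsub>R\<^esub> Suc s \<odot>\<^bsub>C (Suc n)\<^esub> ev f"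
        using below'[OF x reg _ fc(1) fd(1)] fd(2) fc(2) n by auto
      let ?w = "u [^]\<^bsub>R\<^esub> s \<odot>\<^bsub>C n\<^esub> w"
      have wc: "?w \<in> carrier (C n)" using us w by simp
      have dw: "d n ?w = u [^]\<^bsub>R\<^esub> (s + Suc s) \<odot>\<^bsub>C (Suc n)\<^esub> ev f"
        unfolding lin_smult[OF K.d us(1) w(1)] w(2) uss using us fc by (simp add: B.smult_assoc1 del: nat_pow_Suc)
      show ?thesis
      proof (cases n)
        case 0
        have "od f = \<zero>\<^bsub>C 0\<^esub>" "?w = \<zero>\<^bsub>C 0\<^esub>" using fc wc K.triv 0 by auto
        then show ?thesis using dw 0 us us z x0[OF x] x0[OF us(3)]
          by (intro bexI[of _ "pr ?w \<zero>\<^bsub>C 0\<^esub>"]) (auto simp: cone_def cone_d_def)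
      next
        case (Suc k)
        \<comment> \<open>What the choice of w leaves over in the second component. It is a cocycle
          of C in degree n = k + 1 with k < length xs, so u^s makes it a coboundary.\<close>
        let ?c = "u [^]\<^bsub>R\<^esub> Suc s \<odot>\<^bsub>C n\<^esub> od f \<ominus>\<^bsub>C n\<^esub> x \<odot>\<^bsub>C n\<^esub> w"
        have cc: "u [^]\<^bsub>R\<^esub> Suc s \<odot>\<^bsub>C n\<^esub> od f \<in> carrier (C n)" "x \<odot>\<^bsub>C n\<^esub> w \<in> carrier (C n)" using us fc x w by simp_all
        have cc': "?c \<in> carrier (C n)" by (rule minus_closed[OF mC cc])
        have "d n ?c = \<zero>\<^bsub>C (Suc n)\<^esub>"
          unfolding lin_diff[OF K.d mC mC cc] lin_smult[OF K.d us(2) fc(2)] lin_smult[OF K.d x w(1)] w(2) fd(2)[symmetric]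
          using smult_commute[OF mC us(2) x fc(1)] minus_eq_zero_iff[OF mC] x us fc by simp
        then obtain v where v: "v \<in> carrier (C k)" "d k v = u [^]\<^bsub>R\<^esub> s \<odot>\<^bsub>C n\<^esub> ?c"
          using below[of k ?c] cc' n Suc by auto
        have e: "u [^]\<^bsub>R\<^esub> s \<odot>\<^bsub>C n\<^esub> ?c = u [^]\<^bsub>R\<^esub> (s + Suc s) \<odot>\<^bsub>C n\<^esub> od f \<ominus>\<^bsub>C n\<^esub> x \<odot>\<^bsub>C n\<^esub> ?w"
          unfolding smult_diff[OF mC us(1) cc] smult_commute[OF mC x us(1) w(1)] uss
          using us fc by (simp add: B0.smult_assoc1 del: nat_pow_Suc)
        have "u [^]\<^bsub>R\<^esub> (s + Suc s) \<odot>\<^bsub>cone C (Suc n)\<^esub> f = cone_d C d x (Suc k) (pr ?w (\<ominus>\<^bsub>C k\<^esub> v))"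
          by (rule fin(1)) (use wc v dw e us fc Suc B0.smult_closed[OF us(3) fc(2)] in \<open>auto simp: cone_def simp del: nat_pow_Suc\<close>)
        moreover have "pr ?w (\<ominus>\<^bsub>C k\<^esub> v) \<in> carrier (cone C (Suc k))" using wc negc[OF v(1)] Suc by (simp add: cone_carrier_Suc)
        ultimately show ?thesis unfolding Suc by metis
      qed
    qed
  qed
qed

end

lemma (in aug_complex) koszul_exists:
  assumes u: "u \<in> carrier R" and "set xs \<subseteq> carrier R" "almost_regular M u xs"
  shows "\<exists>C d \<pi> \<mu> s. koszul R P \<delta> M \<epsilon> C d xs u \<pi> \<mu> s"
  using assms(2,3)
proof (induction xs)
  case Nil
  show ?case using koszul_Nil[OF u] by blast
next
  case (Cons x xs)
  then obtain C d \<pi> \<mu> s where "koszul R P \<delta> M \<epsilon> C d xs u \<pi> \<mu> s" by auto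
  then interpret koszul R P \<delta> M \<epsilon> C d xs u \<pi> \<mu> s .
  have "koszul R P \<delta> M \<epsilon> (cone C) (cone_d C d x) (x # xs) u (\<lambda>n f. \<pi> n (ev f))
    (\<lambda>y. pr \<zero>\<^bsub>C (Suc (Suc (length xs)))\<^esub> (\<mu> y)) (s + Suc s)"
    by (rule koszul_Cons) (use Cons.prems in auto)
  then show ?case by (intro exI)
qed

text \<open>As z is killed by xs, it lifts to a cocycle z' of the Koszul complex in a degree where
  u^s kills the cohomology. The contraction there is linear and z' has at least the annihilators of
  z, so w = \<pi> (h z') is killed by whatever kills z; a bare preimage of the multiple of z would
  not have this property.\<close>

lemma (in aug_complex) almost_regular_ext_vanish:
  assumes u: "u \<in> carrier R" and xs: "set xs \<subseteq> carrier R" and reg: "almost_regular M u xs" and i: "i < length xs"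
    and z: "z \<in> carrier (P (Suc i))" "\<delta> (Suc i) z = \<zero>\<^bsub>P (Suc (Suc i))\<^esub>"
    and kill: "\<And>x. x \<in> set xs \<Longrightarrow> x \<odot>\<^bsub>P (Suc i)\<^esub> z = \<zero>\<^bsub>P (Suc i)\<^esub>"
  shows "\<exists>(b::nat) w. w \<in> carrier (P i) \<and> \<delta> i w = u [^]\<^bsub>R\<^esub> b \<odot>\<^bsub>P (Suc i)\<^esub> z \<and>
    (\<forall>r\<in>carrier R. r \<odot>\<^bsub>P (Suc i)\<^esub> z = \<zero>\<^bsub>P (Suc i)\<^esub> \<longrightarrow> r \<odot>\<^bsub>P i\<^esub> w = \<zero>\<^bsub>P i\<^esub>)"
proof -
  obtain C d \<pi> \<mu> s where "koszul R P \<delta> M \<epsilon> C d xs u \<pi> \<mu> s" using koszul_exists[OF u xs reg] by blast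
  then interpret koszul R P \<delta> M \<epsilon> C d xs u \<pi> \<mu> s .
  interpret R: cring R by (rule R)
  have us: "u [^]\<^bsub>R\<^esub> s \<in> carrier R" using u by simp
  obtain z' where z': "z' \<in> carrier (C (Suc i))" "d (Suc i) z' = \<zero>\<^bsub>C (Suc (Suc i))\<^esub>" "\<pi> (Suc i) z' = z"
    "\<And>r. r \<in> carrier R \<Longrightarrow> r \<odot>\<^bsub>P (Suc i)\<^esub> z = \<zero>\<^bsub>P (Suc i)\<^esub> \<Longrightarrow> r \<odot>\<^bsub>C (Suc i)\<^esub> z' = \<zero>\<^bsub>C (Suc i)\<^esub>"
    using lift[OF z kill] by blast
  have "\<exists>(b::nat) h. lin R (C (Suc i)) (C i) h \<and>
    (\<forall>z\<in>carrier (C (Suc i)). d (Suc i) z = \<zero>\<^bsub>C (Suc (Suc i))\<^esub> \<longrightarrow> d i (h z) = ((u [^]\<^bsub>R\<^esub> s) [^]\<^bsub>R\<^esub> b) \<odot>\<^bsub>C (Suc i)\<^esub> z)"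
    by (rule partial_contraction_cycles[where k = "length xs", OF K.C K.d K.dd K.triv us]) (use below i in auto)
  then obtain b :: nat and h where h: "lin R (C (Suc i)) (C i) h" "d i (h z') = ((u [^]\<^bsub>R\<^esub> s) [^]\<^bsub>R\<^esub> b) \<odot>\<^bsub>C (Suc i)\<^esub> z'"
    using z'(1,2) by blast
  have hc: "h z' \<in> carrier (C i)" by (rule lin_closed[OF h(1) z'(1)])
  show ?thesis
  proof (intro exI conjI ballI impI)
    show "\<pi> i (h z') \<in> carrier (P i)" by (rule lin_closed[OF pi hc])
    have "\<delta> i (\<pi> i (h z')) = \<pi> (Suc i) (d i (h z'))" using pi_d[OF hc] by simp
    also have "\<dots> = ((u [^]\<^bsub>R\<^esub> s) [^]\<^bsub>R\<^esub> b) \<odot>\<^bsub>P (Suc i)\<^esub> z"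
      unfolding h(2) using lin_smult[OF pi _ z'(1)] us z'(3) by simp
    also have "(u [^]\<^bsub>R\<^esub> s) [^]\<^bsub>R\<^esub> b = u [^]\<^bsub>R\<^esub> (s * b)" using u by (rule R.nat_pow_pow)
    finally show "\<delta> i (\<pi> i (h z')) = u [^]\<^bsub>R\<^esub> (s * b) \<odot>\<^bsub>P (Suc i)\<^esub> z" .
    fix r assume r: "r \<in> carrier R" "r \<odot>\<^bsub>P (Suc i)\<^esub> z = \<zero>\<^bsub>P (Suc i)\<^esub>"
    have "r \<odot>\<^bsub>P i\<^esub> \<pi> i (h z') = \<pi> i (h (r \<odot>\<^bsub>C (Suc i)\<^esub> z'))"
      using lin_smult[OF h(1) r(1) z'(1)] lin_smult[OF pi r(1) hc] by simp
    then show "r \<odot>\<^bsub>P i\<^esub> \<pi> i (h z') = \<zero>\<^bsub>P i\<^esub>"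
      using z'(4)[OF r] lin_zero[OF h(1) K.m K.m] lin_zero[OF pi K.m m] by simp
  qed
qed

section \<open>Localization at a prime ideal\<close>

lemma UN_const_eq2:
  assumes "(a, b) \<in> X" "(a', b') \<in> Y" "\<And>x s y t. (x, s) \<in> X \<Longrightarrow> (y, t) \<in> Y \<Longrightarrow> f x s y t = k"
  shows "(\<Union>(x, s)\<in>X. \<Union>(y, t)\<in>Y. f x s y t) = k"
proof (rule UN_const_eq[OF assms(1)])
  fix p assume "p \<in> X"
  then obtain x s where "p = (x, s)" "(x, s) \<in> X" by (cases p) auto
  moreover have "(\<Union>(y, t)\<in>Y. f x s y t) = k" if "(x, s) \<in> X" for x s
    by (rule UN_const_eq[OF assms(2)]) (use assms(3)[OF that] in auto)
  ultimately show "(case p of (x, s) \<Rightarrow> \<Union>(y, t)\<in>Y. f x s y t) = k" by simp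
qed

locale prime_loc =
  fixes R :: "('r, 'z) ring_scheme" and \<pp> :: "'r set"
  assumes cR: "cring R" and pR: "primeideal \<pp> R"
begin

sublocale R: cring R by (rule cR)
sublocale p: primeideal \<pp> R by (rule pR)

abbreviation S where "S \<equiv> carrier R - \<pp>"

lemma S_one: "\<one>\<^bsub>R\<^esub> \<in> S"
  using p.I_notcarr p.one_imp_carrier by auto

lemma S_mult: "s \<in> S \<Longrightarrow> t \<in> S \<Longrightarrow> s \<otimes>\<^bsub>R\<^esub> t \<in> S"
  using p.I_prime by auto

lemma S_pow: "s \<in> S \<Longrightarrow> s [^]\<^bsub>R\<^esub> (n::nat) \<in> S"
proof (induction n)
  case 0
  then show ?case using S_one by simp
next
  case (Suc n)
  then show ?case using S_mult[of "s [^]\<^bsub>R\<^esub> n" s] by simp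
qed

lemma frac_mem:
  "(y, t) \<in> loc_frac R A \<pp> x s \<longleftrightarrow> x \<in> carrier A \<and> y \<in> carrier A \<and> s \<in> S \<and> t \<in> S \<and>
     (\<exists>u\<in>S. u \<odot>\<^bsub>A\<^esub> (t \<odot>\<^bsub>A\<^esub> x) = u \<odot>\<^bsub>A\<^esub> (s \<odot>\<^bsub>A\<^esub> y))"
  by (auto simp: loc_frac_def loc_rel_def)

lemma frac_self: "x \<in> carrier A \<Longrightarrow> s \<in> S \<Longrightarrow> (x, s) \<in> loc_frac R A \<pp> x s"
  unfolding frac_mem using S_one by auto

text \<open>Transitivity of the relation between fractions; the denominator t of the middle fraction
  has to be part of the multiplier.\<close>

lemma loc_trans_aux:
  assumes A: "module R A" and c: "x \<in> carrier A" "y \<in> carrier A" "z \<in> carrier A" "s \<in> S" "t \<in> S" "q \<in> S" "u \<in> S" "v \<in> S"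
    and 1: "u \<odot>\<^bsub>A\<^esub> (t \<odot>\<^bsub>A\<^esub> x) = u \<odot>\<^bsub>A\<^esub> (s \<odot>\<^bsub>A\<^esub> y)" and 2: "v \<odot>\<^bsub>A\<^esub> (q \<odot>\<^bsub>A\<^esub> y) = v \<odot>\<^bsub>A\<^esub> (t \<odot>\<^bsub>A\<^esub> z)"
  shows "(u \<otimes>\<^bsub>R\<^esub> v \<otimes>\<^bsub>R\<^esub> t) \<odot>\<^bsub>A\<^esub> (q \<odot>\<^bsub>A\<^esub> x) = (u \<otimes>\<^bsub>R\<^esub> v \<otimes>\<^bsub>R\<^esub> t) \<odot>\<^bsub>A\<^esub> (s \<odot>\<^bsub>A\<^esub> z)"
proof -
  interpret A: module R A by fact
  have sc: "s \<in> carrier R" "t \<in> carrier R" "q \<in> carrier R" "u \<in> carrier R" "v \<in> carrier R" using c by auto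
  have "(u \<otimes>\<^bsub>R\<^esub> v \<otimes>\<^bsub>R\<^esub> t) \<odot>\<^bsub>A\<^esub> (q \<odot>\<^bsub>A\<^esub> x) = (v \<otimes>\<^bsub>R\<^esub> q) \<odot>\<^bsub>A\<^esub> (u \<odot>\<^bsub>A\<^esub> (t \<odot>\<^bsub>A\<^esub> x))"
    using sc c by (simp add: R.m_ac flip: A.smult_assoc1)
  also have "\<dots> = (u \<otimes>\<^bsub>R\<^esub> s) \<odot>\<^bsub>A\<^esub> (v \<odot>\<^bsub>A\<^esub> (q \<odot>\<^bsub>A\<^esub> y))"
    unfolding 1 using sc c by (simp add: R.m_ac flip: A.smult_assoc1)
  also have "\<dots> = (u \<otimes>\<^bsub>R\<^esub> v \<otimes>\<^bsub>R\<^esub> t) \<odot>\<^bsub>A\<^esub> (s \<odot>\<^bsub>A\<^esub> z)"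
    unfolding 2 using sc c by (simp add: R.m_ac flip: A.smult_assoc1)
  finally show ?thesis .
qed

lemma frac_eq:
  assumes A: "module R A" and c: "x \<in> carrier A" "y \<in> carrier A" "s \<in> S" "t \<in> S"
  shows "loc_frac R A \<pp> x s = loc_frac R A \<pp> y t \<longleftrightarrow> (\<exists>u\<in>S. u \<odot>\<^bsub>A\<^esub> (t \<odot>\<^bsub>A\<^esub> x) = u \<odot>\<^bsub>A\<^esub> (s \<odot>\<^bsub>A\<^esub> y))"
proof
  assume "loc_frac R A \<pp> x s = loc_frac R A \<pp> y t"
  then have "(y, t) \<in> loc_frac R A \<pp> x s" using frac_self[OF c(2,4)] by simp
  then show "\<exists>u\<in>S. u \<odot>\<^bsub>A\<^esub> (t \<odot>\<^bsub>A\<^esub> x) = u \<odot>\<^bsub>A\<^esub> (s \<odot>\<^bsub>A\<^esub> y)" unfolding frac_mem by simp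
next
  have sub: "loc_frac R A \<pp> x s \<subseteq> loc_frac R A \<pp> y t"
    if c: "x \<in> carrier A" "y \<in> carrier A" "s \<in> S" "t \<in> S" and u: "u \<in> S" and e: "u \<odot>\<^bsub>A\<^esub> (t \<odot>\<^bsub>A\<^esub> x) = u \<odot>\<^bsub>A\<^esub> (s \<odot>\<^bsub>A\<^esub> y)" for x y s t u
  proof
    fix w assume w: "w \<in> loc_frac R A \<pp> x s"
    obtain z q where zq: "w = (z, q)" by (cases w)
    from w obtain v where v: "z \<in> carrier A" "q \<in> S" "v \<in> S" "v \<odot>\<^bsub>A\<^esub> (q \<odot>\<^bsub>A\<^esub> x) = v \<odot>\<^bsub>A\<^esub> (s \<odot>\<^bsub>A\<^esub> z)"
      unfolding zq frac_mem by blast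
    have "(u \<otimes>\<^bsub>R\<^esub> v \<otimes>\<^bsub>R\<^esub> s) \<odot>\<^bsub>A\<^esub> (q \<odot>\<^bsub>A\<^esub> y) = (u \<otimes>\<^bsub>R\<^esub> v \<otimes>\<^bsub>R\<^esub> s) \<odot>\<^bsub>A\<^esub> (t \<odot>\<^bsub>A\<^esub> z)"
      by (rule loc_trans_aux[OF A c(2,1) v(1) c(4,3) v(2) u v(3) e[symmetric] v(4)])
    then show "w \<in> loc_frac R A \<pp> y t" unfolding zq frac_mem
      using c v S_mult[OF S_mult[OF u v(3)] c(3)] by blast
  qed
  assume "\<exists>u\<in>S. u \<odot>\<^bsub>A\<^esub> (t \<odot>\<^bsub>A\<^esub> x) = u \<odot>\<^bsub>A\<^esub> (s \<odot>\<^bsub>A\<^esub> y)"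
  then obtain u where u: "u \<in> S" "u \<odot>\<^bsub>A\<^esub> (t \<odot>\<^bsub>A\<^esub> x) = u \<odot>\<^bsub>A\<^esub> (s \<odot>\<^bsub>A\<^esub> y)" by blast
  show "loc_frac R A \<pp> x s = loc_frac R A \<pp> y t"
    using sub[OF c u] sub[OF c(2,1,4,3) u(1) u(2)[symmetric]] by (rule subset_antisym)
qed

lemma frac_rep:
  assumes A: "module R A" and c: "x \<in> carrier A" "s \<in> S" and m: "(y, t) \<in> loc_frac R A \<pp> x s"
  shows "y \<in> carrier A" "t \<in> S" "\<exists>u\<in>S. u \<odot>\<^bsub>A\<^esub> (t \<odot>\<^bsub>A\<^esub> x) = u \<odot>\<^bsub>A\<^esub> (s \<odot>\<^bsub>A\<^esub> y)"
  using m unfolding frac_mem by auto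

lemma frac_cancel:
  assumes A: "module R A" and c: "x \<in> carrier A" "s \<in> S" "t \<in> S"
  shows "loc_frac R A \<pp> (t \<odot>\<^bsub>A\<^esub> x) (t \<otimes>\<^bsub>R\<^esub> s) = loc_frac R A \<pp> x s"
proof -
  interpret A: module R A by fact
  have "s \<odot>\<^bsub>A\<^esub> (t \<odot>\<^bsub>A\<^esub> x) = (t \<otimes>\<^bsub>R\<^esub> s) \<odot>\<^bsub>A\<^esub> x" using c by (simp add: R.m_comm flip: A.smult_assoc1)
  then show ?thesis using frac_eq[OF A _ c(1) S_mult[OF c(3,2)] c(2), of "t \<odot>\<^bsub>A\<^esub> x"] c S_one by auto
qed

lemma loc_add:
  assumes A: "module R A" and c: "x \<in> carrier A" "y \<in> carrier A" "s \<in> S" "t \<in> S"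
  shows "loc_frac R A \<pp> x s \<oplus>\<^bsub>loc_module R \<pp> A\<^esub> loc_frac R A \<pp> y t
    = loc_frac R A \<pp> (t \<odot>\<^bsub>A\<^esub> x \<oplus>\<^bsub>A\<^esub> s \<odot>\<^bsub>A\<^esub> y) (s \<otimes>\<^bsub>R\<^esub> t)"
proof -
  interpret A: module R A by fact
  have "loc_frac R A \<pp> (t' \<odot>\<^bsub>A\<^esub> x' \<oplus>\<^bsub>A\<^esub> s' \<odot>\<^bsub>A\<^esub> y') (s' \<otimes>\<^bsub>R\<^esub> t') = loc_frac R A \<pp> (t \<odot>\<^bsub>A\<^esub> x \<oplus>\<^bsub>A\<^esub> s \<odot>\<^bsub>A\<^esub> y) (s \<otimes>\<^bsub>R\<^esub> t)"
    if m: "(x', s') \<in> loc_frac R A \<pp> x s" "(y', t') \<in> loc_frac R A \<pp> y t" for x' s' y' t'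
  proof -
    note a = frac_rep[OF A c(1,3) m(1)] and b = frac_rep[OF A c(2,4) m(2)]
    obtain u v where uv: "u \<in> S" "v \<in> S" "u \<odot>\<^bsub>A\<^esub> (s' \<odot>\<^bsub>A\<^esub> x) = u \<odot>\<^bsub>A\<^esub> (s \<odot>\<^bsub>A\<^esub> x')" "v \<odot>\<^bsub>A\<^esub> (t' \<odot>\<^bsub>A\<^esub> y) = v \<odot>\<^bsub>A\<^esub> (t \<odot>\<^bsub>A\<^esub> y')"
      using a(3) b(3) by blast
    have sc: "s \<in> carrier R" "t \<in> carrier R" "s' \<in> carrier R" "t' \<in> carrier R" "u \<in> carrier R" "v \<in> carrier R"
      using c a(2) b(2) uv by auto
    have ac: "x' \<in> carrier A" "y' \<in> carrier A" by fact+
    have "(u \<otimes>\<^bsub>R\<^esub> v) \<odot>\<^bsub>A\<^esub> ((s \<otimes>\<^bsub>R\<^esub> t) \<odot>\<^bsub>A\<^esub> (t' \<odot>\<^bsub>A\<^esub> x' \<oplus>\<^bsub>A\<^esub> s' \<odot>\<^bsub>A\<^esub> y'))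
      = (v \<otimes>\<^bsub>R\<^esub> t \<otimes>\<^bsub>R\<^esub> t') \<odot>\<^bsub>A\<^esub> (u \<odot>\<^bsub>A\<^esub> (s \<odot>\<^bsub>A\<^esub> x')) \<oplus>\<^bsub>A\<^esub> (u \<otimes>\<^bsub>R\<^esub> s \<otimes>\<^bsub>R\<^esub> s') \<odot>\<^bsub>A\<^esub> (v \<odot>\<^bsub>A\<^esub> (t \<odot>\<^bsub>A\<^esub> y'))"
      using sc ac by (simp add: A.smult_r_distr R.m_ac flip: A.smult_assoc1)
    also have "\<dots> = (u \<otimes>\<^bsub>R\<^esub> v) \<odot>\<^bsub>A\<^esub> ((s' \<otimes>\<^bsub>R\<^esub> t') \<odot>\<^bsub>A\<^esub> (t \<odot>\<^bsub>A\<^esub> x \<oplus>\<^bsub>A\<^esub> s \<odot>\<^bsub>A\<^esub> y))"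
      unfolding uv(3,4)[symmetric] using sc c(1,2) by (simp add: A.smult_r_distr R.m_ac flip: A.smult_assoc1)
    finally show ?thesis
      using frac_eq[OF A _ _ S_mult[OF a(2) b(2)] S_mult[OF c(3,4)], of "t' \<odot>\<^bsub>A\<^esub> x' \<oplus>\<^bsub>A\<^esub> s' \<odot>\<^bsub>A\<^esub> y'" "t \<odot>\<^bsub>A\<^esub> x \<oplus>\<^bsub>A\<^esub> s \<odot>\<^bsub>A\<^esub> y"]
        S_mult[OF uv(1,2)] sc ac c(1,2) by blast
  qed
  then have "(\<Union>(x, s)\<in>loc_frac R A \<pp> x s. \<Union>(y, t)\<in>loc_frac R A \<pp> y t. loc_frac R A \<pp> (t \<odot>\<^bsub>A\<^esub> x \<oplus>\<^bsub>A\<^esub> s \<odot>\<^bsub>A\<^esub> y) (s \<otimes>\<^bsub>R\<^esub> t))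
    = loc_frac R A \<pp> (t \<odot>\<^bsub>A\<^esub> x \<oplus>\<^bsub>A\<^esub> s \<odot>\<^bsub>A\<^esub> y) (s \<otimes>\<^bsub>R\<^esub> t)"
    by (rule UN_const_eq2[OF frac_self[OF c(1,3)] frac_self[OF c(2,4)]])
  then show ?thesis by (simp add: loc_module_def)
qed

lemma loc_smult:
  assumes A: "module R A" and c: "r \<in> carrier R" "x \<in> carrier A" "s \<in> S" "t \<in> S"
  shows "loc_frac R (reg_module R) \<pp> r s \<odot>\<^bsub>loc_module R \<pp> A\<^esub> loc_frac R A \<pp> x t = loc_frac R A \<pp> (r \<odot>\<^bsub>A\<^esub> x) (s \<otimes>\<^bsub>R\<^esub> t)"
proof -
  interpret A: module R A by fact
  have rc: "r \<in> carrier (reg_module R)" using c by simp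
  note Rm = reg_module[OF cR]
  have "loc_frac R A \<pp> (r' \<odot>\<^bsub>A\<^esub> x') (s' \<otimes>\<^bsub>R\<^esub> t') = loc_frac R A \<pp> (r \<odot>\<^bsub>A\<^esub> x) (s \<otimes>\<^bsub>R\<^esub> t)"
    if m: "(r', s') \<in> loc_frac R (reg_module R) \<pp> r s" "(x', t') \<in> loc_frac R A \<pp> x t" for x' s' r' t'
  proof -
    note a = frac_rep[OF Rm rc c(3) m(1)] and b = frac_rep[OF A c(2,4) m(2)]
    obtain u v where uv: "u \<in> S" "v \<in> S" "u \<otimes>\<^bsub>R\<^esub> (s' \<otimes>\<^bsub>R\<^esub> r) = u \<otimes>\<^bsub>R\<^esub> (s \<otimes>\<^bsub>R\<^esub> r')" "v \<odot>\<^bsub>A\<^esub> (t' \<odot>\<^bsub>A\<^esub> x) = v \<odot>\<^bsub>A\<^esub> (t \<odot>\<^bsub>A\<^esub> x')"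
      using a(3) b(3) by auto
    have sc: "s \<in> carrier R" "t \<in> carrier R" "s' \<in> carrier R" "t' \<in> carrier R" "u \<in> carrier R" "v \<in> carrier R" "r' \<in> carrier R"
      using c a(1,2) b(2) uv by auto
    have ac: "x' \<in> carrier A" by fact
    have "(u \<otimes>\<^bsub>R\<^esub> v) \<odot>\<^bsub>A\<^esub> ((s \<otimes>\<^bsub>R\<^esub> t) \<odot>\<^bsub>A\<^esub> (r' \<odot>\<^bsub>A\<^esub> x')) = (u \<otimes>\<^bsub>R\<^esub> (s \<otimes>\<^bsub>R\<^esub> r')) \<odot>\<^bsub>A\<^esub> (v \<odot>\<^bsub>A\<^esub> (t \<odot>\<^bsub>A\<^esub> x'))"
      using sc ac by (simp add: R.m_ac flip: A.smult_assoc1)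
    also have "\<dots> = (u \<otimes>\<^bsub>R\<^esub> v) \<odot>\<^bsub>A\<^esub> ((s' \<otimes>\<^bsub>R\<^esub> t') \<odot>\<^bsub>A\<^esub> (r \<odot>\<^bsub>A\<^esub> x))"
      unfolding uv(3,4)[symmetric] using sc c(1,2) by (simp add: R.m_ac flip: A.smult_assoc1)
    finally show ?thesis
      using frac_eq[OF A _ _ S_mult[OF a(2) b(2)] S_mult[OF c(3,4)], of "r' \<odot>\<^bsub>A\<^esub> x'" "r \<odot>\<^bsub>A\<^esub> x"]
        S_mult[OF uv(1,2)] sc ac c(1,2) by blast
  qed
  then have "(\<Union>(r, s)\<in>loc_frac R (reg_module R) \<pp> r s. \<Union>(x, t)\<in>loc_frac R A \<pp> x t. loc_frac R A \<pp> (r \<odot>\<^bsub>A\<^esub> x) (s \<otimes>\<^bsub>R\<^esub> t))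
    = loc_frac R A \<pp> (r \<odot>\<^bsub>A\<^esub> x) (s \<otimes>\<^bsub>R\<^esub> t)"
    by (rule UN_const_eq2[OF frac_self[OF rc c(3)] frac_self[OF c(2,4)]])
  then show ?thesis by (simp add: loc_module_def)
qed

lemma loc_carrierE:
  assumes "X \<in> carrier (loc_module R \<pp> A)"
  obtains x s where "x \<in> carrier A" "s \<in> S" "X = loc_frac R A \<pp> x s"
  using assms by (auto simp: loc_module_def)

lemma loc_carrierI: "x \<in> carrier A \<Longrightarrow> s \<in> S \<Longrightarrow> loc_frac R A \<pp> x s \<in> carrier (loc_module R \<pp> A)"
  by (auto simp: loc_module_def)

lemma loc_zero: "\<zero>\<^bsub>loc_module R \<pp> A\<^esub> = loc_frac R A \<pp> \<zero>\<^bsub>A\<^esub> \<one>\<^bsub>R\<^esub>"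
  by (simp add: loc_module_def)

lemma loc_zero_eq:
  assumes A: "module R A" and s: "s \<in> S"
  shows "loc_frac R A \<pp> \<zero>\<^bsub>A\<^esub> s = \<zero>\<^bsub>loc_module R \<pp> A\<^esub>"
proof -
  interpret A: module R A by fact
  show ?thesis unfolding loc_zero using frac_eq[OF A A.M.zero_closed A.M.zero_closed s S_one] s S_one by auto
qed

lemma loc_add_same:
  assumes A: "module R A" and c: "x \<in> carrier A" "y \<in> carrier A" "s \<in> S"
  shows "loc_frac R A \<pp> x s \<oplus>\<^bsub>loc_module R \<pp> A\<^esub> loc_frac R A \<pp> y s = loc_frac R A \<pp> (x \<oplus>\<^bsub>A\<^esub> y) s"
proof -
  interpret A: module R A by fact
  have "s \<odot>\<^bsub>A\<^esub> x \<oplus>\<^bsub>A\<^esub> s \<odot>\<^bsub>A\<^esub> y = s \<odot>\<^bsub>A\<^esub> (x \<oplus>\<^bsub>A\<^esub> y)" using c by (simp add: A.smult_r_distr)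
  then show ?thesis unfolding loc_add[OF A c(1,2,3,3)] using frac_cancel[OF A _ c(3,3), of "x \<oplus>\<^bsub>A\<^esub> y"] c by simp
qed

lemma loc_common2:
  assumes A: "module R A" and "X \<in> carrier (loc_module R \<pp> A)" "Y \<in> carrier (loc_module R \<pp> A)"
  obtains x y s where "x \<in> carrier A" "y \<in> carrier A" "s \<in> S" "X = loc_frac R A \<pp> x s" "Y = loc_frac R A \<pp> y s"
proof -
  interpret A: module R A by fact
  obtain x s where x: "x \<in> carrier A" "s \<in> S" "X = loc_frac R A \<pp> x s" using loc_carrierE[OF assms(2)] .
  obtain y t where y: "y \<in> carrier A" "t \<in> S" "Y = loc_frac R A \<pp> y t" using loc_carrierE[OF assms(3)] .
  have "X = loc_frac R A \<pp> (t \<odot>\<^bsub>A\<^esub> x) (t \<otimes>\<^bsub>R\<^esub> s)" "Y = loc_frac R A \<pp> (s \<odot>\<^bsub>A\<^esub> y) (t \<otimes>\<^bsub>R\<^esub> s)"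
    using frac_cancel[OF A x(1,2) y(2)] frac_cancel[OF A y(1,2) x(2)] x y R.m_comm[of s t] by auto
  moreover have "t \<otimes>\<^bsub>R\<^esub> s \<in> S" using S_mult x y by blast
  ultimately show thesis using that[of "t \<odot>\<^bsub>A\<^esub> x" "s \<odot>\<^bsub>A\<^esub> y" "t \<otimes>\<^bsub>R\<^esub> s"] x y by simp
qed

lemma loc_add_closed:
  assumes A: "module R A" and "X \<in> carrier (loc_module R \<pp> A)" "Y \<in> carrier (loc_module R \<pp> A)"
  shows "X \<oplus>\<^bsub>loc_module R \<pp> A\<^esub> Y \<in> carrier (loc_module R \<pp> A)"
proof -
  interpret A: module R A by fact
  obtain x y s where "x \<in> carrier A" "y \<in> carrier A" "s \<in> S" "X = loc_frac R A \<pp> x s" "Y = loc_frac R A \<pp> y s"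
    using loc_common2[OF assms] .
  then show ?thesis using loc_add_same[OF A] loc_carrierI[of "x \<oplus>\<^bsub>A\<^esub> y" A s] by simp
qed

lemma loc_abelian_group:
  assumes A: "module R A"
  shows "abelian_group (loc_module R \<pp> A)"
proof -
  interpret A: module R A by fact
  let ?L = "loc_module R \<pp> A"
  show ?thesis
  proof (rule abelian_groupI)
    show "\<zero>\<^bsub>?L\<^esub> \<in> carrier ?L" unfolding loc_zero by (rule loc_carrierI[OF A.M.zero_closed S_one])
    fix X assume X: "X \<in> carrier ?L"
    then obtain x s where x: "x \<in> carrier A" "s \<in> S" "X = loc_frac R A \<pp> x s" using loc_carrierE by blast
    show "\<zero>\<^bsub>?L\<^esub> \<oplus>\<^bsub>?L\<^esub> X = X"
      using loc_add_same[OF A A.M.zero_closed x(1,2)] x loc_zero_eq[OF A x(2)] by simp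
    show "\<exists>Y\<in>carrier ?L. Y \<oplus>\<^bsub>?L\<^esub> X = \<zero>\<^bsub>?L\<^esub>"
      using loc_add_same[OF A A.M.a_inv_closed[OF x(1)] x(1,2)] x loc_zero_eq[OF A x(2)] loc_carrierI[OF A.M.a_inv_closed[OF x(1)] x(2)]
      by (metis A.M.l_neg)
    fix Y assume Y: "Y \<in> carrier ?L"
    show "X \<oplus>\<^bsub>?L\<^esub> Y \<in> carrier ?L" by (rule loc_add_closed[OF A X Y])
    show "X \<oplus>\<^bsub>?L\<^esub> Y = Y \<oplus>\<^bsub>?L\<^esub> X"
    proof -
      obtain x y s where "x \<in> carrier A" "y \<in> carrier A" "s \<in> S" "X = loc_frac R A \<pp> x s" "Y = loc_frac R A \<pp> y s"
        using loc_common2[OF A X Y] .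
      then show ?thesis using loc_add_same[OF A] A.M.a_comm by simp
    qed
    fix Z assume Z: "Z \<in> carrier ?L"
    show "X \<oplus>\<^bsub>?L\<^esub> Y \<oplus>\<^bsub>?L\<^esub> Z = X \<oplus>\<^bsub>?L\<^esub> (Y \<oplus>\<^bsub>?L\<^esub> Z)"
    proof -
      obtain x y s where x: "x \<in> carrier A" "y \<in> carrier A" "s \<in> S" "X = loc_frac R A \<pp> x s" "Y = loc_frac R A \<pp> y s"
        using loc_common2[OF A X Y] .
      obtain z t where z: "z \<in> carrier A" "t \<in> S" "Z = loc_frac R A \<pp> z t" using loc_carrierE[OF Z] .
      let ?q = "t \<otimes>\<^bsub>R\<^esub> s"
      have q: "?q \<in> S" using S_mult x z by blast
      have e: "X = loc_frac R A \<pp> (t \<odot>\<^bsub>A\<^esub> x) ?q" "Y = loc_frac R A \<pp> (t \<odot>\<^bsub>A\<^esub> y) ?q" "Z = loc_frac R A \<pp> (s \<odot>\<^bsub>A\<^esub> z) ?q"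
        using frac_cancel[OF A x(1,3) z(2)] frac_cancel[OF A x(2,3) z(2)] frac_cancel[OF A z(1,2) x(3)] x z R.m_comm[of s t] by auto
      have c: "t \<odot>\<^bsub>A\<^esub> x \<in> carrier A" "t \<odot>\<^bsub>A\<^esub> y \<in> carrier A" "s \<odot>\<^bsub>A\<^esub> z \<in> carrier A" using x z by auto
      show ?thesis unfolding e using loc_add_same[OF A _ _ q] c by (simp add: A.M.a_assoc)
    qed
  qed
qed

lemma loc_smult_closed:
  assumes A: "module R A" and "Z \<in> carrier (loc_module R \<pp> (reg_module R))" "X \<in> carrier (loc_module R \<pp> A)"
  shows "Z \<odot>\<^bsub>loc_module R \<pp> A\<^esub> X \<in> carrier (loc_module R \<pp> A)"
proof -
  interpret A: module R A by fact
  obtain r s where r: "r \<in> carrier R" "s \<in> S" "Z = loc_frac R (reg_module R) \<pp> r s" using loc_carrierE[OF assms(2)] by auto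
  obtain x t where x: "x \<in> carrier A" "t \<in> S" "X = loc_frac R A \<pp> x t" using loc_carrierE[OF assms(3)] .
  show ?thesis using loc_smult[OF A r(1) x(1) r(2) x(2)] loc_carrierI[of "r \<odot>\<^bsub>A\<^esub> x" A "s \<otimes>\<^bsub>R\<^esub> t"] r x S_mult by auto
qed

lemma loc_smult_r_distr:
  assumes A: "module R A" and Z: "Z \<in> carrier (loc_module R \<pp> (reg_module R))" and X: "X \<in> carrier (loc_module R \<pp> A)" and Y: "Y \<in> carrier (loc_module R \<pp> A)"
  shows "Z \<odot>\<^bsub>loc_module R \<pp> A\<^esub> (X \<oplus>\<^bsub>loc_module R \<pp> A\<^esub> Y) = Z \<odot>\<^bsub>loc_module R \<pp> A\<^esub> X \<oplus>\<^bsub>loc_module R \<pp> A\<^esub> Z \<odot>\<^bsub>loc_module R \<pp> A\<^esub> Y"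
proof -
  interpret A: module R A by fact
  obtain r s where r: "r \<in> carrier R" "s \<in> S" "Z = loc_frac R (reg_module R) \<pp> r s" using loc_carrierE[OF Z] by auto
  obtain x y t where x: "x \<in> carrier A" "y \<in> carrier A" "t \<in> S" "X = loc_frac R A \<pp> x t" "Y = loc_frac R A \<pp> y t"
    using loc_common2[OF A X Y] .
  show ?thesis unfolding r x loc_add_same[OF A x(1,2,3)] loc_smult[OF A r(1) x(1) r(2) x(3)] loc_smult[OF A r(1) x(2) r(2) x(3)]
    using loc_smult[OF A r(1) _ r(2) x(3), of "x \<oplus>\<^bsub>A\<^esub> y"] loc_add_same[OF A _ _ S_mult[OF r(2) x(3)], of "r \<odot>\<^bsub>A\<^esub> x" "r \<odot>\<^bsub>A\<^esub> y"]
      r x by (simp add: A.smult_r_distr)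
qed

lemma loc_ring_simps [simp]:
  "carrier (loc_ring R \<pp>) = carrier (loc_module R \<pp> (reg_module R))"
  "x \<oplus>\<^bsub>loc_ring R \<pp>\<^esub> y = x \<oplus>\<^bsub>loc_module R \<pp> (reg_module R)\<^esub> y"
  "x \<otimes>\<^bsub>loc_ring R \<pp>\<^esub> y = x \<odot>\<^bsub>loc_module R \<pp> (reg_module R)\<^esub> y"
  "\<zero>\<^bsub>loc_ring R \<pp>\<^esub> = \<zero>\<^bsub>loc_module R \<pp> (reg_module R)\<^esub>"
  "\<one>\<^bsub>loc_ring R \<pp>\<^esub> = loc_frac R (reg_module R) \<pp> \<one>\<^bsub>R\<^esub> \<one>\<^bsub>R\<^esub>"
  by (simp_all add: loc_ring_def)

lemma loc_ring_mult:
  assumes "r \<in> carrier R" "x \<in> carrier R" "s \<in> S" "t \<in> S"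
  shows "loc_frac R (reg_module R) \<pp> r s \<odot>\<^bsub>loc_module R \<pp> (reg_module R)\<^esub> loc_frac R (reg_module R) \<pp> x t
    = loc_frac R (reg_module R) \<pp> (r \<otimes>\<^bsub>R\<^esub> x) (s \<otimes>\<^bsub>R\<^esub> t)"
  using loc_smult[OF reg_module[OF cR], of r x s t] assms by simp

lemma loc_ring_ring: "ring (loc_ring R \<pp>)"
proof -
  note Rm = reg_module[OF cR]
  let ?L = "loc_module R \<pp> (reg_module R)"
  interpret L: abelian_group ?L by (rule loc_abelian_group[OF Rm])
  have ag: "abelian_group (loc_ring R \<pp>)"
    by (rule abelian_groupI) (use L.l_neg L.a_inv_closed in \<open>auto simp: L.a_ac\<close>)
  have comm: "X \<odot>\<^bsub>?L\<^esub> Y = Y \<odot>\<^bsub>?L\<^esub> X" if XY: "X \<in> carrier ?L" "Y \<in> carrier ?L" for X Y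
  proof -
    obtain r s where r: "r \<in> carrier R" "s \<in> S" "X = loc_frac R (reg_module R) \<pp> r s" using loc_carrierE[OF XY(1)] by auto
    obtain x t where x: "x \<in> carrier R" "t \<in> S" "Y = loc_frac R (reg_module R) \<pp> x t" using loc_carrierE[OF XY(2)] by auto
    show ?thesis unfolding r x using loc_ring_mult r x R.m_comm[of r x] R.m_comm[of s t] by auto
  qed
  have mon: "monoid (loc_ring R \<pp>)"
  proof (rule monoidI)
    have "\<one>\<^bsub>loc_ring R \<pp>\<^esub> \<in> carrier ?L" using loc_carrierI[of "\<one>\<^bsub>R\<^esub>" "reg_module R" "\<one>\<^bsub>R\<^esub>"] S_one by simp
    then show "\<one>\<^bsub>loc_ring R \<pp>\<^esub> \<in> carrier (loc_ring R \<pp>)" by simp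
    fix X Y Z assume X: "X \<in> carrier (loc_ring R \<pp>)"
    then obtain r s where r: "r \<in> carrier R" "s \<in> S" "X = loc_frac R (reg_module R) \<pp> r s" using loc_carrierE[of X "reg_module R"] by auto
    show 1: "\<one>\<^bsub>loc_ring R \<pp>\<^esub> \<otimes>\<^bsub>loc_ring R \<pp>\<^esub> X = X" using loc_ring_mult[OF R.one_closed r(1) S_one r(2)] r by simp
    show "X \<otimes>\<^bsub>loc_ring R \<pp>\<^esub> \<one>\<^bsub>loc_ring R \<pp>\<^esub> = X" using 1 comm[of X "\<one>\<^bsub>loc_ring R \<pp>\<^esub>"] X \<open>\<one>\<^bsub>loc_ring R \<pp>\<^esub> \<in> carrier ?L\<close> by simp
    assume Y: "Y \<in> carrier (loc_ring R \<pp>)"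
    then obtain x t where x: "x \<in> carrier R" "t \<in> S" "Y = loc_frac R (reg_module R) \<pp> x t" using loc_carrierE[of Y "reg_module R"] by auto
    show "X \<otimes>\<^bsub>loc_ring R \<pp>\<^esub> Y \<in> carrier (loc_ring R \<pp>)" using loc_smult_closed[OF Rm, of X Y] X Y by simp
    assume "Z \<in> carrier (loc_ring R \<pp>)"
    then obtain y q where y: "y \<in> carrier R" "q \<in> S" "Z = loc_frac R (reg_module R) \<pp> y q" using loc_carrierE[of Z "reg_module R"] by auto
    show "X \<otimes>\<^bsub>loc_ring R \<pp>\<^esub> Y \<otimes>\<^bsub>loc_ring R \<pp>\<^esub> Z = X \<otimes>\<^bsub>loc_ring R \<pp>\<^esub> (Y \<otimes>\<^bsub>loc_ring R \<pp>\<^esub> Z)"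
      unfolding r x y loc_ring_simps
      using loc_ring_mult[OF r(1) x(1) r(2) x(2)] loc_ring_mult[OF x(1) y(1) x(2) y(2)]
        loc_ring_mult[OF r(1) _ r(2) S_mult[OF x(2) y(2)], of "x \<otimes>\<^bsub>R\<^esub> y"] loc_ring_mult[OF _ y(1) S_mult[OF r(2) x(2)] y(2), of "r \<otimes>\<^bsub>R\<^esub> x"]
        r x y by (simp add: R.m_assoc)
  qed
  show ?thesis
  proof (rule ringI[OF ag mon])
    fix X Y Z assume c: "X \<in> carrier (loc_ring R \<pp>)" "Y \<in> carrier (loc_ring R \<pp>)" "Z \<in> carrier (loc_ring R \<pp>)"
    then have c': "X \<in> carrier ?L" "Y \<in> carrier ?L" "Z \<in> carrier ?L" by simp_all
    show "Z \<otimes>\<^bsub>loc_ring R \<pp>\<^esub> (X \<oplus>\<^bsub>loc_ring R \<pp>\<^esub> Y) = Z \<otimes>\<^bsub>loc_ring R \<pp>\<^esub> X \<oplus>\<^bsub>loc_ring R \<pp>\<^esub> Z \<otimes>\<^bsub>loc_ring R \<pp>\<^esub> Y"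
      using loc_smult_r_distr[OF Rm c'(3,1,2)] by simp
    then show "(X \<oplus>\<^bsub>loc_ring R \<pp>\<^esub> Y) \<otimes>\<^bsub>loc_ring R \<pp>\<^esub> Z = X \<otimes>\<^bsub>loc_ring R \<pp>\<^esub> Z \<oplus>\<^bsub>loc_ring R \<pp>\<^esub> Y \<otimes>\<^bsub>loc_ring R \<pp>\<^esub> Z"
      using comm[OF c'(3)] c' L.a_closed[OF c'(1,2)] by simp
  qed
qed

end

context prime_loc
begin

text \<open>The fractions with numerator in \<aa> already form an ideal, and this ideal contains the
  generators of the extension.\<close>

lemma loc_ideal_mem:
  assumes a: "ideal \<aa> R" and X: "X \<in> loc_ideal R \<pp> \<aa>"
  shows "\<exists>r\<in>\<aa>. \<exists>s\<in>S. X = loc_frac R (reg_module R) \<pp> r s"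
proof -
  let ?L = "loc_module R \<pp> (reg_module R)"
  note Rm = reg_module[OF cR]
  interpret L: ring "loc_ring R \<pp>" by (rule loc_ring_ring)
  interpret a: ideal \<aa> R by (rule a)
  let ?I = "{loc_frac R (reg_module R) \<pp> r s |r s. r \<in> \<aa> \<and> s \<in> S}"
  have ac: "r \<in> carrier R" if "r \<in> \<aa>" for r using that by (rule a.a_Hcarr)
  have sub: "?I \<subseteq> carrier ?L" using ac loc_carrierI[of _ "reg_module R"] by auto
  have mult: "Y \<otimes>\<^bsub>loc_ring R \<pp>\<^esub> X \<in> ?I \<and> X \<otimes>\<^bsub>loc_ring R \<pp>\<^esub> Y \<in> ?I" if XI: "X \<in> ?I" and Y: "Y \<in> carrier ?L" for X Y
  proof -
    obtain r s where r: "r \<in> \<aa>" "s \<in> S" "X = loc_frac R (reg_module R) \<pp> r s" using XI by blast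
    obtain x t where x: "x \<in> carrier R" "t \<in> S" "Y = loc_frac R (reg_module R) \<pp> x t" using loc_carrierE[OF Y] by auto
    have "Y \<otimes>\<^bsub>loc_ring R \<pp>\<^esub> X = loc_frac R (reg_module R) \<pp> (x \<otimes>\<^bsub>R\<^esub> r) (t \<otimes>\<^bsub>R\<^esub> s)"
      "X \<otimes>\<^bsub>loc_ring R \<pp>\<^esub> Y = loc_frac R (reg_module R) \<pp> (r \<otimes>\<^bsub>R\<^esub> x) (s \<otimes>\<^bsub>R\<^esub> t)"
      unfolding r x loc_ring_simps using loc_ring_mult ac[OF r(1)] r x by auto
    then show ?thesis using a.I_l_closed[OF r(1) x(1)] a.I_r_closed[OF r(1) x(1)] S_mult r x by blast
  qed
  have "ideal ?I (loc_ring R \<pp>)"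
  proof (rule idealI[OF loc_ring_ring])
    show "subgroup ?I (add_monoid (loc_ring R \<pp>))"
    proof (rule L.add.subgroupI)
      show "?I \<subseteq> carrier (loc_ring R \<pp>)" using sub by simp
      show "?I \<noteq> {}" using a.zero_closed S_one by blast
      fix X assume X: "X \<in> ?I"
      show "\<ominus>\<^bsub>loc_ring R \<pp>\<^esub> X \<in> ?I"
      proof -
        have Xc: "X \<in> carrier (loc_ring R \<pp>)" using X sub by auto
        have "\<ominus>\<^bsub>loc_ring R \<pp>\<^esub> X = (\<ominus>\<^bsub>loc_ring R \<pp>\<^esub> \<one>\<^bsub>loc_ring R \<pp>\<^esub>) \<otimes>\<^bsub>loc_ring R \<pp>\<^esub> X"
          using L.l_minus[OF L.one_closed Xc] Xc by (metis L.l_one)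
        moreover have "\<ominus>\<^bsub>loc_ring R \<pp>\<^esub> \<one>\<^bsub>loc_ring R \<pp>\<^esub> \<in> carrier ?L" using L.a_inv_closed[OF L.one_closed] unfolding loc_ring_simps(1) .
        ultimately show ?thesis using mult[OF X, of "\<ominus>\<^bsub>loc_ring R \<pp>\<^esub> \<one>\<^bsub>loc_ring R \<pp>\<^esub>"] by (simp only:)
      qed
      fix Y assume Y: "Y \<in> ?I"
      show "X \<oplus>\<^bsub>loc_ring R \<pp>\<^esub> Y \<in> ?I"
      proof -
        obtain r s where r: "r \<in> \<aa>" "s \<in> S" "X = loc_frac R (reg_module R) \<pp> r s" using X by blast
        obtain x t where x: "x \<in> \<aa>" "t \<in> S" "Y = loc_frac R (reg_module R) \<pp> x t" using Y by blast
        have "X \<oplus>\<^bsub>loc_ring R \<pp>\<^esub> Y = loc_frac R (reg_module R) \<pp> (t \<otimes>\<^bsub>R\<^esub> r \<oplus>\<^bsub>R\<^esub> s \<otimes>\<^bsub>R\<^esub> x) (s \<otimes>\<^bsub>R\<^esub> t)"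
          unfolding r x loc_ring_simps using loc_add[OF Rm, of r x s t] ac r x by simp
        moreover have "t \<otimes>\<^bsub>R\<^esub> r \<oplus>\<^bsub>R\<^esub> s \<otimes>\<^bsub>R\<^esub> x \<in> \<aa>" using a.a_closed a.I_l_closed r x by blast
        ultimately show ?thesis using S_mult r x by blast
      qed
    qed
    fix X Y assume "X \<in> ?I" "Y \<in> carrier (loc_ring R \<pp>)"
    then have "Y \<otimes>\<^bsub>loc_ring R \<pp>\<^esub> X \<in> ?I \<and> X \<otimes>\<^bsub>loc_ring R \<pp>\<^esub> Y \<in> ?I" using mult[of X Y] unfolding loc_ring_simps(1) by blast
    then show "Y \<otimes>\<^bsub>loc_ring R \<pp>\<^esub> X \<in> ?I" "X \<otimes>\<^bsub>loc_ring R \<pp>\<^esub> Y \<in> ?I" by blast+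
  qed
  moreover have "(\<lambda>r. loc_frac R (reg_module R) \<pp> r \<one>\<^bsub>R\<^esub>) ` \<aa> \<subseteq> ?I" using S_one by blast
  ultimately have "loc_ideal R \<pp> \<aa> \<subseteq> ?I" unfolding loc_ideal_def by (rule L.genideal_minimal)
  then show ?thesis using X by blast
qed

lemma frac_one_pow:
  assumes "a \<in> carrier R"
  shows "loc_frac R (reg_module R) \<pp> a \<one>\<^bsub>R\<^esub> [^]\<^bsub>loc_ring R \<pp>\<^esub> (k::nat) = loc_frac R (reg_module R) \<pp> (a [^]\<^bsub>R\<^esub> k) \<one>\<^bsub>R\<^esub>"
proof (induction k)
  case 0
  interpret L: ring "loc_ring R \<pp>" by (rule loc_ring_ring)
  show ?case by simp
next
  case (Suc k)
  interpret L: ring "loc_ring R \<pp>" by (rule loc_ring_ring)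
  show ?case using Suc loc_ring_mult[of "a [^]\<^bsub>R\<^esub> k" a "\<one>\<^bsub>R\<^esub>" "\<one>\<^bsub>R\<^esub>"] assms S_one by simp
qed

text \<open>For a in I some power of a/1 lies in the extension of J. Clearing denominators gives u s
  a^k in \<pp> with u and s outside \<pp>, so a lies in \<pp>. Equality of the radicals thus
  excludes a prime that contains J but not I.\<close>

lemma Rad_loc_le:
  assumes I: "ideal I R" and J: "ideal J R" and Jp: "J \<subseteq> \<pp>"
    and rad: "Rad (loc_ring R \<pp>) (loc_ideal R \<pp> I) = Rad (loc_ring R \<pp>) (loc_ideal R \<pp> J)"
  shows "I \<subseteq> \<pp>"
proof
  fix a assume a: "a \<in> I"
  interpret L: ring "loc_ring R \<pp>" by (rule loc_ring_ring)
  have ac: "a \<in> carrier R" by (rule ideal.Icarr[OF I a])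
  let ?f = "\<lambda>r. loc_frac R (reg_module R) \<pp> r \<one>\<^bsub>R\<^esub>"
  have "?f ` I \<subseteq> carrier (loc_ring R \<pp>)" using loc_carrierI[of _ "reg_module R" "\<one>\<^bsub>R\<^esub>"] S_one ideal.Icarr[OF I] by auto
  then have "?f a \<in> loc_ideal R \<pp> I" "?f a \<in> carrier (loc_ring R \<pp>)" unfolding loc_ideal_def using L.genideal_self[of "?f ` I"] a by auto
  moreover have "?f a [^]\<^bsub>loc_ring R \<pp>\<^esub> (1::nat) = ?f a" using frac_one_pow[OF ac, of 1] ac by simp
  ultimately have "\<exists>k::nat. ?f a [^]\<^bsub>loc_ring R \<pp>\<^esub> k \<in> loc_ideal R \<pp> I" by metis
  then have "?f a \<in> Rad (loc_ring R \<pp>) (loc_ideal R \<pp> I)" unfolding Rad_def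
    using \<open>?f a \<in> carrier (loc_ring R \<pp>)\<close> by blast
  then obtain k :: nat where "?f a [^]\<^bsub>loc_ring R \<pp>\<^esub> k \<in> loc_ideal R \<pp> J" unfolding rad unfolding Rad_def by blast
  then obtain r s where r: "r \<in> J" "s \<in> S" "?f (a [^]\<^bsub>R\<^esub> k) = loc_frac R (reg_module R) \<pp> r s"
    using loc_ideal_mem[OF J] unfolding frac_one_pow[OF ac] by blast
  have rc: "r \<in> carrier R" by (rule ideal.Icarr[OF J r(1)])
  obtain u where u: "u \<in> S" "u \<otimes>\<^bsub>R\<^esub> (s \<otimes>\<^bsub>R\<^esub> a [^]\<^bsub>R\<^esub> k) = u \<otimes>\<^bsub>R\<^esub> r"
    using r(3) frac_eq[OF reg_module[OF cR], of "a [^]\<^bsub>R\<^esub> k" r "\<one>\<^bsub>R\<^esub>" s] ac rc r(2) S_one by auto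
  have "u \<otimes>\<^bsub>R\<^esub> r \<in> \<pp>" using p.I_l_closed[of r u] r(1) Jp u(1) by blast
  then have "(u \<otimes>\<^bsub>R\<^esub> s) \<otimes>\<^bsub>R\<^esub> a [^]\<^bsub>R\<^esub> k \<in> \<pp>" using u r(2) ac by (simp add: R.m_assoc)
  then have "a [^]\<^bsub>R\<^esub> k \<in> \<pp>" using p.I_prime[of "u \<otimes>\<^bsub>R\<^esub> s" "a [^]\<^bsub>R\<^esub> k"] S_mult[OF u(1) r(2)] ac by auto
  then show "a \<in> \<pp>"
    using S_pow[of a k] ac by blast
qed

lemma common_denominator:
  assumes "module R A" "submodule N R A" "finite F" "\<And>x. x \<in> F \<Longrightarrow> x \<in> carrier A \<and> (\<exists>u\<in>S. u \<odot>\<^bsub>A\<^esub> x \<in> N)"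
  shows "\<exists>u\<in>S. \<forall>x\<in>F. u \<odot>\<^bsub>A\<^esub> x \<in> N"
  using assms(3,4)
proof induction
  case empty
  then show ?case using S_one by blast
next
  case (insert x F)
  interpret A: module R A by fact
  obtain u where u: "u \<in> S" "\<forall>x\<in>F. u \<odot>\<^bsub>A\<^esub> x \<in> N" using insert by blast
  obtain v where v: "v \<in> S" "v \<odot>\<^bsub>A\<^esub> x \<in> N" using insert by blast
  have "(u \<otimes>\<^bsub>R\<^esub> v) \<odot>\<^bsub>A\<^esub> y \<in> N" if y: "y \<in> insert x F" for y
  proof (cases "y = x")
    case True
    have "u \<odot>\<^bsub>A\<^esub> (v \<odot>\<^bsub>A\<^esub> x) \<in> N" using submodD(4)[OF assms(2) _ v(2)] u by blast
    then show ?thesis using True u v insert.prems by (simp add: A.smult_assoc1)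
  next
    case False
    then have "y \<in> F" using y by simp
    then have "v \<odot>\<^bsub>A\<^esub> (u \<odot>\<^bsub>A\<^esub> y) \<in> N" using submodD(4)[OF assms(2)] u v by blast
    then show ?thesis using smult_commute[OF assms(1), of v u y] u v insert.prems y by (simp add: A.smult_assoc1)
  qed
  then show ?case using S_mult[OF u(1) v(1)] by blast
qed

text \<open>A finite set generates U, and a common denominator of the generators serves all of U,
  since the elements that it carries into N form a submodule.\<close>

lemma uniform_denominator:
  assumes A: "module R A" and noeth: "noeth_pair R A {\<zero>\<^bsub>A\<^esub>} (carrier A)"
    and N: "submodule N R A" and U: "submodule U R A" and loc: "\<And>x. x \<in> U \<Longrightarrow> \<exists>u\<in>S. u \<odot>\<^bsub>A\<^esub> x \<in> N"
  shows "\<exists>u\<in>S. \<forall>x\<in>U. u \<odot>\<^bsub>A\<^esub> x \<in> N"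
proof -
  have "{\<zero>\<^bsub>A\<^esub>} \<subseteq> U" using submodD(2)[OF U] by simp
  from noeth_pairD[OF noeth U this submodD(1)[OF U]] obtain F where F: "finite F" "F \<subseteq> U"
    "\<And>V. submodule V R A \<Longrightarrow> {\<zero>\<^bsub>A\<^esub>} \<subseteq> V \<Longrightarrow> F \<subseteq> V \<Longrightarrow> U \<subseteq> V" by metis
  obtain u where u: "u \<in> S" "\<forall>x\<in>F. u \<odot>\<^bsub>A\<^esub> x \<in> N"
    using common_denominator[OF A N F(1)] F(2) loc submodD(1)[OF U] by blast
  have "submodule {x \<in> carrier A. u \<odot>\<^bsub>A\<^esub> x \<in> N} R A"
    by (rule submod_vimage[OF lin_mult[OF A] A A N]) (use u in blast)
  from F(3)[OF this] have "U \<subseteq> {x \<in> carrier A. u \<odot>\<^bsub>A\<^esub> x \<in> N}"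
    using u(2) F(2) submodD(1)[OF U] submodD(2)[OF \<open>submodule {x \<in> carrier A. u \<odot>\<^bsub>A\<^esub> x \<in> N} R A\<close>] by blast
  then show ?thesis using u by blast
qed

lemma not_Supp_uniform:
  assumes A: "module R A" and noeth: "noeth_pair R A {\<zero>\<^bsub>A\<^esub>} (carrier A)" and ns: "\<pp> \<notin> Supp R A"
  shows "\<exists>u\<in>S. \<forall>x\<in>carrier A. u \<odot>\<^bsub>A\<^esub> x = \<zero>\<^bsub>A\<^esub>"
proof -
  interpret A: module R A by fact
  have e: "carrier (loc_module R \<pp> A) = {\<zero>\<^bsub>loc_module R \<pp> A\<^esub>}" using ns pR unfolding Supp_def by blast
  have "\<exists>u\<in>S. u \<odot>\<^bsub>A\<^esub> x \<in> {\<zero>\<^bsub>A\<^esub>}" if x: "x \<in> carrier A" for x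
  proof -
    have "loc_frac R A \<pp> x \<one>\<^bsub>R\<^esub> = loc_frac R A \<pp> \<zero>\<^bsub>A\<^esub> \<one>\<^bsub>R\<^esub>"
      using loc_carrierI[OF x S_one] e unfolding loc_zero by blast
    then show ?thesis using frac_eq[OF A x A.M.zero_closed S_one S_one] x by auto
  qed
  from uniform_denominator[OF A noeth submod_zero[OF A] submod_carrier[OF A] this] show ?thesis by blast
qed

lemma frac_one_smult:
  assumes A: "module R A" and "x \<in> carrier A" "r \<in> carrier R" "s \<in> S"
  shows "loc_frac R A \<pp> (r \<odot>\<^bsub>A\<^esub> x) \<one>\<^bsub>R\<^esub>
    = loc_frac R (reg_module R) \<pp> s \<one>\<^bsub>R\<^esub> \<odot>\<^bsub>loc_module R \<pp> A\<^esub> (loc_frac R (reg_module R) \<pp> r s \<odot>\<^bsub>loc_module R \<pp> A\<^esub> loc_frac R A \<pp> x \<one>\<^bsub>R\<^esub>)"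
proof -
  interpret A: module R A by fact
  have sc: "s \<in> carrier R" using assms by blast
  have "loc_frac R (reg_module R) \<pp> s \<one>\<^bsub>R\<^esub> \<odot>\<^bsub>loc_module R \<pp> A\<^esub> (loc_frac R (reg_module R) \<pp> r s \<odot>\<^bsub>loc_module R \<pp> A\<^esub> loc_frac R A \<pp> x \<one>\<^bsub>R\<^esub>)
    = loc_frac R A \<pp> (s \<odot>\<^bsub>A\<^esub> (r \<odot>\<^bsub>A\<^esub> x)) (s \<otimes>\<^bsub>R\<^esub> \<one>\<^bsub>R\<^esub>)"
    using loc_smult[OF A assms(3,2,4) S_one] loc_smult[OF A sc _ S_one assms(4), of "r \<odot>\<^bsub>A\<^esub> x"] assms sc by simp
  also have "\<dots> = loc_frac R A \<pp> (r \<odot>\<^bsub>A\<^esub> x) \<one>\<^bsub>R\<^esub>" using frac_cancel[OF A _ S_one assms(4), of "r \<odot>\<^bsub>A\<^esub> x"] assms by simp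
  finally show ?thesis ..
qed

text \<open>This set is the localization of N inside that of A. The numerator is only asked to enter
  N after multiplication by an element outside \<pp>, which makes the condition independent of the
  chosen fraction.\<close>

lemma loc_submod_frac:
  assumes A: "module R A" and N: "submodule N R A"
  shows "submodule {loc_frac R A \<pp> x s |x s. x \<in> carrier A \<and> s \<in> S \<and> (\<exists>u\<in>S. u \<odot>\<^bsub>A\<^esub> x \<in> N)} (loc_ring R \<pp>) (loc_module R \<pp> A)"
    (is "submodule ?T _ ?L")
proof -
  interpret A: module R A by fact
  interpret L: abelian_group ?L by (rule loc_abelian_group[OF A])
  have sub: "?T \<subseteq> carrier ?L"
  proof
    fix X assume "X \<in> ?T"
    then obtain x s where "x \<in> carrier A" "s \<in> S" "X = loc_frac R A \<pp> x s" by blast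
    then show "X \<in> carrier ?L" using loc_carrierI by simp
  qed
  show ?thesis
  proof (intro submodule.intro submodule_axioms.intro)
    show "subgroup ?T (add_monoid ?L)"
    proof (rule L.add.subgroupI)
      show "?T \<subseteq> carrier ?L" by (rule sub)
      have "\<one>\<^bsub>R\<^esub> \<odot>\<^bsub>A\<^esub> \<zero>\<^bsub>A\<^esub> \<in> N" using submodD(2)[OF N] by simp
      then show "?T \<noteq> {}" using S_one A.M.zero_closed by blast
      fix X assume X: "X \<in> ?T"
      then obtain x s u where x: "x \<in> carrier A" "s \<in> S" "X = loc_frac R A \<pp> x s" "u \<in> S" "u \<odot>\<^bsub>A\<^esub> x \<in> N" by blast
      have xc: "\<ominus>\<^bsub>A\<^esub> x \<in> carrier A" using x by simp
      have "loc_frac R A \<pp> (\<ominus>\<^bsub>A\<^esub> x) s \<oplus>\<^bsub>?L\<^esub> X = \<zero>\<^bsub>?L\<^esub>"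
        unfolding x(3) loc_add_same[OF A xc x(1,2)] using loc_zero_eq[OF A x(2)] x(1) by (simp add: A.M.l_neg)
      then have "\<ominus>\<^bsub>?L\<^esub> X = loc_frac R A \<pp> (\<ominus>\<^bsub>A\<^esub> x) s" using L.minus_equality X sub loc_carrierI[OF xc x(2)] by blast
      moreover have "u \<odot>\<^bsub>A\<^esub> (\<ominus>\<^bsub>A\<^esub> x) \<in> N" using submodD(5)[OF N x(5)] x by (simp add: A.smult_r_minus)
      ultimately show "\<ominus>\<^bsub>?L\<^esub> X \<in> ?T" using x xc by blast
      fix Y assume "Y \<in> ?T"
      then obtain y t v where y: "y \<in> carrier A" "t \<in> S" "Y = loc_frac R A \<pp> y t" "v \<in> S" "v \<odot>\<^bsub>A\<^esub> y \<in> N" by blast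
      have c: "s \<in> carrier R" "t \<in> carrier R" "u \<in> carrier R" "v \<in> carrier R" using x y by auto
      have "(u \<otimes>\<^bsub>R\<^esub> v) \<odot>\<^bsub>A\<^esub> (t \<odot>\<^bsub>A\<^esub> x \<oplus>\<^bsub>A\<^esub> s \<odot>\<^bsub>A\<^esub> y) = (v \<otimes>\<^bsub>R\<^esub> t) \<odot>\<^bsub>A\<^esub> (u \<odot>\<^bsub>A\<^esub> x) \<oplus>\<^bsub>A\<^esub> (u \<otimes>\<^bsub>R\<^esub> s) \<odot>\<^bsub>A\<^esub> (v \<odot>\<^bsub>A\<^esub> y)"
        using c x(1) y(1) by (simp add: A.smult_r_distr R.m_ac flip: A.smult_assoc1)
      also have "\<dots> \<in> N" using submodD(3,4)[OF N] x(5) y(5) c by simp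
      finally show "X \<oplus>\<^bsub>?L\<^esub> Y \<in> ?T"
        unfolding x(3) y(3) loc_add[OF A x(1) y(1) x(2) y(2)]
        using S_mult[OF x(4) y(4)] S_mult[OF x(2) y(2)] c x(1) y(1) by (intro CollectI exI conjI[OF refl]) auto
    qed
    fix Z X assume Z: "Z \<in> carrier (loc_ring R \<pp>)" and "X \<in> ?T"
    then obtain x t u where x: "x \<in> carrier A" "t \<in> S" "X = loc_frac R A \<pp> x t" "u \<in> S" "u \<odot>\<^bsub>A\<^esub> x \<in> N" by blast
    obtain r s where r: "r \<in> carrier R" "s \<in> S" "Z = loc_frac R (reg_module R) \<pp> r s" using loc_carrierE[of Z "reg_module R"] Z by auto
    have "u \<odot>\<^bsub>A\<^esub> (r \<odot>\<^bsub>A\<^esub> x) \<in> N" using submodD(4)[OF N r(1) x(5)] smult_commute[OF A, of u r x] x r by simp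
    then show "Z \<odot>\<^bsub>?L\<^esub> X \<in> ?T" unfolding r(3) x(3) loc_smult[OF A r(1) x(1) r(2) x(2)]
      using S_mult[OF r(2) x(2)] x r by (intro CollectI exI conjI[OF refl]) auto
  qed
qed

lemma seqsub_least:
  assumes A: "module R A" and V: "submodule V R A" and g: "\<And>r y. r \<in> set xs \<Longrightarrow> y \<in> carrier A \<Longrightarrow> r \<odot>\<^bsub>A\<^esub> y \<in> V"
  shows "seqsub A xs \<subseteq> V"
  using g
proof (induction xs)
  case Nil
  then show ?case using submodD(2)[OF V] by simp
next
  case (Cons x xs)
  then show ?case using submod_sum_le[OF V, of "seqsub A xs" "(\<lambda>m. x \<odot>\<^bsub>A\<^esub> m) ` carrier A"] by auto
qed

lemma seqsub_gen:
  assumes A: "module R A" and "set xs \<subseteq> carrier R" "r \<in> set xs" "y \<in> carrier A"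
  shows "r \<odot>\<^bsub>A\<^esub> y \<in> seqsub A xs"
  using assms(2,3)
proof (induction xs)
  case (Cons x xs)
  have x: "x \<in> carrier R" and xs: "set xs \<subseteq> carrier R" using Cons by auto
  note s = submod_sum(2,3)[OF A seqsub_submod[OF A xs] submod_image[OF lin_mult[OF A x] A A submod_carrier[OF A]]]
  show ?case
  proof (cases "r = x")
    case True
    then show ?thesis using s(2) assms(4) by auto
  next
    case False
    then show ?thesis using s(1) Cons xs by auto
  qed
qed simp

lemma almost_regular_mono:
  assumes A: "module R A" and xs: "set xs \<subseteq> carrier R" and u: "u \<in> carrier R" "v \<in> carrier R" and r: "almost_regular A u xs"
  shows "almost_regular A (v \<otimes>\<^bsub>R\<^esub> u) xs"
  using xs r
proof (induction xs)
  case (Cons x xs)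
  interpret A: module R A by fact
  have "(v \<otimes>\<^bsub>R\<^esub> u) \<odot>\<^bsub>A\<^esub> m \<in> seqsub A xs" if "m \<in> carrier A" "x \<odot>\<^bsub>A\<^esub> m \<in> seqsub A xs" for m
    using that Cons.prems submodD(4)[OF seqsub_submod[OF A, of xs] u(2), of "u \<odot>\<^bsub>A\<^esub> m"] u by (simp add: A.smult_assoc1)
  then show ?case using Cons by simp
qed simp

lemma loc_vimage_submod:
  assumes A: "module R A" and W: "submodule W (loc_ring R \<pp>) (loc_module R \<pp> A)"
  shows "submodule {x \<in> carrier A. loc_frac R A \<pp> x \<one>\<^bsub>R\<^esub> \<in> W} R A"
proof (rule submodI[OF A])
  interpret A: module R A by fact
  note W' = submodD[OF W]
  show "\<zero>\<^bsub>A\<^esub> \<in> {x \<in> carrier A. loc_frac R A \<pp> x \<one>\<^bsub>R\<^esub> \<in> W}" using W'(2) by (simp add: loc_zero)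
  show "x \<oplus>\<^bsub>A\<^esub> y \<in> {x \<in> carrier A. loc_frac R A \<pp> x \<one>\<^bsub>R\<^esub> \<in> W}"
    if "x \<in> {x \<in> carrier A. loc_frac R A \<pp> x \<one>\<^bsub>R\<^esub> \<in> W}" "y \<in> {x \<in> carrier A. loc_frac R A \<pp> x \<one>\<^bsub>R\<^esub> \<in> W}" for x y
    using that loc_add_same[OF A _ _ S_one, of x y] W'(3) by fastforce
  show "r \<odot>\<^bsub>A\<^esub> x \<in> {x \<in> carrier A. loc_frac R A \<pp> x \<one>\<^bsub>R\<^esub> \<in> W}"
    if r: "r \<in> carrier R" and x: "x \<in> {x \<in> carrier A. loc_frac R A \<pp> x \<one>\<^bsub>R\<^esub> \<in> W}" for r x
  proof -
    have "loc_frac R (reg_module R) \<pp> r \<one>\<^bsub>R\<^esub> \<odot>\<^bsub>loc_module R \<pp> A\<^esub> loc_frac R A \<pp> x \<one>\<^bsub>R\<^esub> \<in> W"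
      by (rule W'(4)) (use x r loc_carrierI[of r "reg_module R" "\<one>\<^bsub>R\<^esub>"] S_one in auto)
    then show ?thesis using loc_smult[OF A r _ S_one S_one, of x] r x by simp
  qed
qed auto

text \<open>Formulated for an abelian group, the structure established for localized modules. The
  submodule T guarantees that the intersection runs over a nonempty family.\<close>

lemma gen_submodule_submod:
  assumes L: "abelian_group L" and ex: "submodule T R' L" "G \<subseteq> T"
  shows "submodule (gen_submodule R' L G) R' L" "G \<subseteq> gen_submodule R' L G"
proof -
  interpret L: abelian_group L by fact
  have "subgroup (\<Inter>{N. submodule N R' L \<and> G \<subseteq> N}) (add_monoid L)"
    by (rule L.add.subgroups_Inter) (use ex in \<open>auto simp: submodule_def\<close>)
  then show "submodule (gen_submodule R' L G) R' L"
    unfolding gen_submodule_def by (auto intro!: submodule.intro submodule_axioms.intro dest: submodule.smult_closed)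
  show "G \<subseteq> gen_submodule R' L G" unfolding gen_submodule_def by blast
qed

text \<open>Take the numerators of a regular sequence of length above c on the localization; the
  denominators are units there. Regularity at each step says that an element of the colon submodule
  enters the preceding submodule after multiplication by some element outside \<pp>, and
  Noetherianity of A makes this element uniform.\<close>

lemma depth_gt_almost_regular:
  assumes A: "module R A" and noeth: "noeth_pair R A {\<zero>\<^bsub>A\<^esub>} (carrier A)"
    and ne: "carrier (loc_module R \<pp> A) \<noteq> {\<zero>\<^bsub>loc_module R \<pp> A\<^esub>}"
    and dep: "\<not> depth (loc_ring R \<pp>) (loc_ideal R \<pp> \<pp>) (loc_module R \<pp> A) \<le> enat c"
  shows "\<exists>xs u. set xs \<subseteq> \<pp> \<and> c < length xs \<and> u \<in> S \<and> almost_regular A u xs"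
proof -
  interpret A: module R A by fact
  let ?L = "loc_module R \<pp> A" and ?LR = "loc_ring R \<pp>"
  interpret L: abelian_group ?L by (rule loc_abelian_group[OF A])
  have pI: "ideal \<pp> R" by (rule p.is_ideal)
  have "\<exists>rs. set rs \<subseteq> loc_ideal R \<pp> \<pp> \<and> regular_seq ?LR ?L rs \<and> c < length rs"
  proof (rule ccontr)
    assume "\<not> ?thesis"
    then have "Sup {enat (length rs) |rs. set rs \<subseteq> loc_ideal R \<pp> \<pp> \<and> regular_seq ?LR ?L rs} \<le> enat c"
      by (intro Sup_least) (auto simp: not_less)
    then show False using dep ne unfolding depth_def by simp
  qed
  then obtain rs where rs: "set rs \<subseteq> loc_ideal R \<pp> \<pp>" "regular_seq ?LR ?L rs" "c < length rs" by blast
  have "\<forall>Z\<in>set rs. \<exists>r s. r \<in> \<pp> \<and> s \<in> S \<and> Z = loc_frac R (reg_module R) \<pp> r s"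
    using loc_ideal_mem[OF pI] rs(1) by blast
  then obtain rn sn where rn: "\<And>Z. Z \<in> set rs \<Longrightarrow> rn Z \<in> \<pp> \<and> sn Z \<in> S \<and> Z = loc_frac R (reg_module R) \<pp> (rn Z) (sn Z)"
    by metis
  have rnc: "rn Z \<in> carrier R" if "Z \<in> set rs" for Z using rn[OF that] p.a_Hcarr by blast
  \<comment> \<open>Reversed, to match the convention of \<open>seqsub\<close> and
    \<open>almost_regular\<close> that the head is the last element of the sequence.\<close>
  let ?ys = "\<lambda>i. rev (take i (map rn rs))"
  have setys: "set (?ys i) = rn ` set (take i rs)" for i by (simp add: take_map)
  have ysc: "set (?ys i) \<subseteq> carrier R" for i unfolding setys using rnc set_take_subset[of i rs] by blast
  have local: "\<exists>u\<in>S. u \<odot>\<^bsub>A\<^esub> m \<in> seqsub A (?ys i)"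
    if i: "i < length rs" and m: "m \<in> carrier A" "rn (rs ! i) \<odot>\<^bsub>A\<^esub> m \<in> seqsub A (?ys i)" for i m
  proof -
    let ?N = "seqsub A (?ys i)"
    let ?Z = "rs ! i"
    have Z: "?Z \<in> set rs" using i by simp
    have sN: "submodule ?N R A" by (rule seqsub_submod[OF A ysc])
    let ?T = "{loc_frac R A \<pp> x s |x s. x \<in> carrier A \<and> s \<in> S \<and> (\<exists>u\<in>S. u \<odot>\<^bsub>A\<^esub> x \<in> ?N)}"
    let ?G = "{r \<odot>\<^bsub>?L\<^esub> x |r x. r \<in> set (take i rs) \<and> x \<in> carrier ?L}"
    let ?W = "seq_submodule ?LR ?L (take i rs)"
    have sT: "submodule ?T ?LR ?L" by (rule loc_submod_frac[OF A sN])
    have GT: "?G \<subseteq> ?T"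
    proof
      fix g assume "g \<in> ?G"
      then obtain Y X where Y: "g = Y \<odot>\<^bsub>?L\<^esub> X" "Y \<in> set (take i rs)" "X \<in> carrier ?L" by blast
      have Yr: "Y \<in> set rs" using Y(2) by (meson in_set_takeD)
      obtain x t where x: "x \<in> carrier A" "t \<in> S" "X = loc_frac R A \<pp> x t" using loc_carrierE[OF Y(3)] .
      have "g = loc_frac R A \<pp> (rn Y \<odot>\<^bsub>A\<^esub> x) (sn Y \<otimes>\<^bsub>R\<^esub> t)"
        using loc_smult[OF A rnc[OF Yr] x(1) _ x(2), of "sn Y"] rn[OF Yr] Y(1) x(3) by simp
      moreover have "rn Y \<odot>\<^bsub>A\<^esub> x \<in> ?N" using seqsub_gen[OF A ysc, of "rn Y" i x] Y(2) x(1) setys by blast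
      then have "\<one>\<^bsub>R\<^esub> \<odot>\<^bsub>A\<^esub> (rn Y \<odot>\<^bsub>A\<^esub> x) \<in> ?N" using rnc[OF Yr] x(1) by simp
      ultimately show "g \<in> ?T" using rnc[OF Yr] x(1) S_mult[OF _ x(2), of "sn Y"] rn[OF Yr] S_one A.smult_closed by blast
    qed
    have W: "submodule ?W ?LR ?L" "?G \<subseteq> ?W" unfolding seq_submodule_def by (rule gen_submodule_submod[OF L.abelian_group_axioms sT GT])+
    have WT: "?W \<subseteq> ?T" unfolding seq_submodule_def gen_submodule_def using sT GT by (intro Inter_lower) simp
    \<comment> \<open>Together with \<open>WT\<close> this compares the submodule generated by the
      first i elements of rs on the localization with the localization of
      \<open>seqsub A (?ys i)\<close>, in both directions.\<close>
    have "?N \<subseteq> {x \<in> carrier A. loc_frac R A \<pp> x \<one>\<^bsub>R\<^esub> \<in> ?W}"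
    proof (rule seqsub_least[OF A loc_vimage_submod[OF A W(1)]])
      fix r y assume r: "r \<in> set (?ys i)" and y: "y \<in> carrier A"
      then obtain Y where Y: "Y \<in> set (take i rs)" "r = rn Y" using setys by blast
      have Yr: "Y \<in> set rs" using Y(1) by (meson in_set_takeD)
      have "Y \<odot>\<^bsub>?L\<^esub> loc_frac R A \<pp> y \<one>\<^bsub>R\<^esub> \<in> ?W" using W(2) Y(1) loc_carrierI[OF y S_one] by blast
      moreover have sc: "loc_frac R (reg_module R) \<pp> (sn Y) \<one>\<^bsub>R\<^esub> \<in> carrier ?LR"
        using loc_carrierI[of "sn Y" "reg_module R" "\<one>\<^bsub>R\<^esub>"] rn[OF Yr] S_one by simp
      ultimately have "loc_frac R (reg_module R) \<pp> (sn Y) \<one>\<^bsub>R\<^esub> \<odot>\<^bsub>?L\<^esub> (Y \<odot>\<^bsub>?L\<^esub> loc_frac R A \<pp> y \<one>\<^bsub>R\<^esub>) \<in> ?W"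
        using submodD(4)[OF W(1)] by blast
      then have "loc_frac R A \<pp> (r \<odot>\<^bsub>A\<^esub> y) \<one>\<^bsub>R\<^esub> \<in> ?W"
        using frac_one_smult[OF A y rnc[OF Yr], of "sn Y"] rn[OF Yr] Y(2) by simp
      then show "r \<odot>\<^bsub>A\<^esub> y \<in> {x \<in> carrier A. loc_frac R A \<pp> x \<one>\<^bsub>R\<^esub> \<in> ?W}" using rnc[OF Yr] y Y(2) by simp
    qed
    then have f1: "loc_frac R A \<pp> (rn ?Z \<odot>\<^bsub>A\<^esub> m) \<one>\<^bsub>R\<^esub> \<in> ?W" using m(2) by blast
    have rm: "rn ?Z \<odot>\<^bsub>A\<^esub> m \<in> carrier A" using rnc[OF Z] m by simp
    have "loc_frac R (reg_module R) \<pp> \<one>\<^bsub>R\<^esub> (sn ?Z) \<odot>\<^bsub>?L\<^esub> loc_frac R A \<pp> (rn ?Z \<odot>\<^bsub>A\<^esub> m) \<one>\<^bsub>R\<^esub> \<in> ?W"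
      using submodD(4)[OF W(1) _ f1] loc_carrierI[of "\<one>\<^bsub>R\<^esub>" "reg_module R" "sn ?Z"] rn[OF Z] by simp
    then have f2: "?Z \<odot>\<^bsub>?L\<^esub> loc_frac R A \<pp> m \<one>\<^bsub>R\<^esub> \<in> ?W"
      using loc_smult[OF A R.one_closed rm _ S_one, of "sn ?Z"] loc_smult[OF A rnc[OF Z] m(1) _ S_one, of "sn ?Z"] rn[OF Z] rm by simp
    have Wg: "subgroup ?W (add_monoid ?L)" using W(1) by (simp add: submodule_def)
    have join: "?W +>\<^bsub>?L\<^esub> X = ?W \<longleftrightarrow> X \<in> ?W" if "X \<in> carrier ?L" for X
      using L.add.coset_join1[OF _ _ Wg, of X] L.add.coset_join2[OF _ Wg, of X] that unfolding a_r_coset_def by auto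
    have Xc: "loc_frac R A \<pp> m \<one>\<^bsub>R\<^esub> \<in> carrier ?L" by (rule loc_carrierI[OF m(1) S_one])
    let ?X = "?W +>\<^bsub>?L\<^esub> loc_frac R A \<pp> m \<one>\<^bsub>R\<^esub>"
    let ?Q = "quot_module ?L ?W"
    have XQ: "?X \<in> carrier ?Q" using Xc by (auto simp: quot_carrier)
    have Zc: "?Z \<in> carrier (loc_module R \<pp> (reg_module R))"
      using rn[OF Z] loc_carrierI[of "rn ?Z" "reg_module R" "sn ?Z"] rnc[OF Z] by simp
    have "(\<Union>x\<in>?X. ?W +>\<^bsub>?L\<^esub> (?Z \<odot>\<^bsub>?L\<^esub> x)) = ?W"
    proof (rule UN_const_eq)
      show "loc_frac R A \<pp> m \<one>\<^bsub>R\<^esub> \<in> ?X"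
        unfolding coset_mem using submodD(2)[OF W(1)] L.l_zero[OF Xc] by (intro bexI[of _ "\<zero>\<^bsub>?L\<^esub>"]) simp_all
      fix X assume "X \<in> ?X"
      then obtain h where h: "h \<in> ?W" "X = h \<oplus>\<^bsub>?L\<^esub> loc_frac R A \<pp> m \<one>\<^bsub>R\<^esub>" unfolding coset_mem by blast
      have hc: "h \<in> carrier ?L" using h(1) submodD(1)[OF W(1)] by blast
      have "?Z \<odot>\<^bsub>?L\<^esub> h \<in> ?W" using submodD(4)[OF W(1) _ h(1), of ?Z] Zc by simp
      then have "?Z \<odot>\<^bsub>?L\<^esub> X \<in> ?W" unfolding h(2) loc_smult_r_distr[OF A Zc hc Xc] using f2 submodD(3)[OF W(1)] by blast
      then show "?W +>\<^bsub>?L\<^esub> (?Z \<odot>\<^bsub>?L\<^esub> X) = ?W" using join submodD(1)[OF W(1)] by blast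
    qed
    then have "?Z \<odot>\<^bsub>?Q\<^esub> ?X = \<zero>\<^bsub>?Q\<^esub>" by (simp add: quot_module_def)
    then have "?X = \<zero>\<^bsub>?Q\<^esub>" using rs(2) i XQ unfolding regular_seq_def by blast
    then have "loc_frac R A \<pp> m \<one>\<^bsub>R\<^esub> \<in> ?W" using join[OF Xc] by simp
    then have "loc_frac R A \<pp> m \<one>\<^bsub>R\<^esub> \<in> ?T" using WT by blast
    then obtain x s u where x: "loc_frac R A \<pp> m \<one>\<^bsub>R\<^esub> = loc_frac R A \<pp> x s" "x \<in> carrier A" "s \<in> S" "u \<in> S" "u \<odot>\<^bsub>A\<^esub> x \<in> ?N" by blast
    then obtain v where v: "v \<in> S" "v \<odot>\<^bsub>A\<^esub> (s \<odot>\<^bsub>A\<^esub> m) = v \<odot>\<^bsub>A\<^esub> (\<one>\<^bsub>R\<^esub> \<odot>\<^bsub>A\<^esub> x)"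
      using frac_eq[OF A m(1) x(2) S_one x(3)] by blast
    have c: "s \<in> carrier R" "u \<in> carrier R" "v \<in> carrier R" using x v by auto
    have "(u \<otimes>\<^bsub>R\<^esub> v \<otimes>\<^bsub>R\<^esub> s) \<odot>\<^bsub>A\<^esub> m = u \<odot>\<^bsub>A\<^esub> (v \<odot>\<^bsub>A\<^esub> x)" using v(2) c m(1) x(2) by (simp add: A.smult_assoc1)
    also have "\<dots> = v \<odot>\<^bsub>A\<^esub> (u \<odot>\<^bsub>A\<^esub> x)" by (rule smult_commute[OF A c(2,3) x(2)])
    also have "\<dots> \<in> ?N" by (rule submodD(4)[OF sN c(3) x(5)])
    finally show ?thesis using S_mult[OF S_mult[OF x(4) v(1)] x(3)] by blast
  qed
  have "\<exists>u\<in>S. almost_regular A u (?ys i)" if "i \<le> length rs" for i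
    using that
  proof (induction i)
    case 0
    then show ?case using S_one by auto
  next
    case (Suc i)
    then obtain u where u: "u \<in> S" "almost_regular A u (?ys i)" by auto
    let ?r = "rn (rs ! i)"
    have il: "i < length rs" using Suc by simp
    have rc: "?r \<in> carrier R" using rnc il by simp
    have sN: "submodule (seqsub A (?ys i)) R A" by (rule seqsub_submod[OF A ysc])
    have sU: "submodule {m \<in> carrier A. ?r \<odot>\<^bsub>A\<^esub> m \<in> seqsub A (?ys i)} R A"
      by (rule submod_vimage[OF lin_mult[OF A rc] A A sN])
    \<comment> \<open>One v for the whole colon submodule of the new element. The product v u then
      works for the new element and still for the earlier ones.\<close>
    obtain v where v: "v \<in> S" "\<forall>m\<in>{m \<in> carrier A. ?r \<odot>\<^bsub>A\<^esub> m \<in> seqsub A (?ys i)}. v \<odot>\<^bsub>A\<^esub> m \<in> seqsub A (?ys i)"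
      using uniform_denominator[OF A noeth sN sU] local[OF il] by blast
    have c: "u \<in> carrier R" "v \<in> carrier R" using u v by auto
    have "?ys (Suc i) = ?r # ?ys i" using il by (simp add: take_Suc_conv_app_nth)
    moreover have "almost_regular A (v \<otimes>\<^bsub>R\<^esub> u) (?ys i)" by (rule almost_regular_mono[OF A ysc c u(2)])
    moreover have "(v \<otimes>\<^bsub>R\<^esub> u) \<odot>\<^bsub>A\<^esub> m \<in> seqsub A (?ys i)" if m: "m \<in> carrier A" "?r \<odot>\<^bsub>A\<^esub> m \<in> seqsub A (?ys i)" for m
    proof -
      have "u \<odot>\<^bsub>A\<^esub> (v \<odot>\<^bsub>A\<^esub> m) \<in> seqsub A (?ys i)" using submodD(4)[OF sN c(1)] v(2) m by blast
      then show ?thesis using smult_commute[OF A c m(1)] c m(1) by (simp add: A.smult_assoc1)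
    qed
    ultimately show ?case using S_mult[OF v(1) u(1)] by auto
  qed
  then obtain u where u: "u \<in> S" "almost_regular A u (?ys (length rs))" by blast
  have "set (?ys (length rs)) \<subseteq> \<pp>" unfolding setys using rn by auto
  then show ?thesis using u rs(3) by (intro exI[of _ "?ys (length rs)"] exI[of _ u]) simp
qed

end

section \<open>Modules of homomorphisms and \<open>Ext\<close>\<close>

lemma Hom_mod_simps [simp]:
  "carrier (Hom_mod R A B) = mod_hom R A B"
  "\<zero>\<^bsub>Hom_mod R A B\<^esub> = (\<lambda>x\<in>carrier A. \<zero>\<^bsub>B\<^esub>)"
  "f \<oplus>\<^bsub>Hom_mod R A B\<^esub> g = (\<lambda>x\<in>carrier A. f x \<oplus>\<^bsub>B\<^esub> g x)"
  "r \<odot>\<^bsub>Hom_mod R A B\<^esub> f = (\<lambda>x\<in>carrier A. r \<odot>\<^bsub>B\<^esub> f x)"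
  by (simp_all add: Hom_mod_def)

lemma mod_hom_eqI:
  assumes "f \<in> mod_hom R A B" "g \<in> mod_hom R A B" "\<And>x. x \<in> carrier A \<Longrightarrow> f x = g x"
  shows "f = g"
  using assms by (intro extensionalityI[of f "carrier A" g]) (auto simp: mod_hom_iff)

lemma mod_hom_restrict: "f \<in> mod_hom R A B \<Longrightarrow> restrict f (carrier A) = f"
  by (simp add: mod_hom_iff extensional_restrict)

lemma Hom_mod_module:
  assumes A: "module R A" and B: "module R B"
  shows "module R (Hom_mod R A B)"
proof -
  interpret A: module R A by fact
  interpret B: module R B by fact
  have c: "f x \<in> carrier B" if "f \<in> mod_hom R A B" "x \<in> carrier A" for f x
    using lin_closed[OF mod_hom_lin[OF that(1)] that(2)] .
  have add: "(\<lambda>x\<in>carrier A. f x \<oplus>\<^bsub>B\<^esub> g x) \<in> mod_hom R A B" if "f \<in> mod_hom R A B" "g \<in> mod_hom R A B" for f g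
    by (rule lin_restrict[OF lin_fun_add[OF mod_hom_lin[OF that(1)] mod_hom_lin[OF that(2)] A B] A])
  have sm: "(\<lambda>x\<in>carrier A. r \<odot>\<^bsub>B\<^esub> f x) \<in> mod_hom R A B" if "f \<in> mod_hom R A B" "r \<in> carrier R" for f r
    by (rule lin_restrict[OF lin_fun_smult[OF mod_hom_lin[OF that(1)] that(2) A B] A])
  have zero: "(\<lambda>x\<in>carrier A. \<zero>\<^bsub>B\<^esub>) \<in> mod_hom R A B" by (rule lin_restrict[OF lin_const_zero[OF A B] A])
  have "abelian_group (Hom_mod R A B)"
  proof (rule abelian_groupI)
    fix f assume f: "f \<in> carrier (Hom_mod R A B)"
    then have f': "f \<in> mod_hom R A B" by simp
    show "\<zero>\<^bsub>Hom_mod R A B\<^esub> \<oplus>\<^bsub>Hom_mod R A B\<^esub> f = f"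
      using add[OF zero f'] by (intro mod_hom_eqI[of _ R A B]) (use f' c[OF f'] in auto)
    have m: "(\<lambda>x\<in>carrier A. (\<ominus>\<^bsub>R\<^esub> \<one>\<^bsub>R\<^esub>) \<odot>\<^bsub>B\<^esub> f x) \<in> mod_hom R A B" by (rule sm[OF f']) simp
    have "(\<lambda>x\<in>carrier A. (\<ominus>\<^bsub>R\<^esub> \<one>\<^bsub>R\<^esub>) \<odot>\<^bsub>B\<^esub> f x) \<oplus>\<^bsub>Hom_mod R A B\<^esub> f = \<zero>\<^bsub>Hom_mod R A B\<^esub>"
      using add[OF m f'] zero c[OF f'] smult_neg_one[OF B]
      by (intro mod_hom_eqI[of _ R A B]) (auto simp: B.M.l_neg)
    moreover have "(\<lambda>x\<in>carrier A. (\<ominus>\<^bsub>R\<^esub> \<one>\<^bsub>R\<^esub>) \<odot>\<^bsub>B\<^esub> f x) \<in> carrier (Hom_mod R A B)" using m by simp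
    ultimately show "\<exists>g\<in>carrier (Hom_mod R A B). g \<oplus>\<^bsub>Hom_mod R A B\<^esub> f = \<zero>\<^bsub>Hom_mod R A B\<^esub>" by (rule bexI)
  qed (use add zero c in \<open>auto simp: B.M.a_ac restrict_def fun_eq_iff\<close>)
  moreover have "\<one>\<^bsub>R\<^esub> \<odot>\<^bsub>Hom_mod R A B\<^esub> f = f" if "f \<in> carrier (Hom_mod R A B)" for f
    using that sm[of f "\<one>\<^bsub>R\<^esub>"] c[of f] by (intro mod_hom_eqI[of _ R A B]) auto
  ultimately show ?thesis
    using c sm by (intro moduleI module_cring[OF A])
      (auto simp: B.smult_l_distr B.smult_r_distr B.smult_assoc1 fun_eq_iff restrict_def)
qed

lemma a_r_coset_update [simp]: "a_r_coset (A\<lparr>carrier := N\<rparr>) = a_r_coset A"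
  by (auto simp: a_r_coset_def r_coset_def fun_eq_iff)

text \<open>A zero module is put before the resolution: degree \<open>i\<close> of \<open>Q\<close> is index \<open>i + 1\<close> of \<open>pad Q\<close>.\<close>

definition pad :: "(nat \<Rightarrow> ('r, 'q) module) \<Rightarrow> nat \<Rightarrow> ('r, 'q) module" where
  "pad Q = case_nat ((Q 0)\<lparr>carrier := {\<zero>\<^bsub>Q 0\<^esub>}\<rparr>) Q"

text \<open>On the zero module in index 0 the identity is the zero map into Q 0.\<close>

definition pad_d :: "(nat \<Rightarrow> 'q \<Rightarrow> 'q) \<Rightarrow> nat \<Rightarrow> 'q \<Rightarrow> 'q" where
  "pad_d d = case_nat (\<lambda>x. x) d"

lemma pad_simps [simp]: "pad Q (Suc n) = Q n" "pad_d d (Suc n) = d n" "pad_d d 0 = (\<lambda>x. x)"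
  "carrier (pad Q 0) = {\<zero>\<^bsub>Q 0\<^esub>}" "\<zero>\<^bsub>pad Q 0\<^esub> = \<zero>\<^bsub>Q 0\<^esub>"
  by (simp_all add: pad_def pad_d_def)

locale inj_res =
  fixes R :: "('r, 'z) ring_scheme" and M :: "('r, 'm) module" and Q :: "nat \<Rightarrow> ('r, 'q) module" and \<epsilon> and d
  assumes mM: "module R M" and res: "injective_resolution R M Q \<epsilon> d"
begin

lemma Qb: "baer R (Q i)"
  using res by (simp add: injective_resolution_def injective_baer)

lemma Qm: "module R (Q i)"
  by (rule baer_module[OF Qb])

lemma dl: "lin R (Q i) (Q (Suc i)) (d i)"
  using res unfolding injective_resolution_def by (auto intro: mod_hom_lin)

lemma cR: "cring R"
  by (rule module_cring[OF mM])

lemma ker_im: "{x \<in> carrier (Q (Suc i)). d (Suc i) x = \<zero>\<^bsub>Q (Suc (Suc i))\<^esub>} = d i ` carrier (Q i)"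
  using res unfolding injective_resolution_def by blast

sublocale aug_complex R "pad Q" "pad_d d" M \<epsilon>
proof -
  have pb: "baer R (pad Q n)" for n
  proof (cases n)
    case 0
    interpret Q0: module R "Q 0" by (rule Qm)
    have m0: "module R (pad Q 0)" using submod_module[OF submod_zero[OF Qm[of 0]] Qm[of 0]] by (simp add: pad_def)
    have "\<exists>e\<in>carrier (pad Q 0). \<forall>r\<in>\<bb>. f r = r \<odot>\<^bsub>pad Q 0\<^esub> e"
      if "ideal \<bb> R \<and> lin R (reg_module R\<lparr>carrier := \<bb>\<rparr>) (pad Q 0) f" for \<bb> f
    proof -
      have "f r \<in> carrier (pad Q 0)" if "r \<in> \<bb>" for r
        using lin_closed[of R "reg_module R\<lparr>carrier := \<bb>\<rparr>" "pad Q 0" f r] \<open>ideal \<bb> R \<and> _\<close> that by simp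
      moreover have "r \<in> carrier R" if "r \<in> \<bb>" for r using \<open>ideal \<bb> R \<and> _\<close> ideal.Icarr[OF _ that] by blast
      ultimately show ?thesis by (auto simp: pad_def)
    qed
    then show ?thesis unfolding baer_def 0 using m0 by blast
  next
    case (Suc k)
    then show ?thesis using Qb by simp
  qed
  have pl: "lin R (pad Q n) (pad Q (Suc n)) (pad_d d n)" for n
  proof (cases n)
    case 0
    interpret Q0: module R "Q 0" by (rule Qm)
    have "lin R ((Q 0)\<lparr>carrier := {\<zero>\<^bsub>Q 0\<^esub>}\<rparr>) (Q 0) (\<lambda>x. x)" by (rule lin_id) auto
    then show ?thesis using 0 by (simp add: pad_def pad_d_def)
  qed (use dl in simp)
  have e: "\<epsilon> \<in> mod_hom R M (Q 0)" "inj_on \<epsilon> (carrier M)" "{x \<in> carrier (Q 0). d 0 x = \<zero>\<^bsub>Q 1\<^esub>} = \<epsilon> ` carrier M"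
    using res unfolding injective_resolution_def by blast+
  interpret MM: module R M by (rule mM)
  interpret ic: inj_complex R "pad Q" "pad_d d"
  proof
    show "pad_d d (Suc n) (pad_d d n x) = \<zero>\<^bsub>pad Q (Suc (Suc n))\<^esub>" if "x \<in> carrier (pad Q n)" for n x
    proof (cases n)
      case 0
      then show ?thesis using that lin_zero[OF dl Qm Qm, of 0] by simp
    next
      case (Suc k)
      then have "d k x \<in> {x \<in> carrier (Q (Suc k)). d (Suc k) x = \<zero>\<^bsub>Q (Suc (Suc k))\<^esub>}" using that unfolding ker_im by simp
      then show ?thesis using Suc by simp
    qed
  qed (use pb pl in auto)
  show "aug_complex R (pad Q) (pad_d d) M \<epsilon>"
  proof
    show "lin R M (pad Q 1) \<epsilon>" using mod_hom_lin[OF e(1)] by simp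
    show "x = \<zero>\<^bsub>M\<^esub>" if "x \<in> carrier M" "\<epsilon> x = \<zero>\<^bsub>pad Q 1\<^esub>" for x
      using that inj_onD[OF e(2), of x "\<zero>\<^bsub>M\<^esub>"] lin_zero[OF mod_hom_lin[OF e(1)] mM Qm] by simp
    show "ic.cyc 1 = \<epsilon> ` carrier M" using e(3) by (simp add: ic.cyc_def)
    show "ic.cyc (Suc (Suc n)) \<subseteq> pad_d d (Suc n) ` carrier (pad Q (Suc n))" for n
      using ker_im[of n] by (simp add: ic.cyc_def)
  qed
qed

text \<open>The cocycle condition for functions that need not be extensional, so that
  representatives can be written as lambda terms; \<open>ex\<close> restricts them before it forms
  the class.\<close>

definition cocy where "cocy i N f \<longleftrightarrow> lin R N (Q i) f \<and> (\<forall>x\<in>carrier N. d i (f x) = \<zero>\<^bsub>Q (Suc i)\<^esub>)"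

definition ex where "ex i N f = coboundaries R Q d i N +>\<^bsub>Hom_mod R N (Q i)\<^esub> restrict f (carrier N)"

lemma cocycles_submod:
  assumes N: "module R N"
  shows "submodule (cocycles R Q d i N) R (Hom_mod R N (Q i))"
proof -
  interpret N: module R N by fact
  interpret Qi: module R "Q i" by (rule Qm)
  interpret Qs: module R "Q (Suc i)" by (rule Qm)
  note H = Hom_mod_module[OF N Qm]
  show ?thesis
  proof (rule submodI[OF H])
    show "cocycles R Q d i N \<subseteq> carrier (Hom_mod R N (Q i))" by (auto simp: cocycles_def)
    interpret H: module R "Hom_mod R N (Q i)" by (rule H)
    show "\<zero>\<^bsub>Hom_mod R N (Q i)\<^esub> \<in> cocycles R Q d i N"
      using H.M.zero_closed lin_zero[OF dl Qm Qm, of i] by (auto simp: cocycles_def)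
    have vc: "f x \<in> carrier (Q i)" if "f \<in> cocycles R Q d i N" "x \<in> carrier N" for f x
      using that lin_closed[OF mod_hom_lin, of f R N "Q i" x] by (simp add: cocycles_def)
    show "f \<oplus>\<^bsub>Hom_mod R N (Q i)\<^esub> g \<in> cocycles R Q d i N" if "f \<in> cocycles R Q d i N" "g \<in> cocycles R Q d i N" for f g
      using H.M.a_closed[of f g] that lin_add[OF dl vc[OF that(1)] vc[OF that(2)]]
      by (simp add: cocycles_def)
    show "r \<odot>\<^bsub>Hom_mod R N (Q i)\<^esub> f \<in> cocycles R Q d i N" if "r \<in> carrier R" "f \<in> cocycles R Q d i N" for r f
      using H.smult_closed[of r f] that lin_smult[OF dl that(1) vc[OF that(2)]]
      by (simp add: cocycles_def)
  qed
qed

text \<open>In the padded complex a coboundary of degree 0 is the composite with a map into the zero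
  module, which removes the case distinction of \<open>coboundaries\<close>.\<close>

lemma coboundaries_eq:
  assumes N: "module R N"
  shows "coboundaries R Q d i N = {restrict (\<lambda>x. pad_d d i (h x)) (carrier N) |h. lin R N (pad Q i) h}"
proof (cases i)
  case 0
  interpret N: module R N by fact
  interpret Q0: module R "Q 0" by (rule Qm)
  have 1: "restrict h (carrier N) = (\<lambda>x\<in>carrier N. \<zero>\<^bsub>Q 0\<^esub>)" if "lin R N (pad Q 0) h" for h
    using lin_closed[OF that] by auto
  have 2: "lin R N (pad Q 0) (\<lambda>x. \<zero>\<^bsub>Q 0\<^esub>)" using lin_const_zero[OF N m[of 0]] by simp
  have "{restrict (\<lambda>x. pad_d d 0 (h x)) (carrier N) |h. lin R N (pad Q 0) h} = {\<lambda>x\<in>carrier N. \<zero>\<^bsub>Q 0\<^esub>}"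
  proof (intro equalityI subsetI)
    fix y assume "y \<in> {restrict (\<lambda>x. pad_d d 0 (h x)) (carrier N) |h. lin R N (pad Q 0) h}"
    then obtain h where "lin R N (pad Q 0) h" "y = restrict h (carrier N)" by auto
    then show "y \<in> {\<lambda>x\<in>carrier N. \<zero>\<^bsub>Q 0\<^esub>}" using 1 by simp
  next
    fix y assume "y \<in> {\<lambda>x\<in>carrier N. \<zero>\<^bsub>Q 0\<^esub>}"
    then show "y \<in> {restrict (\<lambda>x. pad_d d 0 (h x)) (carrier N) |h. lin R N (pad Q 0) h}" using 2 by auto
  qed
  then show ?thesis unfolding 0 coboundaries_def by simp
next
  case (Suc k)
  have "compose (carrier N) (d k) g = restrict (\<lambda>x. d k (g x)) (carrier N)" for g by (simp add: compose_def)
  moreover have "\<exists>g. restrict (\<lambda>x. d k (h x)) (carrier N) = restrict (\<lambda>x. d k (g x)) (carrier N) \<and> g \<in> mod_hom R N (Q k)"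
    if "lin R N (Q k) h" for h
    by (rule exI[of _ "restrict h (carrier N)"]) (use lin_restrict[OF that N] in auto)
  ultimately show ?thesis unfolding Suc coboundaries_def using mod_hom_lin by fastforce
qed

lemma coboundary_iff:
  assumes N: "module R N" and f: "f \<in> extensional (carrier N)"
  shows "f \<in> coboundaries R Q d i N \<longleftrightarrow> (\<exists>h. lin R N (pad Q i) h \<and> (\<forall>x\<in>carrier N. f x = pad_d d i (h x)))"
proof
  assume "f \<in> coboundaries R Q d i N"
  then show "\<exists>h. lin R N (pad Q i) h \<and> (\<forall>x\<in>carrier N. f x = pad_d d i (h x))" unfolding coboundaries_eq[OF N] by force
next
  assume "\<exists>h. lin R N (pad Q i) h \<and> (\<forall>x\<in>carrier N. f x = pad_d d i (h x))"
  then obtain h where h: "lin R N (pad Q i) h" "\<forall>x\<in>carrier N. f x = pad_d d i (h x)" by blast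
  then have "f = restrict (\<lambda>x. pad_d d i (h x)) (carrier N)" by (intro extensionalityI[OF f]) auto
  then show "f \<in> coboundaries R Q d i N" unfolding coboundaries_eq[OF N] using h(1) by blast
qed

lemma coboundaries_submod:
  assumes N: "module R N"
  shows "submodule (coboundaries R Q d i N) R (Hom_mod R N (Q i))"
proof -
  interpret N: module R N by fact
  interpret Qi: module R "Q i" by (rule Qm)
  note H = Hom_mod_module[OF N Qm[of i]]
  interpret H: module R "Hom_mod R N (Q i)" by (rule H)
  have pd: "lin R (pad Q i) (Q i) (pad_d d i)" using d[of i] by simp
  have ext: "f \<in> extensional (carrier N)" if "f \<in> mod_hom R N (Q i)" for f using that by (simp add: mod_hom_iff)
  have sub: "coboundaries R Q d i N \<subseteq> mod_hom R N (Q i)"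
    unfolding coboundaries_eq[OF N] using lin_restrict[OF lin_comp[OF _ pd] N] by blast
  show ?thesis
  proof (rule submodI[OF H])
    show "coboundaries R Q d i N \<subseteq> carrier (Hom_mod R N (Q i))" using sub by simp
    show "\<zero>\<^bsub>Hom_mod R N (Q i)\<^esub> \<in> coboundaries R Q d i N"
      using coboundary_iff[OF N, of "\<zero>\<^bsub>Hom_mod R N (Q i)\<^esub>" i] lin_const_zero[OF N m[of i]] lin_zero[OF pd m Qm] by auto
    fix f assume f: "f \<in> coboundaries R Q d i N"
    obtain h where h: "lin R N (pad Q i) h" "\<And>x. x \<in> carrier N \<Longrightarrow> f x = pad_d d i (h x)"
      using coboundary_iff[OF N ext] f sub by blast
    { fix g assume g: "g \<in> coboundaries R Q d i N"
      obtain h' where h': "lin R N (pad Q i) h'" "\<And>x. x \<in> carrier N \<Longrightarrow> g x = pad_d d i (h' x)"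
        using coboundary_iff[OF N ext] g sub by blast
      have "lin R N (pad Q i) (\<lambda>x. h x \<oplus>\<^bsub>pad Q i\<^esub> h' x)" by (rule lin_fun_add[OF h(1) h'(1) N m])
      moreover have "(f \<oplus>\<^bsub>Hom_mod R N (Q i)\<^esub> g) x = pad_d d i (h x \<oplus>\<^bsub>pad Q i\<^esub> h' x)" if "x \<in> carrier N" for x
        using that h(2) h'(2) lin_add[OF pd lin_closed[OF h(1)] lin_closed[OF h'(1)]] by simp
      ultimately show "f \<oplus>\<^bsub>Hom_mod R N (Q i)\<^esub> g \<in> coboundaries R Q d i N"
        using coboundary_iff[OF N ext, of "f \<oplus>\<^bsub>Hom_mod R N (Q i)\<^esub> g"] H.M.a_closed[of f g] f g sub by (auto simp del: Hom_mod_simps(3)) }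
    fix r assume r: "r \<in> carrier R"
    have "lin R N (pad Q i) (\<lambda>x. r \<odot>\<^bsub>pad Q i\<^esub> h x)" by (rule lin_fun_smult[OF h(1) r N m])
    moreover have "(r \<odot>\<^bsub>Hom_mod R N (Q i)\<^esub> f) x = pad_d d i (r \<odot>\<^bsub>pad Q i\<^esub> h x)" if "x \<in> carrier N" for x
      using that h(2) lin_smult[OF pd r lin_closed[OF h(1)]] by simp
    ultimately show "r \<odot>\<^bsub>Hom_mod R N (Q i)\<^esub> f \<in> coboundaries R Q d i N"
      using coboundary_iff[OF N ext, of "r \<odot>\<^bsub>Hom_mod R N (Q i)\<^esub> f"] H.smult_closed[of r f] f r sub by (auto simp del: Hom_mod_simps(4))
  qed
qed

lemma coboundaries_sub:
  assumes N: "module R N"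
  shows "coboundaries R Q d i N \<subseteq> cocycles R Q d i N"
proof
  fix f assume f: "f \<in> coboundaries R Q d i N"
  have fh: "f \<in> mod_hom R N (Q i)" using submodD(1)[OF coboundaries_submod[OF N]] f by auto
  then obtain h where h: "lin R N (pad Q i) h" "\<And>x. x \<in> carrier N \<Longrightarrow> f x = pad_d d i (h x)"
    using coboundary_iff[OF N, of f i] f by (auto simp: mod_hom_iff)
  then have "d i (f x) = \<zero>\<^bsub>Q (Suc i)\<^esub>" if "x \<in> carrier N" for x
    using dd[OF lin_closed[OF h(1) that]] h(2)[OF that] by simp
  then show "f \<in> cocycles R Q d i N" using fh by (simp add: cocycles_def)
qed

lemma cob_sub_Z:
  assumes N: "module R N"
  shows "submodule (coboundaries R Q d i N) R ((Hom_mod R N (Q i))\<lparr>carrier := cocycles R Q d i N\<rparr>)"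
    and "module R ((Hom_mod R N (Q i))\<lparr>carrier := cocycles R Q d i N\<rparr>)"
proof -
  show m: "module R ((Hom_mod R N (Q i))\<lparr>carrier := cocycles R Q d i N\<rparr>)"
    by (rule submod_module[OF cocycles_submod[OF N] Hom_mod_module[OF N Qm]])
  show "submodule (coboundaries R Q d i N) R ((Hom_mod R N (Q i))\<lparr>carrier := cocycles R Q d i N\<rparr>)"
    by (rule submodI[OF m]) (use coboundaries_sub[OF N] submodD[OF coboundaries_submod[OF N]] in auto)
qed

lemma Ext_module: "module R N \<Longrightarrow> module R (Ext_mod R Q d i N)"
  unfolding Ext_mod_def by (rule quot_module_module(1)[OF cob_sub_Z])

lemma cocy_restrict:
  assumes N: "module R N" and f: "cocy i N f"
  shows "restrict f (carrier N) \<in> cocycles R Q d i N"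
  using f lin_restrict[OF _ N] by (auto simp: cocy_def cocycles_def)

lemma Ext_carrier:
  assumes N: "module R N"
  shows "carrier (Ext_mod R Q d i N) = {ex i N f |f. cocy i N f}"
proof -
  have "f \<in> cocycles R Q d i N \<Longrightarrow> cocy i N f \<and> restrict f (carrier N) = f" for f
    using mod_hom_restrict[of f R N "Q i"] mod_hom_lin by (auto simp: cocycles_def cocy_def)
  then show ?thesis
    unfolding Ext_mod_def quot_carrier ex_def using cocy_restrict[OF N] by (auto simp: image_iff) metis+
qed

lemma ex_closed: "module R N \<Longrightarrow> cocy i N f \<Longrightarrow> ex i N f \<in> carrier (Ext_mod R Q d i N)"
  unfolding Ext_carrier by blast

lemma ex_cong: "(\<And>x. x \<in> carrier N \<Longrightarrow> f x = g x) \<Longrightarrow> ex i N f = ex i N g"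
  unfolding ex_def by (metis restrict_ext)

lemma cocy_add:
  assumes "module R N" "cocy i N f" "cocy i N g"
  shows "cocy i N (\<lambda>x. f x \<oplus>\<^bsub>Q i\<^esub> g x)"
proof -
  interpret Qs: module R "Q (Suc i)" by (rule Qm)
  show ?thesis
    using assms lin_fun_add[of R N "Q i" f g] lin_add[OF dl, of _ i] lin_closed[of R N "Q i"] Qm by (auto simp: cocy_def)
qed

lemma cocy_smult:
  assumes "module R N" "cocy i N f" "r \<in> carrier R"
  shows "cocy i N (\<lambda>x. r \<odot>\<^bsub>Q i\<^esub> f x)"
proof -
  interpret Qs: module R "Q (Suc i)" by (rule Qm)
  show ?thesis
    using assms lin_fun_smult[of R N "Q i" f r] lin_smult[OF dl, of r _ i] lin_closed[of R N "Q i"] Qm by (auto simp: cocy_def)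
qed

lemma ex_add:
  assumes N: "module R N" and f: "cocy i N f" and g: "cocy i N g"
  shows "ex i N f \<oplus>\<^bsub>Ext_mod R Q d i N\<^esub> ex i N g = ex i N (\<lambda>x. f x \<oplus>\<^bsub>Q i\<^esub> g x)"
  using quot_add[OF cob_sub_Z[OF N], of "restrict f (carrier N)" i "restrict g (carrier N)"] cocy_restrict[OF N f] cocy_restrict[OF N g]
  unfolding Ext_mod_def ex_def by (simp cong: restrict_cong)

lemma ex_smult:
  assumes N: "module R N" and f: "cocy i N f" and r: "r \<in> carrier R"
  shows "r \<odot>\<^bsub>Ext_mod R Q d i N\<^esub> ex i N f = ex i N (\<lambda>x. r \<odot>\<^bsub>Q i\<^esub> f x)"
  using quot_smult[OF cob_sub_Z[OF N] r, of "restrict f (carrier N)" i] cocy_restrict[OF N f]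
  unfolding Ext_mod_def ex_def by (simp cong: restrict_cong)

lemma ex_eq:
  assumes N: "module R N" and f: "cocy i N f" and g: "cocy i N g"
  shows "ex i N f = ex i N g \<longleftrightarrow> (\<exists>h. lin R N (pad Q i) h \<and> (\<forall>x\<in>carrier N. f x = g x \<oplus>\<^bsub>Q i\<^esub> pad_d d i (h x)))"
proof -
  note H = Hom_mod_module[OF N Qm[of i]]
  interpret H: module R "Hom_mod R N (Q i)" by (rule H)
  interpret Qi: module R "Q i" by (rule Qm)
  have rf: "restrict f (carrier N) \<in> mod_hom R N (Q i)" and rg: "restrict g (carrier N) \<in> mod_hom R N (Q i)"
    using cocy_restrict[OF N f] cocy_restrict[OF N g] by (auto simp: cocycles_def)
  let ?D = "restrict f (carrier N) \<ominus>\<^bsub>Hom_mod R N (Q i)\<^esub> restrict g (carrier N)"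
  have Dh: "?D \<in> mod_hom R N (Q i)" using minus_closed[OF H, of "restrict f (carrier N)" "restrict g (carrier N)"] rf rg by simp
  have fc: "f x \<in> carrier (Q i)" "g x \<in> carrier (Q i)" if "x \<in> carrier N" for x
    using f g that lin_closed by (auto simp: cocy_def intro: lin_closed)
  have Dx: "?D x \<oplus>\<^bsub>Q i\<^esub> g x = f x" if "x \<in> carrier N" for x
  proof -
    have "?D \<oplus>\<^bsub>Hom_mod R N (Q i)\<^esub> restrict g (carrier N) = restrict f (carrier N)"
      using minus_add_cancel(1)[OF H, of "restrict f (carrier N)" "restrict g (carrier N)"] rf rg by simp
    from fun_cong[OF this, of x] show ?thesis using that by simp
  qed
  have Dc: "?D x \<in> carrier (Q i)" if "x \<in> carrier N" for x using lin_closed[OF mod_hom_lin[OF Dh] that] .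
  have "ex i N f = ex i N g \<longleftrightarrow> ?D \<in> coboundaries R Q d i N"
    unfolding ex_def using coset_eq[OF coboundaries_submod[OF N] H, of "restrict f (carrier N)" "restrict g (carrier N)"] rf rg by simp
  also have "\<dots> \<longleftrightarrow> (\<exists>h. lin R N (pad Q i) h \<and> (\<forall>x\<in>carrier N. ?D x = pad_d d i (h x)))"
    using coboundary_iff[OF N, of ?D i] Dh by (simp add: mod_hom_iff)
  also have "\<dots> \<longleftrightarrow> (\<exists>h. lin R N (pad Q i) h \<and> (\<forall>x\<in>carrier N. f x = g x \<oplus>\<^bsub>Q i\<^esub> pad_d d i (h x)))"
  proof -
    have "?D x = pad_d d i (h x) \<longleftrightarrow> f x = g x \<oplus>\<^bsub>Q i\<^esub> pad_d d i (h x)" if "x \<in> carrier N" "lin R N (pad Q i) h" for x h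
    proof -
      have hc: "pad_d d i (h x) \<in> carrier (Q i)" using d_closed[OF lin_closed[OF that(2,1)]] by simp
      have "f x = g x \<oplus>\<^bsub>Q i\<^esub> ?D x" using Dx[OF that(1)] Qi.M.a_comm[OF Dc fc(2), OF that(1) that(1)] by simp
      then show ?thesis using Qi.M.add.l_cancel[OF _ Dc[OF that(1)] hc fc(2)[OF that(1)]] by auto
    qed
    then show ?thesis by blast
  qed
  finally show ?thesis .
qed

text \<open>Composition with h turns a coboundary, a composite of the differential with k, into the
  composite with k after h. All members of the union in \<open>Ext_map\<close> are therefore the
  same class.\<close>

lemma Ext_map_ex:
  assumes N: "module R N" and N': "module R N'" and h: "lin R N N' h" and f: "cocy i N' f"
  shows "Ext_map R Q d i N N' h (ex i N' f) = ex i N (\<lambda>x. f (h x))" "cocy i N (\<lambda>x. f (h x))"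
proof -
  have hc: "h x \<in> carrier N'" if "x \<in> carrier N" for x using lin_closed[OF h that] .
  show c: "cocy i N (\<lambda>x. f (h x))" using f lin_comp[OF h] hc by (auto simp: cocy_def)
  note H' = Hom_mod_module[OF N' Qm[of i]]
  have fm: "restrict f (carrier N') \<in> carrier (Hom_mod R N' (Q i))" using cocy_restrict[OF N' f] by (simp add: cocycles_def)
  have "(\<Union>g\<in>ex i N' f. coboundaries R Q d i N +>\<^bsub>Hom_mod R N (Q i)\<^esub> compose (carrier N) g h) = ex i N (\<lambda>x. f (h x))"
  proof (rule UN_const_eq)
    show "restrict f (carrier N') \<in> ex i N' f" unfolding ex_def by (rule coset_self[OF coboundaries_submod[OF N'] H' fm])
    fix g assume g: "g \<in> ex i N' f"
    note gm = coset_mem_eq[OF coboundaries_submod[OF N'] H' fm g[unfolded ex_def]]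
    have gh: "g \<in> mod_hom R N' (Q i)" using gm(1) by simp
    then have gr: "restrict g (carrier N') = g" by (rule mod_hom_restrict)
    have gc: "cocy i N' g"
    proof -
      obtain b where b: "b \<in> coboundaries R Q d i N'" "g = b \<oplus>\<^bsub>Hom_mod R N' (Q i)\<^esub> restrict f (carrier N')" using g unfolding ex_def coset_mem by blast
      then have "g \<in> cocycles R Q d i N'" using submodD(3)[OF cocycles_submod[OF N']] coboundaries_sub[OF N'] cocy_restrict[OF N' f] by blast
      then show ?thesis by (auto simp: cocy_def cocycles_def intro: mod_hom_lin)
    qed
    have "ex i N' g = ex i N' f" unfolding ex_def gr by (rule gm(2))
    then obtain k where k: "lin R N' (pad Q i) k" "\<forall>x\<in>carrier N'. g x = f x \<oplus>\<^bsub>Q i\<^esub> pad_d d i (k x)" using ex_eq[OF N' gc f] by blast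
    have "ex i N (\<lambda>x. g (h x)) = ex i N (\<lambda>x. f (h x))"
      using ex_eq[OF N _ c, of "\<lambda>x. g (h x)"] gc lin_comp[OF h] hc k lin_comp[OF h k(1)] by (auto simp: cocy_def)
    then show "coboundaries R Q d i N +>\<^bsub>Hom_mod R N (Q i)\<^esub> compose (carrier N) g h = ex i N (\<lambda>x. f (h x))"
      unfolding ex_def by (simp add: compose_def)
  qed
  then show "Ext_map R Q d i N N' h (ex i N' f) = ex i N (\<lambda>x. f (h x))"
    unfolding Ext_map_def using ex_closed[OF N' f] by simp
qed

end

section \<open>Cyclic modules\<close>

lemma cyc_module_props:
  assumes R: "cring R" and a: "ideal \<aa> R"
  shows "module R (cyc_module R \<aa>)" "lin R (reg_module R) (cyc_module R \<aa>) (\<lambda>r. \<aa> +>\<^bsub>R\<^esub> r)"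
  using quot_module_module[OF ideal_submod[OF R a] reg_module[OF R]] by simp_all

lemma cyc_carrier: "carrier (cyc_module R \<aa>) = (\<lambda>r. \<aa> +>\<^bsub>R\<^esub> r) ` carrier R"
  by (simp add: quot_carrier)

lemma cyc_smult_one:
  assumes R: "cring R" and a: "ideal \<aa> R" and r: "r \<in> carrier R"
  shows "r \<odot>\<^bsub>cyc_module R \<aa>\<^esub> (\<aa> +>\<^bsub>R\<^esub> \<one>\<^bsub>R\<^esub>) = \<aa> +>\<^bsub>R\<^esub> r"
proof -
  interpret cring R by fact
  show ?thesis using lin_smult[OF cyc_module_props(2)[OF R a] r, of "\<one>\<^bsub>R\<^esub>"] r by simp
qed

lemma cyc_one_closed: "cring R \<Longrightarrow> \<aa> +>\<^bsub>R\<^esub> \<one>\<^bsub>R\<^esub> \<in> carrier (cyc_module R \<aa>)"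
proof -
  assume "cring R"
  then interpret cring R .
  show ?thesis unfolding cyc_carrier by blast
qed

lemma orbit_map_coset:
  assumes N: "module R N" and a: "ideal \<aa> R" and x: "x \<in> killed N \<aa>" and r: "r \<in> carrier R"
  shows "orbit_map R N \<aa> x (\<aa> +>\<^bsub>R\<^esub> r) = r \<odot>\<^bsub>N\<^esub> x"
proof -
  interpret N: module R N by fact
  have xc: "x \<in> carrier N" using x by (simp add: killed_def)
  have "(\<lambda>r. r \<odot>\<^bsub>N\<^esub> x) ` (\<aa> +>\<^bsub>R\<^esub> r) = {r \<odot>\<^bsub>N\<^esub> x}"
  proof -
    have "(h \<oplus>\<^bsub>R\<^esub> r) \<odot>\<^bsub>N\<^esub> x = r \<odot>\<^bsub>N\<^esub> x" if "h \<in> \<aa>" for h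
      using that x ideal.Icarr[OF a that] r xc by (simp add: N.smult_l_distr killed_def)
    moreover have "r \<in> \<aa> +>\<^bsub>R\<^esub> r"
      using coset_self[OF ideal_submod[OF N.R.cring_axioms a] reg_module[OF N.R.cring_axioms], of r] r by simp
    ultimately show ?thesis by (auto simp: coset_mem image_iff) (metis coset_mem)
  qed
  then show ?thesis unfolding orbit_map_def cyc_carrier using r by simp
qed

lemma orbit_map_one:
  assumes N: "module R N" and a: "ideal \<aa> R" and x: "x \<in> killed N \<aa>"
  shows "orbit_map R N \<aa> x (\<aa> +>\<^bsub>R\<^esub> \<one>\<^bsub>R\<^esub>) = x"
proof -
  interpret N: module R N by fact
  show ?thesis using orbit_map_coset[OF N a x, of "\<one>\<^bsub>R\<^esub>"] x by (simp add: killed_def)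
qed

lemma orbit_map_lin:
  assumes N: "module R N" and a: "ideal \<aa> R" and x: "x \<in> killed N \<aa>"
  shows "lin R (cyc_module R \<aa>) N (orbit_map R N \<aa> x)"
proof -
  interpret N: module R N by fact
  have R: "cring R" by (rule N.R.cring_axioms)
  note c = cyc_module_props(2)[OF R a]
  have xc: "x \<in> carrier N" using x by (simp add: killed_def)
  show ?thesis
  proof (rule linI)
    fix X assume "X \<in> carrier (cyc_module R \<aa>)"
    then obtain r where r: "r \<in> carrier R" "X = \<aa> +>\<^bsub>R\<^esub> r" unfolding cyc_carrier by blast
    show "orbit_map R N \<aa> x X \<in> carrier N" unfolding r(2) using orbit_map_coset[OF N a x r(1)] r xc by simp
    { fix Y assume "Y \<in> carrier (cyc_module R \<aa>)"
      then obtain s where s: "s \<in> carrier R" "Y = \<aa> +>\<^bsub>R\<^esub> s" unfolding cyc_carrier by blast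
      have "X \<oplus>\<^bsub>cyc_module R \<aa>\<^esub> Y = \<aa> +>\<^bsub>R\<^esub> (r \<oplus>\<^bsub>R\<^esub> s)" unfolding r s using lin_add[OF c, of r s] r s by simp
      then show "orbit_map R N \<aa> x (X \<oplus>\<^bsub>cyc_module R \<aa>\<^esub> Y) = orbit_map R N \<aa> x X \<oplus>\<^bsub>N\<^esub> orbit_map R N \<aa> x Y"
        using orbit_map_coset[OF N a x] r s xc by (simp add: N.smult_l_distr) }
    fix t assume t: "t \<in> carrier R"
    have "t \<odot>\<^bsub>cyc_module R \<aa>\<^esub> X = \<aa> +>\<^bsub>R\<^esub> (t \<otimes>\<^bsub>R\<^esub> r)" unfolding r using lin_smult[OF c t, of r] r by simp
    then show "orbit_map R N \<aa> x (t \<odot>\<^bsub>cyc_module R \<aa>\<^esub> X) = t \<odot>\<^bsub>N\<^esub> orbit_map R N \<aa> x X"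
      using orbit_map_coset[OF N a x] r t xc by (simp add: N.smult_assoc1)
  qed
qed

text \<open>Evaluation at the class of 1 identifies Hom(R/\<aa>, N) with the elements killed by
  \<aa>; \<open>orbit_map\<close> is the inverse.\<close>

lemma lin_from_cyc:
  assumes N: "module R N" and a: "ideal \<aa> R" and f: "lin R (cyc_module R \<aa>) N f"
  shows "f (\<aa> +>\<^bsub>R\<^esub> \<one>\<^bsub>R\<^esub>) \<in> killed N \<aa>"
    and "X \<in> carrier (cyc_module R \<aa>) \<Longrightarrow> f X = orbit_map R N \<aa> (f (\<aa> +>\<^bsub>R\<^esub> \<one>\<^bsub>R\<^esub>)) X"
proof -
  interpret N: module R N by fact
  have R: "cring R" by (rule N.R.cring_axioms)
  have fr: "f (\<aa> +>\<^bsub>R\<^esub> r) = r \<odot>\<^bsub>N\<^esub> f (\<aa> +>\<^bsub>R\<^esub> \<one>\<^bsub>R\<^esub>)" if "r \<in> carrier R" for r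
    using lin_smult[OF f that cyc_one_closed[OF R]] cyc_smult_one[OF R a that] by simp
  have "r \<odot>\<^bsub>N\<^esub> f (\<aa> +>\<^bsub>R\<^esub> \<one>\<^bsub>R\<^esub>) = \<zero>\<^bsub>N\<^esub>" if r: "r \<in> \<aa>" for r
  proof -
    have rc: "r \<in> carrier R" by (rule ideal.Icarr[OF a r])
    have "\<aa> +>\<^bsub>R\<^esub> r = \<zero>\<^bsub>cyc_module R \<aa>\<^esub>"
      using coset_eq_sub[OF ideal_submod[OF R a] reg_module[OF R], of r] rc r by simp
    then show ?thesis using fr[OF rc] lin_zero[OF f cyc_module_props(1)[OF R a] N] by simp
  qed
  then show k: "f (\<aa> +>\<^bsub>R\<^esub> \<one>\<^bsub>R\<^esub>) \<in> killed N \<aa>" using lin_closed[OF f cyc_one_closed[OF R]] by (simp add: killed_def)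
  assume "X \<in> carrier (cyc_module R \<aa>)"
  then obtain r where r: "r \<in> carrier R" "X = \<aa> +>\<^bsub>R\<^esub> r" unfolding cyc_carrier by blast
  show "f X = orbit_map R N \<aa> (f (\<aa> +>\<^bsub>R\<^esub> \<one>\<^bsub>R\<^esub>)) X" unfolding r(2) using fr[OF r(1)] orbit_map_coset[OF N a k r(1)] by simp
qed

lemma cyc_proj_coset:
  assumes R: "cring R" and a: "ideal \<aa> R" and b: "ideal \<bb> R" and ab: "\<aa> \<subseteq> \<bb>" and r: "r \<in> carrier R"
  shows "cyc_proj R \<aa> \<bb> (\<aa> +>\<^bsub>R\<^esub> r) = \<bb> +>\<^bsub>R\<^esub> r"
proof -
  note Rm = reg_module[OF R]
  have "(\<Union>s\<in>\<aa> +>\<^bsub>R\<^esub> r. \<bb> +>\<^bsub>R\<^esub> s) = \<bb> +>\<^bsub>R\<^esub> r"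
  proof (rule UN_const_eq)
    show "r \<in> \<aa> +>\<^bsub>R\<^esub> r" using coset_self[OF ideal_submod[OF R a] Rm, of r] r by simp
    fix s assume "s \<in> \<aa> +>\<^bsub>R\<^esub> r"
    then have "s \<in> \<bb> +>\<^bsub>R\<^esub> r" using ab by (auto simp: coset_mem)
    then show "\<bb> +>\<^bsub>R\<^esub> s = \<bb> +>\<^bsub>R\<^esub> r" using coset_mem_eq(2)[OF ideal_submod[OF R b] Rm, of r s] r by simp
  qed
  then show ?thesis unfolding cyc_proj_def cyc_carrier using r by simp
qed

lemma cyc_proj_lin:
  assumes R: "cring R" and a: "ideal \<aa> R" and b: "ideal \<bb> R" and ab: "\<aa> \<subseteq> \<bb>"
  shows "lin R (cyc_module R \<aa>) (cyc_module R \<bb>) (cyc_proj R \<aa> \<bb>)"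
proof -
  interpret cring R by fact
  note ca = cyc_module_props(2)[OF R a] and cb = cyc_module_props(2)[OF R b]
  show ?thesis
  proof (rule linI)
    fix X assume "X \<in> carrier (cyc_module R \<aa>)"
    then obtain r where r: "r \<in> carrier R" "X = \<aa> +>\<^bsub>R\<^esub> r" unfolding cyc_carrier by blast
    show "cyc_proj R \<aa> \<bb> X \<in> carrier (cyc_module R \<bb>)" unfolding r(2) cyc_proj_coset[OF assms r(1)] cyc_carrier using r by blast
    { fix Y assume "Y \<in> carrier (cyc_module R \<aa>)"
      then obtain s where s: "s \<in> carrier R" "Y = \<aa> +>\<^bsub>R\<^esub> s" unfolding cyc_carrier by blast
      have "X \<oplus>\<^bsub>cyc_module R \<aa>\<^esub> Y = \<aa> +>\<^bsub>R\<^esub> (r \<oplus>\<^bsub>R\<^esub> s)" unfolding r s using lin_add[OF ca, of r s] r s by simp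
      then show "cyc_proj R \<aa> \<bb> (X \<oplus>\<^bsub>cyc_module R \<aa>\<^esub> Y) = cyc_proj R \<aa> \<bb> X \<oplus>\<^bsub>cyc_module R \<bb>\<^esub> cyc_proj R \<aa> \<bb> Y"
        unfolding r s using cyc_proj_coset[OF assms] r s lin_add[OF cb, of r s] by simp }
    fix t assume t: "t \<in> carrier R"
    have "t \<odot>\<^bsub>cyc_module R \<aa>\<^esub> X = \<aa> +>\<^bsub>R\<^esub> (t \<otimes>\<^bsub>R\<^esub> r)" unfolding r using lin_smult[OF ca t, of r] r by simp
    then show "cyc_proj R \<aa> \<bb> (t \<odot>\<^bsub>cyc_module R \<aa>\<^esub> X) = t \<odot>\<^bsub>cyc_module R \<bb>\<^esub> cyc_proj R \<aa> \<bb> X"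
      unfolding r using cyc_proj_coset[OF assms] r t lin_smult[OF cb t, of r] by simp
  qed
qed

section \<open>Local cohomology as the cohomology of the torsion complex\<close>

context inj_res
begin

text \<open>\<open>lcZ\<close> and \<open>lcB\<close> are the cocycles and coboundaries of degree i
  in the subcomplex of K-torsion elements. Through the padding \<open>lcB\<close> is zero in degree
  0.\<close>

definition lcZ where "lcZ K i = {z \<in> tors R K (Q i). d i z = \<zero>\<^bsub>Q (Suc i)\<^esub>}"

definition lcB where "lcB K i = pad_d d i ` tors R K (pad Q i)"

text \<open>Under evaluation at the class of 1 these are the cocycles of degree i of
  Hom(R/K^\<alpha>, Q).\<close>

definition kcyc where "kcyc K i \<alpha> = {z \<in> killed (Q i) (ideal_pow R K \<alpha>). d i z = \<zero>\<^bsub>Q (Suc i)\<^esub>}"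

text \<open>The class in \<open>Ext\<^sup>i(R/K\<^sup>\<alpha>, M)\<close> of a cocycle \<open>z\<close> that is killed by \<open>K\<^sup>\<alpha>\<close>, and the class of \<open>z\<close> in the
  direct limit.\<close>

definition en where "en K i \<alpha> z = ex i (cyc_module R (ideal_pow R K \<alpha>)) (orbit_map R (Q i) (ideal_pow R K \<alpha>) z)"

definition cl where
  "cl K i z = {(\<beta>, en K i \<beta> z') |\<beta> z'. z' \<in> kcyc K i \<beta> \<and> (\<exists>w\<in>tors R K (pad Q i). z = z' \<oplus>\<^bsub>Q i\<^esub> pad_d d i w)}"

context
  fixes K :: "'r set" and i :: nat
  assumes K: "ideal K R"
begin

lemma Kp: "ideal (ideal_pow R K \<alpha>) R"
  by (rule cring.ideal_pow_ideal[OF cR K])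

lemma Kc: "ideal_pow R K \<alpha> \<subseteq> carrier R"
  by (rule ideal_pow_carr[OF cR K])

lemma Km: "module R (cyc_module R (ideal_pow R K \<alpha>))"
  by (rule cyc_module_props(1)[OF cR Kp])

lemma kcyc_killed: "z \<in> kcyc K i \<alpha> \<Longrightarrow> z \<in> killed (Q i) (ideal_pow R K \<alpha>)"
  by (simp add: kcyc_def)

lemma kcyc_carrier: "z \<in> kcyc K i \<alpha> \<Longrightarrow> z \<in> carrier (Q i)"
  by (simp add: kcyc_def killed_def)

lemma kcyc_mono: "\<alpha> \<le> \<beta> \<Longrightarrow> z \<in> kcyc K i \<alpha> \<Longrightarrow> z \<in> kcyc K i \<beta>"
  using subsetD[OF killed_pow_mono[OF cR K], of \<alpha> \<beta> z "Q i"] by (simp add: kcyc_def)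

lemma lcZ_iff: "z \<in> lcZ K i \<longleftrightarrow> (\<exists>\<alpha>. z \<in> kcyc K i \<alpha>)"
  by (auto simp: lcZ_def kcyc_def tors_def)

lemma kcyc_submod: "submodule (kcyc K i \<alpha>) R (Q i)"
proof -
  have "kcyc K i \<alpha> = killed (Q i) (ideal_pow R K \<alpha>) \<inter> {z \<in> carrier (Q i). d i z = \<zero>\<^bsub>Q (Suc i)\<^esub>}"
    by (auto simp: kcyc_def killed_def)
  then show ?thesis using submod_inter[OF Qm killed_submod[OF Qm Kc] submod_ker[OF dl Qm Qm]] by metis
qed

lemma lcZ_submod: "submodule (lcZ K i) R (Q i)"
proof -
  have "lcZ K i = tors R K (Q i) \<inter> {z \<in> carrier (Q i). d i z = \<zero>\<^bsub>Q (Suc i)\<^esub>}"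
    by (auto simp: lcZ_def tors_def killed_def)
  then show ?thesis using submod_inter[OF Qm tors_submod[OF Qm K] submod_ker[OF dl Qm Qm]] by metis
qed

lemma pd: "lin R (pad Q i) (Q i) (pad_d d i)"
  using d[of i] by simp

lemma lcB_submod: "submodule (lcB K i) R (Q i)"
  unfolding lcB_def by (rule submod_image[OF pd m Qm tors_submod[OF m K]])

lemma lcB_sub: "lcB K i \<subseteq> lcZ K i"
proof
  fix z assume "z \<in> lcB K i"
  then obtain w where w: "w \<in> tors R K (pad Q i)" "z = pad_d d i w" by (auto simp: lcB_def)
  have "w \<in> carrier (pad Q i)" using w(1) submodD(1)[OF tors_submod[OF m K]] by blast
  then show "z \<in> lcZ K i" using w tors_lin[OF pd m Qm K] dd[of w i] by (simp add: lcZ_def)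
qed

lemma kcyc_cocy:
  assumes z: "z \<in> kcyc K i \<alpha>"
  shows "cocy i (cyc_module R (ideal_pow R K \<alpha>)) (orbit_map R (Q i) (ideal_pow R K \<alpha>) z)"
  unfolding cocy_def
proof (intro conjI ballI)
  show "lin R (cyc_module R (ideal_pow R K \<alpha>)) (Q i) (orbit_map R (Q i) (ideal_pow R K \<alpha>) z)"
    by (rule orbit_map_lin[OF Qm Kp kcyc_killed[OF z]])
  fix X assume "X \<in> carrier (cyc_module R (ideal_pow R K \<alpha>))"
  then obtain r where r: "r \<in> carrier R" "X = ideal_pow R K \<alpha> +>\<^bsub>R\<^esub> r" unfolding cyc_carrier by blast
  have "d i (r \<odot>\<^bsub>Q i\<^esub> z) = \<zero>\<^bsub>Q (Suc i)\<^esub>" using submodD(4)[OF kcyc_submod r(1) z] by (simp add: kcyc_def)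
  then show "d i (orbit_map R (Q i) (ideal_pow R K \<alpha>) z X) = \<zero>\<^bsub>Q (Suc i)\<^esub>"
    unfolding r(2) orbit_map_coset[OF Qm Kp kcyc_killed[OF z] r(1)] .
qed

lemma ex_cyc:
  assumes f: "cocy i (cyc_module R (ideal_pow R K \<alpha>)) f"
  shows "f (ideal_pow R K \<alpha> +>\<^bsub>R\<^esub> \<one>\<^bsub>R\<^esub>) \<in> kcyc K i \<alpha>"
    and "ex i (cyc_module R (ideal_pow R K \<alpha>)) f = en K i \<alpha> (f (ideal_pow R K \<alpha> +>\<^bsub>R\<^esub> \<one>\<^bsub>R\<^esub>))"
proof -
  have l: "lin R (cyc_module R (ideal_pow R K \<alpha>)) (Q i) f" using f by (simp add: cocy_def)
  show "f (ideal_pow R K \<alpha> +>\<^bsub>R\<^esub> \<one>\<^bsub>R\<^esub>) \<in> kcyc K i \<alpha>"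
    using lin_from_cyc(1)[OF Qm Kp l] f cyc_one_closed[OF cR] by (simp add: cocy_def kcyc_def)
  show "ex i (cyc_module R (ideal_pow R K \<alpha>)) f = en K i \<alpha> (f (ideal_pow R K \<alpha> +>\<^bsub>R\<^esub> \<one>\<^bsub>R\<^esub>))"
    unfolding en_def by (rule ex_cong) (rule lin_from_cyc(2)[OF Qm Kp l])
qed

lemma sys_carrier: "carrier (lc_system R Q d K i \<alpha>) = en K i \<alpha> ` kcyc K i \<alpha>"
proof -
  have "carrier (lc_system R Q d K i \<alpha>) = {ex i (cyc_module R (ideal_pow R K \<alpha>)) f |f. cocy i (cyc_module R (ideal_pow R K \<alpha>)) f}"
    unfolding lc_system_def by (rule Ext_carrier[OF Km])
  also have "\<dots> = en K i \<alpha> ` kcyc K i \<alpha>"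
  proof (intro equalityI subsetI)
    fix \<xi> assume "\<xi> \<in> {ex i (cyc_module R (ideal_pow R K \<alpha>)) f |f. cocy i (cyc_module R (ideal_pow R K \<alpha>)) f}"
    then obtain f where "\<xi> = ex i (cyc_module R (ideal_pow R K \<alpha>)) f" "cocy i (cyc_module R (ideal_pow R K \<alpha>)) f" by blast
    then show "\<xi> \<in> en K i \<alpha> ` kcyc K i \<alpha>" using ex_cyc by simp
  next
    fix \<xi> assume "\<xi> \<in> en K i \<alpha> ` kcyc K i \<alpha>"
    then obtain z where "\<xi> = en K i \<alpha> z" "z \<in> kcyc K i \<alpha>" by blast
    then show "\<xi> \<in> {ex i (cyc_module R (ideal_pow R K \<alpha>)) f |f. cocy i (cyc_module R (ideal_pow R K \<alpha>)) f}"
      using kcyc_cocy unfolding en_def by blast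
  qed
  finally show ?thesis .
qed

text \<open>A homomorphism from R/K^\<alpha> is its value at 1, so two classes agree exactly when
  their elements differ by the differential of an element killed by the same power of K.\<close>

lemma en_eq:
  assumes z: "z \<in> kcyc K i \<alpha>" and z': "z' \<in> kcyc K i \<alpha>"
  shows "en K i \<alpha> z = en K i \<alpha> z' \<longleftrightarrow> (\<exists>w\<in>killed (pad Q i) (ideal_pow R K \<alpha>). z = z' \<oplus>\<^bsub>Q i\<^esub> pad_d d i w)"
  unfolding en_def ex_eq[OF Km kcyc_cocy[OF z] kcyc_cocy[OF z']]
proof
  let ?A = "ideal_pow R K \<alpha>"
  assume "\<exists>h. lin R (cyc_module R ?A) (pad Q i) h \<and>
    (\<forall>X\<in>carrier (cyc_module R ?A). orbit_map R (Q i) ?A z X = orbit_map R (Q i) ?A z' X \<oplus>\<^bsub>Q i\<^esub> pad_d d i (h X))"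
  then obtain h where h: "lin R (cyc_module R ?A) (pad Q i) h"
    "\<forall>X\<in>carrier (cyc_module R ?A). orbit_map R (Q i) ?A z X = orbit_map R (Q i) ?A z' X \<oplus>\<^bsub>Q i\<^esub> pad_d d i (h X)" by blast
  have "z = z' \<oplus>\<^bsub>Q i\<^esub> pad_d d i (h (?A +>\<^bsub>R\<^esub> \<one>\<^bsub>R\<^esub>))"
    using bspec[OF h(2) cyc_one_closed[OF cR]] orbit_map_one[OF Qm Kp kcyc_killed[OF z]] orbit_map_one[OF Qm Kp kcyc_killed[OF z']] by simp
  then show "\<exists>w\<in>killed (pad Q i) ?A. z = z' \<oplus>\<^bsub>Q i\<^esub> pad_d d i w" using lin_from_cyc(1)[OF m Kp h(1)] by blast
next
  let ?A = "ideal_pow R K \<alpha>"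
  interpret Qi: module R "Q i" by (rule Qm)
  assume "\<exists>w\<in>killed (pad Q i) ?A. z = z' \<oplus>\<^bsub>Q i\<^esub> pad_d d i w"
  then obtain w where w: "w \<in> killed (pad Q i) ?A" "z = z' \<oplus>\<^bsub>Q i\<^esub> pad_d d i w" by blast
  have wc: "w \<in> carrier (pad Q i)" using w by (simp add: killed_def)
  have "orbit_map R (Q i) ?A z X = orbit_map R (Q i) ?A z' X \<oplus>\<^bsub>Q i\<^esub> pad_d d i (orbit_map R (pad Q i) ?A w X)"
    if Xc: "X \<in> carrier (cyc_module R ?A)" for X
  proof -
    obtain r where r: "r \<in> carrier R" "X = ?A +>\<^bsub>R\<^esub> r" using Xc unfolding cyc_carrier by blast
    have "r \<odot>\<^bsub>Q i\<^esub> z = r \<odot>\<^bsub>Q i\<^esub> z' \<oplus>\<^bsub>Q i\<^esub> r \<odot>\<^bsub>Q i\<^esub> pad_d d i w"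
      unfolding w(2) by (rule Qi.smult_r_distr[OF r(1) kcyc_carrier[OF z'] lin_closed[OF pd wc]])
    then show ?thesis unfolding r(2) orbit_map_coset[OF Qm Kp kcyc_killed[OF z] r(1)] orbit_map_coset[OF Qm Kp kcyc_killed[OF z'] r(1)]
        orbit_map_coset[OF m Kp w(1) r(1)] lin_smult[OF pd r(1) wc] .
  qed
  then show "\<exists>h. lin R (cyc_module R ?A) (pad Q i) h \<and>
    (\<forall>X\<in>carrier (cyc_module R ?A). orbit_map R (Q i) ?A z X = orbit_map R (Q i) ?A z' X \<oplus>\<^bsub>Q i\<^esub> pad_d d i (h X))"
    using orbit_map_lin[OF m Kp w(1)] by blast
qed

text \<open>In terms of values at 1 the transition maps are inclusions: an element killed by
  K^\<alpha> is also killed by K^\<beta>.\<close>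

lemma en_trans:
  assumes z: "z \<in> kcyc K i \<alpha>" and le: "\<alpha> \<le> \<beta>"
  shows "lc_trans R Q d K i \<alpha> \<beta> (en K i \<alpha> z) = en K i \<beta> z"
proof -
  let ?A = "ideal_pow R K \<alpha>" and ?B = "ideal_pow R K \<beta>"
  have BA: "?B \<subseteq> ?A" by (rule cring.ideal_pow_antimono[OF cR K le])
  note pl = cyc_proj_lin[OF cR Kp Kp BA]
  have c: "cocy i (cyc_module R ?B) (\<lambda>X. orbit_map R (Q i) ?A z (cyc_proj R ?B ?A X))"
    by (rule Ext_map_ex(2)[OF Km Km pl kcyc_cocy[OF z]])
  have one: "\<one>\<^bsub>R\<^esub> \<in> carrier R" using cR by (simp add: cring.cring_simprules(6))
  have "lc_trans R Q d K i \<alpha> \<beta> (en K i \<alpha> z) = ex i (cyc_module R ?B) (\<lambda>X. orbit_map R (Q i) ?A z (cyc_proj R ?B ?A X))"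
    unfolding lc_trans_def en_def by (rule Ext_map_ex(1)[OF Km Km pl kcyc_cocy[OF z]])
  also have "\<dots> = en K i \<beta> z"
    using ex_cyc(2)[OF c] unfolding cyc_proj_coset[OF cR Kp Kp BA one] orbit_map_one[OF Qm Kp kcyc_killed[OF z]] .
  finally show ?thesis .
qed

lemma en_add:
  assumes z: "z \<in> kcyc K i \<alpha>" and z': "z' \<in> kcyc K i \<alpha>"
  shows "en K i \<alpha> z \<oplus>\<^bsub>lc_system R Q d K i \<alpha>\<^esub> en K i \<alpha> z' = en K i \<alpha> (z \<oplus>\<^bsub>Q i\<^esub> z')"
proof -
  note c = cocy_add[OF Km kcyc_cocy[OF z] kcyc_cocy[OF z']]
  show ?thesis
    unfolding lc_system_def
    using ex_add[OF Km kcyc_cocy[OF z] kcyc_cocy[OF z']] ex_cyc(2)[OF c]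
      orbit_map_one[OF Qm Kp kcyc_killed[OF z]] orbit_map_one[OF Qm Kp kcyc_killed[OF z']] by (simp add: en_def)
qed

lemma en_smult:
  assumes z: "z \<in> kcyc K i \<alpha>" and r: "r \<in> carrier R"
  shows "r \<odot>\<^bsub>lc_system R Q d K i \<alpha>\<^esub> en K i \<alpha> z = en K i \<alpha> (r \<odot>\<^bsub>Q i\<^esub> z)"
proof -
  note c = cocy_smult[OF Km kcyc_cocy[OF z] r]
  show ?thesis
    unfolding lc_system_def
    using ex_smult[OF Km kcyc_cocy[OF z] r] ex_cyc(2)[OF c]
      orbit_map_one[OF Qm Kp kcyc_killed[OF z]] by (simp add: en_def)
qed

lemma diff_in_lcB:
  assumes "z \<in> carrier (Q i)" "z' \<in> carrier (Q i)"
  shows "(\<exists>w\<in>tors R K (pad Q i). z = z' \<oplus>\<^bsub>Q i\<^esub> pad_d d i w) \<longleftrightarrow> z \<ominus>\<^bsub>Q i\<^esub> z' \<in> lcB K i"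
proof -
  interpret Qi: module R "Q i" by (rule Qm)
  have "z = z' \<oplus>\<^bsub>Q i\<^esub> pad_d d i w \<longleftrightarrow> z \<ominus>\<^bsub>Q i\<^esub> z' = pad_d d i w" if w: "w \<in> tors R K (pad Q i)" for w
  proof -
    have c: "pad_d d i w \<in> carrier (Q i)" using lin_closed[OF pd] w submodD(1)[OF tors_submod[OF m K]] by blast
    show ?thesis
      using minus_add_cancel(2)[OF Qm assms] minus_add_cancel(3)[OF Qm c assms(2)] Qi.M.a_comm[OF c assms(2)] by metis
  qed
  then show ?thesis unfolding lcB_def by blast
qed

lemma cl_iff:
  assumes "z \<in> carrier (Q i)"
  shows "(\<beta>, \<xi>) \<in> cl K i z \<longleftrightarrow> (\<exists>z'\<in>kcyc K i \<beta>. \<xi> = en K i \<beta> z' \<and> z \<ominus>\<^bsub>Q i\<^esub> z' \<in> lcB K i)"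
proof -
  have "(\<beta>, \<xi>) \<in> cl K i z \<longleftrightarrow> (\<exists>z'\<in>kcyc K i \<beta>. \<xi> = en K i \<beta> z' \<and> (\<exists>w\<in>tors R K (pad Q i). z = z' \<oplus>\<^bsub>Q i\<^esub> pad_d d i w))"
    by (auto simp: cl_def)
  also have "\<dots> \<longleftrightarrow> (\<exists>z'\<in>kcyc K i \<beta>. \<xi> = en K i \<beta> z' \<and> z \<ominus>\<^bsub>Q i\<^esub> z' \<in> lcB K i)"
    by (rule bex_cong[OF refl]) (simp only: diff_in_lcB[OF assms kcyc_carrier])
  finally show ?thesis .
qed

lemma diff_trans:
  assumes "x \<in> carrier (Q i)" "y \<in> carrier (Q i)" "z \<in> carrier (Q i)" "x \<ominus>\<^bsub>Q i\<^esub> y \<in> lcB K i"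
  shows "x \<ominus>\<^bsub>Q i\<^esub> z \<in> lcB K i \<longleftrightarrow> y \<ominus>\<^bsub>Q i\<^esub> z \<in> lcB K i"
  using coset_eq[OF lcB_submod Qm] assms by metis

text \<open>Cocycles whose difference is the differential of a torsion element w become equal at the
  stage where their own exponents and an exponent that kills w are all reached. Hence the class in
  the limit consists of the pairs listed in \<open>cl\<close>.\<close>

lemma dlim_in_en:
  assumes z: "z \<in> kcyc K i \<alpha>"
  shows "dlim_in (lc_system R Q d K i) (lc_trans R Q d K i) \<alpha> (en K i \<alpha> z) = cl K i z"
proof (intro equalityI subsetI)
  note zc = kcyc_carrier[OF z]
  fix p assume "p \<in> dlim_in (lc_system R Q d K i) (lc_trans R Q d K i) \<alpha> (en K i \<alpha> z)"
  then obtain \<beta> y k where p: "p = (\<beta>, y)" "y \<in> carrier (lc_system R Q d K i \<beta>)" "\<alpha> \<le> k" "\<beta> \<le> k"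
    "lc_trans R Q d K i \<alpha> k (en K i \<alpha> z) = lc_trans R Q d K i \<beta> k y"
    unfolding dlim_in_def dlim_rel_def by auto
  then obtain z' where z': "z' \<in> kcyc K i \<beta>" "y = en K i \<beta> z'" unfolding sys_carrier by blast
  have "en K i k z = en K i k z'" using p(5) unfolding z'(2) en_trans[OF z p(3)] en_trans[OF z'(1) p(4)] .
  then have "\<exists>w\<in>tors R K (pad Q i). z = z' \<oplus>\<^bsub>Q i\<^esub> pad_d d i w"
    using en_eq[OF kcyc_mono[OF p(3) z] kcyc_mono[OF p(4) z'(1)]] by (auto simp: tors_def)
  then show "p \<in> cl K i z" unfolding p(1) cl_def using z' by blast
next
  fix p assume "p \<in> cl K i z"
  then obtain \<beta> z' w where p: "p = (\<beta>, en K i \<beta> z')" "z' \<in> kcyc K i \<beta>" "w \<in> tors R K (pad Q i)" "z = z' \<oplus>\<^bsub>Q i\<^esub> pad_d d i w"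
    unfolding cl_def by blast
  obtain \<gamma> where g: "w \<in> killed (pad Q i) (ideal_pow R K \<gamma>)" using p(3) by (auto simp: tors_def)
  let ?k = "max (max \<alpha> \<beta>) \<gamma>"
  have le: "\<alpha> \<le> ?k" "\<beta> \<le> ?k" "\<gamma> \<le> ?k" by auto
  have "w \<in> killed (pad Q i) (ideal_pow R K ?k)" by (rule subsetD[OF killed_pow_mono[OF cR K le(3)] g])
  then have "en K i ?k z = en K i ?k z'" using en_eq[OF kcyc_mono[OF le(1) z] kcyc_mono[OF le(2) p(2)]] p(4) by blast
  then have "lc_trans R Q d K i \<alpha> ?k (en K i \<alpha> z) = lc_trans R Q d K i \<beta> ?k (en K i \<beta> z')"
    unfolding en_trans[OF z le(1)] en_trans[OF p(2) le(2)] .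
  then show "p \<in> dlim_in (lc_system R Q d K i) (lc_trans R Q d K i) \<alpha> (en K i \<alpha> z)"
    unfolding dlim_in_def dlim_rel_def p(1) using le z p(2) unfolding sys_carrier by blast
qed

lemma cl_eq:
  assumes z: "z \<in> lcZ K i" and z': "z' \<in> lcZ K i"
  shows "cl K i z = cl K i z' \<longleftrightarrow> z \<ominus>\<^bsub>Q i\<^esub> z' \<in> lcB K i"
proof
  have c: "z \<in> carrier (Q i)" "z' \<in> carrier (Q i)" using assms subsetD[OF submodD(1)[OF lcZ_submod]] by simp_all
  { assume d: "z \<ominus>\<^bsub>Q i\<^esub> z' \<in> lcB K i"
    show "cl K i z = cl K i z'"
    proof (rule Set.set_eqI)
      fix p :: "nat \<times> ('r set \<Rightarrow> 'q) set"
      obtain \<beta> \<xi> where p: "p = (\<beta>, \<xi>)" by (cases p)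
      show "p \<in> cl K i z \<longleftrightarrow> p \<in> cl K i z'"
        unfolding p cl_iff[OF c(1)] cl_iff[OF c(2)] using diff_trans[OF c kcyc_carrier d] by blast
    qed }
  assume e: "cl K i z = cl K i z'"
  obtain \<alpha> where a: "z \<in> kcyc K i \<alpha>" using z lcZ_iff by blast
  interpret Qi: module R "Q i" by (rule Qm)
  have "z \<ominus>\<^bsub>Q i\<^esub> z = \<zero>\<^bsub>Q i\<^esub>" using minus_eq_zero_iff[OF Qm c(1,1)] by simp
  then have "(\<alpha>, en K i \<alpha> z) \<in> cl K i z" unfolding cl_iff[OF c(1)] using a submodD(2)[OF lcB_submod] by auto
  then obtain z'' where z'': "z'' \<in> kcyc K i \<alpha>" "en K i \<alpha> z = en K i \<alpha> z''" "z' \<ominus>\<^bsub>Q i\<^esub> z'' \<in> lcB K i"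
    unfolding e cl_iff[OF c(2)] by blast
  then have "\<exists>w\<in>tors R K (pad Q i). z = z'' \<oplus>\<^bsub>Q i\<^esub> pad_d d i w" using en_eq[OF a z''(1)] by (auto simp: tors_def)
  then have "z \<ominus>\<^bsub>Q i\<^esub> z'' \<in> lcB K i" using diff_in_lcB[OF c(1) kcyc_carrier[OF z''(1)]] by simp
  then show "z \<ominus>\<^bsub>Q i\<^esub> z' \<in> lcB K i"
    using z''(3) coset_eq[OF lcB_submod Qm] c kcyc_carrier[OF z''(1)] by metis
qed

lemma lc_carrier: "carrier (loc_coh R Q d K i) = cl K i ` lcZ K i"
proof -
  have "carrier (loc_coh R Q d K i) = {dlim_in (lc_system R Q d K i) (lc_trans R Q d K i) \<alpha> \<xi> |\<alpha> \<xi>. \<xi> \<in> en K i \<alpha> ` kcyc K i \<alpha>}"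
    unfolding loc_coh_def direct_limit_def using sys_carrier by simp
  also have "\<dots> = cl K i ` lcZ K i"
  proof (intro equalityI subsetI)
    fix X assume "X \<in> {dlim_in (lc_system R Q d K i) (lc_trans R Q d K i) \<alpha> \<xi> |\<alpha> \<xi>. \<xi> \<in> en K i \<alpha> ` kcyc K i \<alpha>}"
    then obtain \<alpha> z where z: "z \<in> kcyc K i \<alpha>" "X = dlim_in (lc_system R Q d K i) (lc_trans R Q d K i) \<alpha> (en K i \<alpha> z)" by blast
    then show "X \<in> cl K i ` lcZ K i" using dlim_in_en[OF z(1)] lcZ_iff by blast
  next
    fix X assume "X \<in> cl K i ` lcZ K i"
    then obtain z where z: "z \<in> lcZ K i" "X = cl K i z" by blast
    then obtain \<alpha> where a: "z \<in> kcyc K i \<alpha>" using lcZ_iff by blast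
    show "X \<in> {dlim_in (lc_system R Q d K i) (lc_trans R Q d K i) \<alpha> \<xi> |\<alpha> \<xi>. \<xi> \<in> en K i \<alpha> ` kcyc K i \<alpha>}"
      using dlim_in_en[OF a] z(2) a by blast
  qed
  finally show ?thesis .
qed

lemma cl_mem:
  assumes z: "z \<in> lcZ K i" and p: "(\<beta>, \<xi>) \<in> cl K i z"
  shows "\<exists>z'\<in>kcyc K i \<beta>. \<xi> = en K i \<beta> z' \<and> cl K i z' = cl K i z"
proof -
  have zc: "z \<in> carrier (Q i)" using z submodD(1)[OF lcZ_submod] by auto
  obtain z' where z': "z' \<in> kcyc K i \<beta>" "\<xi> = en K i \<beta> z'" "z \<ominus>\<^bsub>Q i\<^esub> z' \<in> lcB K i" using p cl_iff[OF zc] by blast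
  then have "cl K i z = cl K i z'" using cl_eq[OF z, of z'] lcZ_iff by blast
  then show ?thesis using z' by metis
qed

lemma cl_self:
  assumes "z \<in> kcyc K i \<alpha>"
  shows "(\<alpha>, en K i \<alpha> z) \<in> cl K i z"
  using cl_iff[OF kcyc_carrier[OF assms]] assms submodD(2)[OF lcB_submod] minus_eq_zero_iff[OF Qm kcyc_carrier[OF assms] kcyc_carrier[OF assms]] by auto

lemma cl_add:
  assumes z: "z \<in> lcZ K i" and z': "z' \<in> lcZ K i"
  shows "cl K i z \<oplus>\<^bsub>loc_coh R Q d K i\<^esub> cl K i z' = cl K i (z \<oplus>\<^bsub>Q i\<^esub> z')"
proof -
  obtain \<alpha> \<beta> where a: "z \<in> kcyc K i \<alpha>" and b: "z' \<in> kcyc K i \<beta>" using z z' lcZ_iff by blast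
  interpret Qi: module R "Q i" by (rule Qm)
  have "dlim_in (lc_system R Q d K i) (lc_trans R Q d K i) (max \<alpha> \<beta>)
      (lc_trans R Q d K i \<alpha> (max \<alpha> \<beta>) \<xi> \<oplus>\<^bsub>lc_system R Q d K i (max \<alpha> \<beta>)\<^esub> lc_trans R Q d K i \<beta> (max \<alpha> \<beta>) \<zeta>) = cl K i (z \<oplus>\<^bsub>Q i\<^esub> z')"
    if m: "(\<alpha>, \<xi>) \<in> cl K i z" "(\<beta>, \<zeta>) \<in> cl K i z'" for \<alpha> \<xi> \<beta> \<zeta>
  proof -
    obtain x where x: "x \<in> kcyc K i \<alpha>" "\<xi> = en K i \<alpha> x" "cl K i x = cl K i z" using cl_mem[OF z m(1)] by blast
    obtain y where y: "y \<in> kcyc K i \<beta>" "\<zeta> = en K i \<beta> y" "cl K i y = cl K i z'" using cl_mem[OF z' m(2)] by blast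
    let ?k = "max \<alpha> \<beta>"
    have xk: "x \<in> kcyc K i ?k" and yk: "y \<in> kcyc K i ?k" using x y kcyc_mono[of \<alpha> ?k] kcyc_mono[of \<beta> ?k] by auto
    have xy: "x \<oplus>\<^bsub>Q i\<^esub> y \<in> kcyc K i ?k" by (rule submodD(3)[OF kcyc_submod xk yk])
    have "dlim_in (lc_system R Q d K i) (lc_trans R Q d K i) ?k
      (lc_trans R Q d K i \<alpha> ?k \<xi> \<oplus>\<^bsub>lc_system R Q d K i ?k\<^esub> lc_trans R Q d K i \<beta> ?k \<zeta>) = cl K i (x \<oplus>\<^bsub>Q i\<^esub> y)"
      unfolding x(2) y(2) en_trans[OF x(1) max.cobounded1] en_trans[OF y(1) max.cobounded2] en_add[OF xk yk] by (rule dlim_in_en[OF xy])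
    also have "\<dots> = cl K i (z \<oplus>\<^bsub>Q i\<^esub> z')"
    proof -
      have Z: "x \<in> lcZ K i" "y \<in> lcZ K i" using x(1) y(1) lcZ_iff by blast+
      have c: "x \<in> carrier (Q i)" "y \<in> carrier (Q i)" "z \<in> carrier (Q i)" "z' \<in> carrier (Q i)" using Z z z' submodD(1)[OF lcZ_submod] by auto
      have "x \<ominus>\<^bsub>Q i\<^esub> z \<in> lcB K i" "y \<ominus>\<^bsub>Q i\<^esub> z' \<in> lcB K i" using x(3) y(3) cl_eq Z z z' by blast+
      then have "(x \<ominus>\<^bsub>Q i\<^esub> z) \<oplus>\<^bsub>Q i\<^esub> (y \<ominus>\<^bsub>Q i\<^esub> z') \<in> lcB K i" by (rule submodD(3)[OF lcB_submod])
      moreover have "(x \<ominus>\<^bsub>Q i\<^esub> z) \<oplus>\<^bsub>Q i\<^esub> (y \<ominus>\<^bsub>Q i\<^esub> z') = (x \<oplus>\<^bsub>Q i\<^esub> y) \<ominus>\<^bsub>Q i\<^esub> (z \<oplus>\<^bsub>Q i\<^esub> z')"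
        using c by (simp add: a_minus_def Qi.M.minus_add Qi.M.a_ac)
      ultimately show ?thesis using cl_eq submodD(3)[OF lcZ_submod] Z z z' by simp
    qed
    finally show ?thesis .
  qed
  then have "(\<Union>(\<alpha>, \<xi>)\<in>cl K i z. \<Union>(\<beta>, \<zeta>)\<in>cl K i z'. dlim_in (lc_system R Q d K i) (lc_trans R Q d K i) (max \<alpha> \<beta>)
      (lc_trans R Q d K i \<alpha> (max \<alpha> \<beta>) \<xi> \<oplus>\<^bsub>lc_system R Q d K i (max \<alpha> \<beta>)\<^esub> lc_trans R Q d K i \<beta> (max \<alpha> \<beta>) \<zeta>)) = cl K i (z \<oplus>\<^bsub>Q i\<^esub> z')"
    by (rule UN_const_eq2[OF cl_self[OF a] cl_self[OF b]])
  then show ?thesis by (simp add: loc_coh_def direct_limit_def)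
qed

lemma UN_const_eq_pair: "(a, b) \<in> X \<Longrightarrow> (\<And>x y. (x, y) \<in> X \<Longrightarrow> f x y = c) \<Longrightarrow> (\<Union>(x, y)\<in>X. f x y) = c"
  by (rule UN_const_eq[of "(a, b)"]) auto

lemma cl_smult:
  assumes z: "z \<in> lcZ K i" and r: "r \<in> carrier R"
  shows "r \<odot>\<^bsub>loc_coh R Q d K i\<^esub> cl K i z = cl K i (r \<odot>\<^bsub>Q i\<^esub> z)"
proof -
  obtain \<alpha> where a: "z \<in> kcyc K i \<alpha>" using z lcZ_iff by blast
  have "(\<Union>(\<alpha>, \<xi>)\<in>cl K i z. dlim_in (lc_system R Q d K i) (lc_trans R Q d K i) \<alpha> (r \<odot>\<^bsub>lc_system R Q d K i \<alpha>\<^esub> \<xi>)) = cl K i (r \<odot>\<^bsub>Q i\<^esub> z)"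
  proof (rule UN_const_eq_pair[OF cl_self[OF a]])
    fix \<beta> \<xi> assume "(\<beta>, \<xi>) \<in> cl K i z"
    then obtain x where x: "x \<in> kcyc K i \<beta>" "\<xi> = en K i \<beta> x" "cl K i x = cl K i z" using cl_mem[OF z] by blast
    have Z: "x \<in> lcZ K i" using x(1) lcZ_iff by blast
    have c: "x \<in> carrier (Q i)" "z \<in> carrier (Q i)" using Z z submodD(1)[OF lcZ_submod] by auto
    have "x \<ominus>\<^bsub>Q i\<^esub> z \<in> lcB K i" using x(3) cl_eq Z z by blast
    then have "r \<odot>\<^bsub>Q i\<^esub> x \<ominus>\<^bsub>Q i\<^esub> r \<odot>\<^bsub>Q i\<^esub> z \<in> lcB K i"
      using submodD(4)[OF lcB_submod r] smult_diff[OF Qm r c] by metis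
    then have "cl K i (r \<odot>\<^bsub>Q i\<^esub> x) = cl K i (r \<odot>\<^bsub>Q i\<^esub> z)" using cl_eq submodD(4)[OF lcZ_submod r] Z z by blast
    then show "dlim_in (lc_system R Q d K i) (lc_trans R Q d K i) \<beta> (r \<odot>\<^bsub>lc_system R Q d K i \<beta>\<^esub> \<xi>) = cl K i (r \<odot>\<^bsub>Q i\<^esub> z)"
      unfolding x(2) en_smult[OF x(1) r] using dlim_in_en[OF submodD(4)[OF kcyc_submod r x(1)]] by simp
  qed
  then show ?thesis by (simp add: loc_coh_def direct_limit_def)
qed

lemma cl_zero: "\<zero>\<^bsub>loc_coh R Q d K i\<^esub> = cl K i \<zero>\<^bsub>Q i\<^esub>"
proof -
  have z: "\<zero>\<^bsub>Q i\<^esub> \<in> kcyc K i 0" by (rule submodD(2)[OF kcyc_submod])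
  interpret Qi: module R "Q i" by (rule Qm)
  interpret S: module R "lc_system R Q d K i 0" unfolding lc_system_def by (rule Ext_module[OF Km])
  have c: "en K i 0 \<zero>\<^bsub>Q i\<^esub> \<in> carrier (lc_system R Q d K i 0)" unfolding sys_carrier using z by blast
  have "\<zero>\<^bsub>R\<^esub> \<odot>\<^bsub>lc_system R Q d K i 0\<^esub> en K i 0 \<zero>\<^bsub>Q i\<^esub> = en K i 0 \<zero>\<^bsub>Q i\<^esub>"
    using en_smult[OF z, of "\<zero>\<^bsub>R\<^esub>"] Qi.R.zero_closed by simp
  then have "\<zero>\<^bsub>lc_system R Q d K i 0\<^esub> = en K i 0 \<zero>\<^bsub>Q i\<^esub>" using S.smult_l_null[OF c] by simp
  then show ?thesis using dlim_in_en[OF z] by (simp add: loc_coh_def direct_limit_def)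
qed

lemma lc_module: "module R (loc_coh R Q d K i)"
  and cl_lin: "lin R ((Q i)\<lparr>carrier := lcZ K i\<rparr>) (loc_coh R Q d K i) (cl K i)"
proof -
  note mZ = submod_module[OF lcZ_submod Qm]
  note im = module_image[OF mZ, of "loc_coh R Q d K i" "cl K i"]
  show "module R (loc_coh R Q d K i)" by (rule im(1)) (simp_all add: lc_carrier cl_add cl_smult cl_zero)
  show "lin R ((Q i)\<lparr>carrier := lcZ K i\<rparr>) (loc_coh R Q d K i) (cl K i)" by (rule im(2)) (simp_all add: lc_carrier cl_add cl_smult cl_zero)
qed

lemma cl_zero_iff: "z \<in> lcZ K i \<Longrightarrow> cl K i z = \<zero>\<^bsub>loc_coh R Q d K i\<^esub> \<longleftrightarrow> z \<in> lcB K i"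
  unfolding cl_zero using cl_eq[OF _ submodD(2)[OF lcZ_submod], of z] minus_zero_right[OF Qm, of z i] submodD(1)[OF lcZ_submod] by auto

text \<open>Representing cocycles are torsion elements of Q and \<open>cl\<close> is linear. This is
  what allows \<open>Ext_to_Hom\<close> to be applied with the local cohomology module itself as
  N.\<close>

lemma lc_tors: "tors R K (loc_coh R Q d K i) = carrier (loc_coh R Q d K i)"
proof
  show "tors R K (loc_coh R Q d K i) \<subseteq> carrier (loc_coh R Q d K i)" by (rule submodD(1)[OF tors_submod[OF lc_module K]])
  have mZ: "module R ((Q i)\<lparr>carrier := lcZ K i\<rparr>)" by (rule submod_module[OF lcZ_submod Qm])
  show "carrier (loc_coh R Q d K i) \<subseteq> tors R K (loc_coh R Q d K i)"
  proof
    fix x assume "x \<in> carrier (loc_coh R Q d K i)"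
    then obtain z where z: "z \<in> lcZ K i" "x = cl K i z" unfolding lc_carrier by blast
    then have "z \<in> tors R K ((Q i)\<lparr>carrier := lcZ K i\<rparr>)" by (auto simp: lcZ_def tors_def killed_def)
    then show "x \<in> tors R K (loc_coh R Q d K i)" unfolding z(2) by (rule tors_lin[OF cl_lin mZ lc_module K])
  qed
qed

text \<open>The pullback of f along r \<mapsto> r x has value f x at 1, and f x is killed by every
  power of K that kills x. The union over the exponents is therefore the single class of f
  x.\<close>

lemma Ext_to_Hom_ex:
  assumes N: "module R N" and f: "cocy i N f" and x: "x \<in> tors R K N"
  shows "Ext_to_Hom R Q d K i N (ex i N f) x = cl K i (f x)" "f x \<in> lcZ K i"
proof -
  have xc: "x \<in> carrier N" using x submodD(1)[OF tors_submod[OF N K]] by blast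
  have fl: "lin R N (Q i) f" using f by (simp add: cocy_def)
  have kc: "f x \<in> kcyc K i \<alpha>" if "x \<in> killed N (ideal_pow R K \<alpha>)" for \<alpha>
    using killed_lin[OF fl N Qm Kc that] f xc by (simp add: kcyc_def cocy_def)
  obtain \<alpha>0 where a0: "x \<in> killed N (ideal_pow R K \<alpha>0)" using x by (auto simp: tors_def)
  show "f x \<in> lcZ K i" using kc[OF a0] lcZ_iff by blast
  have one: "\<one>\<^bsub>R\<^esub> \<in> carrier R" using cR by (simp add: cring.cring_simprules(6))
  have "(\<Union>\<alpha>\<in>{\<alpha>. \<forall>a\<in>ideal_pow R K \<alpha>. a \<odot>\<^bsub>N\<^esub> x = \<zero>\<^bsub>N\<^esub>}.
       dlim_in (lc_system R Q d K i) (lc_trans R Q d K i) \<alpha>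
         (Ext_map R Q d i (cyc_module R (ideal_pow R K \<alpha>)) N (orbit_map R N (ideal_pow R K \<alpha>) x) (ex i N f))) = cl K i (f x)"
  proof (rule UN_const_eq)
    show "\<alpha>0 \<in> {\<alpha>. \<forall>a\<in>ideal_pow R K \<alpha>. a \<odot>\<^bsub>N\<^esub> x = \<zero>\<^bsub>N\<^esub>}" using a0 by (simp add: killed_def)
    fix \<alpha> assume "\<alpha> \<in> {\<alpha>. \<forall>a\<in>ideal_pow R K \<alpha>. a \<odot>\<^bsub>N\<^esub> x = \<zero>\<^bsub>N\<^esub>}"
    then have k: "x \<in> killed N (ideal_pow R K \<alpha>)" using xc by (simp add: killed_def)
    note e = Ext_map_ex[OF Km N orbit_map_lin[OF N Kp k] f]
    have "Ext_map R Q d i (cyc_module R (ideal_pow R K \<alpha>)) N (orbit_map R N (ideal_pow R K \<alpha>) x) (ex i N f) = en K i \<alpha> (f x)"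
      unfolding e(1) using ex_cyc(2)[OF e(2)] unfolding orbit_map_one[OF N Kp k] .
    then show "dlim_in (lc_system R Q d K i) (lc_trans R Q d K i) \<alpha>
         (Ext_map R Q d i (cyc_module R (ideal_pow R K \<alpha>)) N (orbit_map R N (ideal_pow R K \<alpha>) x) (ex i N f)) = cl K i (f x)"
      using dlim_in_en[OF kc[OF k]] by simp
  qed
  then show "Ext_to_Hom R Q d K i N (ex i N f) x = cl K i (f x)"
    unfolding Ext_to_Hom_def using ex_closed[OF N f] xc by simp
qed

end

text \<open>As J^\<alpha> is contained in I^\<alpha>, an element killed by the latter is killed by
  the former. In terms of torsion complexes the comparison map is induced by the inclusion of
  I-torsion into J-torsion.\<close>

lemma lc_incl_cl:
  assumes I: "ideal I R" and J: "ideal J R" and JI: "J \<subseteq> I" and z: "z \<in> lcZ I i"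
  shows "lc_incl R Q d I J i (cl I i z) = cl J i z" "z \<in> lcZ J i"
proof -
  have k: "x \<in> kcyc J i \<alpha>" if "x \<in> kcyc I i \<alpha>" for x \<alpha>
    using that subsetD[OF killed_antimono[OF cring.ideal_pow_mono[OF cR JI]], of x "Q i" \<alpha>] by (simp add: kcyc_def)
  have t: "lcB I i \<subseteq> lcB J i"
    unfolding lcB_def tors_def by (intro image_mono UN_mono subset_refl killed_antimono cring.ideal_pow_mono[OF cR JI])
  obtain \<alpha>0 where a0: "z \<in> kcyc I i \<alpha>0" using z lcZ_iff[OF I] by blast
  show zJ: "z \<in> lcZ J i" using k[OF a0] lcZ_iff[OF J] by blast
  have one: "\<one>\<^bsub>R\<^esub> \<in> carrier R" using cR by (simp add: cring.cring_simprules(6))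
  have "(\<Union>(\<alpha>, \<xi>)\<in>cl I i z. dlim_in (lc_system R Q d J i) (lc_trans R Q d J i) \<alpha>
       (Ext_map R Q d i (cyc_module R (ideal_pow R J \<alpha>)) (cyc_module R (ideal_pow R I \<alpha>))
          (cyc_proj R (ideal_pow R J \<alpha>) (ideal_pow R I \<alpha>)) \<xi>)) = cl J i z"
  proof (rule UN_const_eq_pair[OF I cl_self[OF I a0]])
    fix \<alpha> \<xi> assume "(\<alpha>, \<xi>) \<in> cl I i z"
    then obtain x where x: "x \<in> kcyc I i \<alpha>" "\<xi> = en I i \<alpha> x" "cl I i x = cl I i z" using cl_mem[OF I z] by blast
    let ?A = "ideal_pow R I \<alpha>" and ?B = "ideal_pow R J \<alpha>"
    have BA: "?B \<subseteq> ?A" by (rule cring.ideal_pow_mono[OF cR JI])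
    note pl = cyc_proj_lin[OF cR Kp[OF J] Kp[OF I] BA]
    note e = Ext_map_ex[OF Km[OF J] Km[OF I] pl kcyc_cocy[OF I x(1)]]
    have "Ext_map R Q d i (cyc_module R ?B) (cyc_module R ?A) (cyc_proj R ?B ?A) \<xi> = en J i \<alpha> x"
      unfolding x(2) en_def[of I] e(1) using ex_cyc(2)[OF J e(2)]
      unfolding cyc_proj_coset[OF cR Kp[OF J] Kp[OF I] BA one] orbit_map_one[OF Qm Kp[OF I] kcyc_killed[OF I x(1)]] .
    moreover have "cl J i x = cl J i z"
      using x(3) cl_eq[OF I _ z, of x] cl_eq[OF J _ zJ, of x] x(1) k[OF x(1)] t lcZ_iff[OF I] lcZ_iff[OF J] by blast
    ultimately show "dlim_in (lc_system R Q d J i) (lc_trans R Q d J i) \<alpha>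
       (Ext_map R Q d i (cyc_module R ?B) (cyc_module R ?A) (cyc_proj R ?B ?A) \<xi>) = cl J i z"
      using dlim_in_en[OF J k[OF x(1)]] by simp
  qed
  then show "lc_incl R Q d I J i (cl I i z) = cl J i z"
    unfolding lc_incl_def lc_carrier[OF I] using z by simp
qed

end

section \<open>Factorization over surjections, associated primes, and elementwise torsion\<close>

lemma lin_factor_surj:
  assumes A: "module R A" and B: "module R B" and C: "module R C" and f: "lin R A B f" and g: "lin R A C g"
    and surj: "f ` carrier A = carrier B" and ker: "\<And>x. x \<in> carrier A \<Longrightarrow> f x = \<zero>\<^bsub>B\<^esub> \<Longrightarrow> g x = \<zero>\<^bsub>C\<^esub>"
  shows "\<exists>s. lin R B C s \<and> (\<forall>x\<in>carrier A. s (f x) = g x)"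
proof -
  interpret A: module R A by fact
  interpret B: module R B by fact
  define r where "r y = (SOME x. x \<in> carrier A \<and> f x = y)" for y
  have r: "r y \<in> carrier A \<and> f (r y) = y" if "y \<in> carrier B" for y
    unfolding r_def
  proof (rule someI_ex)
    have "y \<in> f ` carrier A" using that surj by simp
    then show "\<exists>x. x \<in> carrier A \<and> f x = y" by auto
  qed
  have e: "g (r (f x)) = g x" if x: "x \<in> carrier A" for x
  proof -
    have fx: "f x \<in> carrier B" by (rule lin_closed[OF f x])
    have "f (r (f x) \<ominus>\<^bsub>A\<^esub> x) = \<zero>\<^bsub>B\<^esub>"
      using lin_diff[OF f A B _ x, of "r (f x)"] r[OF fx] minus_eq_zero_iff[OF B fx fx] by simp
    then have "g (r (f x) \<ominus>\<^bsub>A\<^esub> x) = \<zero>\<^bsub>C\<^esub>" by (intro ker minus_closed[OF A]) (use r[OF fx] x in auto)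
    then show ?thesis using lin_diff[OF g A C _ x, of "r (f x)"] r[OF fx] minus_eq_zero_iff[OF C lin_closed[OF g] lin_closed[OF g x]] by simp
  qed
  have "lin R B C (\<lambda>y. g (r y))"
  proof (rule linI)
    fix y assume y: "y \<in> carrier B"
    show "g (r y) \<in> carrier C" using lin_closed[OF g] r[OF y] by blast
    show "g (r (y \<oplus>\<^bsub>B\<^esub> y')) = g (r y) \<oplus>\<^bsub>C\<^esub> g (r y')" if y': "y' \<in> carrier B" for y'
      using e[of "r y \<oplus>\<^bsub>A\<^esub> r y'"] r[OF y] r[OF y'] lin_add[OF f] lin_add[OF g] by simp
    show "g (r (t \<odot>\<^bsub>B\<^esub> y)) = t \<odot>\<^bsub>C\<^esub> g (r y)" if t: "t \<in> carrier R" for t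
      using e[of "t \<odot>\<^bsub>A\<^esub> r y"] r[OF y] lin_smult[OF f t] lin_smult[OF g t] t by simp
  qed
  then show ?thesis using e by blast
qed

lemma killed_sub [simp]: "N \<subseteq> carrier A \<Longrightarrow> killed (A\<lparr>carrier := N\<rparr>) \<aa> = killed A \<aa> \<inter> N"
  by (auto simp: killed_def)

text \<open>Among the multiples y of x that no power of a kills, choose one with maximal
  annihilator. If s t kills y but t does not, then no power of a kills t y either, because a^k y has
  the same annihilator as y. By maximality t y has that annihilator too, and it contains s.\<close>

lemma assoc_prime:
  assumes N: "noetherian_ring R" and A: "module R A" and a: "a \<in> carrier R" and x: "x \<in> carrier A"
    and nz: "\<And>k::nat. a [^]\<^bsub>R\<^esub> k \<odot>\<^bsub>A\<^esub> x \<noteq> \<zero>\<^bsub>A\<^esub>"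
  shows "\<exists>r\<in>carrier R. primeideal {t \<in> carrier R. t \<odot>\<^bsub>A\<^esub> (r \<odot>\<^bsub>A\<^esub> x) = \<zero>\<^bsub>A\<^esub>} R \<and> a \<notin> {t \<in> carrier R. t \<odot>\<^bsub>A\<^esub> (r \<odot>\<^bsub>A\<^esub> x) = \<zero>\<^bsub>A\<^esub>}"
proof -
  interpret A: module R A by fact
  have R: "cring R" by (rule module_cring[OF A])
  define ann where "ann y = {t \<in> carrier R. t \<odot>\<^bsub>A\<^esub> y = \<zero>\<^bsub>A\<^esub>}" for y
  define F where "F = {y. \<exists>r\<in>carrier R. y = r \<odot>\<^bsub>A\<^esub> x \<and> (\<forall>k::nat. a [^]\<^bsub>R\<^esub> k \<odot>\<^bsub>A\<^esub> y \<noteq> \<zero>\<^bsub>A\<^esub>)}"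
  have Fc: "y \<in> carrier A" if "y \<in> F" for y using that x by (auto simp: F_def)
  have annI: "ideal (ann y) R" if "y \<in> carrier A" for y
    using submod_ideal[OF R submod_ker[OF lin_orbit[OF A that] reg_module[OF R] A]] by (simp add: ann_def)
  have "\<one>\<^bsub>R\<^esub> \<odot>\<^bsub>A\<^esub> x \<in> F" using nz x by (auto simp: F_def intro!: bexI[of _ "\<one>\<^bsub>R\<^esub>"])
  then have "ann ` F \<noteq> {}" by blast
  then have "\<exists>I\<in>ann ` F. \<forall>J\<in>ann ` F. I \<subseteq> J \<longrightarrow> J = I"
    by (rule noetherian_maximal[OF N]) (use annI Fc in auto)
  then obtain y where y: "y \<in> F" and mx: "\<And>y'. y' \<in> F \<Longrightarrow> ann y \<subseteq> ann y' \<Longrightarrow> ann y' = ann y" by blast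
  obtain r where r: "r \<in> carrier R" "y = r \<odot>\<^bsub>A\<^esub> x" and yk: "\<And>k::nat. a [^]\<^bsub>R\<^esub> k \<odot>\<^bsub>A\<^esub> y \<noteq> \<zero>\<^bsub>A\<^esub>" using y unfolding F_def by blast
  have yc: "y \<in> carrier A" by (rule Fc[OF y])
  have mul: "ann y \<subseteq> ann (t \<odot>\<^bsub>A\<^esub> y)" if t: "t \<in> carrier R" for t
    using smult_commute[OF A _ t yc] t by (auto simp: ann_def)
  have ay: "ann (a [^]\<^bsub>R\<^esub> k \<odot>\<^bsub>A\<^esub> y) = ann y" for k :: nat
  proof (rule mx[OF _ mul])
    have "a [^]\<^bsub>R\<^esub> j \<odot>\<^bsub>A\<^esub> (a [^]\<^bsub>R\<^esub> k \<odot>\<^bsub>A\<^esub> y) \<noteq> \<zero>\<^bsub>A\<^esub>" for j :: nat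
      using yk[of "j + k"] a yc by (simp add: A.R.nat_pow_mult[symmetric] A.smult_assoc1)
    moreover have "a [^]\<^bsub>R\<^esub> k \<odot>\<^bsub>A\<^esub> y = (a [^]\<^bsub>R\<^esub> k \<otimes>\<^bsub>R\<^esub> r) \<odot>\<^bsub>A\<^esub> x" using a r x by (simp add: A.smult_assoc1)
    ultimately show "a [^]\<^bsub>R\<^esub> k \<odot>\<^bsub>A\<^esub> y \<in> F" unfolding F_def using a r by blast
  qed (use a in simp)
  have "primeideal (ann y) R"
  proof (rule primeidealI[OF annI[OF yc] R])
    have "\<one>\<^bsub>R\<^esub> \<notin> ann y" using yk[of 0] yc by (simp add: ann_def)
    then show "carrier R \<noteq> ann y" by auto
    fix s t assume s: "s \<in> carrier R" and t: "t \<in> carrier R" and st: "s \<otimes>\<^bsub>R\<^esub> t \<in> ann y"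
    show "s \<in> ann y \<or> t \<in> ann y"
    proof (rule disjCI)
      assume tn: "t \<notin> ann y"
      have "a [^]\<^bsub>R\<^esub> k \<odot>\<^bsub>A\<^esub> (t \<odot>\<^bsub>A\<^esub> y) \<noteq> \<zero>\<^bsub>A\<^esub>" for k :: nat
        using ay[of k] tn t smult_commute[OF A _ t yc, of "a [^]\<^bsub>R\<^esub> k"] a by (auto simp: ann_def)
      moreover have "t \<odot>\<^bsub>A\<^esub> y = (t \<otimes>\<^bsub>R\<^esub> r) \<odot>\<^bsub>A\<^esub> x" using r t x by (simp add: A.smult_assoc1)
      ultimately have "t \<odot>\<^bsub>A\<^esub> y \<in> F" unfolding F_def using t r by blast
      then have "ann (t \<odot>\<^bsub>A\<^esub> y) = ann y" by (rule mx[OF _ mul[OF t]])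
      moreover have "s \<in> ann (t \<odot>\<^bsub>A\<^esub> y)" using st s t yc by (simp add: ann_def A.smult_assoc1)
      ultimately show "s \<in> ann y" by simp
    qed
  qed
  moreover have "a \<notin> ann y" using yk[of 1] a by (simp add: ann_def)
  ultimately show ?thesis using r unfolding ann_def by blast
qed

text \<open>The ideal I has its elements in the radical of the annihilator of x, and over a
  Noetherian ring this puts a power of I into the annihilator.\<close>

lemma tors_elt:
  assumes N: "noetherian_ring R" and A: "module R A" and I: "ideal I R" and x: "x \<in> carrier A"
    and k: "\<And>a. a \<in> I \<Longrightarrow> \<exists>k::nat. a [^]\<^bsub>R\<^esub> k \<odot>\<^bsub>A\<^esub> x = \<zero>\<^bsub>A\<^esub>"
  shows "x \<in> tors R I A"
proof -
  interpret A: module R A by fact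
  have R: "cring R" by (rule module_cring[OF A])
  let ?L = "{t \<in> carrier (reg_module R). t \<odot>\<^bsub>A\<^esub> x = \<zero>\<^bsub>A\<^esub>}"
  have L: "ideal ?L R" by (rule submod_ideal[OF R submod_ker[OF lin_orbit[OF A x] reg_module[OF R] A]])
  have "\<exists>k::nat. a [^]\<^bsub>R\<^esub> k \<in> ?L" if a: "a \<in> I" for a
    using k[OF a] ideal.Icarr[OF I a] by auto
  then obtain n where "ideal_pow R I n \<subseteq> ?L" using ideal_pow_le_of_radical[OF R N I L] by blast
  then show ?thesis using x by (auto simp: tors_def killed_def)
qed

section \<open>Vanishing of Ext at primes of large depth, and exactness below the grade\<close>

locale fg_inj_res = inj_res R M Q \<epsilon> d for R :: "('r, 'z) ring_scheme" and M :: "('r, 'm) module"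
    and Q :: "nat \<Rightarrow> ('r, 'q) module" and \<epsilon> d +
  assumes noethR: "noetherian_ring R" and fg: "fin_gen_module R M"
begin

text \<open>On the support, large depth yields an almost regular sequence in \<pp> of length above
  c, and its elements kill z. Off the support one element outside \<pp> kills M, hence the
  cohomology of the padded resolution, and a contraction exists directly. In both cases w is a
  linear image of z or of its lift, so it inherits the annihilation by \<pp>.\<close>

lemma ext_vanish_at_prime:
  assumes p: "primeideal \<pp> R" and z: "z \<in> carrier (Q c)" "d c z = \<zero>\<^bsub>Q (Suc c)\<^esub>" and pz: "\<And>r. r \<in> \<pp> \<Longrightarrow> r \<odot>\<^bsub>Q c\<^esub> z = \<zero>\<^bsub>Q c\<^esub>"
    and far: "\<pp> \<in> Supp R M \<Longrightarrow> \<not> depth (loc_ring R \<pp>) (loc_ideal R \<pp> \<pp>) (loc_module R \<pp> M) \<le> enat c"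
  shows "\<exists>v w. v \<in> carrier R - \<pp> \<and> w \<in> killed (pad Q c) \<pp> \<and> pad_d d c w = v \<odot>\<^bsub>Q c\<^esub> z"
proof -
  interpret prime_loc R \<pp> by (rule prime_loc.intro[OF cR p])
  note nM = noeth_fin_gen[OF noethR fg]
  interpret Qc: module R "Q c" by (rule Qm)
  have "\<exists>u\<in>S. \<exists>(b::nat) w. w \<in> carrier (pad Q c) \<and> pad_d d c w = u [^]\<^bsub>R\<^esub> b \<odot>\<^bsub>Q c\<^esub> z \<and>
      (\<forall>r\<in>carrier R. r \<odot>\<^bsub>Q c\<^esub> z = \<zero>\<^bsub>Q c\<^esub> \<longrightarrow> r \<odot>\<^bsub>pad Q c\<^esub> w = \<zero>\<^bsub>pad Q c\<^esub>)"
  proof (cases "\<pp> \<in> Supp R M")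
    case True
    then have "carrier (loc_module R \<pp> M) \<noteq> {\<zero>\<^bsub>loc_module R \<pp> M\<^esub>}" by (simp add: Supp_def)
    then obtain xs u where x: "set xs \<subseteq> \<pp>" "c < length xs" "u \<in> S" "almost_regular M u xs"
      using depth_gt_almost_regular[OF mM nM _ far[OF True]] by blast
    have "\<exists>(b::nat) w. w \<in> carrier (pad Q c) \<and> pad_d d c w = u [^]\<^bsub>R\<^esub> b \<odot>\<^bsub>pad Q (Suc c)\<^esub> z \<and>
      (\<forall>r\<in>carrier R. r \<odot>\<^bsub>pad Q (Suc c)\<^esub> z = \<zero>\<^bsub>pad Q (Suc c)\<^esub> \<longrightarrow> r \<odot>\<^bsub>pad Q c\<^esub> w = \<zero>\<^bsub>pad Q c\<^esub>)"
      by (rule almost_regular_ext_vanish[OF _ _ x(4,2)]) (use x z pz p.a_Hcarr in auto)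
    then show ?thesis using x(3) by auto
  next
    case False
    then obtain u where u: "u \<in> S" "\<forall>x\<in>carrier M. u \<odot>\<^bsub>M\<^esub> x = \<zero>\<^bsub>M\<^esub>" using not_Supp_uniform[OF mM nM] by blast
    have uc: "u \<in> carrier R" using u by blast
    \<comment> \<open>The only cohomology of the padded resolution is M in index 1, which u kills;
      in higher indices exactness provides the preimage.\<close>
    have ann: "\<exists>w\<in>carrier (pad Q n). pad_d d n w = u \<odot>\<^bsub>pad Q (Suc n)\<^esub> z"
      if z: "z \<in> carrier (pad Q (Suc n))" "pad_d d (Suc n) z = \<zero>\<^bsub>pad Q (Suc (Suc n))\<^esub>" for n z
    proof (cases n)
      case 0
      have "z \<in> cyc 1" using z 0 by (simp add: cyc_def)
      then obtain x where x: "x \<in> carrier M" "z = \<epsilon> x" using cyc1 by blast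
      have "u \<odot>\<^bsub>Q 0\<^esub> z = \<zero>\<^bsub>Q 0\<^esub>" using lin_smult[OF eps uc x(1)] lin_zero[OF eps mM m] u(2) x by simp
      then show ?thesis using 0 by simp
    next
      case (Suc k)
      interpret Qk: module R "Q k" by (rule Qm)
      have "z \<in> cyc (Suc (Suc k))" using z Suc by (simp add: cyc_def)
      then obtain w where w: "w \<in> carrier (Q k)" "z = d k w" using exact[of k] by auto
      show ?thesis using w lin_smult[OF dl uc w(1)] uc Suc by (intro bexI[of _ "u \<odot>\<^bsub>Q k\<^esub> w"]) auto
    qed
    have "\<exists>(b::nat) h. lin R (pad Q (Suc c)) (pad Q c) h \<and>
      (\<forall>z\<in>carrier (pad Q (Suc c)). pad_d d (Suc c) z = \<zero>\<^bsub>pad Q (Suc (Suc c))\<^esub> \<longrightarrow> pad_d d c (h z) = (u [^]\<^bsub>R\<^esub> b) \<odot>\<^bsub>pad Q (Suc c)\<^esub> z)"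
      by (rule partial_contraction_cycles[where k = "Suc c", OF C _ dd triv uc ann]) (use d in auto)
    then obtain b :: nat and h where h: "lin R (Q c) (pad Q c) h" "pad_d d c (h z) = (u [^]\<^bsub>R\<^esub> b) \<odot>\<^bsub>Q c\<^esub> z"
      using z by auto
    have "r \<odot>\<^bsub>pad Q c\<^esub> h z = \<zero>\<^bsub>pad Q c\<^esub>" if "r \<in> carrier R" "r \<odot>\<^bsub>Q c\<^esub> z = \<zero>\<^bsub>Q c\<^esub>" for r
      using lin_smult[OF h(1) that(1) z(1)] that(2) lin_zero[OF h(1) Qm m] by simp
    then show ?thesis using u(1) h lin_closed[OF h(1) z(1)] by blast
  qed
  then obtain u b w where w: "u \<in> S" "w \<in> carrier (pad Q c)" "pad_d d c w = u [^]\<^bsub>R\<^esub> (b::nat) \<odot>\<^bsub>Q c\<^esub> z"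
    "\<And>r. r \<in> carrier R \<Longrightarrow> r \<odot>\<^bsub>Q c\<^esub> z = \<zero>\<^bsub>Q c\<^esub> \<Longrightarrow> r \<odot>\<^bsub>pad Q c\<^esub> w = \<zero>\<^bsub>pad Q c\<^esub>" by blast
  have "w \<in> killed (pad Q c) \<pp>" using w(2,4) pz p.a_Hcarr by (simp add: killed_def)
  then show ?thesis using w(3) S_pow[OF w(1)] by blast
qed

lemma grade_exact:
  assumes K: "ideal K R" and g: "grade R Q d K = enat c" and i: "i < c"
  shows "lcZ K i \<subseteq> lcB K i"
proof
  fix z assume z: "z \<in> lcZ K i"
  have "carrier (loc_coh R Q d K i) = {\<zero>\<^bsub>loc_coh R Q d K i\<^esub>}"
  proof (rule ccontr)
    assume "\<not> ?thesis"
    then have "grade R Q d K \<le> enat i" unfolding grade_def by (intro Inf_lower) blast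
    then show False using g i by simp
  qed
  moreover have "cl K i z \<in> carrier (loc_coh R Q d K i)" unfolding lc_carrier[OF K] using z by blast
  ultimately show "z \<in> lcB K i" using cl_zero_iff[OF K z] by blast
qed

end

section \<open>Splitting of the torsion complex in the degree of the grade\<close>

locale graded_res = fg_inj_res R M Q \<epsilon> d for R :: "('r, 'z) ring_scheme" and M :: "('r, 'm) module"
    and Q :: "nat \<Rightarrow> ('r, 'q) module" and \<epsilon> d +
  fixes K :: "'r set" and c :: nat
  assumes K: "ideal K R" and grade: "grade R Q d K = enat c"
begin

abbreviation H where "H \<equiv> loc_coh R Q d K c"

abbreviation T where "T n \<equiv> (pad Q n)\<lparr>carrier := tors R K (pad Q n)\<rparr>"

lemmas mH = lc_module[OF K, where i = c]

lemma tors_sub: "tors R K (pad Q n) \<subseteq> carrier (pad Q n)"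
  by (rule submodD(1)[OF tors_submod[OF m K]])

text \<open>\<open>partial_contraction\<close> with u = 1: the terms T n are injective, and
  vanishing of local cohomology below c provides the preimages for all indices n + 1 with n < c. At
  the last step n = c, which is degree c in the padded complex, cocycles need not be coboundaries,
  so the identity holds on \<open>lcB K c\<close> only.\<close>

lemma contraction:
  "\<exists>h. lin R (T (Suc c)) (T c) h \<and> (\<forall>b\<in>lcB K c. pad_d d c (h b) = b)"
proof -
  interpret R: cring R by (rule cR)
  have l: "lin R (T n) (T (Suc n)) (pad_d d n)" for n
    by (rule lin_cod[OF lin_dom[OF d tors_sub]]) (use tors_lin[OF d m m K] in simp)
  have t0: "carrier (T 0) = {\<zero>\<^bsub>T 0\<^esub>}"
    using triv tors_sub[of 0] submodD(2)[OF tors_submod[OF m[of 0] K]] by auto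
  have ann: "\<exists>w\<in>carrier (T n). pad_d d n w = \<one>\<^bsub>R\<^esub> \<odot>\<^bsub>T (Suc n)\<^esub> z"
    if n: "n < c" and z: "z \<in> carrier (T (Suc n))" "pad_d d (Suc n) z = \<zero>\<^bsub>T (Suc (Suc n))\<^esub>" for n z
  proof -
    interpret Qn: module R "Q n" by (rule Qm)
    have "z \<in> lcZ K n" using z by (simp add: lcZ_def)
    then have "z \<in> lcB K n" using grade_exact[OF K grade n] by blast
    moreover have "z \<in> carrier (Q n)" using z(1) tors_sub[of "Suc n"] by auto
    ultimately show ?thesis by (auto simp: lcB_def)
  qed
  have "\<exists>(b::nat) h. lin R (T (Suc c)) (T c) h \<and>
    (\<forall>x\<in>carrier (T c). pad_d d c (h (pad_d d c x)) = (\<one>\<^bsub>R\<^esub> [^]\<^bsub>R\<^esub> b) \<odot>\<^bsub>T (Suc c)\<^esub> pad_d d c x)"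
  proof (rule partial_contraction[where k = c, OF _ l _ t0 R.one_closed ann])
    show "baer R (T n)" for n by (rule tors_baer[OF C noethR K])
    show "pad_d d (Suc n) (pad_d d n x) = \<zero>\<^bsub>T (Suc (Suc n))\<^esub>" if "x \<in> carrier (T n)" for n x
      using dd[of x n] that subsetD[OF tors_sub, of x n] by simp
  qed auto
  then obtain b :: nat and h where h: "lin R (T (Suc c)) (T c) h"
    "\<forall>x\<in>carrier (T c). pad_d d c (h (pad_d d c x)) = (\<one>\<^bsub>R\<^esub> [^]\<^bsub>R\<^esub> b) \<odot>\<^bsub>T (Suc c)\<^esub> pad_d d c x" by blast
  interpret Qc: module R "Q c" by (rule Qm)
  have "pad_d d c (h y) = y" if yB: "y \<in> lcB K c" for y
  proof -
    obtain x where x: "x \<in> tors R K (pad Q c)" "y = pad_d d c x" using yB unfolding lcB_def by blast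
    have "y \<in> carrier (Q c)" using yB submodD(1)[OF lcB_submod[OF K]] by blast
    then show ?thesis using h(2) x by simp
  qed
  then show ?thesis using h(1) by blast
qed

definition h where "h = (SOME h. lin R (T (Suc c)) (T c) h \<and> (\<forall>b\<in>lcB K c. pad_d d c (h b) = b))"

lemma h_lin: "lin R (T (Suc c)) (T c) h" and h_id: "b \<in> lcB K c \<Longrightarrow> pad_d d c (h b) = b"
  using someI_ex[OF contraction] unfolding h_def by blast+

lemma h_lin': "lin R ((Q c)\<lparr>carrier := tors R K (Q c)\<rparr>) (pad Q c) h"
  using lin_cod_incl[OF h_lin tors_sub] by simp

text \<open>The map z \<mapsto> z - d (h z) vanishes on coboundaries and changes a cocycle only by a
  coboundary. It therefore descends to cohomology and gives a linear choice of
  representatives.\<close>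

lemma section_ex: "\<exists>s. lin R H (Q c) s \<and> (\<forall>y\<in>carrier H. s y \<in> lcZ K c \<and> cl K c (s y) = y)"
proof -
  let ?Z = "(Q c)\<lparr>carrier := lcZ K c\<rparr>"
  interpret Qc: module R "Q c" by (rule Qm)
  have mZ: "module R ?Z" by (rule submod_module[OF lcZ_submod[OF K] Qm])
  have Zt: "lcZ K c \<subseteq> tors R K (Q c)" by (auto simp: lcZ_def)
  note Zc = submodD(1)[OF lcZ_submod[OF K, of c]]
  have lh: "lin R ?Z (pad Q c) h"
    using lin_dom[OF h_lin', of "lcZ K c"] Zt by simp
  let ?g = "\<lambda>z. z \<ominus>\<^bsub>Q c\<^esub> pad_d d c (h z)"
  have ldh: "lin R ?Z (Q c) (\<lambda>z. pad_d d c (h z))" using lin_comp[OF lh d] by simp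
  have g: "lin R ?Z (Q c) ?g" by (rule lin_fun_diff[OF lin_id[OF Zc] ldh mZ Qm])
  have hB: "pad_d d c (h z) \<in> lcB K c" if "z \<in> lcZ K c" for z
    using lin_closed[OF h_lin, of z] that Zt by (auto simp: lcB_def)
  have "\<exists>s. lin R H (Q c) s \<and> (\<forall>z\<in>carrier ?Z. s (cl K c z) = ?g z)"
  proof (rule lin_factor_surj[OF mZ mH Qm cl_lin[OF K] g])
    show "cl K c ` carrier ?Z = carrier H" using lc_carrier[OF K] by simp
    fix z assume z: "z \<in> carrier ?Z" "cl K c z = \<zero>\<^bsub>H\<^esub>"
    then have "z \<in> lcB K c" using cl_zero_iff[OF K] by simp
    then show "?g z = \<zero>\<^bsub>Q c\<^esub>" using h_id z Zc minus_eq_zero_iff[OF Qm, of z c z] by auto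
  qed
  then obtain s where s: "lin R H (Q c) s" "\<And>z. z \<in> lcZ K c \<Longrightarrow> s (cl K c z) = ?g z" by auto
  have "s y \<in> lcZ K c \<and> cl K c (s y) = y" if y: "y \<in> carrier H" for y
  proof -
    obtain z where z: "z \<in> lcZ K c" "y = cl K c z" using y unfolding lc_carrier[OF K] by blast
    have zc: "z \<in> carrier (Q c)" and bc: "pad_d d c (h z) \<in> carrier (Q c)" using z(1) Zc hB[OF z(1)] submodD(1)[OF lcB_submod[OF K]] by auto
    have gz: "?g z \<in> lcZ K c" using submodD_diff[OF lcZ_submod[OF K] z(1)] hB[OF z(1)] lcB_sub[OF K] by blast
    have "z \<ominus>\<^bsub>Q c\<^esub> ?g z = pad_d d c (h z)"
      using minus_add_cancel(1)[OF Qm zc bc] minus_add_cancel(3)[OF Qm bc minus_closed[OF Qm zc bc]] Qc.M.a_comm[OF bc minus_closed[OF Qm zc bc]] by metis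
    then have "cl K c z = cl K c (?g z)" using cl_eq[OF K z(1) gz] hB[OF z(1)] by simp
    then show ?thesis using s(2)[OF z(1)] z gz by simp
  qed
  then show ?thesis using s(1) by blast
qed

definition s where "s = (SOME s. lin R H (Q c) s \<and> (\<forall>y\<in>carrier H. s y \<in> lcZ K c \<and> cl K c (s y) = y))"

lemma s_lin: "lin R H (Q c) s" and s_Z: "y \<in> carrier H \<Longrightarrow> s y \<in> lcZ K c" and cl_s: "y \<in> carrier H \<Longrightarrow> cl K c (s y) = y"
  using someI_ex[OF section_ex] unfolding s_def by blast+

lemma cl_closed: "z \<in> lcZ K c \<Longrightarrow> cl K c z \<in> carrier H"
  unfolding lc_carrier[OF K] by blast

text \<open>The splitting \<open>s\<close> of the cocycles onto the cohomology makes \<open>Ext\<^sup>c(N, M) \<rightarrow> Hom(N, H)\<close> surjective, and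
  \<open>h\<close> makes it injective.\<close>

lemma Ext_to_Hom_iso:
  assumes N: "module R N" and t: "tors R K N = carrier N"
  shows "Ext_to_Hom R Q d K c N \<in> mod_iso R (Ext_mod R Q d c N) (Hom_mod R N H)"
proof -
  let ?F = "Ext_to_Hom R Q d K c N"
  let ?Z = "(Q c)\<lparr>carrier := lcZ K c\<rparr>"
  have F: "?F (ex c N f) x = cl K c (f x)" and fZ: "f x \<in> lcZ K c" if "cocy c N f" "x \<in> carrier N" for f x
    using Ext_to_Hom_ex[OF K N that(1)] that(2) t by auto
  have Fh: "?F (ex c N f) \<in> mod_hom R N H" if f: "cocy c N f" for f
  proof -
    have "lin R N ?Z f" by (rule lin_cod) (use f fZ in \<open>auto simp: cocy_def\<close>)
    then have "lin R N H (\<lambda>x. cl K c (f x))" by (rule lin_comp[OF _ cl_lin[OF K]])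
    then have "lin R N H (?F (ex c N f))" by (rule lin_cong) (simp_all add: F[OF f] N)
    moreover have "?F (ex c N f) \<in> extensional (carrier N)" unfolding Ext_to_Hom_def using ex_closed[OF N f] by simp
    ultimately show ?thesis by (simp add: mod_hom_iff)
  qed
  interpret HH: module R H by (rule mH)
  interpret N: module R N by (rule N)
  have "?F \<in> mod_hom R (Ext_mod R Q d c N) (Hom_mod R N H)"
    unfolding mod_hom_iff
  proof
    show "?F \<in> extensional (carrier (Ext_mod R Q d c N))" unfolding Ext_to_Hom_def by simp
    interpret HM: module R "Hom_mod R N H" by (rule Hom_mod_module[OF N mH])
    show "lin R (Ext_mod R Q d c N) (Hom_mod R N H) ?F"
    proof (rule linI)
      fix \<xi> assume "\<xi> \<in> carrier (Ext_mod R Q d c N)"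
      then obtain f where f: "cocy c N f" "\<xi> = ex c N f" unfolding Ext_carrier[OF N] by blast
      show "?F \<xi> \<in> carrier (Hom_mod R N H)" using Fh f by simp
      { fix \<xi>' assume "\<xi>' \<in> carrier (Ext_mod R Q d c N)"
        then obtain g where g: "cocy c N g" "\<xi>' = ex c N g" unfolding Ext_carrier[OF N] by blast
        note fg = cocy_add[OF N f(1) g(1)]
        show "?F (\<xi> \<oplus>\<^bsub>Ext_mod R Q d c N\<^esub> \<xi>') = ?F \<xi> \<oplus>\<^bsub>Hom_mod R N H\<^esub> ?F \<xi>'"
          unfolding f(2) g(2) ex_add[OF N f(1) g(1)]
        proof (rule mod_hom_eqI[OF Fh[OF fg]])
          show "?F (ex c N f) \<oplus>\<^bsub>Hom_mod R N H\<^esub> ?F (ex c N g) \<in> mod_hom R N H"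
            using HM.M.a_closed[of "?F (ex c N f)" "?F (ex c N g)"] Fh[OF f(1)] Fh[OF g(1)] unfolding Hom_mod_simps(1) by blast
          show "?F (ex c N (\<lambda>x. f x \<oplus>\<^bsub>Q c\<^esub> g x)) x = (?F (ex c N f) \<oplus>\<^bsub>Hom_mod R N H\<^esub> ?F (ex c N g)) x" if "x \<in> carrier N" for x
            using F[OF fg that] F[OF f(1) that] F[OF g(1) that] cl_add[OF K fZ[OF f(1) that] fZ[OF g(1) that]] that by simp
        qed }
      fix r assume r: "r \<in> carrier R"
      note fr = cocy_smult[OF N f(1) r]
      show "?F (r \<odot>\<^bsub>Ext_mod R Q d c N\<^esub> \<xi>) = r \<odot>\<^bsub>Hom_mod R N H\<^esub> ?F \<xi>"
        unfolding f(2) ex_smult[OF N f(1) r]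
      proof (rule mod_hom_eqI[OF Fh[OF fr]])
        show "r \<odot>\<^bsub>Hom_mod R N H\<^esub> ?F (ex c N f) \<in> mod_hom R N H"
          using HM.smult_closed[of r "?F (ex c N f)"] Fh[OF f(1)] r unfolding Hom_mod_simps(1) by blast
        show "?F (ex c N (\<lambda>x. r \<odot>\<^bsub>Q c\<^esub> f x)) x = (r \<odot>\<^bsub>Hom_mod R N H\<^esub> ?F (ex c N f)) x" if "x \<in> carrier N" for x
          using F[OF fr that] F[OF f(1) that] cl_smult[OF K fZ[OF f(1) that] r] that by simp
      qed
    qed
  qed
  moreover have "inj_on ?F (carrier (Ext_mod R Q d c N))"
  proof (rule inj_onI)
    fix \<xi> \<xi>' assume "\<xi> \<in> carrier (Ext_mod R Q d c N)" "\<xi>' \<in> carrier (Ext_mod R Q d c N)" and e: "?F \<xi> = ?F \<xi>'"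
    then obtain f g where f: "cocy c N f" "\<xi> = ex c N f" and g: "cocy c N g" "\<xi>' = ex c N g" unfolding Ext_carrier[OF N] by blast
    have lf: "lin R N (Q c) f" and lg: "lin R N (Q c) g" using f g by (auto simp: cocy_def)
    have B: "f x \<ominus>\<^bsub>Q c\<^esub> g x \<in> lcB K c" if x: "x \<in> carrier N" for x
      using fun_cong[OF e, of x] F[OF f(1) x] F[OF g(1) x] cl_eq[OF K fZ[OF f(1) x] fZ[OF g(1) x]] f g by simp
    have "lcB K c \<subseteq> tors R K (Q c)" using lcB_sub[OF K] by (auto simp: lcZ_def)
    then have "lin R N ((Q c)\<lparr>carrier := tors R K (Q c)\<rparr>) (\<lambda>x. f x \<ominus>\<^bsub>Q c\<^esub> g x)"
      by (intro lin_cod lin_fun_diff[OF lf lg N Qm]) (use B in blast)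
    then have "lin R N (pad Q c) (\<lambda>x. h (f x \<ominus>\<^bsub>Q c\<^esub> g x))" by (rule lin_comp[OF _ h_lin'])
    moreover have "f x = g x \<oplus>\<^bsub>Q c\<^esub> pad_d d c (h (f x \<ominus>\<^bsub>Q c\<^esub> g x))" if x: "x \<in> carrier N" for x
      unfolding h_id[OF B[OF x]] using minus_add_cancel(2)[OF Qm lin_closed[OF lf x] lin_closed[OF lg x]] by simp
    ultimately show "\<xi> = \<xi>'" unfolding f(2) g(2) ex_eq[OF N f(1) g(1)] by blast
  qed
  moreover have "?F ` carrier (Ext_mod R Q d c N) = carrier (Hom_mod R N H)"
  proof (intro equalityI subsetI)
    fix g assume "g \<in> ?F ` carrier (Ext_mod R Q d c N)"
    then show "g \<in> carrier (Hom_mod R N H)" using Fh unfolding Ext_carrier[OF N] by auto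
  next
    fix g assume "g \<in> carrier (Hom_mod R N H)"
    then have g: "g \<in> mod_hom R N H" by simp
    have gc: "g x \<in> carrier H" if "x \<in> carrier N" for x by (rule lin_closed[OF mod_hom_lin[OF g] that])
    have f: "cocy c N (\<lambda>x. s (g x))"
      unfolding cocy_def using lin_comp[OF mod_hom_lin[OF g] s_lin] s_Z[OF gc] by (simp add: lcZ_def)
    have "?F (ex c N (\<lambda>x. s (g x))) = g"
      by (rule mod_hom_eqI[OF Fh[OF f] g]) (simp add: F[OF f] cl_s[OF gc])
    then show "g \<in> ?F ` carrier (Ext_mod R Q d c N)" using ex_closed[OF N f] by (metis imageI)
  qed
  ultimately show ?thesis by (simp add: mod_iso_def bij_betw_def)
qed

end

section \<open>The comparison map for two ideals of equal grade and its effect on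
  endomorphisms\<close>

locale two_ideals = fg_inj_res R M Q \<epsilon> d for R :: "('r, 'z) ring_scheme" and M :: "('r, 'm) module"
    and Q :: "nat \<Rightarrow> ('r, 'q) module" and \<epsilon> d +
  fixes I J :: "'r set" and c :: nat
  assumes I: "ideal I R" and J: "ideal J R" and JI: "J \<subseteq> I"
    and gI: "grade R Q d I = enat c" and gJ: "grade R Q d J = enat c"
begin

interpretation I: graded_res R M Q \<epsilon> d I c
  by (rule graded_res.intro[OF fg_inj_res_axioms graded_res_axioms.intro[OF I gI]])

interpretation J: graded_res R M Q \<epsilon> d J c
  by (rule graded_res.intro[OF fg_inj_res_axioms graded_res_axioms.intro[OF J gJ]])

abbreviation HI where "HI \<equiv> loc_coh R Q d I c"
abbreviation HJ where "HJ \<equiv> loc_coh R Q d J c"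
abbreviation \<iota> where "\<iota> \<equiv> lc_incl R Q d I J c"

lemma iota_cl: "z \<in> lcZ I c \<Longrightarrow> \<iota> (cl I c z) = cl J c z" and ZI_ZJ: "z \<in> lcZ I c \<Longrightarrow> z \<in> lcZ J c"
  using lc_incl_cl[OF I J JI] by auto

lemma iota_hom: "\<iota> \<in> mod_hom R HI HJ"
  unfolding mod_hom_iff
proof
  show "\<iota> \<in> extensional (carrier HI)" by (simp add: lc_incl_def)
  show "lin R HI HJ \<iota>"
  proof (rule linI)
    fix x assume "x \<in> carrier HI"
    then obtain z where z: "z \<in> lcZ I c" "x = cl I c z" unfolding lc_carrier[OF I] by blast
    show "\<iota> x \<in> carrier HJ" unfolding z(2) iota_cl[OF z(1)] by (rule J.cl_closed[OF ZI_ZJ[OF z(1)]])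
    { fix y assume "y \<in> carrier HI"
      then obtain w where w: "w \<in> lcZ I c" "y = cl I c w" unfolding lc_carrier[OF I] by blast
      show "\<iota> (x \<oplus>\<^bsub>HI\<^esub> y) = \<iota> x \<oplus>\<^bsub>HJ\<^esub> \<iota> y"
        unfolding z(2) w(2) cl_add[OF I z(1) w(1)] iota_cl[OF z(1)] iota_cl[OF w(1)]
          iota_cl[OF submodD(3)[OF lcZ_submod[OF I] z(1) w(1)]] cl_add[OF J ZI_ZJ[OF z(1)] ZI_ZJ[OF w(1)]] .. }
    fix r assume r: "r \<in> carrier R"
    show "\<iota> (r \<odot>\<^bsub>HI\<^esub> x) = r \<odot>\<^bsub>HJ\<^esub> \<iota> x"
      unfolding z(2) cl_smult[OF I z(1) r] iota_cl[OF z(1)] iota_cl[OF submodD(4)[OF lcZ_submod[OF I] r z(1)]]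
        cl_smult[OF J ZI_ZJ[OF z(1)] r] ..
  qed
qed

lemmas iota_lin = mod_hom_lin[OF iota_hom]

text \<open>A coboundary of the \<open>J\<close>-torsion complex that is \<open>I\<close>-torsion is the coboundary of an \<open>I\<close>-torsion
  element, as the contraction \<open>h\<close> is linear.\<close>

lemma iota_inj: "inj_on \<iota> (carrier HI)"
proof -
  have ker: "x = \<zero>\<^bsub>HI\<^esub>" if x: "x \<in> carrier HI" "\<iota> x = \<zero>\<^bsub>HJ\<^esub>" for x
  proof -
    obtain z where z: "z \<in> lcZ I c" "x = cl I c z" using x(1) unfolding lc_carrier[OF I] by blast
    then have zB: "z \<in> lcB J c" using x(2) iota_cl[OF z(1)] cl_zero_iff[OF J ZI_ZJ[OF z(1)]] by simp
    have zt: "z \<in> tors R I (Q c)" "z \<in> tors R J (Q c)" using z(1) ZI_ZJ[OF z(1)] by (auto simp: lcZ_def)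
    let ?T = "(Q c)\<lparr>carrier := tors R J (Q c)\<rparr>"
    have mT: "module R ?T" by (rule submod_module[OF tors_submod[OF Qm J] Qm])
    \<comment> \<open>\<open>J.h\<close> is linear only on the J-torsion part of Q c, so the
      I-torsion of z has to be expressed inside that submodule.\<close>
    have "z \<in> tors R I ?T" using zt submodD(1)[OF tors_submod[OF Qm J]] by (auto simp: tors_def killed_def)
    then have "J.h z \<in> tors R I (pad Q c)" by (rule tors_lin[OF J.h_lin' mT m I])
    then have "z \<in> lcB I c" unfolding lcB_def using J.h_id[OF zB] by (metis imageI)
    then show ?thesis using z cl_zero_iff[OF I z(1)] by simp
  qed
  show ?thesis
  proof (rule inj_onI)
    fix x y assume xy: "x \<in> carrier HI" "y \<in> carrier HI" "\<iota> x = \<iota> y"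
    have "\<iota> (x \<ominus>\<^bsub>HI\<^esub> y) = \<zero>\<^bsub>HJ\<^esub>"
      using lin_diff[OF iota_lin I.mH J.mH xy(1,2)] xy(3) minus_eq_zero_iff[OF J.mH lin_closed[OF iota_lin xy(2)] lin_closed[OF iota_lin xy(2)]] by simp
    then show "x = y" using ker[OF minus_closed[OF I.mH xy(1,2)]] minus_eq_zero_iff[OF I.mH xy(1,2)] by simp
  qed
qed

lemma Ext_to_End_iso:
  assumes "K \<in> {I, J}"
  shows "Ext_to_End R Q d K c \<in> mod_iso R (Ext_mod R Q d c (loc_coh R Q d K c)) (End_loc_coh R Q d K c)"
  using assms I.Ext_to_Hom_iso[OF I.mH lc_tors[OF I]] J.Ext_to_Hom_iso[OF J.mH lc_tors[OF J]] by auto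

text \<open>The class in Ext that corresponds to g is represented by x \<mapsto> s (g x), with s the
  section for J. Its pullback x \<mapsto> s (g (\<iota> x)) has I-torsion values on the I-torsion
  module \<open>HI\<close>, and passing to classes for I and applying \<iota> returns g (\<iota>
  x).\<close>

lemma nat_End_map_char:
  assumes g: "g \<in> mod_hom R HJ HJ"
  shows "nat_End_map R Q d I J c g \<in> mod_hom R HI HI"
    and "x \<in> carrier HI \<Longrightarrow> \<iota> (nat_End_map R Q d I J c g x) = g (\<iota> x)"
proof -
  let ?F = "\<lambda>K. Ext_to_End R Q d K c"
  have gl: "lin R HJ HJ g" by (rule mod_hom_lin[OF g])
  have gc: "g x \<in> carrier HJ" if "x \<in> carrier HJ" for x by (rule lin_closed[OF gl that])
  let ?f = "\<lambda>x. J.s (g x)"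
  have f: "cocy c HJ ?f"
    unfolding cocy_def using lin_comp[OF gl J.s_lin] J.s_Z[OF gc] by (simp add: lcZ_def)
  have isoJ: "?F J \<in> mod_hom R (Ext_mod R Q d c HJ) (End_loc_coh R Q d J c)" "bij_betw (?F J) (carrier (Ext_mod R Q d c HJ)) (carrier (End_loc_coh R Q d J c))"
    using Ext_to_End_iso[of J] by (auto simp: mod_iso_def)
  have Fg: "?F J (ex c HJ ?f) = g"
  proof (rule mod_hom_eqI[OF _ g])
    show "?F J (ex c HJ ?f) \<in> mod_hom R HJ HJ" using lin_closed[OF mod_hom_lin[OF isoJ(1)] ex_closed[OF J.mH f]] by simp
    show "?F J (ex c HJ ?f) x = g x" if "x \<in> carrier HJ" for x
      using Ext_to_Hom_ex(1)[OF J J.mH f, of x] lc_tors[OF J] that J.cl_s[OF gc[OF that]] by simp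
  qed
  have inv: "inv_into (carrier (Ext_mod R Q d c HJ)) (?F J) g = ex c HJ ?f"
    using inv_into_f_f[OF bij_betw_imp_inj_on[OF isoJ(2)] ex_closed[OF J.mH f]] Fg by simp
  note e = Ext_map_ex[OF I.mH J.mH iota_lin f]
  have nat: "nat_End_map R Q d I J c g = ?F I (ex c HI (\<lambda>x. ?f (\<iota> x)))"
    unfolding nat_End_map_def using g inv e(1) by simp
  show "nat_End_map R Q d I J c g \<in> mod_hom R HI HI"
  proof -
    have "?F I \<in> mod_hom R (Ext_mod R Q d c HI) (End_loc_coh R Q d I c)" using Ext_to_End_iso[of I] by (auto simp: mod_iso_def)
    then show ?thesis unfolding nat using lin_closed[OF mod_hom_lin ex_closed[OF I.mH e(2)]] by fastforce
  qed
  assume x: "x \<in> carrier HI"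
  have ix: "\<iota> x \<in> carrier HJ" by (rule lin_closed[OF iota_lin x])
  note ev = Ext_to_Hom_ex[OF I I.mH e(2), of x]
  show "\<iota> (nat_End_map R Q d I J c g x) = g (\<iota> x)"
    unfolding nat using ev lc_tors[OF I] x iota_cl J.cl_s[OF gc[OF ix]] by simp
qed

text \<open>Injectivity of \<iota> makes the relation in \<open>nat_End_map_char\<close> determine
  the endomorphism; linearity and bijectivity are then checked without returning to Ext.\<close>

lemma nat_End_map_eqI:
  assumes "g \<in> mod_hom R HJ HJ" "g' \<in> mod_hom R HI HI" "\<And>x. x \<in> carrier HI \<Longrightarrow> \<iota> (g' x) = g (\<iota> x)"
  shows "nat_End_map R Q d I J c g = g'"
proof (rule mod_hom_eqI[OF nat_End_map_char(1)[OF assms(1)] assms(2)])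
  fix x assume x: "x \<in> carrier HI"
  show "nat_End_map R Q d I J c g x = g' x"
    using inj_onD[OF iota_inj, of "nat_End_map R Q d I J c g x" "g' x"] nat_End_map_char(2)[OF assms(1) x] assms(3)[OF x]
      lin_closed[OF mod_hom_lin[OF nat_End_map_char(1)[OF assms(1)]] x] lin_closed[OF mod_hom_lin[OF assms(2)] x] by simp
qed

lemma nat_End_map_hom: "nat_End_map R Q d I J c \<in> mod_hom R (End_loc_coh R Q d J c) (End_loc_coh R Q d I c)"
  unfolding mod_hom_iff
proof
  show "nat_End_map R Q d I J c \<in> extensional (carrier (End_loc_coh R Q d J c))" by (simp add: nat_End_map_def)
  interpret EI: module R "Hom_mod R HI HI" by (rule Hom_mod_module[OF I.mH I.mH])
  interpret EJ: module R "Hom_mod R HJ HJ" by (rule Hom_mod_module[OF J.mH J.mH])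
  let ?n = "nat_End_map R Q d I J c"
  have nc: "?n g x \<in> carrier HI" if "g \<in> mod_hom R HJ HJ" "x \<in> carrier HI" for g x
    by (rule lin_closed[OF mod_hom_lin[OF nat_End_map_char(1)[OF that(1)]] that(2)])
  have ic: "\<iota> x \<in> carrier HJ" if "x \<in> carrier HI" for x by (rule lin_closed[OF iota_lin that])
  show "lin R (End_loc_coh R Q d J c) (End_loc_coh R Q d I c) ?n"
  proof (rule linI)
    fix g assume "g \<in> carrier (End_loc_coh R Q d J c)"
    then have g: "g \<in> mod_hom R HJ HJ" by simp
    show "?n g \<in> carrier (End_loc_coh R Q d I c)" using nat_End_map_char(1)[OF g] by simp
    { fix g' assume "g' \<in> carrier (End_loc_coh R Q d J c)"
      then have g': "g' \<in> mod_hom R HJ HJ" by simp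
      show "?n (g \<oplus>\<^bsub>End_loc_coh R Q d J c\<^esub> g') = ?n g \<oplus>\<^bsub>End_loc_coh R Q d I c\<^esub> ?n g'"
      proof (rule nat_End_map_eqI)
        show "g \<oplus>\<^bsub>End_loc_coh R Q d J c\<^esub> g' \<in> mod_hom R HJ HJ" using EJ.M.a_closed[of g g'] g g' unfolding Hom_mod_simps(1) by blast
        show "?n g \<oplus>\<^bsub>End_loc_coh R Q d I c\<^esub> ?n g' \<in> mod_hom R HI HI"
          using EI.M.a_closed[of "?n g" "?n g'"] nat_End_map_char(1)[OF g] nat_End_map_char(1)[OF g'] unfolding Hom_mod_simps(1) by blast
        show "\<iota> ((?n g \<oplus>\<^bsub>End_loc_coh R Q d I c\<^esub> ?n g') x) = (g \<oplus>\<^bsub>End_loc_coh R Q d J c\<^esub> g') (\<iota> x)" if x: "x \<in> carrier HI" for x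
          using x lin_add[OF iota_lin nc[OF g x] nc[OF g' x]] nat_End_map_char(2)[OF g x] nat_End_map_char(2)[OF g' x] ic[OF x] by simp
      qed }
    fix r assume r: "r \<in> carrier R"
    show "?n (r \<odot>\<^bsub>End_loc_coh R Q d J c\<^esub> g) = r \<odot>\<^bsub>End_loc_coh R Q d I c\<^esub> ?n g"
    proof (rule nat_End_map_eqI)
      show "r \<odot>\<^bsub>End_loc_coh R Q d J c\<^esub> g \<in> mod_hom R HJ HJ" using EJ.smult_closed[of r g] g r unfolding Hom_mod_simps(1) by blast
      show "r \<odot>\<^bsub>End_loc_coh R Q d I c\<^esub> ?n g \<in> mod_hom R HI HI"
        using EI.smult_closed[of r "?n g"] nat_End_map_char(1)[OF g] r unfolding Hom_mod_simps(1) by blast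
      show "\<iota> ((r \<odot>\<^bsub>End_loc_coh R Q d I c\<^esub> ?n g) x) = (r \<odot>\<^bsub>End_loc_coh R Q d J c\<^esub> g) (\<iota> x)" if x: "x \<in> carrier HI" for x
        using x lin_smult[OF iota_lin r nc[OF g x]] nat_End_map_char(2)[OF g x] ic[OF x] by simp
    qed
  qed
qed

text \<open>If \<open>\<iota>\<close> is not surjective, then some prime ideal \<open>\<pp>\<close> with \<open>J \<subseteq> \<pp>\<close> and \<open>I \<not>\<subseteq> \<pp>\<close> is associated to \<open>H\<^sup>c\<^sub>J(M)\<close>; but
  associated primes of \<open>H\<^sup>c\<^sub>J(M)\<close> satisfy \<open>depth M\<^sub>\<pp> \<le> c\<close>.\<close>

lemma iota_surj:
  assumes rad: "rad_eq_upto_depth R M I J c"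
  shows "\<iota> ` carrier HI = carrier HJ"
proof
  show "\<iota> ` carrier HI \<subseteq> carrier HJ" using lin_closed[OF iota_lin] by blast
  show "carrier HJ \<subseteq> \<iota> ` carrier HI"
  proof
    fix y assume y: "y \<in> carrier HJ"
    interpret HJ: module R HJ by (rule J.mH)
    \<comment> \<open>It is enough that y is I-torsion: the section \<open>J.s\<close> is linear, so
      \<open>J.s y\<close> is an I-torsion cocycle, and its class for I is a preimage of y.\<close>
    have "y \<in> tors R I HJ"
    proof (rule tors_elt[OF noethR J.mH I y], rule ccontr)
      fix a assume a: "a \<in> I" and na: "\<nexists>k::nat. a [^]\<^bsub>R\<^esub> k \<odot>\<^bsub>HJ\<^esub> y = \<zero>\<^bsub>HJ\<^esub>"
      have ac: "a \<in> carrier R" by (rule ideal.Icarr[OF I a])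
      have nz: "a [^]\<^bsub>R\<^esub> k \<odot>\<^bsub>HJ\<^esub> y \<noteq> \<zero>\<^bsub>HJ\<^esub>" for k :: nat using na by simp
      from assoc_prime[OF noethR J.mH ac y nz]
      obtain r where r: "r \<in> carrier R" "primeideal {t \<in> carrier R. t \<odot>\<^bsub>HJ\<^esub> (r \<odot>\<^bsub>HJ\<^esub> y) = \<zero>\<^bsub>HJ\<^esub>} R"
        "a \<notin> {t \<in> carrier R. t \<odot>\<^bsub>HJ\<^esub> (r \<odot>\<^bsub>HJ\<^esub> y) = \<zero>\<^bsub>HJ\<^esub>}"
        by (elim bexE conjE)
      define y' where "y' = r \<odot>\<^bsub>HJ\<^esub> y"
      define \<pp> where "\<pp> = {t \<in> carrier R. t \<odot>\<^bsub>HJ\<^esub> y' = \<zero>\<^bsub>HJ\<^esub>}"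
      have p: "primeideal \<pp> R" and ap: "a \<notin> \<pp>" using r unfolding \<pp>_def y'_def by auto
      interpret pl: prime_loc R \<pp> by (rule prime_loc.intro[OF cR p])
      have y'c: "y' \<in> carrier HJ" unfolding y'_def using r(1) y by simp
      have "y' \<in> tors R J HJ" using y'c lc_tors[OF J] by simp
      then obtain n where n: "y' \<in> killed HJ (ideal_pow R J n)" by (auto simp: tors_def)
      have Jp: "J \<subseteq> \<pp>"
      proof
        fix j assume j: "j \<in> J"
        have jc: "j \<in> carrier R" by (rule ideal.Icarr[OF J j])
        have "j [^]\<^bsub>R\<^esub> n \<in> ideal_pow R J n" by (rule cring.elt_pow_in[OF cR J j])
        then have "j [^]\<^bsub>R\<^esub> n \<odot>\<^bsub>HJ\<^esub> y' = \<zero>\<^bsub>HJ\<^esub>" using n unfolding killed_def by blast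
        then have "j [^]\<^bsub>R\<^esub> n \<in> \<pp>" unfolding \<pp>_def using HJ.R.nat_pow_closed[OF jc] by blast
        then show "j \<in> \<pp>" using pl.S_pow[of j n] jc by blast
      qed
      define z where "z = J.s y'"
      have z: "z \<in> lcZ J c" unfolding z_def by (rule J.s_Z[OF y'c])
      have zc: "z \<in> carrier (Q c)" and dz: "d c z = \<zero>\<^bsub>Q (Suc c)\<^esub>"
        using z submodD(1)[OF lcZ_submod[OF J]] by (auto simp: lcZ_def)
      \<comment> \<open>Linearity of the section transfers the annihilator of the class to the
        chosen cocycle, as \<open>ext_vanish_at_prime\<close> requires.\<close>
      have pz: "t \<odot>\<^bsub>Q c\<^esub> z = \<zero>\<^bsub>Q c\<^esub>" if t: "t \<in> \<pp>" for t
      proof -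
        have t': "t \<in> carrier R" "t \<odot>\<^bsub>HJ\<^esub> y' = \<zero>\<^bsub>HJ\<^esub>" using t unfolding \<pp>_def by blast+
        show ?thesis
          using lin_smult[OF J.s_lin t'(1) y'c] unfolding z_def t'(2) lin_zero[OF J.s_lin J.mH Qm] by (rule sym)
      qed
      show False
      proof (cases "\<pp> \<in> Supp R M \<and> depth (loc_ring R \<pp>) (loc_ideal R \<pp> \<pp>) (loc_module R \<pp> M) \<le> enat c")
        case True
        then have "Rad (loc_ring R \<pp>) (loc_ideal R \<pp> I) = Rad (loc_ring R \<pp>) (loc_ideal R \<pp> J)"
          using rad p Jp unfolding rad_eq_upto_depth_def Vset_def by blast
        then have "I \<subseteq> \<pp>" by (rule pl.Rad_loc_le[OF I J Jp])
        then show False using a ap by blast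
      next
        case False
        \<comment> \<open>Since w is killed by \<pp> and so by J, it belongs to the J-torsion
          complex. Hence v z is a coboundary there, v kills the class y', and v would lie in its
          annihilator \<pp>.\<close>
        then obtain v w where v: "v \<in> carrier R - \<pp>" "w \<in> killed (pad Q c) \<pp>" "pad_d d c w = v \<odot>\<^bsub>Q c\<^esub> z"
          using ext_vanish_at_prime[OF p zc dz pz] by metis
        have vc: "v \<in> carrier R" using v(1) by blast
        have "w \<in> killed (pad Q c) J" by (rule subsetD[OF killed_antimono[OF Jp] v(2)])
        then have "w \<in> killed (pad Q c) (ideal_pow R J 1)" unfolding cring.ideal_pow_1[OF cR J] .
        then have "w \<in> tors R J (pad Q c)" unfolding tors_def by blast
        then have "v \<odot>\<^bsub>Q c\<^esub> z \<in> lcB J c" unfolding lcB_def using v(3) by (metis imageI)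
        then have "v \<odot>\<^bsub>HJ\<^esub> cl J c z = \<zero>\<^bsub>HJ\<^esub>"
          unfolding cl_smult[OF J z vc] using cl_zero_iff[OF J submodD(4)[OF lcZ_submod[OF J] vc z]] by simp
        then have "v \<in> \<pp>" unfolding \<pp>_def z_def J.cl_s[OF y'c] using vc by simp
        then show False using v(1) by blast
      qed
    qed
    then have st: "J.s y \<in> tors R I (Q c)" by (rule tors_lin[OF J.s_lin J.mH Qm I])
    then have sZ: "J.s y \<in> lcZ I c" using J.s_Z[OF y] by (simp add: lcZ_def)
    have "\<iota> (cl I c (J.s y)) = y" unfolding iota_cl[OF sZ] by (rule J.cl_s[OF y])
    then show "y \<in> \<iota> ` carrier HI" using I.cl_closed[OF sZ] by (metis imageI)
  qed
qed

text \<open>When \<iota> is bijective, the natural map is conjugation by \<iota>, with inverse g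
  \<mapsto> \<iota> g k, where k is the inverse of \<iota>.\<close>

lemma nat_End_map_iso:
  assumes rad: "rad_eq_upto_depth R M I J c"
  shows "nat_End_map R Q d I J c \<in> mod_iso R (End_loc_coh R Q d J c) (End_loc_coh R Q d I c)"
proof -
  let ?n = "nat_End_map R Q d I J c"
  note surj = iota_surj[OF rad]
  have "\<exists>k. lin R HJ HI k \<and> (\<forall>x\<in>carrier HI. k (\<iota> x) = x)"
  proof (rule lin_factor_surj[OF I.mH J.mH I.mH iota_lin _ surj])
    show "lin R HI HI (\<lambda>x. x)" by (auto simp: lin_def)
    interpret HI: module R HI by (rule I.mH)
    show "x = \<zero>\<^bsub>HI\<^esub>" if "x \<in> carrier HI" "\<iota> x = \<zero>\<^bsub>HJ\<^esub>" for x
      using inj_onD[OF iota_inj, of x "\<zero>\<^bsub>HI\<^esub>"] that lin_zero[OF iota_lin I.mH J.mH] by simp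
  qed
  then obtain k where k: "lin R HJ HI k" "\<And>x. x \<in> carrier HI \<Longrightarrow> k (\<iota> x) = x" by blast
  have ik: "\<iota> (k y) = y" if y: "y \<in> carrier HJ" for y
  proof -
    obtain x where "x \<in> carrier HI" "y = \<iota> x" using y surj by blast
    then show ?thesis using k(2) by simp
  qed
  have inj: "inj_on ?n (mod_hom R HJ HJ)"
  proof (rule inj_onI)
    fix g g' assume g: "g \<in> mod_hom R HJ HJ" "g' \<in> mod_hom R HJ HJ" "?n g = ?n g'"
    show "g = g'"
    proof (rule mod_hom_eqI[OF g(1,2)])
      fix y assume y: "y \<in> carrier HJ"
      then obtain x where x: "x \<in> carrier HI" "y = \<iota> x" using surj by blast
      show "g y = g' y" using nat_End_map_char(2)[OF g(1) x(1)] nat_End_map_char(2)[OF g(2) x(1)] g(3) x(2) by simp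
    qed
  qed
  have "?n ` mod_hom R HJ HJ = mod_hom R HI HI"
  proof (intro equalityI subsetI)
    fix g assume "g \<in> ?n ` mod_hom R HJ HJ"
    then show "g \<in> mod_hom R HI HI" using nat_End_map_char(1) by blast
  next
    fix g assume g: "g \<in> mod_hom R HI HI"
    let ?g = "restrict (\<lambda>y. \<iota> (g (k y))) (carrier HJ)"
    have g': "?g \<in> mod_hom R HJ HJ"
      by (rule lin_restrict[OF lin_comp[OF lin_comp[OF k(1) mod_hom_lin[OF g]] iota_lin] J.mH])
    have "?n ?g = g"
      by (rule nat_End_map_eqI[OF g' g]) (use k(2) lin_closed[OF iota_lin] in simp)
    then show "g \<in> ?n ` mod_hom R HJ HJ" using g' by (metis imageI)
  qed
  then show ?thesis using nat_End_map_hom inj by (simp add: mod_iso_def bij_betw_def)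
qed

end

section \<open>Matlis duality\<close>

text \<open>The submodule \<open>V\<close> stands for the sums of maps \<open>\<psi> \<circ> \<alpha>\<close>; the induction is on the number of maps \<open>\<alpha>\<close>,
  with \<open>P\<close> replaced by the kernel of one of them.\<close>

lemma baer_factor_family:
  assumes E: "baer R E" and W: "module R W" and "finite A"
  shows "module R P \<Longrightarrow> (\<And>\<alpha>. \<alpha> \<in> A \<Longrightarrow> lin R P W \<alpha>) \<Longrightarrow> \<theta> \<in> mod_hom R P E \<Longrightarrow>
    (\<And>x. x \<in> carrier P \<Longrightarrow> (\<And>\<alpha>. \<alpha> \<in> A \<Longrightarrow> \<alpha> x = \<zero>\<^bsub>W\<^esub>) \<Longrightarrow> \<theta> x = \<zero>\<^bsub>E\<^esub>) \<Longrightarrow>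
    submodule V R (Hom_mod R P E) \<Longrightarrow>
    (\<And>\<alpha> \<psi>. \<alpha> \<in> A \<Longrightarrow> lin R W E \<psi> \<Longrightarrow> restrict (\<lambda>x. \<psi> (\<alpha> x)) (carrier P) \<in> V) \<Longrightarrow> \<theta> \<in> V"
  using \<open>finite A\<close>
proof (induction A arbitrary: P \<theta> V)
  case empty
  have mE: "module R E" by (rule baer_module[OF E])
  have "\<theta> = \<zero>\<^bsub>Hom_mod R P E\<^esub>"
    using empty.prems lin_restrict[OF lin_const_zero[OF empty.prems(1) mE] empty.prems(1)]
    by (intro mod_hom_eqI[of _ R P E]) auto
  then show ?case using submodD(2)[OF empty.prems(5)] by (simp only:)
next
  case (insert \<alpha> A)
  have mE: "module R E" by (rule baer_module[OF E])
  note P = insert.prems(1) and th = insert.prems(3) and V = insert.prems(5)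
  have la: "lin R P W \<alpha>" using insert.prems(2) by simp
  let ?N = "{x \<in> carrier P. \<alpha> x = \<zero>\<^bsub>W\<^esub>}"
  let ?P' = "P\<lparr>carrier := ?N\<rparr>"
  have sN: "submodule ?N R P" by (rule submod_ker[OF la P W])
  have P': "module R ?P'" by (rule submod_module[OF sN P])
  have Nc: "?N \<subseteq> carrier P" by blast
  note HP = Hom_mod_module[OF P mE] and HP' = Hom_mod_module[OF P' mE]
  interpret HP: module R "Hom_mod R P E" by (rule HP)
  let ?r = "\<lambda>g. restrict g ?N"
  have rh: "?r g \<in> mod_hom R ?P' E" if "g \<in> mod_hom R P E" for g
    using lin_restrict[OF lin_dom[OF mod_hom_lin[OF that] Nc] P'] by simp
  have rl: "lin R (Hom_mod R P E) (Hom_mod R ?P' E) ?r"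
    by (rule linI) (use rh in \<open>auto simp: fun_eq_iff\<close>)
  have "?r \<theta> \<in> ?r ` V"
  proof (rule insert.IH[OF P' _ rh[OF th] _ submod_image[OF rl HP HP' V]])
    show "lin R ?P' W \<beta>" if "\<beta> \<in> A" for \<beta> by (rule lin_dom[OF _ Nc]) (use insert.prems(2) that in simp)
    show "?r \<theta> x = \<zero>\<^bsub>E\<^esub>" if "x \<in> carrier ?P'" "\<And>\<beta>. \<beta> \<in> A \<Longrightarrow> \<beta> x = \<zero>\<^bsub>W\<^esub>" for x
      using insert.prems(4)[of x] that by auto
    show "restrict (\<lambda>x. \<psi> (\<beta> x)) (carrier ?P') \<in> ?r ` V" if "\<beta> \<in> A" "lin R W E \<psi>" for \<beta> \<psi>
    proof -
      have "restrict (\<lambda>x. \<psi> (\<beta> x)) (carrier P) \<in> V" by (rule insert.prems(6)[OF insertI2[OF that(1)] that(2)])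
      moreover have "restrict (\<lambda>x. \<psi> (\<beta> x)) (carrier ?P') = ?r (restrict (\<lambda>x. \<psi> (\<beta> x)) (carrier P))" by (auto simp: fun_eq_iff)
      ultimately show ?thesis by blast
    qed
  qed
  then obtain g where g: "g \<in> V" "?r \<theta> = ?r g" by blast
  have gh: "g \<in> mod_hom R P E" using submodD(1)[OF V] g(1) by auto
  let ?D = "\<lambda>x. \<theta> x \<ominus>\<^bsub>E\<^esub> g x"
  have tc: "\<theta> x \<in> carrier E" "g x \<in> carrier E" if "x \<in> carrier P" for x
    using lin_closed[OF mod_hom_lin[OF th] that] lin_closed[OF mod_hom_lin[OF gh] that] by auto
  have "\<exists>\<psi>. lin R W E \<psi> \<and> (\<forall>x\<in>carrier P. \<psi> (\<alpha> x) = ?D x)"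
  proof (rule baer_factor[OF E P W la lin_fun_diff[OF mod_hom_lin[OF th] mod_hom_lin[OF gh] P mE]])
    fix x assume x: "x \<in> carrier P" "\<alpha> x = \<zero>\<^bsub>W\<^esub>"
    then have "\<theta> x = g x" using fun_cong[OF g(2), of x] by simp
    then show "?D x = \<zero>\<^bsub>E\<^esub>" using minus_eq_zero_iff[OF mE] tc[OF x(1)] by simp
  qed
  then obtain \<psi> where psi: "lin R W E \<psi>" "\<And>x. x \<in> carrier P \<Longrightarrow> \<psi> (\<alpha> x) = ?D x" by blast
  have k: "restrict (\<lambda>x. \<psi> (\<alpha> x)) (carrier P) \<in> V" by (rule insert.prems(6)[OF insertI1 psi(1)])
  have sV: "restrict (\<lambda>x. \<psi> (\<alpha> x)) (carrier P) \<oplus>\<^bsub>Hom_mod R P E\<^esub> g \<in> V" by (rule submodD(3)[OF V k g(1)])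
  moreover have "restrict (\<lambda>x. \<psi> (\<alpha> x)) (carrier P) \<oplus>\<^bsub>Hom_mod R P E\<^esub> g = \<theta>"
  proof (rule mod_hom_eqI[OF _ th])
    show "restrict (\<lambda>x. \<psi> (\<alpha> x)) (carrier P) \<oplus>\<^bsub>Hom_mod R P E\<^esub> g \<in> mod_hom R P E"
      using submodD(1)[OF V] sV by auto
    show "(restrict (\<lambda>x. \<psi> (\<alpha> x)) (carrier P) \<oplus>\<^bsub>Hom_mod R P E\<^esub> g) x = \<theta> x" if x: "x \<in> carrier P" for x
      using x psi(2)[OF x] minus_add_cancel(1)[OF mE tc[OF x]] by simp
  qed
  ultimately show ?case by simp
qed

locale local_hull =
  fixes R :: "('r, 'z) ring_scheme" and \<mm> :: "'r set" and E :: "('r, 'h) module" and e :: "'r set \<Rightarrow> 'h"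
  assumes nl: "noetherian_local_ring R \<mm>" and hull: "injective_hull R (cyc_module R \<mm>) E e"
begin

lemma cR: "cring R" and nR: "noetherian_ring R" and mm: "maximalideal \<mm> R"
  and mm_unique: "maximalideal \<nn> R \<Longrightarrow> \<nn> = \<mm>"
  using nl unfolding noetherian_local_ring_def by blast+

sublocale R: cring R by (rule cR)

lemma mI: "ideal \<mm> R"
  by (rule maximalideal.axioms(1)[OF mm])

lemma one_notin: "\<one>\<^bsub>R\<^esub> \<notin> \<mm>"
  using maximalideal.I_notcarr[OF mm] ideal.one_imp_carrier[OF mI] by auto

lemma E: "baer R E"
  using hull injective_baer unfolding injective_hull_def by blast

lemma mE: "module R E"
  by (rule baer_module[OF E])

sublocale E: module R E by (rule mE)

text \<open>An ideal that is maximal among those above \<aa> without 1 is a maximal ideal, hence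
  equal to \<mm>.\<close>

lemma proper_le:
  assumes a: "ideal \<aa> R" and one: "\<one>\<^bsub>R\<^esub> \<notin> \<aa>"
  shows "\<aa> \<subseteq> \<mm>"
proof -
  let ?S = "{I. ideal I R \<and> \<aa> \<subseteq> I \<and> \<one>\<^bsub>R\<^esub> \<notin> I}"
  have "\<exists>I\<in>?S. \<forall>J\<in>?S. I \<subseteq> J \<longrightarrow> J = I"
    by (rule noetherian_maximal[OF nR]) (use a one in auto)
  then obtain I where I: "I \<in> ?S" "\<forall>J\<in>?S. I \<subseteq> J \<longrightarrow> J = I" by blast
  have "maximalideal I R"
  proof (rule maximalidealI)
    show "ideal I R" using I by simp
    show "carrier R \<noteq> I" using I by auto
    fix J assume J: "ideal J R" "I \<subseteq> J" "J \<subseteq> carrier R"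
    show "J = I \<or> J = carrier R"
    proof (cases "\<one>\<^bsub>R\<^esub> \<in> J")
      case True
      then show ?thesis using ideal.one_imp_carrier[OF J(1)] by simp
    next
      case False
      then have "J \<in> ?S" using I(1) J by auto
      then show ?thesis using I(2) J(2) by blast
    qed
  qed
  then have "I = \<mm>" by (rule mm_unique)
  then show ?thesis using I(1) by blast
qed

lemma unit_of_notin:
  assumes "t \<in> carrier R" "t \<notin> \<mm>"
  shows "\<exists>t'\<in>carrier R. t' \<otimes>\<^bsub>R\<^esub> t = \<one>\<^bsub>R\<^esub>"
proof -
  have "\<one>\<^bsub>R\<^esub> \<in> PIdl\<^bsub>R\<^esub> t"
    using proper_le[OF R.cgenideal_ideal[OF assms(1)]] R.cgenideal_self[OF assms(1)] assms(2) by blast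
  then show ?thesis by (auto simp: cgenideal_def)
qed

text \<open>The image of 1 of the residue field; \<open>socle\<close> shows that it generates all
  elements of E killed by \<mm>.\<close>

definition e1 where "e1 = e (\<mm> +>\<^bsub>R\<^esub> \<one>\<^bsub>R\<^esub>)"

lemma e_lin: "lin R (cyc_module R \<mm>) E e" and e_inj: "inj_on e (carrier (cyc_module R \<mm>))"
  and e_ess: "submodule S R E \<Longrightarrow> S \<noteq> {\<zero>\<^bsub>E\<^esub>} \<Longrightarrow> S \<inter> e ` carrier (cyc_module R \<mm>) \<noteq> {\<zero>\<^bsub>E\<^esub>}"
  using hull unfolding injective_hull_def by (auto intro: mod_hom_lin)

lemma e_coset: "r \<in> carrier R \<Longrightarrow> e (\<mm> +>\<^bsub>R\<^esub> r) = r \<odot>\<^bsub>E\<^esub> e1"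
  using lin_smult[OF e_lin, of r "\<mm> +>\<^bsub>R\<^esub> \<one>\<^bsub>R\<^esub>"] cyc_one_closed[OF cR] cyc_smult_one[OF cR mI] unfolding e1_def by metis

lemma e1_closed: "e1 \<in> carrier E"
  unfolding e1_def by (rule lin_closed[OF e_lin cyc_one_closed[OF cR]])

lemma e1_zero_iff:
  assumes r: "r \<in> carrier R"
  shows "r \<odot>\<^bsub>E\<^esub> e1 = \<zero>\<^bsub>E\<^esub> \<longleftrightarrow> r \<in> \<mm>"
proof -
  note mC = cyc_module_props(1)[OF cR mI]
  interpret C: module R "cyc_module R \<mm>" by (rule mC)
  have c: "\<mm> +>\<^bsub>R\<^esub> r \<in> carrier (cyc_module R \<mm>)" unfolding cyc_carrier using r by blast
  have "r \<odot>\<^bsub>E\<^esub> e1 = \<zero>\<^bsub>E\<^esub> \<longleftrightarrow> e (\<mm> +>\<^bsub>R\<^esub> r) = e \<zero>\<^bsub>cyc_module R \<mm>\<^esub>"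
    using e_coset[OF r] lin_zero[OF e_lin mC mE] by simp
  also have "\<dots> \<longleftrightarrow> \<mm> +>\<^bsub>R\<^esub> r = \<zero>\<^bsub>cyc_module R \<mm>\<^esub>" by (rule inj_on_eq_iff[OF e_inj c C.M.zero_closed])
  also have "\<dots> \<longleftrightarrow> r \<in> \<mm>" using coset_eq_sub[OF ideal_submod[OF cR mI] reg_module[OF cR], of r] r by simp
  finally show ?thesis .
qed

text \<open>Essentiality of the residue field in E, applied to the cyclic submodule R v.\<close>

lemma meets_socle:
  assumes v: "v \<in> carrier E" "v \<noteq> \<zero>\<^bsub>E\<^esub>"
  shows "\<exists>t\<in>carrier R. \<exists>s\<in>carrier R. t \<odot>\<^bsub>E\<^esub> v = s \<odot>\<^bsub>E\<^esub> e1 \<and> t \<odot>\<^bsub>E\<^esub> v \<noteq> \<zero>\<^bsub>E\<^esub>"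
proof -
  let ?S = "(\<lambda>r. r \<odot>\<^bsub>E\<^esub> v) ` carrier R"
  have S: "submodule ?S R E"
    using submod_image[OF lin_orbit[OF mE v(1)] reg_module[OF cR] mE submod_carrier[OF reg_module[OF cR]]] by simp
  have "v \<in> ?S" using E.smult_one[OF v(1)] by (metis R.one_closed imageI)
  then have "?S \<noteq> {\<zero>\<^bsub>E\<^esub>}" using v(2) by blast
  then have "?S \<inter> e ` carrier (cyc_module R \<mm>) \<noteq> {\<zero>\<^bsub>E\<^esub>}" by (rule e_ess[OF S])
  moreover have "\<zero>\<^bsub>E\<^esub> \<in> ?S \<inter> e ` carrier (cyc_module R \<mm>)"
    using submodD(2)[OF S] submodD(2)[OF submod_image[OF e_lin cyc_module_props(1)[OF cR mI] mE submod_carrier[OF cyc_module_props(1)[OF cR mI]]]] by blast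
  ultimately obtain w where w: "w \<in> ?S" "w \<in> e ` carrier (cyc_module R \<mm>)" "w \<noteq> \<zero>\<^bsub>E\<^esub>" by blast
  from w(1) obtain t where t: "t \<in> carrier R" "w = t \<odot>\<^bsub>E\<^esub> v" by blast
  from w(2) obtain X where X: "X \<in> carrier (cyc_module R \<mm>)" "w = e X" by blast
  from X(1) obtain s where s: "s \<in> carrier R" "X = \<mm> +>\<^bsub>R\<^esub> s" unfolding cyc_carrier by blast
  have "w = s \<odot>\<^bsub>E\<^esub> e1" unfolding X(2) s(2) by (rule e_coset[OF s(1)])
  then have "t \<odot>\<^bsub>E\<^esub> v = s \<odot>\<^bsub>E\<^esub> e1" "t \<odot>\<^bsub>E\<^esub> v \<noteq> \<zero>\<^bsub>E\<^esub>" using t(2) w(3) by simp_all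
  then show ?thesis using t(1) s(1) by blast
qed

text \<open>The annihilator of y is a proper ideal, hence inside \<mm>. So r y \<mapsto> r e1 is
  well defined on R y, is nonzero at y, and extends to A by injectivity of E.\<close>

lemma cogenerator:
  assumes A: "module R A" and y: "y \<in> carrier A" "y \<noteq> \<zero>\<^bsub>A\<^esub>"
  shows "\<exists>\<phi>\<in>mod_hom R A E. \<phi> y \<noteq> \<zero>\<^bsub>E\<^esub>"
proof -
  interpret A: module R A by fact
  have "\<exists>\<psi>. lin R A E \<psi> \<and> (\<forall>r\<in>carrier (reg_module R). \<psi> (r \<odot>\<^bsub>A\<^esub> y) = r \<odot>\<^bsub>E\<^esub> e1)"
  proof (rule baer_factor[OF E reg_module[OF cR] A lin_orbit[OF A y(1)] lin_orbit[OF mE e1_closed]])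
    fix r assume r: "r \<in> carrier (reg_module R)" "r \<odot>\<^bsub>A\<^esub> y = \<zero>\<^bsub>A\<^esub>"
    let ?L = "{t \<in> carrier (reg_module R). t \<odot>\<^bsub>A\<^esub> y = \<zero>\<^bsub>A\<^esub>}"
    have "ideal ?L R" by (rule submod_ideal[OF cR submod_ker[OF lin_orbit[OF A y(1)] reg_module[OF cR] A]])
    then have "?L \<subseteq> \<mm>" by (rule proper_le) (use y in simp)
    then have "r \<in> \<mm>" using r by blast
    then show "r \<odot>\<^bsub>E\<^esub> e1 = \<zero>\<^bsub>E\<^esub>" using e1_zero_iff r(1) by simp
  qed
  then obtain \<psi> where psi: "lin R A E \<psi>" "\<forall>r\<in>carrier R. \<psi> (r \<odot>\<^bsub>A\<^esub> y) = r \<odot>\<^bsub>E\<^esub> e1" by auto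
  have "\<psi> y = e1" using bspec[OF psi(2) R.one_closed] y e1_closed by simp
  moreover have "e1 \<noteq> \<zero>\<^bsub>E\<^esub>" using e1_zero_iff[OF R.one_closed] one_notin e1_closed by simp
  ultimately have "restrict \<psi> (carrier A) y \<noteq> \<zero>\<^bsub>E\<^esub>" using y(1) by simp
  then show ?thesis using lin_restrict[OF psi(1) A] by blast
qed

lemma eq_by_functionals:
  assumes A: "module R A" and "x \<in> carrier A" "y \<in> carrier A" and "\<And>\<phi>. \<phi> \<in> mod_hom R A E \<Longrightarrow> \<phi> x = \<phi> y"
  shows "x = y"
proof (rule ccontr)
  assume "x \<noteq> y"
  then have "x \<ominus>\<^bsub>A\<^esub> y \<noteq> \<zero>\<^bsub>A\<^esub>" using minus_eq_zero_iff[OF A assms(2,3)] by simp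
  then obtain \<phi> where p: "\<phi> \<in> mod_hom R A E" "\<phi> (x \<ominus>\<^bsub>A\<^esub> y) \<noteq> \<zero>\<^bsub>E\<^esub>" using cogenerator[OF A minus_closed[OF A assms(2,3)]] by blast
  then show False
    using lin_diff[OF mod_hom_lin[OF p(1)] A mE assms(2,3)] assms(4)[OF p(1)]
      minus_eq_zero_iff[OF mE lin_closed[OF mod_hom_lin[OF p(1)] assms(2)] lin_closed[OF mod_hom_lin[OF p(1)] assms(3)]] by simp
qed

text \<open>Otherwise \<open>assoc_prime\<close> provides a multiple y of x with prime annihilator
  that omits some a in \<mm>. A nonzero multiple t y lies in R e1 and is killed by a, so primeness
  puts t into the annihilator, a contradiction.\<close>

lemma E_tors: "x \<in> carrier E \<Longrightarrow> x \<in> tors R \<mm> E"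
proof (rule tors_elt[OF nR mE mI], assumption, rule ccontr)
  fix a assume x: "x \<in> carrier E" and a: "a \<in> \<mm>" and na: "\<nexists>k::nat. a [^]\<^bsub>R\<^esub> k \<odot>\<^bsub>E\<^esub> x = \<zero>\<^bsub>E\<^esub>"
  have ac: "a \<in> carrier R" by (rule ideal.Icarr[OF mI a])
  have nz: "a [^]\<^bsub>R\<^esub> k \<odot>\<^bsub>E\<^esub> x \<noteq> \<zero>\<^bsub>E\<^esub>" for k :: nat using na by simp
  from assoc_prime[OF nR mE ac x nz]
  obtain r where r: "r \<in> carrier R" "primeideal {t \<in> carrier R. t \<odot>\<^bsub>E\<^esub> (r \<odot>\<^bsub>E\<^esub> x) = \<zero>\<^bsub>E\<^esub>} R"
    "a \<notin> {t \<in> carrier R. t \<odot>\<^bsub>E\<^esub> (r \<odot>\<^bsub>E\<^esub> x) = \<zero>\<^bsub>E\<^esub>}" by (elim bexE conjE)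
  let ?y = "r \<odot>\<^bsub>E\<^esub> x" and ?p = "{t \<in> carrier R. t \<odot>\<^bsub>E\<^esub> (r \<odot>\<^bsub>E\<^esub> x) = \<zero>\<^bsub>E\<^esub>}"
  have yc: "?y \<in> carrier E" using r x by simp
  have "?y \<noteq> \<zero>\<^bsub>E\<^esub>" using r(3) ac by auto
  then obtain t s where t: "t \<in> carrier R" "s \<in> carrier R" "t \<odot>\<^bsub>E\<^esub> ?y = s \<odot>\<^bsub>E\<^esub> e1" "t \<odot>\<^bsub>E\<^esub> ?y \<noteq> \<zero>\<^bsub>E\<^esub>" using meets_socle[OF yc] by blast
  have "a \<odot>\<^bsub>E\<^esub> (t \<odot>\<^bsub>E\<^esub> ?y) = \<zero>\<^bsub>E\<^esub>"
  proof -
    have "a \<odot>\<^bsub>E\<^esub> (s \<odot>\<^bsub>E\<^esub> e1) = s \<odot>\<^bsub>E\<^esub> (a \<odot>\<^bsub>E\<^esub> e1)" by (rule smult_commute[OF mE ac t(2) e1_closed])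
    also have "a \<odot>\<^bsub>E\<^esub> e1 = \<zero>\<^bsub>E\<^esub>" using e1_zero_iff[OF ac] a by simp
    finally show ?thesis unfolding t(3) using t(2) by simp
  qed
  then have "(a \<otimes>\<^bsub>R\<^esub> t) \<odot>\<^bsub>E\<^esub> ?y = \<zero>\<^bsub>E\<^esub>" using E.smult_assoc1[OF ac t(1) yc] by simp
  then have "a \<otimes>\<^bsub>R\<^esub> t \<in> ?p" using ac t(1) by blast
  then have "t \<in> ?p" using primeideal.I_prime[OF r(2) ac t(1)] r(3) by blast
  then show False using t(4) by blast
qed

text \<open>A nonzero v has a nonzero multiple t v in R e1. Since \<mm> kills v, t lies outside
  \<mm> and is a unit.\<close>

lemma socle:
  assumes v: "v \<in> killed E \<mm>"
  shows "\<exists>s\<in>carrier R. v = s \<odot>\<^bsub>E\<^esub> e1"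
proof (cases "v = \<zero>\<^bsub>E\<^esub>")
  case True
  then show ?thesis using e1_closed by (intro bexI[of _ "\<zero>\<^bsub>R\<^esub>"]) auto
next
  case False
  have vc: "v \<in> carrier E" using v by (simp add: killed_def)
  obtain t s where t: "t \<in> carrier R" "s \<in> carrier R" "t \<odot>\<^bsub>E\<^esub> v = s \<odot>\<^bsub>E\<^esub> e1" "t \<odot>\<^bsub>E\<^esub> v \<noteq> \<zero>\<^bsub>E\<^esub>" using meets_socle[OF vc False] by blast
  have "t \<notin> \<mm>" using t(4) v by (auto simp: killed_def)
  then obtain t' where t': "t' \<in> carrier R" "t' \<otimes>\<^bsub>R\<^esub> t = \<one>\<^bsub>R\<^esub>" using unit_of_notin[OF t(1)] by blast
  have "v = (t' \<otimes>\<^bsub>R\<^esub> t) \<odot>\<^bsub>E\<^esub> v" unfolding t'(2) using vc by simp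
  also have "\<dots> = t' \<odot>\<^bsub>E\<^esub> (s \<odot>\<^bsub>E\<^esub> e1)" unfolding E.smult_assoc1[OF t'(1) t(1) vc] t(3) ..
  also have "\<dots> = (t' \<otimes>\<^bsub>R\<^esub> s) \<odot>\<^bsub>E\<^esub> e1" by (rule E.smult_assoc1[OF t'(1) t(2) e1_closed, symmetric])
  finally show ?thesis using t'(1) t(2) by blast
qed

text \<open>The difference \<open>f - r\<close> vanishes on the common kernel of generators \<open>a\<close> of \<open>\<mm>\<^sup>k\<close>, and an endomorphism
  of \<open>E\<close> acts as a scalar on the values \<open>a x\<close>, which lie in the socle.\<close>

lemma End_hull_step:
  assumes f: "lin R E E f" and r: "r \<in> carrier R" "\<And>x. x \<in> killed E (ideal_pow R \<mm> k) \<Longrightarrow> f x = r \<odot>\<^bsub>E\<^esub> x"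
  shows "\<exists>t\<in>ideal_pow R \<mm> k. \<forall>x\<in>killed E (ideal_pow R \<mm> (Suc k)). f x = (r \<oplus>\<^bsub>R\<^esub> t) \<odot>\<^bsub>E\<^esub> x"
proof -
  let ?mk = "ideal_pow R \<mm> k"
  let ?N = "killed E (ideal_pow R \<mm> (Suc k))"
  let ?P = "E\<lparr>carrier := ?N\<rparr>"
  have mkI: "ideal ?mk R" by (rule R.ideal_pow_ideal[OF mI])
  have mkc: "?mk \<subseteq> carrier R" by (rule ideal_pow_carr[OF cR mI])
  have sN: "submodule ?N R E" by (rule killed_submod[OF mE ideal_pow_carr[OF cR mI]])
  have P: "module R ?P" by (rule submod_module[OF sN mE])
  have Nc: "?N \<subseteq> carrier E" by (rule submodD(1)[OF sN])
  obtain S where S: "S \<subseteq> carrier R" "finite S" "?mk = Idl\<^bsub>R\<^esub> S" using noetherian_ring.finetely_gen[OF nR mkI] by blast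
  have Sm: "S \<subseteq> ?mk" unfolding S(3) by (rule R.genideal_self[OF S(1)])
  let ?A = "(\<lambda>a x. a \<odot>\<^bsub>E\<^esub> x) ` S"
  let ?D = "\<lambda>x. f x \<ominus>\<^bsub>E\<^esub> r \<odot>\<^bsub>E\<^esub> x"
  have lD: "lin R E E ?D" by (rule lin_fun_diff[OF f lin_mult[OF mE r(1)] mE mE])
  have lDP: "lin R ?P E ?D" by (rule lin_dom[OF lD Nc])
  \<comment> \<open>Multiplications by elements of \<mm>^k, restricted to the elements killed by
    \<mm>^(k+1). That f - r belongs to this submodule is exactly the existence of the correction
    t.\<close>
  let ?V = "{g \<in> mod_hom R ?P E. \<exists>t\<in>?mk. \<forall>x\<in>?N. g x = t \<odot>\<^bsub>E\<^esub> x}"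
  note H = Hom_mod_module[OF P mE]
  interpret H: module R "Hom_mod R ?P E" by (rule H)
  have "restrict ?D (carrier ?P) \<in> ?V"
  proof (rule baer_factor_family[OF E mE finite_imageI[OF S(2)] P _ lin_restrict[OF lDP P]])
    show "lin R ?P E \<alpha>" if al: "\<alpha> \<in> ?A" for \<alpha>
    proof -
      obtain a where "a \<in> S" "\<alpha> = (\<lambda>x. a \<odot>\<^bsub>E\<^esub> x)" using al by blast
      then show ?thesis using lin_dom[OF lin_mult[OF mE, of a] Nc] S(1) by blast
    qed
    show "restrict ?D (carrier ?P) x = \<zero>\<^bsub>E\<^esub>" if x: "x \<in> carrier ?P" "\<And>\<alpha>. \<alpha> \<in> ?A \<Longrightarrow> \<alpha> x = \<zero>\<^bsub>E\<^esub>" for x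
    proof -
      have xc: "x \<in> carrier E" using x(1) Nc by auto
      have "x \<in> killed E S" using x(2) xc by (auto simp: killed_def)
      then have "x \<in> killed E ?mk" unfolding S(3) killed_genideal[OF mE S(1)] .
      then have "f x = r \<odot>\<^bsub>E\<^esub> x" by (rule r(2))
      then show ?thesis using x(1) minus_eq_zero_iff[OF mE] r(1) xc by simp
    qed
    show "submodule ?V R (Hom_mod R ?P E)"
    proof (rule submodI[OF H])
      show "?V \<subseteq> carrier (Hom_mod R ?P E)" by auto
      have "\<forall>x\<in>?N. \<zero>\<^bsub>Hom_mod R ?P E\<^esub> x = \<zero>\<^bsub>R\<^esub> \<odot>\<^bsub>E\<^esub> x" using Nc by auto
      moreover have "\<zero>\<^bsub>R\<^esub> \<in> ?mk" by (rule additive_subgroup.zero_closed[OF ideal.axioms(1)[OF mkI]])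
      moreover have "\<zero>\<^bsub>Hom_mod R ?P E\<^esub> \<in> mod_hom R ?P E" using H.M.zero_closed unfolding Hom_mod_simps(1) .
      ultimately show "\<zero>\<^bsub>Hom_mod R ?P E\<^esub> \<in> ?V" by blast
      fix g assume g: "g \<in> ?V"
      then obtain t where t: "t \<in> ?mk" "\<forall>x\<in>?N. g x = t \<odot>\<^bsub>E\<^esub> x" by blast
      have gh: "g \<in> mod_hom R ?P E" using g by blast
      have tc: "t \<in> carrier R" using t(1) mkc by blast
      { fix g' assume g': "g' \<in> ?V"
        then obtain t' where t': "t' \<in> ?mk" "\<forall>x\<in>?N. g' x = t' \<odot>\<^bsub>E\<^esub> x" by blast
        have gh': "g' \<in> mod_hom R ?P E" using g' by blast
        have tc': "t' \<in> carrier R" using t'(1) mkc by blast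
        have "\<forall>x\<in>?N. (g \<oplus>\<^bsub>Hom_mod R ?P E\<^esub> g') x = (t \<oplus>\<^bsub>R\<^esub> t') \<odot>\<^bsub>E\<^esub> x"
          using t(2) t'(2) E.smult_l_distr[OF tc tc'] Nc by auto
        moreover have "t \<oplus>\<^bsub>R\<^esub> t' \<in> ?mk" by (rule additive_subgroup.a_closed[OF ideal.axioms(1)[OF mkI] t(1) t'(1)])
        moreover have "g \<oplus>\<^bsub>Hom_mod R ?P E\<^esub> g' \<in> mod_hom R ?P E" using H.M.a_closed[of g g'] gh gh' unfolding Hom_mod_simps(1) by blast
        ultimately show "g \<oplus>\<^bsub>Hom_mod R ?P E\<^esub> g' \<in> ?V" by blast }
      fix q assume q: "q \<in> carrier R"
      have "\<forall>x\<in>?N. (q \<odot>\<^bsub>Hom_mod R ?P E\<^esub> g) x = (q \<otimes>\<^bsub>R\<^esub> t) \<odot>\<^bsub>E\<^esub> x"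
        using t(2) E.smult_assoc1[OF q tc] Nc by auto
      moreover have "q \<otimes>\<^bsub>R\<^esub> t \<in> ?mk" by (rule ideal.I_l_closed[OF mkI t(1) q])
      moreover have "q \<odot>\<^bsub>Hom_mod R ?P E\<^esub> g \<in> mod_hom R ?P E" using H.smult_closed[of q g] gh q unfolding Hom_mod_simps(1) by blast
      ultimately show "q \<odot>\<^bsub>Hom_mod R ?P E\<^esub> g \<in> ?V" by blast
    qed
    show "restrict (\<lambda>x. \<psi> (\<alpha> x)) (carrier ?P) \<in> ?V" if al: "\<alpha> \<in> ?A" and psi: "lin R E E \<psi>" for \<alpha> \<psi>
    proof -
      obtain a where a: "a \<in> S" "\<alpha> = (\<lambda>x. a \<odot>\<^bsub>E\<^esub> x)" using al by blast
      have ac: "a \<in> carrier R" and am: "a \<in> ?mk" using a S(1) Sm by auto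
      have e1k: "e1 \<in> killed E \<mm>" using e1_closed e1_zero_iff ideal.Icarr[OF mI] by (auto simp: killed_def)
      have "\<psi> e1 \<in> killed E \<mm>" by (rule killed_lin[OF psi mE mE _ e1k]) (use ideal.Icarr[OF mI] in blast)
      then obtain s where s: "s \<in> carrier R" "\<psi> e1 = s \<odot>\<^bsub>E\<^esub> e1" using socle by blast
      have "\<psi> (a \<odot>\<^bsub>E\<^esub> x) = (s \<otimes>\<^bsub>R\<^esub> a) \<odot>\<^bsub>E\<^esub> x" if x: "x \<in> ?N" for x
      proof -
        have xc: "x \<in> carrier E" using x Nc by blast
        have "b \<odot>\<^bsub>E\<^esub> (a \<odot>\<^bsub>E\<^esub> x) = \<zero>\<^bsub>E\<^esub>" if b: "b \<in> \<mm>" for b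
        proof -
          have bc: "b \<in> carrier R" by (rule ideal.Icarr[OF mI b])
          have "a \<otimes>\<^bsub>R\<^esub> b \<in> ideal_pow R \<mm> (Suc k)" using ideal_prod.prod[OF am b, of R] by simp
          then have "(a \<otimes>\<^bsub>R\<^esub> b) \<odot>\<^bsub>E\<^esub> x = \<zero>\<^bsub>E\<^esub>" using x unfolding killed_def by blast
          then show ?thesis using smult_commute[OF mE bc ac xc] E.smult_assoc1[OF ac bc xc] by simp
        qed
        then have "a \<odot>\<^bsub>E\<^esub> x \<in> killed E \<mm>" using ac xc by (simp add: killed_def)
        then obtain q where q: "q \<in> carrier R" "a \<odot>\<^bsub>E\<^esub> x = q \<odot>\<^bsub>E\<^esub> e1" using socle by blast
        have "\<psi> (a \<odot>\<^bsub>E\<^esub> x) = q \<odot>\<^bsub>E\<^esub> (s \<odot>\<^bsub>E\<^esub> e1)" unfolding q(2) lin_smult[OF psi q(1) e1_closed] s(2) ..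
        also have "\<dots> = s \<odot>\<^bsub>E\<^esub> (a \<odot>\<^bsub>E\<^esub> x)" unfolding q(2) by (rule smult_commute[OF mE q(1) s(1) e1_closed])
        finally show ?thesis using E.smult_assoc1[OF s(1) ac xc] by simp
      qed
      then have "\<forall>x\<in>?N. restrict (\<lambda>x. \<psi> (\<alpha> x)) (carrier ?P) x = (s \<otimes>\<^bsub>R\<^esub> a) \<odot>\<^bsub>E\<^esub> x" unfolding a(2) by simp
      moreover have "s \<otimes>\<^bsub>R\<^esub> a \<in> ?mk" by (rule ideal.I_l_closed[OF mkI am s(1)])
      moreover have "restrict (\<lambda>x. \<psi> (\<alpha> x)) (carrier ?P) \<in> mod_hom R ?P E"
        unfolding a(2) by (rule lin_restrict[OF lin_comp[OF lin_dom[OF lin_mult[OF mE ac] Nc] psi] P])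
      ultimately show ?thesis by blast
    qed
  qed
  then obtain t where t: "t \<in> ?mk" "\<And>x. x \<in> ?N \<Longrightarrow> ?D x = t \<odot>\<^bsub>E\<^esub> x" by auto
  have tc: "t \<in> carrier R" using t(1) mkc by blast
  have "f x = (r \<oplus>\<^bsub>R\<^esub> t) \<odot>\<^bsub>E\<^esub> x" if x: "x \<in> ?N" for x
  proof -
    have xc: "x \<in> carrier E" using x Nc by blast
    have "f x = r \<odot>\<^bsub>E\<^esub> x \<oplus>\<^bsub>E\<^esub> ?D x" using minus_add_cancel(2)[OF mE lin_closed[OF f xc], of "r \<odot>\<^bsub>E\<^esub> x"] r(1) xc by simp
    then show ?thesis unfolding t(2)[OF x] E.smult_l_distr[OF r(1) tc xc] .
  qed
  then show ?thesis using t(1) by blast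
qed

text \<open>The scalars of \<open>End_hull_step\<close> form a Cauchy sequence, whose limit differs
  from the k-th one by an element of \<mm>^k. The limit thus acts as f on elements killed by
  \<mm>^k, and by \<open>E_tors\<close> these exhaust E.\<close>

lemma End_hull:
  assumes comp: "adically_complete R \<mm>" and f: "lin R E E f"
  shows "\<exists>r\<in>carrier R. \<forall>x\<in>carrier E. f x = r \<odot>\<^bsub>E\<^esub> x"
proof -
  let ?ok = "\<lambda>k r. r \<in> carrier R \<and> (\<forall>x\<in>killed E (ideal_pow R \<mm> k). f x = r \<odot>\<^bsub>E\<^esub> x)"
  have "\<exists>r. \<forall>k. ?ok k (r k) \<and> r (Suc k) \<ominus>\<^bsub>R\<^esub> r k \<in> ideal_pow R \<mm> k"
  proof (rule dependent_nat_choice)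
    \<comment> \<open>The zeroth power of \<mm> is R, which kills only zero; so 0 is a valid first
      scalar.\<close>
    have "f x = \<zero>\<^bsub>R\<^esub> \<odot>\<^bsub>E\<^esub> x" if x: "x \<in> killed E (ideal_pow R \<mm> 0)" for x
    proof -
      have xc: "x \<in> carrier E" using x by (simp add: killed_def)
      have "\<one>\<^bsub>R\<^esub> \<odot>\<^bsub>E\<^esub> x = \<zero>\<^bsub>E\<^esub>" using x R.one_closed unfolding killed_def by simp
      then have "x = \<zero>\<^bsub>E\<^esub>" using xc by simp
      then show ?thesis using lin_zero[OF f mE mE] by simp
    qed
    then show "\<exists>r. ?ok 0 r" using R.zero_closed by blast
    fix r k assume r: "?ok k r"
    obtain t where t: "t \<in> ideal_pow R \<mm> k" "\<forall>x\<in>killed E (ideal_pow R \<mm> (Suc k)). f x = (r \<oplus>\<^bsub>R\<^esub> t) \<odot>\<^bsub>E\<^esub> x"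
      using End_hull_step[OF f, of r k] r by blast
    have tc: "t \<in> carrier R" using t(1) ideal_pow_carr[OF cR mI] by blast
    have "(r \<oplus>\<^bsub>R\<^esub> t) \<ominus>\<^bsub>R\<^esub> r = t" using r tc by (simp add: a_minus_def R.a_ac R.r_neg2 R.r_neg1) (metis R.a_assoc R.a_comm R.a_inv_closed R.r_neg1 R.r_neg2)
    then have "?ok (Suc k) (r \<oplus>\<^bsub>R\<^esub> t) \<and> (r \<oplus>\<^bsub>R\<^esub> t) \<ominus>\<^bsub>R\<^esub> r \<in> ideal_pow R \<mm> k" using t r tc by simp
    then show "\<exists>r'. ?ok (Suc k) r' \<and> r' \<ominus>\<^bsub>R\<^esub> r \<in> ideal_pow R \<mm> k" by blast
  qed
  then obtain r where r: "\<And>k. ?ok k (r k)" "\<And>k. r (Suc k) \<ominus>\<^bsub>R\<^esub> r k \<in> ideal_pow R \<mm> k" by blast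
  obtain q where q: "q \<in> carrier R" "\<And>k. q \<ominus>\<^bsub>R\<^esub> r k \<in> ideal_pow R \<mm> k"
    using comp r unfolding adically_complete_def by metis
  have "f x = q \<odot>\<^bsub>E\<^esub> x" if x: "x \<in> carrier E" for x
  proof -
    obtain k where k: "x \<in> killed E (ideal_pow R \<mm> k)" using E_tors[OF x] by (auto simp: tors_def)
    have rk: "r k \<in> carrier R" using r(1) by blast
    have "(q \<ominus>\<^bsub>R\<^esub> r k) \<odot>\<^bsub>E\<^esub> x = \<zero>\<^bsub>E\<^esub>" using q(2)[of k] k unfolding killed_def by blast
    moreover have "(q \<ominus>\<^bsub>R\<^esub> r k) \<odot>\<^bsub>E\<^esub> x = q \<odot>\<^bsub>E\<^esub> x \<ominus>\<^bsub>E\<^esub> r k \<odot>\<^bsub>E\<^esub> x"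
      using q(1) rk x by (simp add: a_minus_def E.smult_l_distr E.smult_l_minus)
    ultimately have "q \<odot>\<^bsub>E\<^esub> x = r k \<odot>\<^bsub>E\<^esub> x" using minus_eq_zero_iff[OF mE, of "q \<odot>\<^bsub>E\<^esub> x" "r k \<odot>\<^bsub>E\<^esub> x"] q(1) rk x by simp
    then show ?thesis using r(1)[of k] k by simp
  qed
  then show ?thesis using q(1) by blast
qed

text \<open>A functional on L that vanishes on the generators is zero, so
  \<open>baer_factor_family\<close> writes \<Lambda> as a sum of maps \<phi> \<mapsto> \<psi>
  (\<phi> l) with l a generator and \<psi> an endomorphism of E. By completeness \<psi> is a scalar
  r, and r (\<phi> l) = \<phi> (r l) is an evaluation again.\<close>

lemma evaluation_surj:
  assumes comp: "adically_complete R \<mm>" and L: "module R L" and S: "finite S" "S \<subseteq> carrier L"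
    and gen: "\<And>V. submodule V R L \<Longrightarrow> S \<subseteq> V \<Longrightarrow> carrier L \<subseteq> V"
    and la: "lin R (Hom_mod R L E) E \<Lambda>"
  shows "\<exists>y\<in>carrier L. \<forall>\<phi>\<in>mod_hom R L E. \<Lambda> \<phi> = \<phi> y"
proof -
  let ?D = "Hom_mod R L E"
  interpret L: module R L by (rule L)
  have D: "module R ?D" by (rule Hom_mod_module[OF L mE])
  interpret D: module R ?D by (rule D)
  have HD: "module R (Hom_mod R ?D E)" by (rule Hom_mod_module[OF D mE])
  interpret HD: module R "Hom_mod R ?D E" by (rule HD)
  have evl: "lin R ?D E (\<lambda>\<phi>. \<phi> l)" if "l \<in> carrier L" for l
    by (rule linI) (use that in \<open>auto intro: lin_closed[OF mod_hom_lin]\<close>)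
  let ?A = "(\<lambda>l \<phi>. \<phi> l) ` S"
  let ?V = "{g \<in> mod_hom R ?D E. \<exists>y\<in>carrier L. \<forall>\<phi>\<in>mod_hom R L E. g \<phi> = \<phi> y}"
  have "restrict \<Lambda> (carrier ?D) \<in> ?V"
  proof (rule baer_factor_family[OF E mE finite_imageI[OF S(1)] D _ lin_restrict[OF la D]])
    show "lin R ?D E \<alpha>" if al: "\<alpha> \<in> ?A" for \<alpha>
    proof -
      obtain l where "l \<in> S" "\<alpha> = (\<lambda>\<phi>. \<phi> l)" using al by blast
      then show ?thesis using evl S(2) by blast
    qed
    show "restrict \<Lambda> (carrier ?D) \<phi> = \<zero>\<^bsub>E\<^esub>" if p: "\<phi> \<in> carrier ?D" "\<And>\<alpha>. \<alpha> \<in> ?A \<Longrightarrow> \<alpha> \<phi> = \<zero>\<^bsub>E\<^esub>" for \<phi>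
    proof -
      have ph: "\<phi> \<in> mod_hom R L E" using p(1) by simp
      have "carrier L \<subseteq> {x \<in> carrier L. \<phi> x = \<zero>\<^bsub>E\<^esub>}"
        by (rule gen[OF submod_ker[OF mod_hom_lin[OF ph] L mE]]) (use p(2) S(2) in auto)
      then have "\<phi> = \<zero>\<^bsub>?D\<^esub>" using D.M.zero_closed by (intro mod_hom_eqI[OF ph]) auto
      then show ?thesis using lin_zero[OF la D mE] p(1) unfolding restrict_def by metis
    qed
    show "submodule ?V R (Hom_mod R ?D E)"
    proof (rule submodI[OF HD])
      show "?V \<subseteq> carrier (Hom_mod R ?D E)" by auto
      have z: "\<zero>\<^bsub>Hom_mod R ?D E\<^esub> \<in> mod_hom R ?D E" using HD.M.zero_closed unfolding Hom_mod_simps(1) .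
      have "\<zero>\<^bsub>Hom_mod R ?D E\<^esub> \<phi> = \<phi> \<zero>\<^bsub>L\<^esub>" if "\<phi> \<in> mod_hom R L E" for \<phi>
        using lin_zero[OF mod_hom_lin[OF that] L mE] that by simp
      then show "\<zero>\<^bsub>Hom_mod R ?D E\<^esub> \<in> ?V" using z L.M.zero_closed by blast
      fix g assume g: "g \<in> ?V"
      then obtain y where y: "y \<in> carrier L" "\<forall>\<phi>\<in>mod_hom R L E. g \<phi> = \<phi> y" by blast
      have gh: "g \<in> mod_hom R ?D E" using g by blast
      { fix g' assume g': "g' \<in> ?V"
        then obtain y' where y': "y' \<in> carrier L" "\<forall>\<phi>\<in>mod_hom R L E. g' \<phi> = \<phi> y'" by blast
        have gh': "g' \<in> mod_hom R ?D E" using g' by blast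
        have "(g \<oplus>\<^bsub>Hom_mod R ?D E\<^esub> g') \<phi> = \<phi> (y \<oplus>\<^bsub>L\<^esub> y')" if "\<phi> \<in> mod_hom R L E" for \<phi>
          using y(2) y'(2) that lin_add[OF mod_hom_lin[OF that] y(1) y'(1)] by simp
        moreover have "g \<oplus>\<^bsub>Hom_mod R ?D E\<^esub> g' \<in> mod_hom R ?D E" using HD.M.a_closed[of g g'] gh gh' unfolding Hom_mod_simps(1) by blast
        moreover have "y \<oplus>\<^bsub>L\<^esub> y' \<in> carrier L" using y y' by simp
        ultimately show "g \<oplus>\<^bsub>Hom_mod R ?D E\<^esub> g' \<in> ?V" by blast }
      fix q assume q: "q \<in> carrier R"
      have "(q \<odot>\<^bsub>Hom_mod R ?D E\<^esub> g) \<phi> = \<phi> (q \<odot>\<^bsub>L\<^esub> y)" if "\<phi> \<in> mod_hom R L E" for \<phi>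
        using y(2) that lin_smult[OF mod_hom_lin[OF that] q y(1)] by simp
      moreover have "q \<odot>\<^bsub>Hom_mod R ?D E\<^esub> g \<in> mod_hom R ?D E" using HD.smult_closed[of q g] gh q unfolding Hom_mod_simps(1) by blast
      moreover have "q \<odot>\<^bsub>L\<^esub> y \<in> carrier L" using y q by simp
      ultimately show "q \<odot>\<^bsub>Hom_mod R ?D E\<^esub> g \<in> ?V" by blast
    qed
    show "restrict (\<lambda>x. \<psi> (\<alpha> x)) (carrier ?D) \<in> ?V" if al: "\<alpha> \<in> ?A" and psi: "lin R E E \<psi>" for \<alpha> \<psi>
    proof -
      obtain l where l: "l \<in> S" "\<alpha> = (\<lambda>\<phi>. \<phi> l)" using al by blast
      have lc: "l \<in> carrier L" using l S(2) by blast
      obtain r where r: "r \<in> carrier R" "\<forall>x\<in>carrier E. \<psi> x = r \<odot>\<^bsub>E\<^esub> x" using End_hull[OF comp psi] by blast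
      have "restrict (\<lambda>x. \<psi> (\<alpha> x)) (carrier ?D) \<phi> = \<phi> (r \<odot>\<^bsub>L\<^esub> l)" if "\<phi> \<in> mod_hom R L E" for \<phi>
        using that r(2) lin_closed[OF mod_hom_lin[OF that] lc] lin_smult[OF mod_hom_lin[OF that] r(1) lc] unfolding l(2) by simp
      moreover have "restrict (\<lambda>x. \<psi> (\<alpha> x)) (carrier ?D) \<in> mod_hom R ?D E"
        unfolding l(2) by (rule lin_restrict[OF lin_comp[OF evl[OF lc] psi] D])
      moreover have "r \<odot>\<^bsub>L\<^esub> l \<in> carrier L" using r(1) lc by simp
      ultimately show ?thesis by blast
    qed
  qed
  then show ?thesis by auto
qed

end

lemma mod_isoI: "f \<in> mod_hom R A B \<Longrightarrow> inj_on f (carrier A) \<Longrightarrow> f ` carrier A = carrier B \<Longrightarrow> f \<in> mod_iso R A B"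
  by (simp add: mod_iso_def bij_betw_def)

lemma mod_iso_inv:
  assumes f: "f \<in> mod_iso R A B" and A: "module R A"
  shows "lin R B A (inv_into (carrier A) f)" and "bij_betw (inv_into (carrier A) f) (carrier B) (carrier A)"
proof -
  interpret A: module R A by fact
  have b: "bij_betw f (carrier A) (carrier B)" and l: "lin R A B f" using f mod_hom_lin unfolding mod_iso_def by blast+
  let ?i = "inv_into (carrier A) f"
  show bi: "bij_betw ?i (carrier B) (carrier A)" by (rule bij_betw_inv_into[OF b])
  note c = bij_betwE[OF bi, rule_format] and fi = bij_betw_inv_into_right[OF b] and i_f = bij_betw_inv_into_left[OF b]
  show "lin R B A ?i"
  proof (rule linI)
    show "?i x \<in> carrier A" if "x \<in> carrier B" for x by (rule c[OF that])
    show "?i (x \<oplus>\<^bsub>B\<^esub> y) = ?i x \<oplus>\<^bsub>A\<^esub> ?i y" if "x \<in> carrier B" "y \<in> carrier B" for x y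
      using i_f[OF A.M.a_closed[OF c[OF that(1)] c[OF that(2)]]] lin_add[OF l c[OF that(1)] c[OF that(2)]] fi that by simp
    show "?i (r \<odot>\<^bsub>B\<^esub> x) = r \<odot>\<^bsub>A\<^esub> ?i x" if "r \<in> carrier R" "x \<in> carrier B" for r x
      using i_f[OF A.smult_closed[OF that(1) c[OF that(2)]]] lin_smult[OF l that(1) c[OF that(2)]] fi that by simp
  qed
qed

section \<open>The transpose map on endomorphisms of a torsion module\<close>

context local_hull
begin

lemma dual_End_map_apply:
  assumes "g \<in> mod_hom R N N" "\<phi> \<in> mod_hom R N E"
  shows "dual_End_map R E N g \<phi> = restrict (\<lambda>x. \<phi> (g x)) (carrier N)"
  using assms by (simp add: dual_End_map_def compose_def)

lemma dual_End_map_closed: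
  assumes N: "module R N" and g: "g \<in> mod_hom R N N"
  shows "dual_End_map R E N g \<in> mod_hom R (Hom_mod R N E) (Hom_mod R N E)"
  unfolding mod_hom_iff
proof (intro conjI linI)
  let ?D = "dual_End_map R E N g"
  note gc = lin_closed[OF mod_hom_lin[OF g]]
  note H = Hom_mod_module[OF N mE]
  interpret H: module R "Hom_mod R N E" by (rule H)
  show "?D \<in> extensional (carrier (Hom_mod R N E))" using g by (simp add: dual_End_map_def)
  have c: "?D \<phi> \<in> mod_hom R N E" if "\<phi> \<in> mod_hom R N E" for \<phi>
    unfolding dual_End_map_apply[OF g that] by (rule lin_restrict[OF lin_comp[OF mod_hom_lin[OF g] mod_hom_lin[OF that]] N])
  show "?D \<phi> \<in> carrier (Hom_mod R N E)" if "\<phi> \<in> carrier (Hom_mod R N E)" for \<phi> using c that by simp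
  show "?D (\<phi> \<oplus>\<^bsub>Hom_mod R N E\<^esub> \<psi>) = ?D \<phi> \<oplus>\<^bsub>Hom_mod R N E\<^esub> ?D \<psi>"
    if p: "\<phi> \<in> carrier (Hom_mod R N E)" "\<psi> \<in> carrier (Hom_mod R N E)" for \<phi> \<psi>
  proof -
    have "\<phi> \<oplus>\<^bsub>Hom_mod R N E\<^esub> \<psi> \<in> mod_hom R N E" using H.M.a_closed[OF p] unfolding Hom_mod_simps(1) .
    from dual_End_map_apply[OF g this] show ?thesis
      using p gc by (auto simp: dual_End_map_apply[OF g] fun_eq_iff)
  qed
  show "?D (r \<odot>\<^bsub>Hom_mod R N E\<^esub> \<phi>) = r \<odot>\<^bsub>Hom_mod R N E\<^esub> ?D \<phi>"
    if p: "r \<in> carrier R" "\<phi> \<in> carrier (Hom_mod R N E)" for r \<phi>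
  proof -
    have "r \<odot>\<^bsub>Hom_mod R N E\<^esub> \<phi> \<in> mod_hom R N E" using H.smult_closed[OF p] unfolding Hom_mod_simps(1) .
    from dual_End_map_apply[OF g this] show ?thesis
      using p gc by (auto simp: dual_End_map_apply[OF g] fun_eq_iff)
  qed
qed

lemma dual_End_map_hom:
  assumes N: "module R N"
  shows "dual_End_map R E N \<in> mod_hom R (Hom_mod R N N) (Hom_mod R (Hom_mod R N E) (Hom_mod R N E))"
  unfolding mod_hom_iff
proof (intro conjI linI)
  let ?D = "dual_End_map R E N" and ?H = "Hom_mod R N E"
  have H: "module R ?H" by (rule Hom_mod_module[OF N mE])
  have NN: "module R (Hom_mod R N N)" by (rule Hom_mod_module[OF N N])
  have HH: "module R (Hom_mod R ?H ?H)" by (rule Hom_mod_module[OF H H])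
  interpret NN: module R "Hom_mod R N N" by (rule NN)
  interpret HH: module R "Hom_mod R ?H ?H" by (rule HH)
  show "?D \<in> extensional (carrier (Hom_mod R N N))" by (simp add: dual_End_map_def)
  show c: "?D g \<in> carrier (Hom_mod R ?H ?H)" if "g \<in> carrier (Hom_mod R N N)" for g
    using dual_End_map_closed[OF N] that by simp
  show "?D (g \<oplus>\<^bsub>Hom_mod R N N\<^esub> g') = ?D g \<oplus>\<^bsub>Hom_mod R ?H ?H\<^esub> ?D g'"
    if g: "g \<in> carrier (Hom_mod R N N)" "g' \<in> carrier (Hom_mod R N N)" for g g'
  proof (rule mod_hom_eqI)
    show "?D (g \<oplus>\<^bsub>Hom_mod R N N\<^esub> g') \<in> mod_hom R ?H ?H" using c[OF NN.M.a_closed[OF g]] by (simp only: Hom_mod_simps(1))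
    show "?D g \<oplus>\<^bsub>Hom_mod R ?H ?H\<^esub> ?D g' \<in> mod_hom R ?H ?H" using HH.M.a_closed[OF c[OF g(1)] c[OF g(2)]] by (simp only: Hom_mod_simps(1))
    have gh: "g \<oplus>\<^bsub>Hom_mod R N N\<^esub> g' \<in> mod_hom R N N" using NN.M.a_closed[OF g] by (simp only: Hom_mod_simps(1))
    have g1: "g \<in> mod_hom R N N" "g' \<in> mod_hom R N N" using g by simp_all
    fix \<phi> assume "\<phi> \<in> carrier ?H"
    then have p: "\<phi> \<in> mod_hom R N E" by simp
    show "?D (g \<oplus>\<^bsub>Hom_mod R N N\<^esub> g') \<phi> = (?D g \<oplus>\<^bsub>Hom_mod R ?H ?H\<^esub> ?D g') \<phi>"
      using dual_End_map_apply[OF gh p] dual_End_map_apply[OF g1(1) p] dual_End_map_apply[OF g1(2) p] p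
        lin_add[OF mod_hom_lin[OF p]] lin_closed[OF mod_hom_lin[OF g1(1)]] lin_closed[OF mod_hom_lin[OF g1(2)]]
      by (auto simp: fun_eq_iff)
  qed
  show "?D (r \<odot>\<^bsub>Hom_mod R N N\<^esub> g) = r \<odot>\<^bsub>Hom_mod R ?H ?H\<^esub> ?D g"
    if g: "r \<in> carrier R" "g \<in> carrier (Hom_mod R N N)" for r g
  proof (rule mod_hom_eqI)
    show "?D (r \<odot>\<^bsub>Hom_mod R N N\<^esub> g) \<in> mod_hom R ?H ?H" using c[OF NN.smult_closed[OF g]] by (simp only: Hom_mod_simps(1))
    show "r \<odot>\<^bsub>Hom_mod R ?H ?H\<^esub> ?D g \<in> mod_hom R ?H ?H" using HH.smult_closed[OF g(1) c[OF g(2)]] by (simp only: Hom_mod_simps(1))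
    have gh: "r \<odot>\<^bsub>Hom_mod R N N\<^esub> g \<in> mod_hom R N N" using NN.smult_closed[OF g] by (simp only: Hom_mod_simps(1))
    have g1: "g \<in> mod_hom R N N" using g by simp
    fix \<phi> assume "\<phi> \<in> carrier ?H"
    then have p: "\<phi> \<in> mod_hom R N E" by simp
    show "?D (r \<odot>\<^bsub>Hom_mod R N N\<^esub> g) \<phi> = (r \<odot>\<^bsub>Hom_mod R ?H ?H\<^esub> ?D g) \<phi>"
      using dual_End_map_apply[OF gh p] dual_End_map_apply[OF g1 p] p
        lin_smult[OF mod_hom_lin[OF p] g(1)] lin_closed[OF mod_hom_lin[OF g1]]
      by (auto simp: fun_eq_iff)
  qed
qed

text \<open>Functionals with values in E separate points.\<close>

lemma dual_End_map_inj:
  assumes N: "module R N"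
  shows "inj_on (dual_End_map R E N) (mod_hom R N N)"
proof (rule inj_onI)
  fix g g' assume g: "g \<in> mod_hom R N N" "g' \<in> mod_hom R N N" "dual_End_map R E N g = dual_End_map R E N g'"
  show "g = g'"
  proof (rule mod_hom_eqI[OF g(1,2)])
    fix x assume x: "x \<in> carrier N"
    show "g x = g' x"
    proof (rule eq_by_functionals[OF N lin_closed[OF mod_hom_lin[OF g(1)] x] lin_closed[OF mod_hom_lin[OF g(2)] x]])
      fix \<phi> assume p: "\<phi> \<in> mod_hom R N E"
      show "\<phi> (g x) = \<phi> (g' x)"
        using fun_cong[OF g(3), of \<phi>] unfolding dual_End_map_apply[OF g(1) p] dual_End_map_apply[OF g(2) p]
        by (metis restrict_apply' x)
    qed
  qed
qed

text \<open>On an element \<open>x\<close> killed by \<open>K\<^sup>\<alpha>\<close>, the functional \<open>\<phi> \<mapsto> f \<phi> x\<close> depends only on the restriction of \<open>\<phi>\<close> to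
  the finitely generated submodule of the elements killed by \<open>K\<^sup>\<alpha>\<close>, so it is an evaluation.\<close>

lemma dual_endo_pointwise:
  assumes comp: "adically_complete R \<mm>" and N: "module R N" and b: "ideal \<bb> R"
    and S: "finite S" "S \<subseteq> killed N \<bb>" "\<And>V. submodule V R N \<Longrightarrow> S \<subseteq> V \<Longrightarrow> killed N \<bb> \<subseteq> V"
    and f: "f \<in> mod_hom R (Hom_mod R N E) (Hom_mod R N E)" and x: "x \<in> killed N \<bb>"
  shows "\<exists>y\<in>carrier N. \<forall>\<phi>\<in>mod_hom R N E. f \<phi> x = \<phi> y"
proof -
  interpret N: module R N by fact
  let ?L = "N\<lparr>carrier := killed N \<bb>\<rparr>"
  have bc: "\<bb> \<subseteq> carrier R" using ideal.Icarr[OF b] by blast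
  have sL: "submodule (killed N \<bb>) R N" by (rule killed_submod[OF N bc])
  have L: "module R ?L" by (rule submod_module[OF sL N])
  note Lc = submodD(1)[OF sL]
  have xc: "x \<in> carrier N" using x Lc by blast
  have H: "module R (Hom_mod R N E)" and HL: "module R (Hom_mod R ?L E)" using Hom_mod_module[OF N mE] Hom_mod_module[OF L mE] by auto
  have fc: "f \<phi> \<in> mod_hom R N E" if "\<phi> \<in> mod_hom R N E" for \<phi> using lin_closed[OF mod_hom_lin[OF f]] that by simp
  have ev: "lin R (Hom_mod R N E) E (\<lambda>\<phi>. \<phi> x)"
    by (rule linI) (use xc in \<open>auto intro: lin_closed[OF mod_hom_lin]\<close>)
  have lF: "lin R (Hom_mod R N E) E (\<lambda>\<phi>. f \<phi> x)" by (rule lin_comp[OF mod_hom_lin[OF f] ev])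
  let ?\<rho> = "\<lambda>\<phi>. restrict \<phi> (killed N \<bb>)"
  have rc: "?\<rho> \<phi> \<in> mod_hom R ?L E" if "\<phi> \<in> mod_hom R N E" for \<phi>
    using lin_restrict[OF lin_dom[OF mod_hom_lin[OF that] Lc] L] by simp
  have lr: "lin R (Hom_mod R N E) (Hom_mod R ?L E) ?\<rho>"
    by (rule linI) (use rc subsetD[OF Lc] in \<open>auto simp: fun_eq_iff\<close>)
  have surj: "?\<rho> ` carrier (Hom_mod R N E) = carrier (Hom_mod R ?L E)"
  proof (intro equalityI subsetI)
    fix \<theta> assume "\<theta> \<in> ?\<rho> ` carrier (Hom_mod R N E)"
    then show "\<theta> \<in> carrier (Hom_mod R ?L E)" using rc by auto
  next
    fix \<theta> assume "\<theta> \<in> carrier (Hom_mod R ?L E)"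
    then have th: "\<theta> \<in> mod_hom R ?L E" by simp
    have "\<exists>\<psi>. lin R N E \<psi> \<and> (\<forall>x\<in>carrier ?L. \<psi> x = \<theta> x)"
      by (rule baer_factor[OF E L N lin_id[OF Lc] mod_hom_lin[OF th]]) (use lin_zero[OF mod_hom_lin[OF th] L mE] in auto)
    then obtain \<psi> where psi: "lin R N E \<psi>" "\<forall>x\<in>carrier ?L. \<psi> x = \<theta> x" by blast
    have r: "restrict \<psi> (carrier N) \<in> mod_hom R N E" by (rule lin_restrict[OF psi(1) N])
    have "?\<rho> (restrict \<psi> (carrier N)) = \<theta>"
      by (rule mod_hom_eqI[OF rc[OF r] th]) (use psi(2) subsetD[OF Lc] in auto)
    then show "\<theta> \<in> ?\<rho> ` carrier (Hom_mod R N E)" using r by (intro image_eqI[of _ _ "restrict \<psi> (carrier N)"]) auto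
  qed
  \<comment> \<open>With finitely many generators a of \<bb>, a functional that vanishes on their
    common kernel is a sum of functionals z \<mapsto> \<psi> (a z), that is of multiples a \<psi>.
    For these, linearity of f gives f (a \<psi>) x = f \<psi> (a x) = 0, as a kills x.\<close>
  have ker: "f \<phi> x = \<zero>\<^bsub>E\<^esub>" if p: "\<phi> \<in> mod_hom R N E" and p0: "\<And>z. z \<in> killed N \<bb> \<Longrightarrow> \<phi> z = \<zero>\<^bsub>E\<^esub>" for \<phi>
  proof -
    obtain G where G: "G \<subseteq> carrier R" "finite G" "\<bb> = Idl\<^bsub>R\<^esub> G" using noetherian_ring.finetely_gen[OF nR b] by blast
    have Gb: "G \<subseteq> \<bb>" unfolding G(3) by (rule R.genideal_self[OF G(1)])
    have "\<phi> \<in> {\<phi> \<in> carrier (Hom_mod R N E). f \<phi> x = \<zero>\<^bsub>E\<^esub>}"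
    proof (rule baer_factor_family[OF E N finite_imageI[OF G(2)] N _ p _ submod_ker[OF lF H mE]])
      show "lin R N N \<alpha>" if al: "\<alpha> \<in> (\<lambda>a z. a \<odot>\<^bsub>N\<^esub> z) ` G" for \<alpha>
      proof -
        obtain a where "a \<in> G" "\<alpha> = (\<lambda>z. a \<odot>\<^bsub>N\<^esub> z)" using al by blast
        then show ?thesis using lin_mult[OF N, of a] G(1) by blast
      qed
      show "\<phi> z = \<zero>\<^bsub>E\<^esub>" if z: "z \<in> carrier N" "\<And>\<alpha>. \<alpha> \<in> (\<lambda>a z. a \<odot>\<^bsub>N\<^esub> z) ` G \<Longrightarrow> \<alpha> z = \<zero>\<^bsub>N\<^esub>" for z
      proof -
        have "z \<in> killed N G" unfolding killed_def using z by blast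
        then show ?thesis using p0 killed_genideal[OF N G(1)] G(3) by simp
      qed
      show "restrict (\<lambda>z. \<psi> (\<alpha> z)) (carrier N) \<in> {\<phi> \<in> carrier (Hom_mod R N E). f \<phi> x = \<zero>\<^bsub>E\<^esub>}"
        if al: "\<alpha> \<in> (\<lambda>a z. a \<odot>\<^bsub>N\<^esub> z) ` G" and psi: "lin R N E \<psi>" for \<alpha> \<psi>
      proof -
        obtain a where a: "a \<in> G" "\<alpha> = (\<lambda>z. a \<odot>\<^bsub>N\<^esub> z)" using al by blast
        have ac: "a \<in> carrier R" using a(1) G(1) by blast
        let ?p = "restrict \<psi> (carrier N)"
        have ph: "?p \<in> mod_hom R N E" by (rule lin_restrict[OF psi N])
        have fp: "f ?p \<in> mod_hom R N E" by (rule fc[OF ph])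
        have e: "restrict (\<lambda>z. \<psi> (\<alpha> z)) (carrier N) = a \<odot>\<^bsub>Hom_mod R N E\<^esub> ?p"
          unfolding a(2) using lin_smult[OF psi ac] by (auto simp: fun_eq_iff)
        have "f (a \<odot>\<^bsub>Hom_mod R N E\<^esub> ?p) = a \<odot>\<^bsub>Hom_mod R N E\<^esub> f ?p"
          by (rule lin_smult[OF mod_hom_lin[OF f] ac]) (use ph in simp)
        then have "f (a \<odot>\<^bsub>Hom_mod R N E\<^esub> ?p) x = a \<odot>\<^bsub>E\<^esub> f ?p x" using xc by simp
        also have "\<dots> = f ?p (a \<odot>\<^bsub>N\<^esub> x)" by (rule lin_smult[OF mod_hom_lin[OF fp] ac xc, symmetric])
        also have "a \<odot>\<^bsub>N\<^esub> x = \<zero>\<^bsub>N\<^esub>" using x a(1) Gb unfolding killed_def by blast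
        also have "f ?p \<zero>\<^bsub>N\<^esub> = \<zero>\<^bsub>E\<^esub>" by (rule lin_zero[OF mod_hom_lin[OF fp] N mE])
        finally have z: "f (a \<odot>\<^bsub>Hom_mod R N E\<^esub> ?p) x = \<zero>\<^bsub>E\<^esub>" .
        have "a \<odot>\<^bsub>Hom_mod R N E\<^esub> ?p \<in> carrier (Hom_mod R N E)" by (rule module.smult_closed[OF H ac]) (use ph in simp)
        then show ?thesis unfolding e using z by blast
      qed
    qed
    then show ?thesis by blast
  qed
  have "\<exists>\<Lambda>. lin R (Hom_mod R ?L E) E \<Lambda> \<and> (\<forall>\<phi>\<in>carrier (Hom_mod R N E). \<Lambda> (?\<rho> \<phi>) = f \<phi> x)"
  proof (rule lin_factor_surj[OF H HL mE lr lF surj])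
    fix \<phi> assume p: "\<phi> \<in> carrier (Hom_mod R N E)" "?\<rho> \<phi> = \<zero>\<^bsub>Hom_mod R ?L E\<^esub>"
    show "f \<phi> x = \<zero>\<^bsub>E\<^esub>"
    proof (rule ker)
      show "\<phi> \<in> mod_hom R N E" using p(1) by simp
      show "\<phi> z = \<zero>\<^bsub>E\<^esub>" if "z \<in> killed N \<bb>" for z using fun_cong[OF p(2), of z] that by simp
    qed
  qed
  then obtain \<Lambda> where La: "lin R (Hom_mod R ?L E) E \<Lambda>" "\<forall>\<phi>\<in>carrier (Hom_mod R N E). \<Lambda> (?\<rho> \<phi>) = f \<phi> x" by blast
  have "\<exists>y\<in>carrier ?L. \<forall>\<phi>\<in>mod_hom R ?L E. \<Lambda> \<phi> = \<phi> y"
  proof (rule evaluation_surj[OF comp L S(1) _ _ La(1)])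
    show "S \<subseteq> carrier ?L" using S(2) by simp
    show "carrier ?L \<subseteq> V" if "submodule V R ?L" "S \<subseteq> V" for V
      using S(3)[OF submod_trans[OF that(1) sL N] that(2)] by simp
  qed
  then obtain y where y: "y \<in> killed N \<bb>" "\<forall>\<phi>\<in>mod_hom R ?L E. \<Lambda> \<phi> = \<phi> y" by auto
  have "f \<phi> x = \<phi> y" if p: "\<phi> \<in> mod_hom R N E" for \<phi>
    using bspec[OF La(2), of \<phi>] bspec[OF y(2) rc[OF p]] p y(1) by simp
  then show ?thesis using y(1) Lc by blast
qed

text \<open>Each x is killed by some power of K, so f \<phi> x = \<phi> (y x) for some element y x.
  Functionals separate points, which makes y linear, and f is the transpose of y.\<close>

lemma dual_End_map_iso:
  assumes comp: "adically_complete R \<mm>" and N: "module R N" and K: "ideal K R" and t: "tors R K N = carrier N"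
    and fin: "\<And>\<alpha>. \<exists>S. finite S \<and> S \<subseteq> killed N (ideal_pow R K \<alpha>) \<and>
      (\<forall>V. submodule V R N \<longrightarrow> S \<subseteq> V \<longrightarrow> killed N (ideal_pow R K \<alpha>) \<subseteq> V)"
  shows "dual_End_map R E N \<in> mod_iso R (Hom_mod R N N) (Hom_mod R (Hom_mod R N E) (Hom_mod R N E))"
proof (rule mod_isoI[OF dual_End_map_hom[OF N]])
  interpret N: module R N by fact
  let ?H = "Hom_mod R N E"
  show "inj_on (dual_End_map R E N) (carrier (Hom_mod R N N))" using dual_End_map_inj[OF N] by simp
  have "f \<in> dual_End_map R E N ` mod_hom R N N" if f: "f \<in> mod_hom R ?H ?H" for f
  proof -
    have pt: "\<exists>y\<in>carrier N. \<forall>\<phi>\<in>mod_hom R N E. f \<phi> x = \<phi> y" if x: "x \<in> carrier N" for x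
    proof -
      obtain \<alpha> where a: "x \<in> killed N (ideal_pow R K \<alpha>)" using x unfolding t[symmetric] tors_def by blast
      obtain S where S: "finite S" "S \<subseteq> killed N (ideal_pow R K \<alpha>)"
        "\<forall>V. submodule V R N \<longrightarrow> S \<subseteq> V \<longrightarrow> killed N (ideal_pow R K \<alpha>) \<subseteq> V" using fin[of \<alpha>] by (elim exE conjE)
      show ?thesis by (rule dual_endo_pointwise[OF comp N R.ideal_pow_ideal[OF K] S(1,2) S(3)[rule_format] f a])
    qed
    define y where "y x = (SOME y. y \<in> carrier N \<and> (\<forall>\<phi>\<in>mod_hom R N E. f \<phi> x = \<phi> y))" for x
    have y0: "y x \<in> carrier N \<and> (\<forall>\<phi>\<in>mod_hom R N E. f \<phi> x = \<phi> (y x))" if "x \<in> carrier N" for x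
      unfolding y_def by (rule someI_ex) (use pt[OF that] in blast)
    then have yc: "y x \<in> carrier N" if "x \<in> carrier N" for x using that by blast
    have yp: "\<phi> (y x) = f \<phi> x" if "x \<in> carrier N" "\<phi> \<in> mod_hom R N E" for x \<phi> using y0[OF that(1)] that(2) by simp
    have fl: "lin R N E (f \<phi>)" if "\<phi> \<in> mod_hom R N E" for \<phi>
      using lin_closed[OF mod_hom_lin[OF f], of \<phi>] that mod_hom_lin by auto
    have ly: "lin R N N y"
    proof (rule linI)
      show "y x \<in> carrier N" if "x \<in> carrier N" for x by (rule yc[OF that])
      show "y (x \<oplus>\<^bsub>N\<^esub> x') = y x \<oplus>\<^bsub>N\<^esub> y x'" if x: "x \<in> carrier N" "x' \<in> carrier N" for x x'
      proof (rule eq_by_functionals[OF N])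
        show "\<phi> (y (x \<oplus>\<^bsub>N\<^esub> x')) = \<phi> (y x \<oplus>\<^bsub>N\<^esub> y x')" if p: "\<phi> \<in> mod_hom R N E" for \<phi>
          using lin_add[OF mod_hom_lin[OF p] yc[OF x(1)] yc[OF x(2)]] yp[OF _ p] x lin_add[OF fl[OF p] x] by simp
      qed (use x yc in auto)
      show "y (r \<odot>\<^bsub>N\<^esub> x) = r \<odot>\<^bsub>N\<^esub> y x" if x: "r \<in> carrier R" "x \<in> carrier N" for r x
      proof (rule eq_by_functionals[OF N])
        show "\<phi> (y (r \<odot>\<^bsub>N\<^esub> x)) = \<phi> (r \<odot>\<^bsub>N\<^esub> y x)" if p: "\<phi> \<in> mod_hom R N E" for \<phi>
          using lin_smult[OF mod_hom_lin[OF p] x(1) yc[OF x(2)]] yp[OF _ p] x lin_smult[OF fl[OF p] x] by simp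
      qed (use x yc in auto)
    qed
    let ?g = "restrict y (carrier N)"
    have g: "?g \<in> mod_hom R N N" by (rule lin_restrict[OF ly N])
    have "dual_End_map R E N ?g = f"
    proof (rule mod_hom_eqI[OF dual_End_map_closed[OF N g] f])
      fix \<phi> assume "\<phi> \<in> carrier ?H"
      then have p: "\<phi> \<in> mod_hom R N E" by simp
      show "dual_End_map R E N ?g \<phi> = f \<phi>"
      proof (rule mod_hom_eqI[of _ R N E])
        show "dual_End_map R E N ?g \<phi> \<in> mod_hom R N E" using lin_closed[OF mod_hom_lin[OF dual_End_map_closed[OF N g]], of \<phi>] p by simp
        show "f \<phi> \<in> mod_hom R N E" using lin_closed[OF mod_hom_lin[OF f], of \<phi>] p by simp
        show "dual_End_map R E N ?g \<phi> x = f \<phi> x" if "x \<in> carrier N" for x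
          unfolding dual_End_map_apply[OF g p] using yp[OF that p] that by simp
      qed
    qed
    then show ?thesis using g by blast
  qed
  then show "dual_End_map R E N ` carrier (Hom_mod R N N) = carrier (Hom_mod R ?H ?H)"
    using dual_End_map_closed[OF N] by auto
qed

end

section \<open>Finite generation of the annihilated parts of local cohomology\<close>

context graded_res
begin

text \<open>The section s is linear, so a class killed by K^\<alpha> has a representative killed by
  K^\<alpha>, a cocycle of Hom(R/K^\<alpha>, Q). As Ext in degree c of R/K^\<alpha> is Noetherian,
  the classes of finitely many such cocycles generate.\<close>

lemma killed_fin_gen:
  "\<exists>S. finite S \<and> S \<subseteq> killed H (ideal_pow R K \<alpha>) \<and>
    (\<forall>V. submodule V R H \<longrightarrow> S \<subseteq> V \<longrightarrow> killed H (ideal_pow R K \<alpha>) \<subseteq> V)"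
proof -
  let ?b = "ideal_pow R K \<alpha>" and ?Z = "(Q c)\<lparr>carrier := lcZ K c\<rparr>"
  let ?U = "killed (Q c) (ideal_pow R K \<alpha>) \<inter> cyc (Suc c)"
  let ?B = "pad_d d c ` killed (pad Q c) (ideal_pow R K \<alpha>)"
  interpret P1: module R "pad Q 1" by (rule m)
  have bI: "ideal ?b R" by (rule Kp[OF K])
  have bc: "?b \<subseteq> carrier R" by (rule Kc[OF K])
  have "noeth_pair R (pad Q 1) {\<zero>\<^bsub>pad Q 1\<^esub>} (cyc 1)"
  proof (rule noeth_pair_image[OF mM m eps noeth_fin_gen[OF noethR fg] submod_carrier[OF mM]])
    show "{\<zero>\<^bsub>M\<^esub>} \<subseteq> carrier M" using submodD(2)[OF submod_carrier[OF mM]] by blast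
    show "\<epsilon> x \<in> {\<zero>\<^bsub>pad Q 1\<^esub>}" if "x \<in> {\<zero>\<^bsub>M\<^esub>}" for x using lin_zero[OF eps mM m] that by simp
    show "cyc 1 \<subseteq> \<epsilon> ` carrier M <+>\<^bsub>pad Q 1\<^esub> {\<zero>\<^bsub>pad Q 1\<^esub>}"
      unfolding cyc1 by (rule submod_sum(2)[OF m submod_image[OF eps mM m submod_carrier[OF mM]] submod_zero[OF m]])
  qed
  then have n: "noeth_pair R (Q c) ?B ?U"
    using ext_quot_noeth[OF noethR _ exact bI, of c] unfolding ext_quot_noeth_def by simp
  have sU: "submodule ?U R (Q c)"
    using submod_inter[OF Qm killed_submod[OF Qm bc] cyc_submod[of "Suc c", simplified]] by simp
  have BU: "?B \<subseteq> ?U"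
  proof
    fix b assume "b \<in> ?B"
    then obtain w where w: "w \<in> killed (pad Q c) ?b" "b = pad_d d c w" by blast
    have wc: "w \<in> carrier (pad Q c)" using w(1) by (simp add: killed_def)
    show "b \<in> ?U" unfolding w(2) using killed_lin[OF d m m bc w(1)] dd[OF wc] lin_closed[OF d wc] by (simp add: cyc_def)
  qed
  obtain S where S: "finite S" "S \<subseteq> ?U" "\<forall>V. submodule V R (Q c) \<longrightarrow> ?B \<subseteq> V \<longrightarrow> S \<subseteq> V \<longrightarrow> ?U \<subseteq> V"
    using noeth_pairD[OF n sU BU order_refl] by (elim exE conjE)
  have UZ: "?U \<subseteq> lcZ K c" by (auto simp: lcZ_def tors_def cyc_def)
  have mZ: "module R ?Z" by (rule submod_module[OF lcZ_submod[OF K] Qm])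
  show ?thesis
  proof (intro exI conjI allI impI)
    show "finite (cl K c ` S)" using S(1) by simp
    show "cl K c ` S \<subseteq> killed H ?b"
    proof
      fix y assume "y \<in> cl K c ` S"
      then obtain z where z: "z \<in> S" "y = cl K c z" by blast
      have "z \<in> ?U" using z(1) S(2) by blast
      then have "z \<in> killed ?Z ?b" using UZ submodD(1)[OF lcZ_submod[OF K]] by auto
      from killed_lin[OF cl_lin[OF K] mZ mH bc this] show "y \<in> killed H ?b" using z(2) by simp
    qed
    fix V assume V: "submodule V R H" "cl K c ` S \<subseteq> V"
    let ?V = "{z \<in> carrier ?Z. cl K c z \<in> V}"
    have sV: "submodule ?V R (Q c)" by (rule submod_trans[OF submod_vimage[OF cl_lin[OF K] mZ mH V(1)] lcZ_submod[OF K] Qm])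
    have "?B \<subseteq> ?V"
    proof
      fix b assume b: "b \<in> ?B"
      have "b \<in> lcB K c" using b unfolding lcB_def tors_def by blast
      have bZ: "b \<in> lcZ K c" by (rule subsetD[OF lcB_sub[OF K] \<open>b \<in> lcB K c\<close>])
      then have "cl K c b = \<zero>\<^bsub>H\<^esub>" using cl_zero_iff[OF K] \<open>b \<in> lcB K c\<close> by blast
      then show "b \<in> ?V" using bZ submodD(2)[OF V(1)] by simp
    qed
    moreover have "S \<subseteq> ?V" using V(2) S(2) UZ by auto
    ultimately have UV: "?U \<subseteq> ?V" using S(3) sV by blast
    show "killed H ?b \<subseteq> V"
    proof
      fix y assume y: "y \<in> killed H ?b"
      then have yc: "y \<in> carrier H" by (simp add: killed_def)
      have "s y \<in> ?U" using killed_lin[OF s_lin mH Qm bc y] s_Z[OF yc] submodD(1)[OF lcZ_submod[OF K]] by (auto simp: lcZ_def cyc_def)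
      then show "y \<in> V" using UV cl_s[OF yc] by auto
    qed
  qed
qed

end

context two_ideals
begin

lemma fin_gen_torsion:
  assumes "k \<in> {I, J}"
  shows "ideal k R" "module R (loc_coh R Q d k c)" "tors R k (loc_coh R Q d k c) = carrier (loc_coh R Q d k c)"
    and "\<exists>S. finite S \<and> S \<subseteq> killed (loc_coh R Q d k c) (ideal_pow R k \<alpha>) \<and>
      (\<forall>V. submodule V R (loc_coh R Q d k c) \<longrightarrow> S \<subseteq> V \<longrightarrow> killed (loc_coh R Q d k c) (ideal_pow R k \<alpha>) \<subseteq> V)"
proof -
  show k: "ideal k R" using assms I J by blast
  have g: "grade R Q d k = enat c" using assms gI gJ by blast
  interpret k: graded_res R M Q \<epsilon> d k c
    by (rule graded_res.intro[OF fg_inj_res_axioms graded_res_axioms.intro[OF k g]])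
  show "module R (loc_coh R Q d k c)" by (rule k.mH)
  show "tors R k (loc_coh R Q d k c) = carrier (loc_coh R Q d k c)" by (rule lc_tors[OF k])
  show "\<exists>S. finite S \<and> S \<subseteq> killed (loc_coh R Q d k c) (ideal_pow R k \<alpha>) \<and>
      (\<forall>V. submodule V R (loc_coh R Q d k c) \<longrightarrow> S \<subseteq> V \<longrightarrow> killed (loc_coh R Q d k c) (ideal_pow R k \<alpha>) \<subseteq> V)"
    by (rule k.killed_fin_gen)
qed

end

text \<open>The assertions on \<open>Ext_to_End\<close> and \<open>dual_End_map\<close> guarantee
  that the uses of \<open>inv_into\<close> in \<open>nat_End_map\<close> and
  \<open>nat_End_dual_map\<close> are inverses of isomorphisms, so that these are the natural
  composites.\<close>

theorem theorem4p1:
  fixes R :: "'r ring" and \<mm> I J :: "'r set" and M :: "('r, 'm) module" and n c :: nat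
    and Q :: "nat \<Rightarrow> ('r, 'q) module" and \<epsilon> :: "'m \<Rightarrow> 'q" and d :: "nat \<Rightarrow> 'q \<Rightarrow> 'q"
    and E :: "('r, 'h) module" and e :: "'r set \<Rightarrow> 'h"
  assumes "noetherian_local_ring R \<mm>"
    and "krull_dim R = enat n"
    and "fin_gen_module R M"
    and "ideal I R" and "ideal J R" and "J \<subseteq> I"
    and "injective_resolution R M Q \<epsilon> d"
    and "injective_hull R (cyc_module R \<mm>) E e"
    and "grade R Q d I = enat c" and "grade R Q d J = enat c"
  shows
    "(lc_incl R Q d I J c \<in> mod_hom R (loc_coh R Q d I c) (loc_coh R Q d J c) \<and>
      inj_on (lc_incl R Q d I J c) (carrier (loc_coh R Q d I c)) \<and>
      (\<forall>K\<in>{I, J}. Ext_to_End R Q d K c \<in>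
         mod_iso R (Ext_mod R Q d c (loc_coh R Q d K c)) (End_loc_coh R Q d K c)) \<and>
      nat_End_map R Q d I J c \<in> mod_hom R (End_loc_coh R Q d J c) (End_loc_coh R Q d I c)) \<and>
     (rad_eq_upto_depth R M I J c \<longrightarrow>
      nat_End_map R Q d I J c \<in> mod_iso R (End_loc_coh R Q d J c) (End_loc_coh R Q d I c)) \<and>
     (adically_complete R \<mm> \<longrightarrow>
      (\<forall>K\<in>{I, J}. dual_End_map R E (loc_coh R Q d K c) \<in>
         mod_iso R (End_loc_coh R Q d K c) (End_dual_loc_coh R E Q d K c)) \<and>
      nat_End_dual_map R E Q d I J c \<in>
        mod_hom R (End_dual_loc_coh R E Q d J c) (End_dual_loc_coh R E Q d I c) \<and>
      (rad_eq_upto_depth R M I J c \<longrightarrow>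
       nat_End_dual_map R E Q d I J c \<in>
         mod_iso R (End_dual_loc_coh R E Q d J c) (End_dual_loc_coh R E Q d I c)))"
proof -
  interpret lh: local_hull R \<mm> E e by (rule local_hull.intro[OF assms(1,8)])
  have mM: "module R M" using assms(3) unfolding fin_gen_module_def by blast
  have fr: "fg_inj_res R M Q \<epsilon> d"
    by (rule fg_inj_res.intro[OF inj_res.intro[OF mM assms(7)] fg_inj_res_axioms.intro[OF lh.nR assms(3)]])
  interpret two_ideals R M Q \<epsilon> d I J c
    by (rule two_ideals.intro[OF fr two_ideals_axioms.intro[OF assms(4-6,9,10)]])
  let ?H = "\<lambda>K. loc_coh R Q d K c"
  let ?n = "nat_End_map R Q d I J c" and ?D = "\<lambda>K. dual_End_map R E (?H K)" and ?n' = "nat_End_dual_map R E Q d I J c"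
  have mE: "module R (End_loc_coh R Q d K c)" if "K \<in> {I, J}" for K
    by (rule Hom_mod_module[OF fin_gen_torsion(2)[OF that] fin_gen_torsion(2)[OF that]])
  have IJ: "I \<in> {I, J}" "J \<in> {I, J}" by auto
  have mD: "module R (End_dual_loc_coh R E Q d J c)"
    by (rule Hom_mod_module; rule Hom_mod_module[OF fin_gen_torsion(2)[OF IJ(2)] lh.mE])
  { assume comp: "adically_complete R \<mm>"
    have D: "?D K \<in> mod_iso R (End_loc_coh R Q d K c) (End_dual_loc_coh R E Q d K c)" if "K \<in> {I, J}" for K
      by (rule lh.dual_End_map_iso[OF comp fin_gen_torsion(2,1,3)[OF that] fin_gen_torsion(4)[OF that]])
    note inv = mod_iso_inv[OF D[OF IJ(2)] mE[OF IJ(2)]]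
    have DI: "?D I \<in> mod_hom R (End_loc_coh R Q d I c) (End_dual_loc_coh R E Q d I c)"
      "bij_betw (?D I) (carrier (End_loc_coh R Q d I c)) (carrier (End_dual_loc_coh R E Q d I c))"
      using D[OF IJ(1)] unfolding mod_iso_def by blast+
    have hom: "?n' \<in> mod_hom R (End_dual_loc_coh R E Q d J c) (End_dual_loc_coh R E Q d I c)"
      unfolding nat_End_dual_map_def
      by (rule lin_restrict[OF lin_comp[OF lin_comp[OF inv(1) mod_hom_lin[OF nat_End_map_hom]] mod_hom_lin[OF DI(1)]] mD])
    moreover have "?n' \<in> mod_iso R (End_dual_loc_coh R E Q d J c) (End_dual_loc_coh R E Q d I c)"
      if rad: "rad_eq_upto_depth R M I J c"
    proof -
      have b: "bij_betw ?n (carrier (End_loc_coh R Q d J c)) (carrier (End_loc_coh R Q d I c))"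
        using nat_End_map_iso[OF rad] unfolding mod_iso_def by blast
      have "bij_betw ?n' (carrier (End_dual_loc_coh R E Q d J c)) (carrier (End_dual_loc_coh R E Q d I c))"
        by (rule bij_betw_cong[THEN iffD1, OF _ bij_betw_trans[OF bij_betw_trans[OF inv(2) b] DI(2)]])
          (simp only: nat_End_dual_map_def restrict_apply' comp_apply)
      then show ?thesis using hom unfolding mod_iso_def by blast
    qed
    ultimately have "(\<forall>K\<in>{I, J}. ?D K \<in> mod_iso R (End_loc_coh R Q d K c) (End_dual_loc_coh R E Q d K c)) \<and>
      ?n' \<in> mod_hom R (End_dual_loc_coh R E Q d J c) (End_dual_loc_coh R E Q d I c) \<and>
      (rad_eq_upto_depth R M I J c \<longrightarrow> ?n' \<in> mod_iso R (End_dual_loc_coh R E Q d J c) (End_dual_loc_coh R E Q d I c))"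
      using D by blast }
  note c = this
  show ?thesis using iota_hom iota_inj Ext_to_End_iso nat_End_map_hom nat_End_map_iso c by (intro conjI ballI impI) blast+
qed

end
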